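(* For $\theta>0$ define signed measures on partitions $P_{sp}(\lambda)=Z_{sp}(\theta)^{-1}sp_\lambda(pl_{2\theta})s_\lambda(pl_\theta)$ and $P_o(\lambda)=Z_o(\theta)^{-1}o_\lambda(pl_{2\theta})s_\lambda(pl_\theta)$, where $Z_{sp}(\theta)=\sum_\lambda sp_\lambda(pl_{2\theta})s_\lambda(pl_\theta)$ and $Z_o(\theta)=\sum_\lambda o_\lambda(pl_{2\theta})s_\lambda(pl_\theta)$. Then for every $s\in\mathbb R$, $$\lim_{\theta\to\infty}P_{sp}\Big(\frac{\lambda_1-2\theta}{\theta^{1/3}}\le s\Big)=\det(1-\mathcal A^{+}),\qquad \lim_{\theta\to\infty}P_{o}\Big(\frac{\lambda_1-2\theta}{\theta^{1/3}}\le s\Big)=\det(1-\mathcal A^{-}),$$ where the Fredholm determinants are on $L^2(s,\infty)$ and $$\mathcal A^{\pm}(x,y)=\int_0^\infty \mathrm{Ai}(x+u)\mathrm{Ai}(y+u)\,du\pm\int_0^\infty\mathrm{Ai}(x-u)\mathrm{Ai}(y+u)\,du,$$ with $\mathrm{Ai}$ the Airy function.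
   Context: A specialization $\rho$ is a sequence $(p_n(\rho))_{n\ge1}$ of complex numbers; $H(\rho;z)=\exp\big(\sum_{n\ge1}p_n(\rho)z^n/n\big)=\sum_{k\ge0}h_k(\rho)z^k$ defines $h_k(\rho)$ ($h_k=0$ for $k<0$). The Plancherel specialization $pl_\theta$ has $p_1=\theta$ and $p_n=0$ for $n\ge2$ (so $h_k(pl_\theta)=\theta^k/k!$). For a partition $\lambda$ of length $\ell(\lambda)$, with determinants of size $\ell(\lambda)$ (equal to $1$ for the empty partition): $s_\lambda(\rho)=\det[h_{\lambda_i-i+j}(\rho)]$, $sp_\lambda(\rho)=\tfrac12\det[h_{\lambda_i-i+j}(\rho)+h_{\lambda_i-i-j+2}(\rho)]$, $o_\lambda(\rho)=\det[h_{\lambda_i-i+j}(\rho)-h_{\lambda_i-i-j}(\rho)]$. $\lambda_1$ is the largest part of $\lambda$; $P(E)=\sum_{\lambda\in E}P(\lambda)$. *)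

theory Defs
  imports "HOL-Analysis.Analysis"
begin

(* h_k of the Plancherel specialization pl_theta: theta^k / k!, and 0 for k < 0 *)
definition h_pl :: "real \<Rightarrow> int \<Rightarrow> real" where
  "h_pl \<theta> k = (if k < 0 then 0 else \<theta> ^ nat k / fact (nat k))"

definition detn :: "nat \<Rightarrow> (nat \<Rightarrow> nat \<Rightarrow> real) \<Rightarrow> real" where
  "detn n M = (\<Sum>p | p permutes {..<n}. of_int (sign p) * (\<Prod>i<n. M i (p i)))"

(* partitions as weakly decreasing lists of positive naturals; lambda_{i+1} = l ! i *)
definition is_partition :: "nat list \<Rightarrow> bool" where
  "is_partition l \<longleftrightarrow> sorted_wrt (\<ge>) l \<and> (\<forall>x\<in>set l. 0 < x)"

definition partitions :: "nat list set" where
  "partitions = {l. is_partition l}"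

definition lam1 :: "nat list \<Rightarrow> nat" where
  "lam1 l = (if l = [] then 0 else hd l)"

definition schur_pl :: "real \<Rightarrow> nat list \<Rightarrow> real" where
  "schur_pl \<theta> l = detn (length l) (\<lambda>i j. h_pl \<theta> (int (l ! i) - int i + int j))"

(* sp_lambda(pl_theta) = 1/2 det[h_{lambda_i-i+j} + h_{lambda_i-i-j+2}] (1-based), 0-based below *)
definition sp_pl :: "real \<Rightarrow> nat list \<Rightarrow> real" where
  "sp_pl \<theta> l = (1/2) * detn (length l)
     (\<lambda>i j. h_pl \<theta> (int (l ! i) - int i + int j) + h_pl \<theta> (int (l ! i) - int i - int j))"

(* o_lambda(pl_theta) = det[h_{lambda_i-i+j} - h_{lambda_i-i-j}] (1-based), 0-based below *)
definition o_pl :: "real \<Rightarrow> nat list \<Rightarrow> real" where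
  "o_pl \<theta> l = detn (length l)
     (\<lambda>i j. h_pl \<theta> (int (l ! i) - int i + int j) - h_pl \<theta> (int (l ! i) - int i - int j - 2))"

definition Z_sp :: "real \<Rightarrow> real" where
  "Z_sp \<theta> = (\<Sum>\<^sub>\<infinity>l\<in>partitions. sp_pl (2*\<theta>) l * schur_pl \<theta> l)"

definition Z_o :: "real \<Rightarrow> real" where
  "Z_o \<theta> = (\<Sum>\<^sub>\<infinity>l\<in>partitions. o_pl (2*\<theta>) l * schur_pl \<theta> l)"

definition edge_event :: "real \<Rightarrow> real \<Rightarrow> nat list set" where
  "edge_event \<theta> s = {l \<in> partitions. (real (lam1 l) - 2*\<theta>) / \<theta> powr (1/3) \<le> s}"

definition P_sp :: "real \<Rightarrow> nat list set \<Rightarrow> real" where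
  "P_sp \<theta> E = (\<Sum>\<^sub>\<infinity>l\<in>E. sp_pl (2*\<theta>) l * schur_pl \<theta> l) / Z_sp \<theta>"

definition P_o :: "real \<Rightarrow> nat list set \<Rightarrow> real" where
  "P_o \<theta> E = (\<Sum>\<^sub>\<infinity>l\<in>E. o_pl (2*\<theta>) l * schur_pl \<theta> l) / Z_o \<theta>"

definition Airy :: "real \<Rightarrow> real" where
  "Airy x = (1/pi) * Lim at_top (\<lambda>R. integral {0..R} (\<lambda>t. cos (t^3/3 + x*t)))"

definition A_plus :: "real \<Rightarrow> real \<Rightarrow> real" where
  "A_plus x y = (LBINT u:{0..}. Airy (x+u) * Airy (y+u)) + (LBINT u:{0..}. Airy (x-u) * Airy (y+u))"

definition A_minus :: "real \<Rightarrow> real \<Rightarrow> real" where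
  "A_minus x y = (LBINT u:{0..}. Airy (x+u) * Airy (y+u)) - (LBINT u:{0..}. Airy (x-u) * Airy (y+u))"

(* Fredholm determinant det(1 - K) on L^2(s,oo), via the Fredholm series
   sum_n (-1)^n/n! int_{(s,oo)^n} det[K(x_i,x_j)]_{i,j<n} dx *)
definition fredholm_det :: "(real \<Rightarrow> real \<Rightarrow> real) \<Rightarrow> real \<Rightarrow> real" where
  "fredholm_det K s = (\<Sum>n. (-1)^n / fact n *
     integral\<^sup>L (PiM {..<n} (\<lambda>_. restrict_space lborel {s<..}))
       (\<lambda>x. detn n (\<lambda>i j. K (x i) (x j))))"

end

theory Submission
  imports Defs "HOL-Complex_Analysis.Complex_Analysis" "HOL-Real_Asymp.Real_Asymp" "HOL-Probability.Distributions"
begin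

text \<open>
  By Cauchy-Binet, the sums over partitions with at most N parts are N by N Gram determinants between
  the functions \<open>h_k\<close> and reflected copies of them. As functions of the parameters these determinants satisfy
  a differential equation up to a vanishing error, which gives the normalisation exp (a b - b^2 / 2).
  Restricting \<open>\<lambda>\<^sub>1\<close> subtracts a tail part from the Gram matrix. The infinite Gram matrix has an explicit
  inverse, and the truncation defect of its N by N section sits in the corner opposite to the tail part,
  so the quotient of determinants tends to the Fredholm determinant of the kernel
  \<open>\<Sum>j. (J\<^bsub>x+j\<^esub> \<plusminus> J\<^bsub>x-j\<^esub>) J\<^bsub>y+j\<^esub>\<close> of Bessel functions at 2 \<open>\<theta>\<close>.
  Integrating over a circle of radius exp (c / \<open>\<theta>\<close>^(1/3)) bounds the rescaled Bessel functions exponentially and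
  identifies their limit with the Airy function; Hadamard's inequality then allows termwise passage to
  the limit in the Fredholm series.
\<close>

section \<open>Determinants\<close>

text \<open>The measures are signed, so positivity cannot provide convergence. Absolute summability
  comes from three explicit bounds: the basis determinant grows at most exponentially in the size of
  the partition, the Schur factor decays like the inverse root of a factorial, and at most 2^m
  partitions have size m. The parameters 2 \<theta> and \<theta> are what produces Bessel functions.
  The symbol exp (2 \<theta> z + \<theta> / z) is a symmetric factor exp (\<theta> (z + 1 / z))
  times a triangular factor exp (\<theta> z). Undoing the symmetric factor on the basis functions,
  and the triangular one on the functions paired with them, leaves exp (\<theta> (z - 1 / z)) on
  both sides. Finite sections of an infinite matrix and of its inverse are not inverse to each
  other. Here the product of their determinants tends to exp (2 \<theta>^2) instead of 1, so the
  truncation defect never becomes negligible; it can only be separated from the tail part and then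
  divided out. This is also why the normalisation is established for general parameters: it is
  needed for the inverse matrix too.\<close>

lemma detn_cong:
  assumes "\<And>i j. i < n \<Longrightarrow> j < n \<Longrightarrow> M i j = M' i j"
  shows "detn n M = detn n M'"
  unfolding detn_def
proof (rule sum.cong[OF refl])
  fix p assume "p \<in> {p. p permutes {..<n}}"
  then have "p i < n" if "i < n" for i using that permutes_in_image[of p "{..<n}" i] by auto
  then show "of_int (sign p) * (\<Prod>i<n. M i (p i)) = of_int (sign p) * (\<Prod>i<n. M' i (p i))"
    using assms by (intro arg_cong2[of _ _ _ _ "(*)"] prod.cong) auto
qed

lemma detn_permute_rows:
  assumes p: "p permutes {..<n}"
  shows "detn n (\<lambda>i. M (p i)) = of_int (sign p) * detn n M"
proof -
  have "detn n (\<lambda>i. M (p i)) = (\<Sum>q | q permutes {..<n}. of_int (sign (q \<circ> p)) * (\<Prod>i<n. M (p i) ((q \<circ> p) i)))"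
    unfolding detn_def using sum_permutations_compose_right[OF p] .
  also have "\<dots> = (\<Sum>q | q permutes {..<n}. of_int (sign p) * (of_int (sign q) * (\<Prod>i<n. M i (q i))))"
  proof (rule sum.cong[OF refl])
    fix q assume "q \<in> {q. q permutes {..<n}}"
    then have "sign (q \<circ> p) = sign q * sign p"
      using p permutes_imp_permutation[of "{..<n}"] by (intro sign_compose) auto
    moreover have "(\<Prod>i<n. M (p i) ((q \<circ> p) i)) = (\<Prod>i<n. M i (q i))"
      using prod.permute[OF p, of "\<lambda>i. M i (q i)"] by (simp add: o_def)
    ultimately show "of_int (sign (q \<circ> p)) * (\<Prod>i<n. M (p i) ((q \<circ> p) i)) =
        of_int (sign p) * (of_int (sign q) * (\<Prod>i<n. M i (q i)))" by simp
  qed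
  finally show ?thesis by (simp add: detn_def sum_distrib_left)
qed

lemma detn_transpose: "detn n (\<lambda>i j. M j i) = detn n M"
proof -
  have "detn n (\<lambda>i j. M j i) = (\<Sum>p | p permutes {..<n}. of_int (sign (inv p)) * (\<Prod>i<n. M (inv p i) i))"
    unfolding detn_def by (subst sum_permutations_inverse) simp
  also have "\<dots> = detn n M"
    unfolding detn_def
  proof (rule sum.cong[OF refl])
    fix p assume "p \<in> {p. p permutes {..<n}}"
    then have p: "p permutes {..<n}" by simp
    have "(\<Prod>i<n. M (inv p i) i) = (\<Prod>i<n. M (inv p (p i)) (p i))"
      using prod.permute[OF p, of "\<lambda>i. M (inv p i) i"] by (simp add: o_def)
    also have "\<dots> = (\<Prod>i<n. M i (p i))" using permutes_inverses(2)[OF p] by simp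
    finally show "of_int (sign (inv p)) * (\<Prod>i<n. M (inv p i) i) = of_int (sign p) * (\<Prod>i<n. M i (p i))"
      using p permutes_imp_permutation[OF _ p] by (simp add: sign_inverse)
  qed
  finally show ?thesis .
qed

lemma detn_identical_rows:
  assumes "a < n" "b < n" "a \<noteq> b" "\<And>j. j < n \<Longrightarrow> M a j = M b j"
  shows "detn n M = 0"
proof -
  let ?t = "Transposition.transpose a b"
  have t: "?t permutes {..<n}" using assms by (intro permutes_swap_id) auto
  have "detn n M = detn n (\<lambda>i. M (?t i))"
    by (rule detn_cong) (use assms in \<open>auto simp: Transposition.transpose_def\<close>)
  also have "\<dots> = - detn n M"
    using detn_permute_rows[OF t, of M] assms by (simp add: sign_swap_id)
  finally show ?thesis by simp
qed

text \<open>Multilinearity in all rows at once. Depending on the meaning of \<open>X\<close> this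
  becomes the product rule, the Cauchy-Binet formula (points of a configuration) or the expansion of
  a finite-rank kernel.\<close>

lemma detn_row_sums:
  assumes "finite X"
  shows "detn n (\<lambda>i j. \<Sum>x\<in>X. c i x * g x j) =
    (\<Sum>f\<in>PiE {..<n} (\<lambda>_. X). (\<Prod>i<n. c i (f i)) * detn n (\<lambda>i. g (f i)))"
proof -
  have "detn n (\<lambda>i j. \<Sum>x\<in>X. c i x * g x j) =
     (\<Sum>p | p permutes {..<n}. of_int (sign p) * (\<Sum>f\<in>PiE {..<n} (\<lambda>_. X). \<Prod>i<n. c i (f i) * g (f i) (p i)))"
    unfolding detn_def using assms by (subst prod_sum_PiE) auto
  also have "\<dots> = (\<Sum>f\<in>PiE {..<n} (\<lambda>_. X). \<Sum>p | p permutes {..<n}. of_int (sign p) * (\<Prod>i<n. c i (f i) * g (f i) (p i)))"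
    unfolding sum_distrib_left by (rule sum.swap)
  also have "\<dots> = (\<Sum>f\<in>PiE {..<n} (\<lambda>_. X). (\<Prod>i<n. c i (f i)) * detn n (\<lambda>i. g (f i)))"
    unfolding detn_def sum_distrib_left
    by (intro sum.cong refl) (simp add: prod.distrib)
  finally show ?thesis .
qed

lemma inj_PiE_permutes:
  fixes n :: nat
  assumes "f \<in> PiE {..<n} (\<lambda>_. {..<n})" "inj_on f {..<n}"
  shows "\<exists>p. p permutes {..<n} \<and> f = restrict p {..<n}"
proof -
  let ?p = "\<lambda>i. if i < n then f i else i"
  have "f ` {..<n} = {..<n}"
    by (rule endo_inj_surj) (use assms in \<open>auto simp: PiE_iff\<close>)
  with assms have "bij_betw f {..<n} {..<n}" by (simp add: bij_betw_def)
  then have "bij_betw ?p {..<n} {..<n}"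
    by (rule bij_betw_cong[THEN iffD1, rotated]) auto
  then have "?p permutes {..<n}" by (intro bij_imp_permutes) auto
  moreover have "f = restrict ?p {..<n}"
    using assms by (auto simp: PiE_iff extensional_def restrict_def fun_eq_iff)
  ultimately show ?thesis by blast
qed

lemma inj_on_restrict_permutes: "inj_on (\<lambda>p. restrict p S) {p. p permutes S}"
proof (rule inj_onI, rule ext)
  fix p q i assume a: "p \<in> {p. p permutes S}" "q \<in> {p. p permutes S}" "restrict p S = restrict q S"
  show "p i = q i"
  proof (cases "i \<in> S")
    case True
    then show ?thesis using fun_cong[OF a(3), of i] by simp
  next
    case False
    then show ?thesis using a(1,2) by (simp add: permutes_not_in)
  qed
qed

lemma detn_mult:
  "detn n (\<lambda>i j. \<Sum>k<n. A i k * B k j) = detn n A * detn n B"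
proof -
  let ?E = "PiE {..<n} (\<lambda>_. {..<n})"
  have "detn n (\<lambda>i j. \<Sum>k<n. A i k * B k j) = (\<Sum>f\<in>?E. (\<Prod>i<n. A i (f i)) * detn n (\<lambda>i. B (f i)))"
    by (rule detn_row_sums) simp
  also have "\<dots> = (\<Sum>f\<in>(\<lambda>p. restrict p {..<n}) ` {p. p permutes {..<n}}. (\<Prod>i<n. A i (f i)) * detn n (\<lambda>i. B (f i)))"
  proof (rule sum.mono_neutral_right)
    show "finite ?E" by (rule finite_PiE) auto
    show "(\<lambda>p. restrict p {..<n}) ` {p. p permutes {..<n}} \<subseteq> ?E"
    proof clarify
      fix p assume "p permutes {..<n}"
      from permutes_in_image[OF this] show "restrict p {..<n} \<in> ?E" by (intro restrict_PiE_iff[THEN iffD2]) auto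
    qed
    show "\<forall>f\<in>?E - (\<lambda>p. restrict p {..<n}) ` {p. p permutes {..<n}}. (\<Prod>i<n. A i (f i)) * detn n (\<lambda>i. B (f i)) = 0"
    proof
      fix f assume f: "f \<in> ?E - (\<lambda>p. restrict p {..<n}) ` {p. p permutes {..<n}}"
      then have "\<not> inj_on f {..<n}" using inj_PiE_permutes[of f n] by blast
      then obtain a b where "a < n" "b < n" "a \<noteq> b" "f a = f b" by (auto simp: inj_on_def)
      then have "detn n (\<lambda>i. B (f i)) = 0" by (intro detn_identical_rows[of a n b]) auto
      then show "(\<Prod>i<n. A i (f i)) * detn n (\<lambda>i. B (f i)) = 0" by simp
    qed
  qed
  also have "\<dots> = (\<Sum>p | p permutes {..<n}. (\<Prod>i<n. A i (p i)) * detn n (\<lambda>i. B (p i)))"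
  proof (subst sum.reindex)
    show "inj_on (\<lambda>p. restrict p {..<n}) {p. p permutes {..<n}}" by (rule inj_on_restrict_permutes)
    have "detn n (\<lambda>i. B (restrict p {..<n} i)) = detn n (\<lambda>i. B (p i))" for p by (rule detn_cong) simp
    then show "sum ((\<lambda>f. (\<Prod>i<n. A i (f i)) * detn n (\<lambda>i. B (f i))) \<circ> (\<lambda>p. restrict p {..<n})) {p. p permutes {..<n}} =
      (\<Sum>p | p permutes {..<n}. (\<Prod>i<n. A i (p i)) * detn n (\<lambda>i. B (p i)))" by simp
  qed
  also have "\<dots> = (\<Sum>p | p permutes {..<n}. of_int (sign p) * (\<Prod>i<n. A i (p i)) * detn n B)"
    by (rule sum.cong[OF refl]) (simp add: detn_permute_rows)
  also have "\<dots> = detn n A * detn n B" by (simp add: detn_def sum_distrib_right)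
  finally show ?thesis .
qed

lemma detn_0 [simp]: "detn 0 M = 1"
  by (simp add: detn_def)

lemma detn_last_row:
  assumes "\<And>j. j < n \<Longrightarrow> M n j = 0"
  shows "detn (Suc n) M = M n n * detn n M"
proof -
  have "detn (Suc n) M = (\<Sum>p | p permutes {..<n}. of_int (sign p) * (\<Prod>i<Suc n. M i (p i)))"
    unfolding detn_def
  proof (rule sum.mono_neutral_right)
    show "finite {p. p permutes {..<Suc n}}" by (rule finite_permutations) auto
    show "{p. p permutes {..<n}} \<subseteq> {p. p permutes {..<Suc n}}"
      using permutes_subset[of _ "{..<n}" "{..<Suc n}"] by auto
    show "\<forall>p\<in>{p. p permutes {..<Suc n}} - {p. p permutes {..<n}}. of_int (sign p) * (\<Prod>i<Suc n. M i (p i)) = 0"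
    proof
      fix p assume p: "p \<in> {p. p permutes {..<Suc n}} - {p. p permutes {..<n}}"
      have "p n \<noteq> n"
      proof
        assume "p n = n"
        then have "p permutes {..<n}"
          using p permutes_superset[of p "{..<Suc n}" "{..<n}"] by (auto simp: less_Suc_eq)
        with p show False by simp
      qed
      moreover have "p n < Suc n" using p permutes_in_image[of p "{..<Suc n}" n] by auto
      ultimately have "M n (p n) = 0" using assms by auto
      then show "of_int (sign p) * (\<Prod>i<Suc n. M i (p i)) = 0" by simp
    qed
  qed
  also have "\<dots> = (\<Sum>p | p permutes {..<n}. M n n * (of_int (sign p) * (\<Prod>i<n. M i (p i))))"
  proof (rule sum.cong[OF refl])
    fix p assume "p \<in> {p. p permutes {..<n}}"
    then have "p n = n" by (auto simp: permutes_def)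
    then show "of_int (sign p) * (\<Prod>i<Suc n. M i (p i)) = M n n * (of_int (sign p) * (\<Prod>i<n. M i (p i)))" by simp
  qed
  finally show ?thesis by (simp add: detn_def sum_distrib_left)
qed

lemma detn_upper_unitriangular:
  assumes "\<And>i j. i < n \<Longrightarrow> j < i \<Longrightarrow> M i j = 0" "\<And>i. i < n \<Longrightarrow> M i i = 1"
  shows "detn n M = 1"
  using assms
proof (induction n)
  case (Suc n)
  have "detn (Suc n) M = M n n * detn n M" by (rule detn_last_row) (use Suc.prems in auto)
  then show ?case using Suc by simp
qed simp

lemma detn_id: "detn n (\<lambda>i j. if i = j then 1 else 0) = 1"
  by (rule detn_upper_unitriangular) auto

lemma detn_row_add:
  assumes "k < n"
  shows "detn n (M(k := (\<lambda>j. c * a j + b j))) = c * detn n (M(k := a)) + detn n (M(k := b))"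
proof -
  have *: "(\<Prod>i<n. (M(k := r)) i (p i)) = r (p k) * (\<Prod>i\<in>{..<n} - {k}. M i (p i))" for r p
  proof -
    have "(\<Prod>i<n. (M(k := r)) i (p i)) = r (p k) * (\<Prod>i\<in>{..<n} - {k}. (M(k := r)) i (p i))"
      using assms by (subst prod.remove[of _ k]) auto
    also have "(\<Prod>i\<in>{..<n} - {k}. (M(k := r)) i (p i)) = (\<Prod>i\<in>{..<n} - {k}. M i (p i))"
      by (rule prod.cong) auto
    finally show ?thesis .
  qed
  show ?thesis unfolding detn_def * by (simp add: algebra_simps sum.distrib sum_distrib_left)
qed

lemma detn_row_scale:
  assumes "k < n"
  shows "detn n (M(k := (\<lambda>j. c * a j))) = c * detn n (M(k := a))"
proof -
  have z: "detn n (M(k := (\<lambda>j. 0))) = 0"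
    using detn_row_add[OF assms, of M 1 "\<lambda>_. 0" "\<lambda>_. 0"] by simp
  show ?thesis using detn_row_add[OF assms, of M c a "\<lambda>_. 0"] z by simp
qed

text \<open>Every permutation term occurs when the product of the row sums is expanded. The bound
  survives growing n as long as the row sums are close enough to 1.\<close>

lemma abs_detn_le_prod_row_sums: "\<bar>detn n M\<bar> \<le> (\<Prod>i<n. \<Sum>j<n. \<bar>M i j\<bar>)"
proof -
  have "\<bar>detn n M\<bar> \<le> (\<Sum>p | p permutes {..<n}. \<Prod>i<n. \<bar>M i (p i)\<bar>)"
    unfolding detn_def
    by (rule order_trans[OF sum_abs]) (auto simp: abs_mult abs_prod sign_def intro!: sum_mono)
  also have "\<dots> = (\<Sum>f\<in>(\<lambda>p. restrict p {..<n}) ` {p. p permutes {..<n}}. \<Prod>i<n. \<bar>M i (f i)\<bar>)"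
  proof (subst sum.reindex)
    show "inj_on (\<lambda>p. restrict p {..<n}) {p. p permutes {..<n}}" by (rule inj_on_restrict_permutes)
  qed simp
  also have "\<dots> \<le> (\<Sum>f\<in>PiE {..<n} (\<lambda>_. {..<n}). \<Prod>i<n. \<bar>M i (f i)\<bar>)"
  proof (rule sum_mono2)
    show "finite (PiE {..<n} (\<lambda>_. {..<n}))" by (rule finite_PiE) auto
    show "(\<lambda>p. restrict p {..<n}) ` {p. p permutes {..<n}} \<subseteq> PiE {..<n} (\<lambda>_. {..<n})"
    proof clarify
      fix p assume "p permutes {..<n}"
      from permutes_in_image[OF this] show "restrict p {..<n} \<in> PiE {..<n} (\<lambda>_. {..<n})"
        by (intro restrict_PiE_iff[THEN iffD2]) auto
    qed
  qed (simp add: prod_nonneg)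
  also have "\<dots> = (\<Prod>i<n. \<Sum>j<n. \<bar>M i j\<bar>)" by (subst prod_sum_PiE) auto
  finally show ?thesis .
qed

text \<open>The rows of \<open>Y\<close> are replaced by those of \<open>X\<close> one at a time;
  each replacement changes a single row, hence costs one row difference times the remaining row
  bounds. With \<open>c i\<close> at least 1 the factor missing from that product can be
  restored.\<close>

lemma abs_detn_diff_le:
  assumes C: "\<And>i. i < n \<Longrightarrow> (\<Sum>j<n. \<bar>X i j\<bar>) \<le> c i" "\<And>i. i < n \<Longrightarrow> (\<Sum>j<n. \<bar>Y i j\<bar>) \<le> c i"
    and c1: "\<And>i. i < n \<Longrightarrow> 1 \<le> c i"
  shows "\<bar>detn n X - detn n Y\<bar> \<le> (\<Prod>i<n. c i) * (\<Sum>i<n. \<Sum>j<n. \<bar>X i j - Y i j\<bar>)"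
proof -
  define Z where "Z m = (\<lambda>i. if i < m then X i else Y i)" for m
  have step: "\<bar>detn n (Z (Suc m)) - detn n (Z m)\<bar> \<le> (\<Prod>i<n. c i) * (\<Sum>j<n. \<bar>X m j - Y m j\<bar>)" if m: "m < n" for m
  proof -
    have a: "Z (Suc m) = (Z m)(m := (\<lambda>j. 1 * X m j + 0))" by (auto simp: Z_def fun_eq_iff less_Suc_eq)
    have b: "Z m = (Z m)(m := Y m)" by (auto simp: Z_def fun_eq_iff)
    have "(Z m)(m := X m) = (Z m)(m := (\<lambda>j. 1 * (X m j - Y m j) + Y m j))" by simp
    then have "detn n (Z (Suc m)) = detn n ((Z m)(m := (\<lambda>j. X m j - Y m j))) + detn n (Z m)"
      using detn_row_add[OF m, of "Z m" 1 "\<lambda>j. X m j - Y m j" "Y m"] a b by simp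
    then have "\<bar>detn n (Z (Suc m)) - detn n (Z m)\<bar> = \<bar>detn n ((Z m)(m := (\<lambda>j. X m j - Y m j)))\<bar>" by simp
    also have "\<dots> \<le> (\<Prod>i<n. \<Sum>j<n. \<bar>((Z m)(m := (\<lambda>j. X m j - Y m j))) i j\<bar>)" by (rule abs_detn_le_prod_row_sums)
    also have "\<dots> = (\<Sum>j<n. \<bar>X m j - Y m j\<bar>) * (\<Prod>i\<in>{..<n} - {m}. \<Sum>j<n. \<bar>Z m i j\<bar>)"
      using m by (subst prod.remove[of _ m]) auto
    also have "\<dots> \<le> (\<Sum>j<n. \<bar>X m j - Y m j\<bar>) * (\<Prod>i\<in>{..<n} - {m}. c i)"
      using C by (intro mult_left_mono prod_mono sum_nonneg) (auto simp: Z_def intro!: sum_nonneg)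
    also have "\<dots> \<le> (\<Sum>j<n. \<bar>X m j - Y m j\<bar>) * (\<Prod>i<n. c i)"
    proof (rule mult_left_mono)
      have "0 \<le> (\<Prod>i\<in>{..<n} - {m}. c i)" using c1 by (intro prod_nonneg) (auto intro: order_trans[of 0 1])
      then show "(\<Prod>i\<in>{..<n} - {m}. c i) \<le> (\<Prod>i<n. c i)"
        using m c1[OF m] by (subst (2) prod.remove[of _ m]) (auto simp: mult_le_cancel_right1)
    qed (simp add: sum_nonneg)
    finally show ?thesis by (simp add: mult.commute)
  qed
  have "detn n X = detn n (Z n)" "detn n Y = detn n (Z 0)" by (auto simp: Z_def intro!: detn_cong)
  then have "detn n X - detn n Y = (\<Sum>m<n. detn n (Z (Suc m)) - detn n (Z m))"
    by (simp add: sum_lessThan_telescope[of "\<lambda>m. detn n (Z m)"])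
  also have "\<bar>\<dots>\<bar> \<le> (\<Sum>m<n. (\<Prod>i<n. c i) * (\<Sum>j<n. \<bar>X m j - Y m j\<bar>))"
    by (rule order_trans[OF sum_abs]) (use step in \<open>auto intro: sum_mono\<close>)
  finally show ?thesis by (simp add: sum_distrib_left)
qed

lemma has_field_derivative_detn:
  assumes "\<And>i j. i < n \<Longrightarrow> j < n \<Longrightarrow> ((\<lambda>t. M t i j) has_field_derivative M' i j) (at t)"
  shows "((\<lambda>t. detn n (M t)) has_field_derivative (\<Sum>k<n. detn n ((M t)(k := M' k)))) (at t)"
proof -
  have *: "((\<lambda>t. \<Sum>p | p permutes {..<n}. of_int (sign p) * (\<Prod>i<n. M t i (p i))) has_field_derivative
     (\<Sum>p | p permutes {..<n}. of_int (sign p) * (\<Sum>k<n. M' k (p k) * (\<Prod>i\<in>{..<n}-{k}. M t i (p i))))) (at t)"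
  proof (intro DERIV_sum DERIV_cmult has_field_derivative_prod assms)
    fix p i assume "p \<in> {p. p permutes {..<n}}" "i \<in> {..<n}"
    then show "i < n" "p i < n" using permutes_in_image[of p "{..<n}" i] by auto
  qed
  have **: "(\<Prod>i<n. ((M t)(k := M' k)) i (p i)) = M' k (p k) * (\<Prod>i\<in>{..<n}-{k}. M t i (p i))" if "k < n" for k p
  proof -
    have "(\<Prod>i<n. ((M t)(k := M' k)) i (p i)) = M' k (p k) * (\<Prod>i\<in>{..<n} - {k}. ((M t)(k := M' k)) i (p i))"
      using that by (subst prod.remove[of _ k]) auto
    also have "(\<Prod>i\<in>{..<n} - {k}. ((M t)(k := M' k)) i (p i)) = (\<Prod>i\<in>{..<n} - {k}. M t i (p i))"
      by (rule prod.cong) auto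
    finally show ?thesis .
  qed
  have "(\<Sum>p | p permutes {..<n}. of_int (sign p) * (\<Sum>k<n. M' k (p k) * (\<Prod>i\<in>{..<n}-{k}. M t i (p i))))
    = (\<Sum>k<n. detn n ((M t)(k := M' k)))"
    unfolding detn_def sum_distrib_left by (subst sum.swap) (simp add: ** del: fun_upd_apply)
  with * show ?thesis by (simp add: detn_def)
qed

lemma tendsto_detn:
  assumes "\<And>i j. i < n \<Longrightarrow> j < n \<Longrightarrow> ((\<lambda>x. M x i j) \<longlongrightarrow> L i j) F"
  shows "((\<lambda>x. detn n (M x)) \<longlongrightarrow> detn n L) F"
  unfolding detn_def
proof (intro tendsto_intros assms)
  fix p i assume "p \<in> {p. p permutes {..<n}}" "i \<in> {..<n}"
  then show "i < n" "p i < n" using permutes_in_image[of p "{..<n}" i] by auto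
qed

text \<open>Reflecting the last row to a multiple of the last unit vector reduces the dimension by one.\<close>

lemma hadamard_inequality: "(detn n M)\<^sup>2 \<le> (\<Prod>i<n. \<Sum>j<n. (M i j)\<^sup>2)"
proof (induction n arbitrary: M)
  case (Suc n)
  define N where "N = Suc n"
  define r where "r = sqrt (\<Sum>j<N. (M n j)\<^sup>2)"
  have r2: "r\<^sup>2 = (\<Sum>j<N. (M n j)\<^sup>2)" unfolding r_def by (simp add: sum_nonneg)
  define v where "v j = M n j - (if j = n then r else 0)" for j
  define q where "q = (\<Sum>j<N. (v j)\<^sup>2)"
  \<comment> \<open>The Householder reflection along \<open>v\<close>. If \<open>q = 0\<close>, the
    last row already is \<open>r\<close> times the last unit vector and \<open>R\<close> is the
    identity.\<close>
  define R where "R i j = (if i = j then 1 else 0) - (if q = 0 then 0 else 2 * v i * v j / q)" for i j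
  have Rsym: "R i j = R j i" for i j by (simp add: R_def)
  have dot_id: "(\<Sum>k<N. a k * (if k = j then 1 else 0)) = a j" if "j < N" for a :: "nat \<Rightarrow> real" and j
    using that by (simp add: if_distrib[of "\<lambda>x. _ * x"] sum.delta cong: if_cong)
  have RR: "(\<Sum>k<N. R i k * R k j) = (if i = j then 1 else 0)" if "i < N" "j < N" for i j
  proof (cases "q = 0")
    case True
    then show ?thesis using that dot_id[of j "\<lambda>k. if i = k then 1 else 0"] by (simp add: R_def)
  next
    case False
    have "(\<Sum>k<N. R i k * R k j) = (\<Sum>k<N. (if i = k then 1 else 0) * (if k = j then 1 else 0) - (if i = k then 1 else 0) * (2 * v k * v j / q)
       - (2 * v i * v k / q) * (if k = j then 1 else 0) + (4 * v i * v j / q\<^sup>2) * (v k)\<^sup>2)"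
      using False by (intro sum.cong refl) (simp add: R_def field_simps power2_eq_square)
    also have "\<dots> = (\<Sum>k<N. (if i = k then 1 else 0) * (if k = j then 1 else 0)) - (\<Sum>k<N. (if i = k then 1 else 0) * (2 * v k * v j / q))
       - (\<Sum>k<N. (2 * v i * v k / q) * (if k = j then 1 else 0)) + (4 * v i * v j / q\<^sup>2) * (\<Sum>k<N. (v k)\<^sup>2)"
      by (simp add: sum.distrib sum_subtractf sum_distrib_left)
    also have "(\<Sum>k<N. (if i = k then 1 else 0) * (2 * v k * v j / q)) = 2 * v i * v j / q"
      using that dot_id[of i "\<lambda>k. 2 * v k * v j / q"] by (simp add: mult.commute eq_commute[of i])
    also have "(\<Sum>k<N. (2 * v i * v k / q) * (if k = j then 1 else 0)) = 2 * v i * v j / q"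
      using dot_id[OF that(2), of "\<lambda>k. 2 * v i * v k / q"] .
    also have "(\<Sum>k<N. (v k)\<^sup>2) = q" by (simp add: q_def)
    also have "(\<Sum>k<N. (if i = k then 1 else 0) * (if k = j then 1 else (0::real))) = (if i = j then 1 else 0)"
      using that by (subst dot_id) auto
    finally show ?thesis using False by (simp add: field_simps power2_eq_square)
  qed
  have "detn N R * detn N R = detn N (\<lambda>i j. if i = j then 1 else 0)"
    unfolding detn_mult[symmetric] by (rule detn_cong) (rule RR)
  then have detR: "(detn N R)\<^sup>2 = 1" by (simp add: detn_id power2_eq_square)
  define A where "A i j = (\<Sum>k<N. M i k * R k j)" for i j
  have detA: "(detn N A)\<^sup>2 = (detn N M)\<^sup>2"
    using detn_mult[of N M R] detR by (simp add: A_def[abs_def] power_mult_distrib)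
  have rows: "(\<Sum>j<N. (A i j)\<^sup>2) = (\<Sum>j<N. (M i j)\<^sup>2)" for i
  proof -
    have "(\<Sum>j<N. (A i j)\<^sup>2) = (\<Sum>j<N. \<Sum>k<N. \<Sum>l<N. M i k * M i l * (R k j * R j l))"
      unfolding A_def power2_eq_square sum_product
      by (intro sum.cong refl) (simp add: Rsym mult_ac)
    also have "\<dots> = (\<Sum>k<N. \<Sum>l<N. \<Sum>j<N. M i k * M i l * (R k j * R j l))"
      by (subst sum.swap, rule sum.cong[OF refl], rule sum.swap)
    also have "\<dots> = (\<Sum>k<N. \<Sum>l<N. M i k * M i l * (if l = k then 1 else 0))"
      unfolding sum_distrib_left[symmetric] by (intro sum.cong refl) (auto simp: RR)
    also have "\<dots> = (\<Sum>k<N. M i k * M i k)"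
      by (intro sum.cong refl, subst dot_id) auto
    finally show ?thesis by (simp add: power2_eq_square)
  qed
  have last: "A n j = 0" if "j < n" for j
  proof (cases "q = 0")
    case True
    then have "v j = 0" using that by (simp add: q_def N_def sum_nonneg_eq_0_iff del: sum.lessThan_Suc)
    then have "M n j = 0" using that by (simp add: v_def)
    then show ?thesis using that True by (simp add: A_def R_def N_def if_distrib[of "\<lambda>x. _ * x"] sum.delta cong: if_cong)
  next
    case False
    \<comment> \<open>Because \<open>r\<close> is the length of the last row, the row has inner
      product q / 2 with \<open>v\<close>; reflecting therefore subtracts exactly \<open>v\<close>
      from it.\<close>
    have qv: "q = 2 * (\<Sum>k<N. M n k * v k)"
    proof -
      have "(\<Sum>k<N. M n k * v k) = r\<^sup>2 - r * M n n"
        using r2 by (simp add: v_def N_def power2_eq_square algebra_simps)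
      moreover have "q = 2 * r\<^sup>2 - 2 * r * M n n"
      proof -
        have "q = (\<Sum>k<n. (M n k)\<^sup>2) + (M n n - r)\<^sup>2" by (simp add: q_def N_def v_def)
        then show ?thesis using r2 by (simp add: N_def power2_eq_square algebra_simps)
      qed
      ultimately show ?thesis by simp
    qed
    have "A n j = (\<Sum>k<N. M n k * (if k = j then 1 else 0)) - 2 * v j / q * (\<Sum>k<N. M n k * v k)"
      unfolding A_def R_def using False
      by (simp add: algebra_simps sum_subtractf sum_distrib_left)
    also have "\<dots> = M n j - v j" using that False qv by (subst dot_id) (auto simp: N_def field_simps)
    also have "\<dots> = 0" using that by (simp add: v_def)
    finally show ?thesis .
  qed
  \<comment> \<open>Only the corner entry of the last row is left. The induction hypothesis applies
    to the leading block, whose rows merely lost their last entry.\<close>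
  have "(detn N A)\<^sup>2 = (A n n)\<^sup>2 * (detn n A)\<^sup>2"
    unfolding N_def by (subst detn_last_row) (auto simp: last power_mult_distrib)
  also have "(A n n)\<^sup>2 \<le> (\<Sum>j<N. (A n j)\<^sup>2)" by (simp add: N_def sum_nonneg)
  also have "(detn n A)\<^sup>2 \<le> (\<Prod>i<n. \<Sum>j<n. (A i j)\<^sup>2)" by (rule Suc.IH)
  also have "\<dots> \<le> (\<Prod>i<n. \<Sum>j<N. (A i j)\<^sup>2)"
    by (intro prod_mono conjI sum_nonneg sum_mono2) (auto simp: N_def)
  finally have "(detn N A)\<^sup>2 \<le> (\<Sum>j<N. (A n j)\<^sup>2) * (\<Prod>i<n. \<Sum>j<N. (A i j)\<^sup>2)"
    by (simp add: mult_left_mono mult_right_mono sum_nonneg)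
  then show ?case unfolding detA rows by (simp add: N_def mult.commute)
qed simp

text \<open>Scaling \<open>g\<close> out of rows and columns leaves entries bounded by
  \<open>C\<close>, to which Hadamard applies. The gain over summing n! terms is the growth n^(n/2),
  which the n! of the Fredholm series can absorb.\<close>

lemma abs_detn_le_of_rank_one_bound:
  assumes "\<And>i j. i < n \<Longrightarrow> j < n \<Longrightarrow> \<bar>M i j\<bar> \<le> C * g i * g j" "\<And>i. i < n \<Longrightarrow> 0 < g i" "0 \<le> C"
  shows "\<bar>detn n M\<bar> \<le> sqrt (real n ^ n) * C ^ n * (\<Prod>i<n. (g i)\<^sup>2)"
proof -
  have scale: "detn n (\<lambda>i j. a i * b j * X i j) = (\<Prod>i<n. a i) * (\<Prod>i<n. b i) * detn n X"
    for a b :: "nat \<Rightarrow> real" and X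
  proof -
    have "(\<Prod>i<n. a i * b (p i) * X i (p i)) = (\<Prod>i<n. a i) * (\<Prod>i<n. b i) * (\<Prod>i<n. X i (p i))"
      if "p permutes {..<n}" for p
      using prod.permute[OF that, of b] by (simp add: prod.distrib o_def)
    then show ?thesis unfolding detn_def sum_distrib_left by (intro sum.cong refl) simp
  qed
  define X where "X i j = M i j / (g i * g j)" for i j
  have X: "\<bar>X i j\<bar> \<le> C" if "i < n" "j < n" for i j
    using assms(1)[OF that] assms(2)[OF that(1)] assms(2)[OF that(2)]
    by (simp add: X_def abs_mult divide_le_eq mult_ac)
  have "detn n M = detn n (\<lambda>i j. g i * g j * X i j)"
    by (rule detn_cong) (use assms(2) in \<open>force simp: X_def\<close>)
  also have "\<dots> = (\<Prod>i<n. (g i)\<^sup>2) * detn n X" by (simp add: scale power2_eq_square prod.distrib)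
  finally have eq: "\<bar>detn n M\<bar> = (\<Prod>i<n. (g i)\<^sup>2) * \<bar>detn n X\<bar>" by (simp add: abs_mult abs_prod)
  have "(detn n X)\<^sup>2 \<le> (\<Prod>i<n. \<Sum>j<n. (X i j)\<^sup>2)" by (rule hadamard_inequality)
  also have "\<dots> \<le> (\<Prod>i<n. \<Sum>j<n. C\<^sup>2)"
    using X assms(3) by (intro prod_mono conjI sum_nonneg sum_mono) (auto simp: abs_le_square_iff[symmetric])
  also have "\<dots> = (sqrt (real n ^ n) * C ^ n)\<^sup>2"
    by (simp add: power_mult_distrib power_mult[symmetric] mult.commute)
  finally have "\<bar>detn n X\<bar> \<le> sqrt (real n ^ n) * C ^ n"
    using assms(3) by (simp add: abs_le_square_iff[symmetric] abs_mult)
  then show ?thesis unfolding eq using mult_right_mono[of "\<bar>detn n X\<bar>" _ "\<Prod>i<n. (g i)\<^sup>2"] by (simp add: mult.commute prod_nonneg)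
qed

text \<open>Von Koch's expansion; tuples of indices that are not injective contribute nothing.\<close>

lemma detn_id_minus:
  "detn N (\<lambda>i j. (if i = j then 1 else 0) - A i j) =
   (\<Sum>k. (-1) ^ k / fact k * (\<Sum>c\<in>PiE {..<k} (\<lambda>_. {..<N}). detn k (\<lambda>a b. A (c a) (c b))))"
proof -
  \<comment> \<open>The principal minor of \<open>A\<close> on \<open>S\<close>, written without
    choosing an enumeration of \<open>S\<close>.\<close>
  define D where "D S = (\<Sum>p | p permutes S. of_int (sign p) * (\<Prod>i\<in>S. A i (p i)))" for S :: "nat set"
  have "detn N (\<lambda>i j. (if i = j then 1 else 0) - A i j) =
     (\<Sum>p | p permutes {..<N}. of_int (sign p) * (\<Sum>S\<in>Pow {..<N}. (\<Prod>i\<in>S. - A i (p i)) * (\<Prod>i\<in>{..<N}-S. if i = p i then 1 else 0)))"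
    unfolding detn_def
  proof (intro sum.cong refl arg_cong2[of _ _ _ _ "(*)"])
    fix p
    show "(\<Prod>i<N. (if i = p i then 1 else 0) - A i (p i)) = (\<Sum>S\<in>Pow {..<N}. (\<Prod>i\<in>S. - A i (p i)) * (\<Prod>i\<in>{..<N}-S. if i = p i then 1 else 0))"
      using prod_add[of "{..<N}" "\<lambda>i. - A i (p i)" "\<lambda>i. if i = p i then 1 else 0"] by simp
  qed
  also have "\<dots> = (\<Sum>S\<in>Pow {..<N}. \<Sum>p | p permutes {..<N}. of_int (sign p) * ((\<Prod>i\<in>S. - A i (p i)) * (\<Prod>i\<in>{..<N}-S. if i = p i then 1 else 0)))"
    unfolding sum_distrib_left by (rule sum.swap)
  also have "\<dots> = (\<Sum>S\<in>Pow {..<N}. (-1) ^ card S * D S)"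
  proof (rule sum.cong[OF refl])
    fix S assume S: "S \<in> Pow {..<N}"
    then have fin: "finite S" by (auto intro: finite_subset)
    \<comment> \<open>The identity matrix supplies the entries outside \<open>S\<close>, so only
      permutations fixing every point outside \<open>S\<close> survive.\<close>
    have "(\<Sum>p | p permutes {..<N}. of_int (sign p) * ((\<Prod>i\<in>S. - A i (p i)) * (\<Prod>i\<in>{..<N}-S. if i = p i then 1 else 0)))
       = (\<Sum>p | p permutes S. of_int (sign p) * ((\<Prod>i\<in>S. - A i (p i)) * (\<Prod>i\<in>{..<N}-S. if i = p i then 1 else 0)))"
    proof (rule sum.mono_neutral_right)
      show "finite {p. p permutes {..<N}}" by (rule finite_permutations) auto
      show "{p. p permutes S} \<subseteq> {p. p permutes {..<N}}" using permutes_subset S by auto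
      show "\<forall>p\<in>{p. p permutes {..<N}} - {p. p permutes S}. of_int (sign p) * ((\<Prod>i\<in>S. - A i (p i)) * (\<Prod>i\<in>{..<N}-S. if i = p i then 1 else 0)) = 0"
      proof
        fix p assume p: "p \<in> {p. p permutes {..<N}} - {p. p permutes S}"
        then obtain i where "i \<in> {..<N} - S" "p i \<noteq> i" using permutes_superset[of p "{..<N}" S] by auto
        then have "(\<Prod>i\<in>{..<N}-S. if i = p i then 1 else (0::real)) = 0" by (intro prod_zero) (auto intro!: bexI[of _ i])
        then show "of_int (sign p) * ((\<Prod>i\<in>S. - A i (p i)) * (\<Prod>i\<in>{..<N}-S. if i = p i then 1 else 0)) = 0" by simp
      qed
    qed
    also have "\<dots> = (\<Sum>p | p permutes S. (-1) ^ card S * (of_int (sign p) * (\<Prod>i\<in>S. A i (p i))))"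
    proof (rule sum.cong[OF refl])
      fix p assume "p \<in> {p. p permutes S}"
      then have "(\<Prod>i\<in>{..<N}-S. if i = p i then 1 else (0::real)) = 1"
        by (intro prod.neutral) (auto simp: permutes_not_in)
      moreover have "(\<Prod>i\<in>S. - A i (p i)) = (-1) ^ card S * (\<Prod>i\<in>S. A i (p i))"
        by (simp add: prod_uminus)
      ultimately show "of_int (sign p) * ((\<Prod>i\<in>S. - A i (p i)) * (\<Prod>i\<in>{..<N}-S. if i = p i then 1 else 0)) = (-1) ^ card S * (of_int (sign p) * (\<Prod>i\<in>S. A i (p i)))"
        by simp
    qed
    finally show "(\<Sum>p | p permutes {..<N}. of_int (sign p) * ((\<Prod>i\<in>S. - A i (p i)) * (\<Prod>i\<in>{..<N}-S. if i = p i then 1 else 0))) = (-1) ^ card S * D S"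
      by (simp add: D_def sum_distrib_left)
  qed
  also have "\<dots> = (\<Sum>k\<le>N. \<Sum>S | S \<subseteq> {..<N} \<and> card S = k. (-1) ^ k * D S)"
  proof -
    have "(\<Sum>k\<le>N. \<Sum>S | S \<in> Pow {..<N} \<and> card S = k. (-1) ^ card S * D S) = (\<Sum>S\<in>Pow {..<N}. (-1) ^ card S * D S)"
      by (rule sum.group) (auto intro: card_mono[of "{..<N}", simplified])
    then show ?thesis by simp
  qed
  also have "\<dots> = (\<Sum>k\<le>N. (-1) ^ k / fact k * (\<Sum>c\<in>PiE {..<k} (\<lambda>_. {..<N}). detn k (\<lambda>a b. A (c a) (c b))))"
  proof (rule sum.cong[OF refl])
    fix k :: nat
    let ?I = "{c \<in> PiE {..<k} (\<lambda>_. {..<N}). inj_on c {..<k}}"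
    have finE: "finite (PiE {..<k} (\<lambda>_. {..<N}))" by (rule finite_PiE) auto
    have "(\<Sum>c\<in>PiE {..<k} (\<lambda>_. {..<N}). detn k (\<lambda>a b. A (c a) (c b))) = (\<Sum>c\<in>?I. detn k (\<lambda>a b. A (c a) (c b)))"
    proof (rule sum.mono_neutral_right[OF finE])
      show "\<forall>c\<in>PiE {..<k} (\<lambda>_. {..<N}) - ?I. detn k (\<lambda>a b. A (c a) (c b)) = 0"
      proof
        fix c assume "c \<in> PiE {..<k} (\<lambda>_. {..<N}) - ?I"
        then obtain a b where "a < k" "b < k" "a \<noteq> b" "c a = c b" by (auto simp: inj_on_def)
        then show "detn k (\<lambda>a b. A (c a) (c b)) = 0" by (intro detn_identical_rows[of a k b]) auto
      qed
    qed auto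
    also have "\<dots> = (\<Sum>S | S \<subseteq> {..<N} \<and> card S = k. \<Sum>c | c \<in> ?I \<and> c ` {..<k} = S. detn k (\<lambda>a b. A (c a) (c b)))"
    proof (rule sum.group[symmetric])
      show "finite ?I" using finE by auto
      show "finite {S. S \<subseteq> {..<N} \<and> card S = k}" by auto
      show "(\<lambda>c. c ` {..<k}) ` ?I \<subseteq> {S. S \<subseteq> {..<N} \<and> card S = k}"
        by (auto simp: card_image PiE_iff)
    qed
    also have "\<dots> = (\<Sum>S | S \<subseteq> {..<N} \<and> card S = k. fact k * D S)"
    proof (rule sum.cong[OF refl])
      fix S assume "S \<in> {S. S \<subseteq> {..<N} \<and> card S = k}"
      then have S: "S \<subseteq> {..<N}" "card S = k" by auto
      then have fS: "finite S" by (auto intro: finite_subset)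
      have det: "detn k (\<lambda>a b. A (c a) (c b)) = D S" if c: "bij_betw c {..<k} S" for c
      proof -
        have "D S = (\<Sum>p | p permutes {..<k}. of_int (sign p) * (\<Prod>a<k. A (c a) (c (p a))))"
          unfolding D_def
        proof (rule sum.reindex_bij_betw[OF bij_betw_permutations[OF c], symmetric, THEN trans], rule sum.cong[OF refl])
          fix p assume "p \<in> {p. p permutes {..<k}}"
          then have p: "p permutes {..<k}" by simp
          let ?q = "\<lambda>x. if x \<in> S then c (p (inv_into {..<k} c x)) else x"
          have "sign ?q = sign p"
          proof -
            have "?q = map_permutation {..<k} c p"
              using c by (auto simp: map_permutation_def restrict_id_def bij_betw_def fun_eq_iff)
            then show ?thesis using sign_map_permutation[of c "{..<k}" p] p c by (simp add: bij_betw_def)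
          qed
          moreover have "(\<Prod>i\<in>S. A i (?q i)) = (\<Prod>a<k. A (c a) (c (p a)))"
          proof -
            have "(\<Prod>i\<in>S. A i (?q i)) = (\<Prod>a<k. A (c a) (?q (c a)))"
              by (rule prod.reindex_bij_betw[OF c, symmetric])
            also have "\<dots> = (\<Prod>a<k. A (c a) (c (p a)))"
              using c by (intro prod.cong refl) (auto simp: bij_betw_def)
            finally show ?thesis .
          qed
          ultimately show "of_int (sign ?q) * (\<Prod>i\<in>S. A i (?q i)) = of_int (sign p) * (\<Prod>a<k. A (c a) (c (p a)))" by simp
        qed
        then show ?thesis by (simp add: detn_def)
      qed
      \<comment> \<open>Each k-element set is enumerated by k! injective tuples, all giving the same
        minor; this is the origin of 1 / k!.\<close>
      have "card {c. c \<in> ?I \<and> c ` {..<k} = S} = fact k"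
      proof -
        have "{c. c \<in> ?I \<and> c ` {..<k} = S} = {c \<in> extensional_funcset {..<k} S. inj_on c {..<k}}"
        proof (intro set_eqI iffI)
          fix c assume "c \<in> {c \<in> extensional_funcset {..<k} S. inj_on c {..<k}}"
          moreover from this have "c ` {..<k} = S"
            using S fS by (intro card_subset_eq) (auto simp: card_image)
          ultimately show "c \<in> {c. c \<in> ?I \<and> c ` {..<k} = S}" using S by (auto simp: PiE_iff)
        qed (auto simp: PiE_iff)
        then show ?thesis using card_inj_on_subset_funcset[of "{..<k}" S "{..<k}"] fS S by (simp add: fact_prod_rev)
      qed
      moreover have "(\<Sum>c | c \<in> ?I \<and> c ` {..<k} = S. detn k (\<lambda>a b. A (c a) (c b))) = (\<Sum>c | c \<in> ?I \<and> c ` {..<k} = S. D S)"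
        by (intro sum.cong refl det) (auto simp: bij_betw_def)
      ultimately show "(\<Sum>c | c \<in> ?I \<and> c ` {..<k} = S. detn k (\<lambda>a b. A (c a) (c b))) = fact k * D S" by simp
    qed
    finally show "(\<Sum>S | S \<subseteq> {..<N} \<and> card S = k. (-1) ^ k * D S) =
       (-1) ^ k / fact k * (\<Sum>c\<in>PiE {..<k} (\<lambda>_. {..<N}). detn k (\<lambda>a b. A (c a) (c b)))"
      by (simp add: sum_distrib_left)
  qed
  also have "\<dots> = (\<Sum>k. (-1) ^ k / fact k * (\<Sum>c\<in>PiE {..<k} (\<lambda>_. {..<N}). detn k (\<lambda>a b. A (c a) (c b))))"
  proof (rule suminf_finite[symmetric])
    fix k assume "k \<notin> {..N}"
    then have k: "N < k" by simp
    have "detn k (\<lambda>a b. A (c a) (c b)) = 0" if "c \<in> PiE {..<k} (\<lambda>_. {..<N})" for c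
    proof -
      have "\<not> inj_on c {..<k}"
        using card_inj_on_le[of c "{..<k}" "{..<N}"] that k by (auto simp: PiE_iff)
      then obtain a b where "a < k" "b < k" "a \<noteq> b" "c a = c b" by (auto simp: inj_on_def)
      then show ?thesis by (intro detn_identical_rows[of a k b]) auto
    qed
    then show "(-1) ^ k / fact k * (\<Sum>c\<in>PiE {..<k} (\<lambda>_. {..<N}). detn k (\<lambda>a b. A (c a) (c b))) = 0" by simp
  qed simp
  finally show ?thesis .
qed

section \<open>Fredholm series\<close>

lemma exp_integrable_half_line:
  assumes "0 < c"
  shows "integrable (restrict_space lborel {s<..}) (\<lambda>x::real. exp (- c * x))"
proof -
  have "(\<integral>\<^sup>+x. ennreal (exp (- c * x)) * indicator {s..} x \<partial>lborel) = ennreal (0 - (- exp (- c * s) / c))"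
  proof (rule nn_integral_FTC_atLeast)
    show "((\<lambda>x. - exp (- c * x) / c) \<longlongrightarrow> 0) at_top" using assms by real_asymp
  qed (use assms in \<open>auto intro!: derivative_eq_intros simp: field_simps\<close>)
  moreover have "(\<integral>\<^sup>+x. ennreal (exp (- c * x)) * indicator {s<..} x \<partial>lborel)
      \<le> (\<integral>\<^sup>+x. ennreal (exp (- c * x)) * indicator {s..} x \<partial>lborel)"
    by (rule nn_integral_mono) (auto split: split_indicator)
  ultimately have "(\<integral>\<^sup>+x. ennreal (exp (- c * x)) * indicator {s<..} x \<partial>lborel) < \<infinity>"
    by (simp add: order_le_less_trans)
  then have "integrable lborel (\<lambda>x. indicator {s<..} x *\<^sub>R exp (- c * x))"
    by (intro integrableI_nonneg) (auto simp: ennreal_mult ennreal_indicator mult.commute)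
  then show ?thesis by (subst integrable_restrict_space) auto
qed

lemma product_sigma_finite_half_line: "product_sigma_finite (\<lambda>_::nat. restrict_space lborel {s::real<..})"
  by (simp add: product_sigma_finite_def sigma_finite_lborel sigma_finite_measure_restrict_space)

lemma measurable_half_line_component:
  assumes "i < k"
  shows "(\<lambda>x. x i) \<in> measurable (PiM {..<k} (\<lambda>_::nat. restrict_space lborel {s::real<..})) borel"
proof -
  have "(\<lambda>x. x i) \<in> measurable (PiM {..<k} (\<lambda>_::nat. restrict_space lborel {s<..})) (restrict_space lborel {s<..})"
    by (rule measurable_component_singleton) (use assms in auto)
  then show ?thesis by (auto simp: measurable_restrict_space2_iff)
qed

text \<open>This is det (1 - G F) = det (1 - F G) for a kernel of finite rank. Both sides expand
  into minors over index tuples, and integrating out the variables turns the minors of the kernel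
  into those of the matrix of integrals.\<close>

lemma detn_finite_rank_eq_fredholm_det:
  assumes int: "\<And>i j. i < N \<Longrightarrow> j < N \<Longrightarrow> integrable (restrict_space lborel {s<..}) (\<lambda>x. f i x * g j x)"
  shows "detn N (\<lambda>i j. (if i = j then 1 else 0) - (LINT x|restrict_space lborel {s<..}. f i x * g j x)) =
    fredholm_det (\<lambda>x y. \<Sum>i<N. f i x * g i y) s"
proof -
  interpret product_sigma_finite "\<lambda>_::nat. restrict_space lborel {s::real<..}"
    by (rule product_sigma_finite_half_line)
  define A where "A i j = (LINT x|restrict_space lborel {s<..}. f i x * g j x)" for i j
  have "integral\<^sup>L (PiM {..<k} (\<lambda>_. restrict_space lborel {s<..})) (\<lambda>x. detn k (\<lambda>a b. \<Sum>i<N. f i (x a) * g i (x b)))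
     = (\<Sum>c\<in>PiE {..<k} (\<lambda>_. {..<N}). detn k (\<lambda>a b. A (c a) (c b)))" for k
  proof -
    let ?P = "PiM {..<k} (\<lambda>_. restrict_space lborel {s<..})"
    have pt: "detn k (\<lambda>a b. \<Sum>i<N. f i (x a) * g i (x b)) =
       (\<Sum>c\<in>PiE {..<k} (\<lambda>_. {..<N}). \<Sum>p | p permutes {..<k}. of_int (sign p) * (\<Prod>a<k. f (c a) (x a) * g (c (p a)) (x a)))" for x
    proof -
      have "detn k (\<lambda>a b. \<Sum>i<N. f i (x a) * g i (x b)) =
        (\<Sum>c\<in>PiE {..<k} (\<lambda>_. {..<N}). (\<Prod>a<k. f (c a) (x a)) * detn k (\<lambda>a b. g (c a) (x b)))"
        using detn_row_sums[of "{..<N}" k "\<lambda>a i. f i (x a)" "\<lambda>i b. g i (x b)"] by simp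
      \<comment> \<open>Transposing the second determinant collects in each product the two factors
        that depend on the same variable, so that the integral over the product space
        factorises.\<close>
      also have "\<dots> = (\<Sum>c\<in>PiE {..<k} (\<lambda>_. {..<N}). (\<Prod>a<k. f (c a) (x a)) * detn k (\<lambda>a b. g (c b) (x a)))"
        by (subst detn_transpose) simp
      finally show ?thesis by (simp add: detn_def sum_distrib_left prod.distrib mult_ac)
    qed
    have cp: "c a < N" "c (p a) < N"
      if "c \<in> PiE {..<k} (\<lambda>_. {..<N})" "p permutes {..<k}" "a \<in> {..<k}" for c p a
      using that permutes_in_image[OF that(2), of a] by (auto simp: PiE_iff)
    have I: "integrable ?P (\<lambda>x. \<Prod>a<k. f (c a) (x a) * g (c (p a)) (x a))"
      "integral\<^sup>L ?P (\<lambda>x. \<Prod>a<k. f (c a) (x a) * g (c (p a)) (x a)) = (\<Prod>a<k. A (c a) (c (p a)))"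
      if "c \<in> PiE {..<k} (\<lambda>_. {..<N})" "p permutes {..<k}" for c p
      using product_integrable_prod[of "{..<k}" "\<lambda>a x. f (c a) x * g (c (p a)) x"]
        product_integral_prod[of "{..<k}" "\<lambda>a x. f (c a) x * g (c (p a)) x"] int cp[OF that]
      by (auto simp: A_def)
    have "integral\<^sup>L ?P (\<lambda>x. detn k (\<lambda>a b. \<Sum>i<N. f i (x a) * g i (x b))) =
       (\<Sum>c\<in>PiE {..<k} (\<lambda>_. {..<N}). \<Sum>p | p permutes {..<k}. of_int (sign p) * (\<Prod>a<k. A (c a) (c (p a))))"
      unfolding pt
      by (subst Bochner_Integration.integral_sum, intro Bochner_Integration.integrable_sum integrable_mult_right I)
         (auto intro!: sum.cong simp: I Bochner_Integration.integral_sum)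
    then show ?thesis by (simp add: detn_def)
  qed
  then show ?thesis unfolding fredholm_det_def A_def[symmetric] by (simp add: detn_id_minus)
qed

text \<open>Half a factorial still beats every geometric rate. The other half is spent on Hadamard's
  bound in the Fredholm series and on the number of removable corners in the Schur
  determinants.\<close>

lemma summable_pow_div_sqrt_fact: "summable (\<lambda>k. (Q::real) ^ k / sqrt (fact k))"
proof -
  have "summable (\<lambda>k. \<bar>Q\<bar> ^ k / sqrt (fact k))"
    proof (rule summable_ratio_test[where c = "1/2" and N = "nat \<lceil>4 * Q\<^sup>2\<rceil>"])
      fix n assume "nat \<lceil>4 * Q\<^sup>2\<rceil> \<le> n"
      then have "4 * Q\<^sup>2 \<le> real n + 1" by linarith
      then have "sqrt (4 * Q\<^sup>2) \<le> sqrt (real n + 1)" by (rule real_sqrt_le_mono)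
      then have "2 * \<bar>Q\<bar> \<le> sqrt (real n + 1)" by (simp add: real_sqrt_mult)
      then have "\<bar>Q\<bar> / sqrt (real n + 1) \<le> 1 / 2" by (simp add: field_simps)
      then have "\<bar>Q\<bar> / sqrt (real n + 1) * (\<bar>Q\<bar> ^ n / sqrt (fact n)) \<le> 1 / 2 * (\<bar>Q\<bar> ^ n / sqrt (fact n))"
        by (rule mult_right_mono) simp
      then show "norm (\<bar>Q\<bar> ^ Suc n / sqrt (fact (Suc n))) \<le> 1 / 2 * norm (\<bar>Q\<bar> ^ n / sqrt (fact n))"
        by (simp add: real_sqrt_mult mult_ac add.commute)
    qed simp
  then show ?thesis
    by (rule summable_rabs_cancel[of "\<lambda>k. Q ^ k / sqrt (fact k)", OF summable_comparison_test', where N = 0])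
       (auto simp: abs_mult power_abs)
qed

text \<open>Dominated convergence is applied twice: to each term, with the integrable majorant that
  Hadamard's inequality extracts from the exponential bound, and then to the series by Tannery's
  theorem. Both majorants are independent of m.\<close>

lemma fredholm_det_tendsto:
  fixes Km :: "nat \<Rightarrow> real \<Rightarrow> real \<Rightarrow> real"
  assumes meas: "\<And>m. (\<lambda>p. Km m (fst p) (snd p)) \<in> borel_measurable (borel \<Otimes>\<^sub>M borel)"
    and bd: "\<And>m x y. s < x \<Longrightarrow> s < y \<Longrightarrow> \<bar>Km m x y\<bar> \<le> C * exp (- x) * exp (- y)"
    and lim: "\<And>x y. s < x \<Longrightarrow> s < y \<Longrightarrow> (\<lambda>m. Km m x y) \<longlonglongrightarrow> K x y"
  shows "(\<lambda>m. fredholm_det (Km m) s) \<longlonglongrightarrow> fredholm_det K s"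
proof -
  interpret product_sigma_finite "\<lambda>_::nat. restrict_space lborel {s::real<..}"
    by (rule product_sigma_finite_half_line)
  define P where "P k = PiM {..<k::nat} (\<lambda>_. restrict_space lborel {s<..})" for k
  define I where "I = (LINT x|restrict_space lborel {s<..}. (exp (- x))\<^sup>2)"
  have I: "integrable (restrict_space lborel {s<..}) (\<lambda>x::real. (exp (- x))\<^sup>2)"
    using exp_integrable_half_line[of 2 s] by (simp add: power2_eq_square exp_add[symmetric])
  have C0: "0 \<le> C"
  proof -
    have "0 \<le> C * exp (- (s+1)) * exp (- (s+1))" using order_trans[OF abs_ge_zero bd[of "s+1" "s+1"]] by simp
    then show ?thesis by (simp add: zero_le_mult_iff)
  qed
  define h where "h k x = sqrt (real k ^ k) * C ^ k * (\<Prod>i<k. (exp (- x i))\<^sup>2)" for k and x :: "nat \<Rightarrow> real"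
  have hint: "integrable (P k) (h k)" and hval: "integral\<^sup>L (P k) (h k) = sqrt (real k ^ k) * C ^ k * I ^ k" for k
    using product_integrable_prod[of "{..<k}" "\<lambda>i x. (exp (- x))\<^sup>2"] product_integral_prod[of "{..<k}" "\<lambda>i x. (exp (- x))\<^sup>2"] I
    by (auto simp: h_def[abs_def] P_def I_def)
  have sp: "s < x i" if "x \<in> space (P k)" "i < k" for x k i
    using that by (auto simp: P_def space_PiM PiE_iff space_restrict_space)
  have hb: "\<bar>detn k (\<lambda>i j. Km m (x i) (x j))\<bar> \<le> h k x" if "x \<in> space (P k)" for k m x
    unfolding h_def using sp[OF that] bd C0 by (intro abs_detn_le_of_rank_one_bound) auto
  have dm: "(\<lambda>x. detn k (\<lambda>i j. Km m (x i) (x j))) \<in> borel_measurable (P k)" for k m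
    unfolding detn_def P_def
  proof (intro borel_measurable_sum borel_measurable_times borel_measurable_prod borel_measurable_const)
    fix p i assume p: "p \<in> {p. p permutes {..<k}}" and i: "i \<in> {..<k}"
    then have "p i < k" using permutes_in_image[of p "{..<k}" i] by auto
    then have "(\<lambda>x. (x i, x (p i))) \<in> measurable (PiM {..<k} (\<lambda>_. restrict_space lborel {s<..})) (borel \<Otimes>\<^sub>M borel)"
      using i by (intro measurable_Pair measurable_half_line_component) auto
    from measurable_compose[OF this meas[of m]]
    show "(\<lambda>x. Km m (x i) (x (p i))) \<in> borel_measurable (PiM {..<k} (\<lambda>_. restrict_space lborel {s<..}))" by simp
  qed
  have dlim: "(\<lambda>m. detn k (\<lambda>i j. Km m (x i) (x j))) \<longlonglongrightarrow> detn k (\<lambda>i j. K (x i) (x j))" if "x \<in> space (P k)" for k x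
    by (intro tendsto_detn lim sp[OF that])
  have T: "(\<lambda>m. integral\<^sup>L (P k) (\<lambda>x. detn k (\<lambda>i j. Km m (x i) (x j)))) \<longlonglongrightarrow> integral\<^sup>L (P k) (\<lambda>x. detn k (\<lambda>i j. K (x i) (x j)))" for k
  proof (rule integral_dominated_convergence[where w = "h k"])
    show "(\<lambda>x. detn k (\<lambda>i j. K (x i) (x j))) \<in> borel_measurable (P k)"
      using dlim dm by (rule borel_measurable_LIMSEQ_real)
  qed (use dm dlim hb hint in auto)
  have I0: "0 \<le> I" unfolding I_def by simp
  \<comment> \<open>Since k^k / k! is a single term of the series of exp k, Hadamard's k^(k/2) costs
    only a geometric factor and one root of k!.\<close>
  have kk: "sqrt (real k ^ k) / fact k \<le> sqrt (exp 1) ^ k / sqrt (fact k)" for k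
  proof -
    have "real k ^ k / fact k \<le> exp (real k)"
    proof -
      have "real k ^ k / fact k \<le> (\<Sum>n. real k ^ n /\<^sub>R fact n)"
        using sum_le_suminf[of "\<lambda>n. real k ^ n /\<^sub>R fact n" "{k}"] summable_exp_generic[of "real k"]
        by (simp add: divide_inverse mult.commute)
      then show ?thesis by (simp add: exp_def)
    qed
    then have "sqrt (real k ^ k / fact k) \<le> sqrt (exp (real k))" by simp
    also have "exp (real k) = exp 1 ^ k" by (simp add: exp_of_nat_mult[symmetric])
    finally have "sqrt (real k ^ k) / sqrt (fact k) \<le> sqrt (exp 1) ^ k" by (simp add: real_sqrt_divide real_sqrt_power)
    then have "sqrt (real k ^ k) / sqrt (fact k) / sqrt (fact k) \<le> sqrt (exp 1) ^ k / sqrt (fact k)"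
      by (rule divide_right_mono) simp
    then show ?thesis by simp
  qed
  define W where "W k = (sqrt (exp 1) * C * I) ^ k / sqrt (fact k)" for k
  have tb: "norm ((-1) ^ k / fact k * integral\<^sup>L (P k) (\<lambda>x. detn k (\<lambda>i j. Km m (x i) (x j)))) \<le> W k" for k m
  proof -
    have "\<bar>integral\<^sup>L (P k) (\<lambda>x. detn k (\<lambda>i j. Km m (x i) (x j)))\<bar> \<le> integral\<^sup>L (P k) (h k)"
      using hb by (intro order_trans[OF integral_abs_bound] integral_mono_AE' hint) (auto simp: h_def prod_nonneg C0 AE_I2)
    then have "\<bar>integral\<^sup>L (P k) (\<lambda>x. detn k (\<lambda>i j. Km m (x i) (x j)))\<bar> / fact k \<le> (sqrt (real k ^ k) / fact k) * (C * I) ^ k"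
      by (simp add: hval divide_right_mono power_mult_distrib mult_ac)
    also have "\<dots> \<le> sqrt (exp 1) ^ k / sqrt (fact k) * (C * I) ^ k"
      using kk C0 I0 by (intro mult_right_mono) auto
    finally show ?thesis by (simp add: W_def abs_mult power_mult_distrib mult_ac)
  qed
  have "(\<lambda>m. \<Sum>k. (-1) ^ k / fact k * integral\<^sup>L (P k) (\<lambda>x. detn k (\<lambda>i j. Km m (x i) (x j)))) \<longlonglongrightarrow>
     (\<Sum>k. (-1) ^ k / fact k * integral\<^sup>L (P k) (\<lambda>x. detn k (\<lambda>i j. K (x i) (x j))))"
  proof (rule tannerys_theorem[THEN conjunct2, THEN conjunct2])
    show "summable W" unfolding W_def by (rule summable_pow_div_sqrt_fact)
    show "\<forall>\<^sub>F (k, m) in sequentially \<times>\<^sub>F sequentially. norm ((-1) ^ k / fact k * integral\<^sup>L (P k) (\<lambda>x. detn k (\<lambda>i j. Km m (x i) (x j)))) \<le> W k"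
      using tb by (intro always_eventually) auto
  qed (intro tendsto_mult tendsto_const T, simp)
  then show ?thesis by (simp add: fredholm_det_def P_def)
qed

section \<open>Airy and Bessel functions\<close>

text \<open>The Airy function as an absolutely convergent integral over a vertical line.\<close>

definition airy_exp :: "real \<Rightarrow> complex \<Rightarrow> complex" where
  "airy_exp x w = exp (w ^ 3 / 3 - of_real x * w)"

definition Ai_line :: "real \<Rightarrow> real \<Rightarrow> real" where
  "Ai_line c x = Re (LINT t|lborel. airy_exp x (Complex c t)) / (2 * pi)"

lemma Re_airy_exponent:
  "Re (Complex c t ^ 3 / 3 - of_real x * Complex c t) = c ^ 3 / 3 - c * t\<^sup>2 - x * c"
proof -
  have "3 * Re (Complex c t ^ 3 / 3) = Re (Complex c t ^ 3)" by simp
  also have "\<dots> = c ^ 3 - 3 * c * t\<^sup>2"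
    by (simp add: power3_eq_cube power2_eq_square algebra_simps)
  finally show ?thesis by simp
qed

lemma norm_airy_exp: "norm (airy_exp x (Complex c t)) = exp (c ^ 3 / 3 - x * c) * exp (- c * t\<^sup>2)"
  unfolding airy_exp_def norm_exp_eq_Re Re_airy_exponent by (simp add: exp_add[symmetric] algebra_simps)

lemma integrable_gaussian:
  assumes "0 < c"
  shows "integrable lborel (\<lambda>t::real. exp (- c * t\<^sup>2))"
proof -
  have "integrable lborel (\<lambda>t. sqrt (pi / c) * normal_density 0 (sqrt (1 / (2 * c))) t)"
    using assms by (intro integrable_mult_right integrable_normal_density) simp
  also have "(\<lambda>t. sqrt (pi / c) * normal_density 0 (sqrt (1 / (2 * c))) t) = (\<lambda>t. exp (- c * t\<^sup>2))"
    using assms by (auto simp: normal_density_def fun_eq_iff real_sqrt_divide field_simps)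
  finally show ?thesis .
qed

lemma airy_exp_continuous: "continuous_on S (\<lambda>t. airy_exp x (Complex c t))"
  unfolding airy_exp_def by (intro continuous_intros) auto

lemma integrable_airy_exp:
  assumes "0 < c"
  shows "integrable lborel (\<lambda>t. airy_exp x (Complex c t))"
proof (rule Bochner_Integration.integrable_bound)
  show "integrable lborel (\<lambda>t. exp (c ^ 3 / 3 - x * c) * exp (- c * t\<^sup>2))"
    using integrable_gaussian[OF assms] by (intro integrable_mult_right)
  show "(\<lambda>t. airy_exp x (Complex c t)) \<in> borel_measurable lborel"
    using borel_measurable_continuous_onI[OF airy_exp_continuous] by simp
qed (simp add: norm_airy_exp)

text \<open>A shift of the contour from the imaginary axis, where the integral converges only
  conditionally, to the line with real part \<open>c\<close>, where the integrand is Gaussian. A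
  primitive of the entire integrand replaces Cauchy's theorem: integrals along segments are
  differences of \<open>P\<close>.\<close>

lemma Airy_eq_Ai_line:
  assumes c: "0 < c"
  shows "Airy x = Ai_line c x"
proof -
  have "airy_exp x holomorphic_on UNIV" unfolding airy_exp_def by (intro holomorphic_intros) auto
  from holomorphic_convex_primitive'[OF convex_UNIV open_UNIV this]
  obtain P where P: "\<And>w. (P has_field_derivative airy_exp x w) (at w)"
    by (metis UNIV_I)
  have vert: "((\<lambda>t. P (Complex a t)) has_vector_derivative \<i> * airy_exp x (Complex a t)) (at t within S)" for a t S
  proof -
    have "(Complex a has_vector_derivative \<i>) (at t within S)"
      unfolding Complex_eq by (auto intro!: derivative_eq_intros)
    from field_vector_diff_chain_within[OF this has_field_derivative_at_within[OF P]]
    show ?thesis by (simp add: o_def)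
  qed
  have I: "((\<lambda>t. airy_exp x (Complex a t)) has_integral (P (Complex a R) - P (Complex a (-R))) / \<i>) {-R..R}" if "0 \<le> R" for a R
  proof -
    have "((\<lambda>t. \<i> * airy_exp x (Complex a t)) has_integral P (Complex a R) - P (Complex a (-R))) {-R..R}"
      using that by (intro fundamental_theorem_of_calculus vert) auto
    from has_integral_mult_right[OF this, of "1 / \<i>"] show ?thesis by simp
  qed
  \<comment> \<open>On the connecting segment at height R the integrand is at most K exp (- u R^2);
    integrating over u leaves K / R^2.\<close>
  have horiz: "norm (P (Complex c R) - P (Complex 0 R)) \<le> exp (c ^ 3 / 3 + \<bar>x\<bar> * c) / R\<^sup>2" if R: "R \<noteq> 0" for R
  proof -
    define K where "K = exp (c ^ 3 / 3 + \<bar>x\<bar> * c)"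
    have hd: "((\<lambda>u. P (Complex u R)) has_vector_derivative airy_exp x (Complex u R)) (at u within S)" for u S
    proof -
      have "((\<lambda>u. Complex u R) has_vector_derivative 1) (at u within S)"
        unfolding Complex_eq by (auto intro!: derivative_eq_intros)
      from field_vector_diff_chain_within[OF this has_field_derivative_at_within[OF P]]
      show ?thesis by (simp add: o_def)
    qed
    have "norm (P (Complex c R) - P (Complex 0 R)) \<le> (- K * exp (- c * R\<^sup>2) / R\<^sup>2) - (- K * exp (- 0 * R\<^sup>2) / R\<^sup>2)"
    proof (rule differentiable_bound_general[where a = 0 and b = c and f = "\<lambda>u. P (Complex u R)" and \<phi> = "\<lambda>u. - K * exp (- u * R\<^sup>2) / R\<^sup>2" and f' = "\<lambda>u. airy_exp x (Complex u R)" and \<phi>' = "\<lambda>u. K * exp (- u * R\<^sup>2)"])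
      show "continuous_on {0..c} (\<lambda>u. P (Complex u R))"
        by (rule continuous_on_vector_derivative, rule hd)
      show "((\<lambda>u. - K * exp (- u * R\<^sup>2) / R\<^sup>2) has_vector_derivative K * exp (- u * R\<^sup>2)) (at u)" for u
        using R by (auto simp: has_real_derivative_iff_has_vector_derivative[symmetric] power2_eq_square field_simps intro!: derivative_eq_intros)
      fix u assume u: "0 < u" "u < c"
      have "u ^ 3 / 3 - x * u \<le> c ^ 3 / 3 + \<bar>x\<bar> * c"
      proof -
        have "u ^ 3 \<le> c ^ 3" using u by (intro power_mono) auto
        moreover have "- x * u \<le> \<bar>x\<bar> * c" using u by (intro mult_mono) auto
        ultimately show ?thesis by simp
      qed
      then show "norm (airy_exp x (Complex u R)) \<le> K * exp (- u * R\<^sup>2)"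
        unfolding norm_airy_exp K_def by (intro mult_right_mono) auto
    qed (use c hd R in \<open>auto intro!: continuous_intros\<close>)
    also have "\<dots> \<le> K / R\<^sup>2" by (simp add: K_def)
    finally show ?thesis by (simp add: K_def)
  qed
  \<comment> \<open>On the imaginary axis the real part of the integrand is the cosine in the
    definition of \<open>Airy\<close>; its evenness accounts for the factor 1/2.\<close>
  have cosI: "integral {0..R} (\<lambda>t. cos (t ^ 3 / 3 + x * t)) = Re ((P (Complex 0 R) - P (Complex 0 (-R))) / \<i>) / 2" if R: "0 \<le> R" for R
  proof -
    have re: "Re (airy_exp x (Complex 0 t)) = cos (t ^ 3 / 3 + x * t)" for t
    proof -
      have "Complex 0 t ^ 3 / 3 - of_real x * Complex 0 t = \<i> * of_real (- (t ^ 3 / 3 + x * t))"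
        by (simp add: Complex_eq power3_eq_cube complex_eq_iff)
      then show ?thesis unfolding airy_exp_def using cos_minus[of "t ^ 3 / 3 + x * t"] by (simp only:) (simp add: Re_exp)
    qed
    have ci: "(\<lambda>t. cos (t ^ 3 / 3 + x * t)) integrable_on {a..b}" for a b
      by (intro integrable_continuous_interval continuous_intros) auto
    have "integral {-R..R} (\<lambda>t. cos (t ^ 3 / 3 + x * t)) = Re ((P (Complex 0 R) - P (Complex 0 (-R))) / \<i>)"
      using has_integral_Re[OF I[OF R, of 0]] unfolding re by (rule integral_unique)
    moreover have "integral {-R..R} (\<lambda>t. cos (t ^ 3 / 3 + x * t)) =
       integral {-R..0} (\<lambda>t. cos (t ^ 3 / 3 + x * t)) + integral {0..R} (\<lambda>t. cos (t ^ 3 / 3 + x * t))"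
      using R by (intro Henstock_Kurzweil_Integration.integral_combine[symmetric] ci) auto
    moreover have "integral {-R..0} (\<lambda>t. cos (t ^ 3 / 3 + x * t)) = integral {0..R} (\<lambda>t. cos (t ^ 3 / 3 + x * t))"
    proof -
      have "cos ((- t) ^ 3 / 3 + x * (- t)) = cos (t ^ 3 / 3 + x * t)" for t
        using cos_minus[of "t ^ 3 / 3 + x * t"] by (simp add: power3_eq_cube)
      then show ?thesis
        using Henstock_Kurzweil_Integration.integral_reflect_real[of R 0 "\<lambda>t. cos (t ^ 3 / 3 + x * t)"] by simp
    qed
    ultimately show ?thesis by simp
  qed
  have "((\<lambda>R. integral {-R..R} (\<lambda>t. airy_exp x (Complex c t))) \<longlongrightarrow> (LINT t|lborel. airy_exp x (Complex c t))) at_top"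
  proof -
    have "((\<lambda>R. LINT t|lborel. indicator {-R..R} t *\<^sub>R airy_exp x (Complex c t)) \<longlongrightarrow> (LINT t|lborel. airy_exp x (Complex c t))) at_top"
    proof (rule integral_dominated_convergence_at_top[where w = "\<lambda>t. norm (airy_exp x (Complex c t))"])
      show "AE t in lborel. ((\<lambda>R. indicator {-R..R} t *\<^sub>R airy_exp x (Complex c t)) \<longlongrightarrow> airy_exp x (Complex c t)) at_top"
      proof (rule AE_I2)
        fix t
        have "eventually (\<lambda>R. airy_exp x (Complex c t) = indicator {-R..R} t *\<^sub>R airy_exp x (Complex c t)) at_top"
          using eventually_ge_at_top[of "\<bar>t\<bar>"] by eventually_elim (auto simp: indicator_def)
        then show "((\<lambda>R. indicator {-R..R} t *\<^sub>R airy_exp x (Complex c t)) \<longlongrightarrow> airy_exp x (Complex c t)) at_top"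
          by (rule tendsto_eventually[OF eventually_mono]) auto
      qed
    qed (use integrable_airy_exp[OF c] in \<open>auto intro!: always_eventually split: split_indicator\<close>)
    moreover have "(LINT t|lborel. indicator {-R..R} t *\<^sub>R airy_exp x (Complex c t)) = integral {-R..R} (\<lambda>t. airy_exp x (Complex c t))" for R
    proof -
      have "set_integrable lborel {-R..R} (\<lambda>t. airy_exp x (Complex c t))"
        unfolding set_integrable_def using integrable_airy_exp[OF c] by (intro integrable_mult_indicator) auto
      from set_borel_integral_eq_integral(2)[OF this] show ?thesis by (simp add: set_lebesgue_integral_def)
    qed
    ultimately show ?thesis by simp
  qed
  from tendsto_divide[OF tendsto_Re[OF this] tendsto_const[of 2]] have L1: "((\<lambda>R. Re (integral {-R..R} (\<lambda>t. airy_exp x (Complex c t))) / 2) \<longlongrightarrow> pi * Ai_line c x) at_top"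
    by (simp add: Ai_line_def)
  have L2: "((\<lambda>R. integral {0..R} (\<lambda>t. cos (t ^ 3 / 3 + x * t)) - Re (integral {-R..R} (\<lambda>t. airy_exp x (Complex c t))) / 2) \<longlongrightarrow> 0) at_top"
  proof (rule Lim_null_comparison)
    show "((\<lambda>R. exp (c ^ 3 / 3 + \<bar>x\<bar> * c) / R\<^sup>2) \<longlongrightarrow> 0) at_top" by real_asymp
    show "eventually (\<lambda>R. norm (integral {0..R} (\<lambda>t. cos (t ^ 3 / 3 + x * t)) - Re (integral {-R..R} (\<lambda>t. airy_exp x (Complex c t))) / 2)
        \<le> exp (c ^ 3 / 3 + \<bar>x\<bar> * c) / R\<^sup>2) at_top"
      using eventually_gt_at_top[of 0]
    proof eventually_elim
      fix R :: real assume R: "0 < R"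
      have e: "integral {-R..R} (\<lambda>t. airy_exp x (Complex c t)) = (P (Complex c R) - P (Complex c (-R))) / \<i>"
        using I[of R c] R by (intro integral_unique) auto
      define D where "D = (P (Complex 0 R) - P (Complex 0 (-R))) / \<i> - (P (Complex c R) - P (Complex c (-R))) / \<i>"
      have "integral {0..R} (\<lambda>t. cos (t ^ 3 / 3 + x * t)) - Re (integral {-R..R} (\<lambda>t. airy_exp x (Complex c t))) / 2 = Re D / 2"
        using R by (subst cosI) (auto simp: e D_def diff_divide_distrib)
      moreover have "\<bar>Re D\<bar> \<le> 2 * (exp (c ^ 3 / 3 + \<bar>x\<bar> * c) / R\<^sup>2)"
      proof -
        have "D = ((P (Complex c (-R)) - P (Complex 0 (-R))) - (P (Complex c R) - P (Complex 0 R))) / \<i>"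
          by (simp add: D_def field_simps)
        then have "norm D = norm ((P (Complex c (-R)) - P (Complex 0 (-R))) - (P (Complex c R) - P (Complex 0 R)))"
          by (simp add: norm_mult)
        also have "\<dots> \<le> exp (c ^ 3 / 3 + \<bar>x\<bar> * c) / R\<^sup>2 + exp (c ^ 3 / 3 + \<bar>x\<bar> * c) / R\<^sup>2"
          using horiz[of R] horiz[of "-R"] R by (intro order_trans[OF norm_triangle_ineq4[of "P (Complex c (- R)) - P (Complex 0 (- R))"]] add_mono) simp_all
        finally show ?thesis using abs_Re_le_cmod[of D] by linarith
      qed
      ultimately show "norm (integral {0..R} (\<lambda>t. cos (t ^ 3 / 3 + x * t)) - Re (integral {-R..R} (\<lambda>t. airy_exp x (Complex c t))) / 2)
        \<le> exp (c ^ 3 / 3 + \<bar>x\<bar> * c) / R\<^sup>2" by simp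
    qed
  qed
  have "((\<lambda>R. integral {0..R} (\<lambda>t. cos (t ^ 3 / 3 + x * t))) \<longlongrightarrow> pi * Ai_line c x) at_top"
    using tendsto_add[OF L2 L1] by simp
  then have "Lim at_top (\<lambda>R. integral {0..R} (\<lambda>t. cos (t ^ 3 / 3 + x * t))) = pi * Ai_line c x"
    by (intro tendsto_Lim) auto
  then show ?thesis by (simp add: Airy_def)
qed

section \<open>Convolution on the integers and the Laurent coefficients of exp (a z + b / z)\<close>

abbreviation absummable :: "('a \<Rightarrow> real) \<Rightarrow> 'a set \<Rightarrow> bool" where
  "absummable f A \<equiv> (\<lambda>x. \<bar>f x\<bar>) summable_on A"

definition conv :: "(int \<Rightarrow> real) \<Rightarrow> (int \<Rightarrow> real) \<Rightarrow> int \<Rightarrow> real" where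
  "conv f g k = (\<Sum>\<^sub>\<infinity>l. f l * g (k - l))"

lemma absummable_prod:
  fixes f :: "'a \<Rightarrow> real" and g :: "'b \<Rightarrow> real"
  assumes "absummable f UNIV" "absummable g UNIV"
  shows "absummable (\<lambda>(l, m). f l * g m) UNIV"
proof -
  have "(\<lambda>x. norm (case x of (l, m) \<Rightarrow> f l * g m)) summable_on Sigma UNIV (\<lambda>_. UNIV)"
    unfolding Infinite_Sum.abs_summable_on_Sigma_iff
  proof (intro conjI ballI)
    fix l :: 'a
    show "(\<lambda>y. norm (case (l, y) of (l, m) \<Rightarrow> f l * g m)) summable_on UNIV"
      using summable_on_cmult_right[OF assms(2), of "\<bar>f l\<bar>"] by (simp add: abs_mult)
    show "(\<lambda>x. norm (\<Sum>\<^sub>\<infinity>y. norm (case (x, y) of (l, m) \<Rightarrow> f l * g m))) summable_on UNIV"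
      using summable_on_cmult_left[OF assms(1), of "infsum (\<lambda>x. \<bar>g x\<bar>) UNIV"]
      by (simp add: abs_mult infsum_cmult_right' infsum_nonneg)
  qed
  then show ?thesis by simp
qed

lemma summable_on_shift:
  fixes f :: "int \<Rightarrow> real"
  shows "(\<lambda>l. f (c - l)) summable_on UNIV \<longleftrightarrow> f summable_on UNIV" "(\<lambda>l. f (l + c)) summable_on UNIV \<longleftrightarrow> f summable_on UNIV"
proof -
  have "bij (\<lambda>l::int. c - l)" "bij (\<lambda>l::int. l + c)"
    by (rule bij_betw_byWitness[where f' = "\<lambda>l. c - l"]; simp) (rule bij_betw_byWitness[where f' = "\<lambda>l. l - c"]; simp)
  then show "(\<lambda>l. f (c - l)) summable_on UNIV \<longleftrightarrow> f summable_on UNIV" "(\<lambda>l. f (l + c)) summable_on UNIV \<longleftrightarrow> f summable_on UNIV"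
    using summable_on_reindex_bij_betw[of _ UNIV UNIV f] by auto
qed

lemma infsum_shift:
  fixes f :: "int \<Rightarrow> real"
  shows "(\<Sum>\<^sub>\<infinity>l. f (c - l)) = infsum f UNIV" "(\<Sum>\<^sub>\<infinity>l. f (l + c)) = infsum f UNIV"
proof -
  have "bij (\<lambda>l::int. c - l)" "bij (\<lambda>l::int. l + c)"
    by (rule bij_betw_byWitness[where f' = "\<lambda>l. c - l"]; simp) (rule bij_betw_byWitness[where f' = "\<lambda>l. l - c"]; simp)
  then show "(\<Sum>\<^sub>\<infinity>l. f (c - l)) = infsum f UNIV" "(\<Sum>\<^sub>\<infinity>l. f (l + c)) = infsum f UNIV"
    using infsum_reindex_bij_betw[of _ UNIV UNIV f] by auto
qed

lemma conv_commute: "conv f g = conv g f"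
proof
  fix k show "conv f g k = conv g f k"
    using infsum_shift(1)[of "\<lambda>l. g l * f (k - l)" k] by (simp add: conv_def mult.commute)
qed

text \<open>The pairs (k, l) and (l, k - l) are in bijection, so summability of a product family
  carries over to the family behind a convolution.\<close>

lemma abs_summable_shear:
  fixes f g :: "int \<Rightarrow> real"
  assumes "absummable f UNIV" "absummable g UNIV"
  shows "absummable (\<lambda>(k, l). f l * g (k - l)) (UNIV \<times> UNIV)"
proof -
  have "bij_betw (\<lambda>(k::int, l::int). (l, k - l)) UNIV UNIV"
    by (rule bij_betw_byWitness[where f' = "\<lambda>(l, m). (l + m, l)"]) auto
  from summable_on_reindex_bij_betw[OF this, of "\<lambda>x. \<bar>case x of (l, m) \<Rightarrow> f l * g m\<bar>"] absummable_prod[OF assms]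
  show ?thesis by (simp add: case_prod_beta)
qed

lemma conv_summable:
  assumes "absummable f UNIV" "absummable g UNIV"
  shows "absummable (\<lambda>l. f l * g (k - l)) (UNIV)" "absummable (conv f g) UNIV"
proof -
  have *: "absummable (\<lambda>(k, l). f l * g (k - l)) (Sigma UNIV (\<lambda>_. UNIV))"
    using abs_summable_shear[OF assms] .
  show "absummable (\<lambda>l. f l * g (k - l)) (UNIV)"
    using *[folded real_norm_def, unfolded Infinite_Sum.abs_summable_on_Sigma_iff] by simp
  have "(\<lambda>k. \<Sum>\<^sub>\<infinity>l. f l * g (k - l)) summable_on UNIV"
    using summable_on_Sigma_banach[OF abs_summable_summable[OF *[folded real_norm_def]]] by simp
  from summable_on_iff_abs_summable_on_real[THEN iffD1, OF this]
  show "absummable (conv f g) UNIV" by (simp add: conv_def)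
qed

lemma conv_assoc:
  assumes f: "absummable f UNIV" and g: "absummable g UNIV" and h: "absummable h UNIV"
  shows "conv (conv f g) h = conv f (conv g h)"
proof
  fix k
  have hb: "\<exists>B. \<forall>x. \<bar>h x\<bar> \<le> B"
  proof -
    have "\<bar>h x\<bar> \<le> infsum (\<lambda>x. \<bar>h x\<bar>) UNIV" for x
      using finite_sum_le_infsum[of "\<lambda>x. \<bar>h x\<bar>" UNIV "{x}"] h by simp
    then show ?thesis by blast
  qed
  then obtain B where B: "\<And>x. \<bar>h x\<bar> \<le> B" by auto
  \<comment> \<open>Two factors are already summable over the plane; for the third, boundedness
    suffices.\<close>
  have S: "(\<lambda>(l, m). f m * g (l - m) * h (k - l)) summable_on UNIV \<times> UNIV"
  proof (rule abs_summable_summable[OF Infinite_Sum.abs_summable_on_comparison_test])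
    show "(\<lambda>x. norm ((case x of (l, m) \<Rightarrow> f m * g (l - m)) * B)) summable_on UNIV \<times> UNIV"
      using summable_on_cmult_left[OF abs_summable_shear[OF f g], of "\<bar>B\<bar>"] by (simp add: abs_mult)
    have "\<bar>h x\<bar> \<le> \<bar>B\<bar>" for x using B[of x] by linarith
    then show "norm (case x of (l, m) \<Rightarrow> f m * g (l - m) * h (k - l)) \<le> norm ((case x of (l, m) \<Rightarrow> f m * g (l - m)) * B)" for x
      by (auto simp: abs_mult split: prod.split intro!: mult_left_mono)
  qed
  have "conv (conv f g) h k = (\<Sum>\<^sub>\<infinity>l. \<Sum>\<^sub>\<infinity>m. f m * g (l - m) * h (k - l))"
    by (simp add: conv_def infsum_cmult_left')
  also have "\<dots> = (\<Sum>\<^sub>\<infinity>m. \<Sum>\<^sub>\<infinity>l. f m * g (l - m) * h (k - l))"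
    by (rule infsum_swap_banach) (use S in simp)
  also have "\<dots> = (\<Sum>\<^sub>\<infinity>m. f m * conv g h (k - m))"
  proof (rule infsum_cong)
    fix m
    have "(\<Sum>\<^sub>\<infinity>l. f m * g (l - m) * h (k - l)) = f m * (\<Sum>\<^sub>\<infinity>l. g (l - m) * h (k - l))"
      by (simp add: mult.assoc infsum_cmult_right')
    also have "(\<Sum>\<^sub>\<infinity>l. g (l - m) * h (k - l)) = conv g h (k - m)"
      using infsum_shift(2)[of "\<lambda>l. g (l - m) * h (k - l)" m] by (simp add: conv_def algebra_simps)
    finally show "(\<Sum>\<^sub>\<infinity>l. f m * g (l - m) * h (k - l)) = f m * conv g h (k - m)" .
  qed
  finally show "conv (conv f g) h k = conv f (conv g h) k" by (simp add: conv_def)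
qed

lemma h_pl_of_nat: "h_pl a (int n) = a ^ n / fact n"
  by (simp add: h_pl_def)

lemma infsum_int_nat:
  fixes f :: "int \<Rightarrow> real"
  assumes "\<And>k. k < 0 \<Longrightarrow> f k = 0"
  shows "f summable_on UNIV \<longleftrightarrow> (\<lambda>n. f (int n)) summable_on UNIV" "infsum f UNIV = (\<Sum>\<^sub>\<infinity>n. f (int n))"
proof -
  have b: "bij_betw int UNIV {0..}"
    by (rule bij_betw_byWitness[where f' = nat]) auto
  have "f summable_on UNIV \<longleftrightarrow> f summable_on {0..}"
    by (rule summable_on_cong_neutral) (use assms in auto)
  then show "f summable_on UNIV \<longleftrightarrow> (\<lambda>n. f (int n)) summable_on UNIV"
    using summable_on_reindex_bij_betw[OF b, of f] by simp
  have "infsum f UNIV = infsum f {0..}"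
    by (rule infsum_cong_neutral) (use assms in auto)
  then show "infsum f UNIV = (\<Sum>\<^sub>\<infinity>n. f (int n))"
    using infsum_reindex_bij_betw[OF b, of f] by simp
qed

lemma h_pl_abs_summable: "absummable (h_pl a) UNIV"
proof -
  have "(\<lambda>n. \<bar>h_pl a (int n)\<bar>) summable_on UNIV"
    using summable_norm_exp[of a]
    by (intro norm_summable_imp_summable_on) (simp add: h_pl_of_nat divide_inverse abs_mult mult.commute power_abs)
  then show ?thesis
    by (subst infsum_int_nat(1)) (auto simp: h_pl_def)
qed

lemma conv_h_pl: "conv (h_pl a) (h_pl b) = h_pl (a + b)"
proof
  fix k
  show "conv (h_pl a) (h_pl b) k = h_pl (a + b) k"
  proof (cases "k < 0")
    case True
    then have "h_pl a l * h_pl b (k - l) = 0" for l by (simp add: h_pl_def)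
    then have "conv (h_pl a) (h_pl b) k = 0" by (simp only: conv_def infsum_0)
    then show ?thesis using True by (simp add: h_pl_def)
  next
    case False
    define n where "n = nat k"
    have k: "k = int n" using False by (simp add: n_def)
    have "conv (h_pl a) (h_pl b) k = (\<Sum>\<^sub>\<infinity>l\<in>int ` {..n}. h_pl a l * h_pl b (k - l))"
      unfolding conv_def
    proof (rule infsum_cong_neutral)
      fix l assume "l \<in> UNIV - int ` {..n}"
      then have "l < 0 \<or> int n < l" by (metis DiffD2 atMost_iff image_eqI int_nat_eq linorder_not_le nat_le_iff not_less)
      then show "h_pl a l * h_pl b (k - l) = 0" by (auto simp: h_pl_def k)
    qed auto
    also have "\<dots> = (\<Sum>m\<le>n. h_pl a (int m) * h_pl b (k - int m))"
      by (simp add: sum.reindex)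
    also have "\<dots> = (\<Sum>m\<le>n. a ^ m / fact m * (b ^ (n - m) / fact (n - m)))"
      by (intro sum.cong refl) (simp add: k h_pl_of_nat of_nat_diff[symmetric] del: of_nat_diff)
    also have "\<dots> = (a + b) ^ n / fact n"
      unfolding binomial_ring sum_divide_distrib
      by (intro sum.cong refl) (simp add: binomial_fact)
    finally show ?thesis by (simp add: k h_pl_of_nat)
  qed
qed

text \<open>These are the coefficients of z^k in exp (a z + b / z); \<open>W \<theta> (- \<theta>) k\<close> is the Bessel function J_k (2 \<theta>).\<close>

definition W :: "real \<Rightarrow> real \<Rightarrow> int \<Rightarrow> real" where
  "W a b = conv (h_pl a) (\<lambda>k. h_pl b (- k))"

lemma h_pl_uminus_abs_summable: "absummable (\<lambda>k. h_pl b (- k)) (UNIV)"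
  using summable_on_shift(1)[of "\<lambda>k. \<bar>h_pl b k\<bar>" 0] h_pl_abs_summable by simp

lemma conv_uminus: "conv (\<lambda>k. f (- k)) (\<lambda>k. g (- k)) = (\<lambda>k. conv f g (- k))"
proof
  fix k show "conv (\<lambda>k. f (- k)) (\<lambda>k. g (- k)) k = conv f g (- k)"
    using infsum_shift(1)[of "\<lambda>l. f l * g (- k - l)" 0] by (simp add: conv_def)
qed

lemma W_abs_summable: "absummable (W a b) UNIV"
  unfolding W_def by (intro conv_summable h_pl_abs_summable h_pl_uminus_abs_summable)

text \<open>Coefficient form of multiplying two exponentials. This group law supplies all inverses
  used later, by negating the parameters.\<close>

lemma conv_W: "conv (W a b) (W a' b') = W (a + a') (b + b')"
proof -
  note [simp] = h_pl_abs_summable h_pl_uminus_abs_summable conv_summable(2)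
  let ?v = "\<lambda>b k. h_pl b (- k)"
  have "conv (W a b) (W a' b') = conv (h_pl a) (conv (?v b) (conv (h_pl a') (?v b')))"
    unfolding W_def by (rule conv_assoc) auto
  also have "conv (?v b) (conv (h_pl a') (?v b')) = conv (conv (h_pl a') (?v b')) (?v b)" by (rule conv_commute)
  also have "\<dots> = conv (h_pl a') (conv (?v b') (?v b))" by (rule conv_assoc) auto
  also have "conv (h_pl a) \<dots> = conv (conv (h_pl a) (h_pl a')) (conv (?v b') (?v b))"
    by (rule conv_assoc[symmetric]) auto
  finally show ?thesis by (simp add: conv_h_pl conv_uminus W_def add.commute)
qed

lemma W_0_right: "W a 0 = h_pl a"
proof
  fix k
  have "W a 0 k = (\<Sum>\<^sub>\<infinity>l\<in>{k}. h_pl a l * h_pl 0 (- (k - l)))"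
    unfolding W_def conv_def by (rule infsum_cong_neutral) (auto simp: h_pl_def power_0_left)
  then show "W a 0 k = h_pl a k" by (simp add: h_pl_def)
qed

lemma W_uminus: "W a b (- k) = W b a k"
proof -
  have "W a b (- k) = conv (\<lambda>k. h_pl a (- k)) (h_pl b) k"
    using fun_cong[OF conv_uminus[of "h_pl a" "\<lambda>k. h_pl b (- k)"], of k] by (simp add: W_def)
  also have "\<dots> = W b a k"
    unfolding W_def by (rule fun_cong[OF conv_commute])
  finally show ?thesis .
qed

lemma W_sums: "(\<lambda>n. h_pl a (k + int n) * h_pl b (int n)) sums W a b k"
proof -
  have "W a b k = (\<Sum>\<^sub>\<infinity>l. h_pl a l * h_pl b (l - k))" by (simp add: W_def conv_def)
  also have "\<dots> = (\<Sum>\<^sub>\<infinity>l. h_pl a (k + l) * h_pl b l)"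
    using infsum_shift(2)[of "\<lambda>l. h_pl a l * h_pl b (l - k)" k] by (simp add: add.commute)
  also have "\<dots> = (\<Sum>\<^sub>\<infinity>n. h_pl a (k + int n) * h_pl b (int n))"
    by (rule infsum_int_nat) (simp add: h_pl_def)
  finally have e: "W a b k = (\<Sum>\<^sub>\<infinity>n. h_pl a (k + int n) * h_pl b (int n))" .
  have "(\<lambda>l. h_pl a l * h_pl b (l - k)) summable_on UNIV"
    using summable_on_iff_abs_summable_on_real[THEN iffD2, unfolded real_norm_def,
        OF conv_summable(1)[OF h_pl_abs_summable[of a] h_pl_uminus_abs_summable[of b], of k]] by simp
  then have "(\<lambda>l. h_pl a (k + l) * h_pl b l) summable_on UNIV"
    using summable_on_shift(2)[of "\<lambda>l. h_pl a l * h_pl b (l - k)" k] by (simp add: add.commute)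
  then have "(\<lambda>n. h_pl a (k + int n) * h_pl b (int n)) summable_on UNIV"
    by (subst (asm) infsum_int_nat) (auto simp: h_pl_def)
  then show ?thesis unfolding e by (intro has_sum_imp_sums has_sum_infsum)
qed

lemma abs_h_pl_le: "\<bar>h_pl a k\<bar> \<le> exp \<bar>a\<bar>"
proof (cases "k < 0")
  case False
  have "\<bar>a\<bar> ^ n / fact n \<le> exp \<bar>a\<bar>" for n
  proof -
    have "\<bar>a\<bar> ^ n / fact n \<le> (\<Sum>n. \<bar>a\<bar> ^ n /\<^sub>R fact n)"
      using sum_le_suminf[of "\<lambda>n. \<bar>a\<bar> ^ n /\<^sub>R fact n" "{n}"] summable_exp_generic[of "\<bar>a\<bar>"]
      by (simp add: divide_inverse mult.commute)
    then show ?thesis by (simp add: exp_def)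
  qed
  with False show ?thesis by (simp add: h_pl_def power_abs)
qed (simp add: h_pl_def)

text \<open>Every geometric rate is available, which makes all infinite matrices below essentially banded.\<close>

lemma h_pl_decay:
  assumes "0 < r"
  shows "\<bar>h_pl a k\<bar> \<le> exp (\<bar>a\<bar> / r) * r powi k"
proof (cases "k < 0")
  case False
  \<comment> \<open>Rescaling the parameter turns the uniform bound for a / r into geometric decay
    for a.\<close>
  then have "h_pl a k = h_pl (a / r) k * r powi k"
    using assms by (simp add: h_pl_def power_int_def power_divide)
  then show ?thesis using abs_h_pl_le[of "a / r" k] assms by (simp add: abs_mult mult_right_mono)
qed (use assms in \<open>simp add: h_pl_def\<close>)

text \<open>This is Cauchy's estimate on the circle of radius 1 / r, read off from the series.
  Taking r below 1 serves nonnegative indices and r above 1 negative ones.\<close>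

lemma W_decay_aux:
  assumes "0 < r"
  shows "\<bar>W a b k\<bar> \<le> exp (\<bar>a\<bar> / r + \<bar>b\<bar> * r) * r powi k"
proof -
  have "(\<lambda>n. (\<bar>b\<bar> * r) ^ n / fact n) sums exp (\<bar>b\<bar> * r)"
    using exp_converges[of "\<bar>b\<bar> * r"] by (simp add: divide_inverse mult.commute)
  from sums_mult[OF this, of "exp (\<bar>a\<bar> / r) * r powi k"]
  have s: "(\<lambda>n. exp (\<bar>a\<bar> / r) * r powi k * ((\<bar>b\<bar> * r) ^ n / fact n)) sums (exp (\<bar>a\<bar> / r) * r powi k * exp (\<bar>b\<bar> * r))" .
  have le: "norm (h_pl a (k + int n) * h_pl b (int n)) \<le> exp (\<bar>a\<bar> / r) * r powi k * ((\<bar>b\<bar> * r) ^ n / fact n)" for n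
  proof -
    have "r powi (k + int n) = r powi k * r ^ n" using assms by (simp add: power_int_add)
    then have "\<bar>h_pl a (k + int n)\<bar> \<le> exp (\<bar>a\<bar> / r) * r powi k * r ^ n"
      using h_pl_decay[OF assms, of a "k + int n"] by (simp only: mult.assoc)
    then have "\<bar>h_pl a (k + int n)\<bar> * \<bar>h_pl b (int n)\<bar> \<le> exp (\<bar>a\<bar> / r) * r powi k * r ^ n * \<bar>h_pl b (int n)\<bar>"
      by (rule mult_right_mono) simp
    moreover have "\<bar>h_pl b (int n)\<bar> = \<bar>b\<bar> ^ n / fact n" by (simp add: h_pl_of_nat power_abs)
    ultimately show ?thesis by (simp only: real_norm_def abs_mult power_mult_distrib times_divide_eq_right mult_ac)
  qed
  have "W a b k = (\<Sum>n. h_pl a (k + int n) * h_pl b (int n))"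
    by (rule sums_unique[OF W_sums])
  also have "norm \<dots> \<le> (\<Sum>n. exp (\<bar>a\<bar> / r) * r powi k * ((\<bar>b\<bar> * r) ^ n / fact n))"
    by (rule norm_suminf_le[OF le sums_summable[OF s]])
  also have "\<dots> = exp (\<bar>a\<bar> / r) * r powi k * exp (\<bar>b\<bar> * r)" by (rule sums_unique[OF s, symmetric])
  finally show ?thesis by (simp add: exp_add mult_ac)
qed

section \<open>Circle integrals and the edge asymptotics of Bessel functions\<close>

abbreviation circ :: "real measure" where
  "circ \<equiv> restrict_space lborel {-pi..pi}"

lemma circ_integrable:
  fixes f :: "real \<Rightarrow> complex"
  assumes "continuous_on {-pi..pi} f"
  shows "integrable circ f"
  using borel_integrable_atLeastAtMost'[OF assms]
  by (simp add: set_integrable_def integrable_restrict_space)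

lemma circ_integral:
  fixes f :: "real \<Rightarrow> complex"
  assumes "continuous_on {-pi..pi} f"
  shows "integral\<^sup>L circ f = integral {-pi..pi} f"
  using set_borel_integral_eq_integral(2)[OF borel_integrable_atLeastAtMost'[OF assms]]
  by (simp add: set_lebesgue_integral_def integral_restrict_space)

lemma circ_sums:
  fixes f :: "nat \<Rightarrow> real \<Rightarrow> complex"
  assumes cont: "\<And>n. continuous_on {-pi..pi} (f n)" and B: "\<And>n t. norm (f n t) \<le> B n" "summable B"
  shows "(\<lambda>n. integral\<^sup>L circ (f n)) sums (integral\<^sup>L circ (\<lambda>t. \<Sum>n. f n t))"
proof (rule sums_integral)
  show "integrable circ (f n)" for n using cont by (rule circ_integrable)
  show "AE t in circ. summable (\<lambda>n. norm (f n t))"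
    by (rule AE_I2, rule summable_comparison_test'[OF B(2)]) (use B(1) in auto)
  show "summable (\<lambda>n. integral\<^sup>L circ (\<lambda>t. norm (f n t)))"
  proof (rule summable_comparison_test')
    show "summable (\<lambda>n. 2 * pi * B n)" using B(2) by (rule summable_mult)
    fix n
    have i: "integrable circ (\<lambda>t. B n)"
    proof -
      have "integrable circ (\<lambda>t. norm (of_real (B n) :: complex))"
        by (intro integrable_norm circ_integrable continuous_intros)
      moreover have "0 \<le> B n" using order_trans[OF norm_ge_zero B(1)] .
      ultimately show ?thesis by simp
    qed
    have "integral\<^sup>L circ (\<lambda>t. norm (f n t)) \<le> integral\<^sup>L circ (\<lambda>t. B n)"
      by (rule integral_mono) (use circ_integrable[OF cont] i B in auto)
    also have "\<dots> = 2 * pi * B n"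
      by (simp add: integral_restrict_space measure_restrict_space)
    finally show "norm (integral\<^sup>L circ (\<lambda>t. norm (f n t))) \<le> 2 * pi * B n" by simp
  qed
qed

lemma fourier_orthogonality:
  "integral\<^sup>L circ (\<lambda>t. exp (of_int j * Complex r t)) = (if j = 0 then 2 * pi else 0)"
proof -
  have c: "continuous_on {-pi..pi} (\<lambda>t. exp (of_int j * Complex r t))" by (intro continuous_intros)
  show ?thesis
  proof (cases "j = 0")
    case True
    then show ?thesis using circ_integral[OF c] by (simp add: scaleR_conv_of_real)
  next
    case False
    have "((\<lambda>t. exp (of_int j * Complex r t)) has_integral
       exp (of_int j * Complex r pi) / (\<i> * of_int j) - exp (of_int j * Complex r (- pi)) / (\<i> * of_int j)) {-pi..pi}"
    proof (rule fundamental_theorem_of_calculus)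
      fix t
      have "((\<lambda>t. of_int j * Complex r t) has_vector_derivative of_int j * \<i>) (at t within {-pi..pi})"
        unfolding Complex_eq by (auto intro!: derivative_eq_intros)
      from field_vector_diff_chain_within[OF this, of exp "exp (of_int j * Complex r t)"]
      have "((\<lambda>t. exp (of_int j * Complex r t)) has_vector_derivative (of_int j * \<i>) * exp (of_int j * Complex r t)) (at t within {-pi..pi})"
        by (simp add: o_def DERIV_exp has_field_derivative_at_within)
      from has_vector_derivative_mult_left[OF this, of "1 / (\<i> * of_int j)"] False
      show "((\<lambda>t. exp (of_int j * Complex r t) / (\<i> * of_int j)) has_vector_derivative exp (of_int j * Complex r t)) (at t within {-pi..pi})"
        by (simp add: mult_ac)
    qed simp
    moreover have "exp (of_int j * Complex r pi) = exp (of_int j * Complex r (- pi))"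
    proof -
      have "of_int j * Complex r pi = of_int j * Complex r (- pi) + (2 * of_int j * of_real pi) * \<i>"
        by (simp add: complex_eq_iff)
      then show ?thesis using exp_integer_2pi[of "real_of_int j"] by (simp add: exp_add)
    qed
    ultimately have "((\<lambda>t. exp (of_int j * Complex r t)) has_integral 0) {-pi..pi}" by simp
    then show ?thesis using circ_integral[OF c] False by (simp add: integral_unique)
  qed
qed

lemma norm_exp_of_int_Complex: "norm (exp (of_int j * Complex r t)) = exp (of_int j * r)"
  by (simp add: norm_exp_eq_Re)

lemma exp_of_int_diff:
  fixes w :: "'a :: {real_normed_field, banach}"
  shows "exp (of_int (int n - j) * w) = exp w ^ n * exp (of_int (- j) * w)"
proof -
  have "of_int (int n - j) * w = of_nat n * w + of_int (- j) * w" by (simp add: algebra_simps)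
  then show ?thesis by (simp only: exp_add exp_of_nat_mult)
qed

lemma exp_sums_div: "(\<lambda>n. x ^ n / fact n) sums exp (x :: 'a :: {real_normed_field, banach})"
  using exp_converges[of x] by (simp add: scaleR_conv_of_real divide_inverse mult.commute)

lemma h_pl_integral:
  "integral\<^sup>L circ (\<lambda>t. exp (of_real a * exp (Complex r t)) * exp (of_int (- j) * Complex r t)) = of_real (2 * pi * h_pl a j)"
proof -
  define f where "f n t = of_real (a ^ n / fact n) * exp (of_int (int n - j) * Complex r t)" for n t
  define B where "B n = exp (- of_int j * r) * ((\<bar>a\<bar> * exp r) ^ n / fact n)" for n
  have s: "(\<lambda>n. integral\<^sup>L circ (f n)) sums (integral\<^sup>L circ (\<lambda>t. \<Sum>n. f n t))"
  proof (rule circ_sums)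
    show "continuous_on {-pi..pi} (f n)" for n unfolding f_def[abs_def] by (intro continuous_intros)
    show "norm (f n t) \<le> B n" for n t
      by (simp only: f_def B_def norm_mult norm_exp_of_int_Complex exp_of_int_diff power_mult_distrib)
         (simp add: norm_divide norm_power mult_ac)
    show "summable B" unfolding B_def by (intro summable_mult sums_summable[OF exp_sums_div])
  qed
  have "(\<Sum>n. f n t) = exp (of_real a * exp (Complex r t)) * exp (of_int (- j) * Complex r t)" for t
  proof -
    have f: "f n t = (of_real a * exp (Complex r t)) ^ n / fact n * exp (of_int (- j) * Complex r t)" for n
      by (simp only: f_def exp_of_int_diff power_mult_distrib) simp
    have "(\<lambda>n. f n t) sums (exp (of_real a * exp (Complex r t)) * exp (of_int (- j) * Complex r t))"
      unfolding f by (rule sums_mult2[OF exp_sums_div])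
    then show ?thesis by (rule sums_unique[symmetric])
  qed
  moreover have "integral\<^sup>L circ (f n) = (if int n = j then of_real (2 * pi * h_pl a j) else 0)" for n
    using fourier_orthogonality[of "int n - j" r] by (auto simp: f_def[abs_def] h_pl_def)
  ultimately have s: "(\<lambda>n. if int n = j then of_real (2 * pi * h_pl a j) else 0) sums
     (integral\<^sup>L circ (\<lambda>t. exp (of_real a * exp (Complex r t)) * exp (of_int (- j) * Complex r t)))"
    using s by (simp only:)
  show ?thesis
  proof (cases "j < 0")
    case True
    then have "(\<lambda>n. if int n = j then of_real (2 * pi * h_pl a j) else (0::complex)) = (\<lambda>_. 0)" by auto
    with s have "integral\<^sup>L circ (\<lambda>t. exp (of_real a * exp (Complex r t)) * exp (of_int (- j) * Complex r t)) = 0"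
      by (simp only:) (rule sums_unique2[OF _ sums_zero])
    then show ?thesis using True by (simp add: h_pl_def)
  next
    case False
    then have "(\<lambda>n. if int n = j then of_real (2 * pi * h_pl a j) else (0::complex)) = (\<lambda>n. if n = nat j then of_real (2 * pi * h_pl a j) else 0)"
      by (intro ext) auto
    with s sums_single[of "nat j" "\<lambda>_. of_real (2 * pi * h_pl a j) :: complex"]
    show ?thesis by (simp only:) (rule sums_unique2)
  qed
qed

text \<open>Cauchy's coefficient formula on the circle of radius exp r. The radius stays free
  because exponential decay in the scaled index is obtained by moving slightly off the unit
  circle.\<close>

lemma W_integral:
  "integral\<^sup>L circ (\<lambda>t. exp (of_real a * exp (Complex r t) + of_real b * exp (- Complex r t) - of_int k * Complex r t)) = of_real (2 * pi * W a b k)"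
proof -
  define f where "f n t = of_real (b ^ n / fact n) * (exp (of_real a * exp (Complex r t)) * exp (of_int (- (k + int n)) * Complex r t))" for n t
  define B where "B n = exp (- of_int k * r) * exp (\<bar>a\<bar> * exp r) * ((\<bar>b\<bar> * exp (- r)) ^ n / fact n)" for n
  have s: "(\<lambda>n. integral\<^sup>L circ (f n)) sums (integral\<^sup>L circ (\<lambda>t. \<Sum>n. f n t))"
  proof (rule circ_sums)
    show "continuous_on {-pi..pi} (f n)" for n unfolding f_def[abs_def] by (intro continuous_intros)
    show "norm (f n t) \<le> B n" for n t
    proof -
      have "norm (exp (of_real a * exp (Complex r t))) \<le> exp (\<bar>a\<bar> * exp r)"
        using norm_exp[of "of_real a * exp (Complex r t)"] by (simp add: norm_mult norm_exp_eq_Re)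
      moreover have "norm (exp (of_int (- (k + int n)) * Complex r t)) = exp (- of_int k * r) * exp (- r) ^ n"
      proof -
        have "of_int (- (k + int n)) * r = - of_int k * r + of_nat n * (- r)" by (simp add: algebra_simps)
        then show ?thesis unfolding norm_exp_of_int_Complex by (simp only: exp_add exp_of_nat_mult)
      qed
      ultimately show ?thesis
        by (simp add: f_def B_def norm_mult norm_divide norm_power power_mult_distrib divide_right_mono mult_left_mono mult_ac)
    qed
    show "summable B" unfolding B_def by (intro summable_mult sums_summable[OF exp_sums_div])
  qed
  have e: "(\<Sum>n. f n t) = exp (of_real a * exp (Complex r t) + of_real b * exp (- Complex r t) - of_int k * Complex r t)" for t
  proof -
    have f: "f n t = (of_real b * exp (- Complex r t)) ^ n / fact n * (exp (of_real a * exp (Complex r t)) * exp (- of_int k * Complex r t))" for n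
    proof -
      have "exp (of_int (- (k + int n)) * Complex r t) = exp (- Complex r t) ^ n * exp (- of_int k * Complex r t)"
      proof -
        have "of_int (- (k + int n)) * Complex r t = of_nat n * (- Complex r t) + - of_int k * Complex r t" by (simp add: algebra_simps)
        then show ?thesis by (simp only: exp_add exp_of_nat_mult)
      qed
      then show ?thesis by (simp add: f_def power_mult_distrib mult_ac)
    qed
    have "(\<lambda>n. f n t) sums (exp (of_real b * exp (- Complex r t)) * (exp (of_real a * exp (Complex r t)) * exp (- of_int k * Complex r t)))"
      unfolding f by (rule sums_mult2[OF exp_sums_div])
    moreover have "exp (x + y - of_int k * z) = exp y * (exp x * exp (- of_int k * z))" for x y z :: complex
      by (simp add: exp_add exp_diff exp_minus divide_inverse mult_ac)
    ultimately show ?thesis by (simp only: sums_iff)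
  qed
  have i: "integral\<^sup>L circ (f n) = of_real (2 * pi * (h_pl a (k + int n) * h_pl b (int n)))" for n
    using h_pl_integral[of a r "k + int n"] by (simp add: f_def[abs_def] h_pl_of_nat)
  have "(\<lambda>n. complex_of_real (2 * pi * (h_pl a (k + int n) * h_pl b (int n)))) sums of_real (2 * pi * W a b k)"
    by (intro sums_of_real sums_mult W_sums)
  with s show ?thesis unfolding e i by (rule sums_unique2)
qed

text \<open>A quadratic lower bound is required on the whole circle, not only near 0. Quartering the
  angle brings it into the range where the squared cosine is at least 1/2, and 1 - cos y equals 8
  (sin x cos x)^2 for x = |y| / 4.\<close>

lemma cos_le_quadratic:
  assumes "\<bar>y\<bar> \<le> pi"
  shows "y\<^sup>2 / 8 \<le> 1 - cos (y::real)"
proof -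
  define x where "x = \<bar>y\<bar> / 4"
  have x: "0 \<le> x" "x \<le> pi / 4" using assms by (auto simp: x_def)
  have c: "1 / 2 \<le> (cos x)\<^sup>2"
  proof -
    have "cos (pi / 4) \<le> cos x" using x by (intro cos_monotone_0_pi_le) auto
    then have "(cos (pi/4))\<^sup>2 \<le> (cos x)\<^sup>2" by (intro power_mono) (auto simp: cos_45)
    then show ?thesis by (simp add: cos_45 power_divide)
  qed
  have "x * cos x \<le> sin x"
  proof (cases "x = 0")
    case False
    then have "0 < x" using x by simp
    from MVT2[OF this, of sin cos] obtain z where z: "0 < z" "z < x" "sin x = x * cos z"
      by (auto simp: DERIV_sin)
    have "cos x \<le> cos z" using z x pi_gt_zero by (intro cos_monotone_0_pi_le) auto
    then show ?thesis using z x by (simp add: mult_left_mono)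
  qed simp
  then have "(x * cos x)\<^sup>2 \<le> (sin x)\<^sup>2"
    using x by (intro power_mono mult_nonneg_nonneg cos_ge_zero) auto
  then have "(x * cos x)\<^sup>2 * (cos x)\<^sup>2 \<le> (sin x)\<^sup>2 * (cos x)\<^sup>2" by (rule mult_right_mono) simp
  moreover have "x\<^sup>2 * (1 / 4) \<le> (x * cos x)\<^sup>2 * (cos x)\<^sup>2"
  proof -
    have "(1 / 2) * (1 / 2) \<le> (cos x)\<^sup>2 * (cos x)\<^sup>2" using c by (intro mult_mono) auto
    then have "x\<^sup>2 * (1 / 4) \<le> x\<^sup>2 * ((cos x)\<^sup>2 * (cos x)\<^sup>2)" by (intro mult_left_mono) auto
    then show ?thesis by (simp add: power_mult_distrib mult_ac)
  qed
  moreover have "1 - cos y = 8 * ((sin x)\<^sup>2 * (cos x)\<^sup>2)"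
  proof -
    have "cos y = cos (2 * (2 * x))" by (simp add: x_def)
    also have "\<dots> = 1 - 2 * (sin (2 * x))\<^sup>2" by (rule cos_double_sin)
    finally show ?thesis by (simp add: sin_double power_mult_distrib)
  qed
  moreover have "x\<^sup>2 = y\<^sup>2 / 16" by (simp add: x_def power_divide)
  ultimately show ?thesis by simp
qed

text \<open>In the Bessel phase the linear term of the hyperbolic sine cancels against the index and
  the cubic term becomes the Airy phase; this bounds what remains. The even Taylor terms at u and -
  u cancel.\<close>

lemma norm_exp_diff_cubic:
  fixes u :: complex
  shows "norm ((exp u - exp (- u)) / 2 - u - u ^ 3 / 6) \<le> exp (norm u) * norm u ^ 4 / 6"
proof -
  define E where "E v = exp v - (\<Sum>k\<le>3. v ^ k / fact k)" for v :: complex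
  have E: "norm (E v) \<le> exp (norm v) * norm v ^ 4 / 6" for v
  proof -
    have "norm (E v) \<le> exp \<bar>Re v\<bar> * norm v ^ 4 / 6"
      using Taylor_exp[of v 3] by (simp add: E_def fact_numeral)
    also have "\<dots> \<le> exp (norm v) * norm v ^ 4 / 6"
      using abs_Re_le_cmod[of v] by (intro divide_right_mono mult_right_mono) auto
    finally show ?thesis .
  qed
  have "(exp u - exp (- u)) / 2 - u - u ^ 3 / 6 = (E u - E (- u)) / 2"
    by (simp add: E_def eval_nat_numeral fact_numeral field_simps)
  also have "norm \<dots> \<le> (norm (E u) + norm (E (- u))) / 2"
    using norm_triangle_ineq4[of "E u" "E (- u)"] by (simp add: norm_divide)
  also have "\<dots> \<le> exp (norm u) * norm u ^ 4 / 6" using E[of u] E[of "- u"] by simp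
  finally show ?thesis .
qed

text \<open>The first bound keeps the Gaussian rate from degenerating, the second bounds the
  exponent at the real point of the circle. Both are uniform in \<kappa>, because the scaled cubic
  term is independent of \<kappa>.\<close>

lemma sinh_scaled_bounds:
  fixes c \<kappa> :: real
  assumes c: "0 < c" and \<kappa>: "1 \<le> \<kappa>"
  shows "c \<le> \<kappa> * sinh (c / \<kappa>)" "2 * \<kappa> ^ 3 * (sinh (c / \<kappa>) - c / \<kappa>) \<le> c ^ 3 / 3 + exp c * c ^ 4 / 3"
proof -
  define x where "x = c / \<kappa>"
  have x: "0 < x" "x \<le> c" "\<kappa> * x = c" using c \<kappa> mult_left_mono[of 1 \<kappa> c] by (auto simp: x_def divide_le_eq)
  have "x \<le> sinh x"
  proof -
    have "(sinh has_real_derivative cosh y) (at y)" for y by (auto intro!: derivative_eq_intros)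
    from MVT2[OF x(1) this] obtain z where "sinh x = x * cosh z" by auto
    then show ?thesis using x cosh_real_ge_1[of z] by simp
  qed
  then show "c \<le> \<kappa> * sinh (c / \<kappa>)" using x \<kappa> by (metis x_def mult_left_mono order_trans zero_le_one)
  have "norm (of_real (sinh x - x - x ^ 3 / 6) :: complex) \<le> exp x * x ^ 4 / 6"
    using norm_exp_diff_cubic[of "of_real x"] x
    by (simp add: sinh_field_def exp_of_real[symmetric])
  then have "\<bar>sinh x - x - x ^ 3 / 6\<bar> \<le> exp x * x ^ 4 / 6" by (simp only: norm_of_real)
  then have "sinh x - x \<le> x ^ 3 / 6 + exp x * x ^ 4 / 6" by linarith
  also have "\<dots> \<le> x ^ 3 / 6 + exp c * c * x ^ 3 / 6"
  proof -
    have "exp x * x * x ^ 3 \<le> exp c * c * x ^ 3" using x by (intro mult_right_mono mult_mono) auto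
    then show ?thesis by (simp add: power4_eq_xxxx power3_eq_cube mult_ac)
  qed
  finally have "2 * \<kappa> ^ 3 * (sinh x - x) \<le> 2 * \<kappa> ^ 3 * (x ^ 3 / 6 + exp c * c * x ^ 3 / 6)"
    using \<kappa> by (intro mult_left_mono) auto
  also have "\<dots> = (\<kappa> * x) ^ 3 / 3 + exp c * c * (\<kappa> * x) ^ 3 / 3" by (simp add: field_simps)
  finally show "2 * \<kappa> ^ 3 * (sinh (c / \<kappa>) - c / \<kappa>) \<le> c ^ 3 / 3 + exp c * c ^ 4 / 3"
    unfolding x(3) by (simp add: x_def power4_eq_xxxx power3_eq_cube mult_ac)
qed

text \<open>On the circle of radius exp (c / kappa) the Bessel integrand has Gaussian decay at scale 1 / kappa,
  uniformly in the index; this is what makes the edge asymptotics elementary.\<close>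

definition bessel_integrand :: "real \<Rightarrow> real \<Rightarrow> real \<Rightarrow> real \<Rightarrow> complex" where
  "bessel_integrand c \<kappa> \<xi> \<tau> = indicator {- pi * \<kappa>..pi * \<kappa>} \<tau> *\<^sub>R
     exp (of_real (\<kappa> ^ 3) * (exp (Complex c \<tau> / of_real \<kappa>) - exp (- Complex c \<tau> / of_real \<kappa>))
       - of_real (2 * \<kappa>\<^sup>2 + \<xi>) * Complex c \<tau>)"

lemma bessel_eq_integral:
  assumes \<kappa>: "0 < \<kappa>" and \<xi>: "real_of_int k = 2 * \<kappa> ^ 3 + \<xi> * \<kappa>"
  shows "\<kappa> * W (\<kappa> ^ 3) (- (\<kappa> ^ 3)) k = Re (integral\<^sup>L lborel (bessel_integrand c \<kappa> \<xi>)) / (2 * pi)"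
proof -
  define F where "F t = indicator {-pi..pi} t *\<^sub>R exp (of_real (\<kappa> ^ 3) * exp (Complex (c / \<kappa>) t) + of_real (- (\<kappa> ^ 3)) * exp (- Complex (c / \<kappa>) t) - of_int k * Complex (c / \<kappa>) t)" for t
  have "of_real (2 * pi * W (\<kappa> ^ 3) (- (\<kappa> ^ 3)) k) = integral\<^sup>L lborel F"
    using W_integral[of "\<kappa> ^ 3" "c / \<kappa>" "- (\<kappa> ^ 3)" k] by (simp add: integral_restrict_space F_def[abs_def])
  also have "\<dots> = \<bar>1 / \<kappa>\<bar> *\<^sub>R integral\<^sup>L lborel (\<lambda>\<tau>. F (0 + 1 / \<kappa> * \<tau>))"
    using \<kappa> by (intro lborel_integral_real_affine) auto
  also have "(\<lambda>\<tau>. F (0 + 1 / \<kappa> * \<tau>)) = bessel_integrand c \<kappa> \<xi>"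
  proof
    fix \<tau>
    have k: "(of_int k :: complex) = of_real (2 * \<kappa> ^ 3 + \<xi> * \<kappa>)" using \<xi> by (metis of_real_of_int_eq)
    have w: "Complex (c / \<kappa>) (\<tau> / \<kappa>) = Complex c \<tau> / of_real \<kappa>" by (simp add: complex_eq_iff)
    have "of_int k * (Complex c \<tau> / of_real \<kappa>) = of_real (2 * \<kappa>\<^sup>2 + \<xi>) * Complex c \<tau>"
      unfolding k using \<kappa> by (simp add: field_simps power3_eq_cube power2_eq_square)
    moreover have "indicator {-pi..pi} (\<tau> / \<kappa>) = (indicator {- pi * \<kappa>..pi * \<kappa>} \<tau> :: real)"
      using \<kappa> by (auto simp: indicator_def field_simps)
    ultimately show "F (0 + 1 / \<kappa> * \<tau>) = bessel_integrand c \<kappa> \<xi> \<tau>"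
      by (simp add: F_def bessel_integrand_def w algebra_simps)
  qed
  finally have "Re (of_real (2 * pi * W (\<kappa> ^ 3) (- (\<kappa> ^ 3)) k)) = Re (\<bar>1 / \<kappa>\<bar> *\<^sub>R integral\<^sup>L lborel (bessel_integrand c \<kappa> \<xi>))"
    by simp
  then show ?thesis using \<kappa> by (simp add: field_simps)
qed

lemma norm_bessel_integrand_le:
  assumes c: "0 < c" and \<kappa>: "1 \<le> \<kappa>"
  shows "norm (bessel_integrand c \<kappa> \<xi> \<tau>) \<le> exp (c ^ 3 / 3 + exp c * c ^ 4 / 3) * exp (- c * \<xi>) * exp (- (c / 4) * \<tau>\<^sup>2)"
proof (cases "\<bar>\<tau>\<bar> \<le> pi * \<kappa>")
  case False
  then have "indicator {- pi * \<kappa>..pi * \<kappa>} \<tau> = (0::real)" by (auto simp: indicator_def abs_le_iff)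
  then show ?thesis by (simp add: bessel_integrand_def)
next
  case True
  have y: "\<bar>\<tau> / \<kappa>\<bar> \<le> pi" using True \<kappa> by (simp add: field_simps)
  have re: "Re (exp (Complex c \<tau> / of_real \<kappa>) - exp (- Complex c \<tau> / of_real \<kappa>)) = 2 * sinh (c / \<kappa>) * cos (\<tau> / \<kappa>)"
  proof -
    have "Complex c \<tau> / of_real \<kappa> = Complex (c / \<kappa>) (\<tau> / \<kappa>)" by (simp add: complex_eq_iff)
    then have e: "exp (Complex c \<tau> / of_real \<kappa>) = exp (Complex (c / \<kappa>) (\<tau> / \<kappa>))"
      "exp (- Complex c \<tau> / of_real \<kappa>) = exp (- Complex (c / \<kappa>) (\<tau> / \<kappa>))"
      by (simp_all only: minus_divide_left[symmetric])
    show ?thesis unfolding e by (simp add: Re_exp sinh_field_def left_diff_distrib)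
  qed
  \<comment> \<open>The real part of the exponent is \<open>A\<close>, minus a loss proportional to
    1 - cos (\<tau> / \<kappa>), minus c \<xi>. In \<open>A\<close> the large term 2 \<kappa>^2 c
    from the centre of the index has cancelled; the loss dominates a quadratic in \<tau>.\<close>
  define A where "A = 2 * \<kappa> ^ 3 * (sinh (c / \<kappa>) - c / \<kappa>)"
  have A: "A \<le> c ^ 3 / 3 + exp c * c ^ 4 / 3" unfolding A_def using sinh_scaled_bounds(2)[OF c \<kappa>] .
  have B: "c / 4 * \<tau>\<^sup>2 \<le> 2 * \<kappa> ^ 3 * sinh (c / \<kappa>) * (1 - cos (\<tau> / \<kappa>))"
  proof -
    have "c / 4 * \<tau>\<^sup>2 = 2 * \<kappa>\<^sup>2 * c * ((\<tau> / \<kappa>)\<^sup>2 / 8)" using \<kappa> by (simp add: power_divide)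
    also have "\<dots> \<le> 2 * \<kappa>\<^sup>2 * (\<kappa> * sinh (c / \<kappa>)) * (1 - cos (\<tau> / \<kappa>))"
      using sinh_scaled_bounds(1)[OF c \<kappa>] cos_le_quadratic[OF y] c by (intro mult_mono) auto
    finally show ?thesis by (simp add: power3_eq_cube power2_eq_square mult_ac)
  qed
  have "Re (of_real (\<kappa> ^ 3) * (exp (Complex c \<tau> / of_real \<kappa>) - exp (- Complex c \<tau> / of_real \<kappa>)) - of_real (2 * \<kappa>\<^sup>2 + \<xi>) * Complex c \<tau>)
     = \<kappa> ^ 3 * (2 * sinh (c / \<kappa>) * cos (\<tau> / \<kappa>)) - (2 * \<kappa>\<^sup>2 + \<xi>) * c"
  proof -
    have "Re (of_real p * E - of_real q * Complex c \<tau>) = p * Re E - q * c" for p q E by simp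
    then show ?thesis by (simp only: re)
  qed
  also have "\<dots> = A - 2 * \<kappa> ^ 3 * sinh (c / \<kappa>) * (1 - cos (\<tau> / \<kappa>)) - c * \<xi>"
    using \<kappa> by (simp add: A_def field_simps power3_eq_cube power2_eq_square)
  also have "\<dots> \<le> c ^ 3 / 3 + exp c * c ^ 4 / 3 + - c * \<xi> + - (c / 4) * \<tau>\<^sup>2" using A B by linarith
  finally have "exp (Re (of_real (\<kappa> ^ 3) * (exp (Complex c \<tau> / of_real \<kappa>) - exp (- Complex c \<tau> / of_real \<kappa>)) - of_real (2 * \<kappa>\<^sup>2 + \<xi>) * Complex c \<tau>))
    \<le> exp (c ^ 3 / 3 + exp c * c ^ 4 / 3 + - c * \<xi> + - (c / 4) * \<tau>\<^sup>2)" by simp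
  moreover have "norm (bessel_integrand c \<kappa> \<xi> \<tau>) \<le> norm (exp (of_real (\<kappa> ^ 3) * (exp (Complex c \<tau> / of_real \<kappa>) - exp (- Complex c \<tau> / of_real \<kappa>)) - of_real (2 * \<kappa>\<^sup>2 + \<xi>) * Complex c \<tau>))"
    unfolding bessel_integrand_def norm_scaleR by (auto simp: indicator_def)
  ultimately show ?thesis unfolding norm_exp_eq_Re exp_add by linarith
qed

lemma bessel_integrand_measurable: "bessel_integrand c \<kappa> \<xi> \<in> borel_measurable borel"
proof -
  have "continuous_on UNIV (\<lambda>\<tau>. exp (of_real (\<kappa> ^ 3) * (exp (Complex c \<tau> * of_real (1 / \<kappa>)) - exp (- Complex c \<tau> * of_real (1 / \<kappa>)))
       - of_real (2 * \<kappa>\<^sup>2 + \<xi>) * Complex c \<tau>))"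
    by (intro continuous_intros)
  then have "(\<lambda>\<tau>. exp (of_real (\<kappa> ^ 3) * (exp (Complex c \<tau> / of_real \<kappa>) - exp (- Complex c \<tau> / of_real \<kappa>))
       - of_real (2 * \<kappa>\<^sup>2 + \<xi>) * Complex c \<tau>)) \<in> borel_measurable borel"
    by (intro borel_measurable_continuous_onI) (simp add: divide_inverse)
  then show ?thesis unfolding bessel_integrand_def[abs_def] by (intro borel_measurable_scaleR) auto
qed

text \<open>The constant depends on the rate \<open>c\<close> only, not on \<kappa> or the index.
  Rates can be chosen freely, which later lets the decay of one Bessel factor beat the possible
  growth of this bound for another.\<close>

lemma scaled_bessel_bound:
  assumes c: "0 < c"
  obtains D where "0 < D"
    "\<And>\<kappa> \<xi> k. 1 \<le> \<kappa> \<Longrightarrow> real_of_int k = 2 * \<kappa> ^ 3 + \<xi> * \<kappa> \<Longrightarrow> \<bar>\<kappa> * W (\<kappa> ^ 3) (- (\<kappa> ^ 3)) k\<bar> \<le> D * exp (- c * \<xi>)"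
proof -
  define I where "I = (LINT t|lborel. exp (- (c / 4) * t\<^sup>2))"
  define D where "D = exp (c ^ 3 / 3 + exp c * c ^ 4 / 3) * I / (2 * pi)"
  have gi: "integrable lborel (\<lambda>t. exp (- (c / 4) * t\<^sup>2))" using c by (intro integrable_gaussian) auto
  have "\<bar>\<kappa> * W (\<kappa> ^ 3) (- (\<kappa> ^ 3)) k\<bar> \<le> D * exp (- c * \<xi>)"
    if \<kappa>: "1 \<le> \<kappa>" and k: "real_of_int k = 2 * \<kappa> ^ 3 + \<xi> * \<kappa>" for \<kappa> \<xi> k
  proof -
    have "\<bar>Re (integral\<^sup>L lborel (bessel_integrand c \<kappa> \<xi>))\<bar> \<le> norm (integral\<^sup>L lborel (bessel_integrand c \<kappa> \<xi>))"
      by (rule abs_Re_le_cmod)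
    also have "\<dots> \<le> (LINT t|lborel. exp (c ^ 3 / 3 + exp c * c ^ 4 / 3) * exp (- c * \<xi>) * exp (- (c / 4) * t\<^sup>2))"
    proof (rule order_trans[OF integral_norm_bound integral_mono])
      show g: "integrable lborel (\<lambda>t. exp (c ^ 3 / 3 + exp c * c ^ 4 / 3) * exp (- c * \<xi>) * exp (- (c / 4) * t\<^sup>2))"
        by (rule integrable_mult_right[OF gi])
      show "integrable lborel (\<lambda>t. norm (bessel_integrand c \<kappa> \<xi> t))"
        by (rule integrable_norm, rule Bochner_Integration.integrable_bound[OF g])
          (use norm_bessel_integrand_le[OF c \<kappa>] bessel_integrand_measurable in auto)
    qed (rule norm_bessel_integrand_le[OF c \<kappa>])
    also have "\<dots> = exp (c ^ 3 / 3 + exp c * c ^ 4 / 3) * exp (- c * \<xi>) * I" by (simp add: I_def)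
    finally have "\<bar>Re (integral\<^sup>L lborel (bessel_integrand c \<kappa> \<xi>))\<bar> / (2 * pi) \<le> D * exp (- c * \<xi>)"
      by (simp add: D_def field_simps)
    then show ?thesis using \<kappa> by (subst bessel_eq_integral[OF _ k, of c]) auto
  qed
  then have "\<bar>\<kappa> * W (\<kappa> ^ 3) (- (\<kappa> ^ 3)) k\<bar> \<le> (\<bar>D\<bar> + 1) * exp (- c * \<xi>)"
    if "1 \<le> \<kappa>" "real_of_int k = 2 * \<kappa> ^ 3 + \<xi> * \<kappa>" for \<kappa> \<xi> k
    by (rule order_trans[OF _ mult_right_mono]) (use that in auto)
  then show ?thesis using that[of "\<bar>D\<bar> + 1"] by auto
qed

lemma scaled_bessel_tendsto:
  assumes c: "0 < c" and \<kappa>: "\<And>m. 1 \<le> \<kappa> m" "filterlim \<kappa> at_top sequentially"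
    and k: "\<And>m. real_of_int (k m) = 2 * \<kappa> m ^ 3 + \<xi> m * \<kappa> m" and lim: "\<xi> \<longlonglongrightarrow> x"
  shows "(\<lambda>m. \<kappa> m * W (\<kappa> m ^ 3) (- (\<kappa> m ^ 3)) (k m)) \<longlonglongrightarrow> Ai_line c x"
proof -
  obtain E where E: "\<And>m. \<bar>\<xi> m\<bar> \<le> E"
    using convergent_imp_Bseq[OF convergentI[OF lim]] by (auto simp: Bseq_def)
  define w where "w t = exp (c ^ 3 / 3 + exp c * c ^ 4 / 3) * exp (c * E) * exp (- (c / 4) * t\<^sup>2)" for t
  have "(\<lambda>m. integral\<^sup>L lborel (bessel_integrand c (\<kappa> m) (\<xi> m))) \<longlonglongrightarrow> integral\<^sup>L lborel (\<lambda>t. airy_exp x (Complex c t))"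
  proof (rule integral_dominated_convergence[where w = w])
    show "(\<lambda>t. airy_exp x (Complex c t)) \<in> borel_measurable lborel"
      using borel_measurable_integrable[OF integrable_airy_exp[OF c]] .
    show "bessel_integrand c (\<kappa> m) (\<xi> m) \<in> borel_measurable lborel" for m
      using bessel_integrand_measurable by simp
    show "integrable lborel w" unfolding w_def using c by (intro integrable_mult_right integrable_gaussian) auto
    show "AE t in lborel. norm (bessel_integrand c (\<kappa> m) (\<xi> m) t) \<le> w t" for m
    proof (rule AE_I2)
      fix t
      have "- c * \<xi> m \<le> c * E" using E[of m] c mult_left_mono[of "- \<xi> m" E c] by (auto simp: abs_le_iff)
      then have "exp (- c * \<xi> m) \<le> exp (c * E)" by simp
      then show "norm (bessel_integrand c (\<kappa> m) (\<xi> m) t) \<le> w t"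
        unfolding w_def using order_trans[OF norm_bessel_integrand_le[OF c \<kappa>(1)] mult_right_mono[OF mult_left_mono]] by simp
    qed
    show "AE t in lborel. (\<lambda>m. bessel_integrand c (\<kappa> m) (\<xi> m) t) \<longlonglongrightarrow> airy_exp x (Complex c t)"
    proof (rule AE_I2)
      fix t
      define \<omega> where "\<omega> = Complex c t"
      define u where "u m = \<omega> / of_real (\<kappa> m)" for m
      define R where "R m = of_real (2 * \<kappa> m ^ 3) * ((exp (u m) - exp (- u m)) / 2 - u m - u m ^ 3 / 6)" for m
      have inv: "(\<lambda>m. inverse (\<kappa> m)) \<longlonglongrightarrow> 0" using \<kappa>(2) by (rule tendsto_inverse_0_at_top)
      have nu: "norm (u m) = norm \<omega> * inverse (\<kappa> m)" for m
        using \<kappa>(1)[of m] by (simp add: u_def norm_divide divide_inverse norm_mult norm_inverse)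
      have R0: "R \<longlonglongrightarrow> 0"
      proof (rule Lim_null_comparison)
        show "\<forall>\<^sub>F m in sequentially. norm (R m) \<le> exp (norm \<omega>) * norm \<omega> ^ 4 / 3 * inverse (\<kappa> m)"
        proof (rule always_eventually, rule allI)
          fix m
          have k1: "1 \<le> \<kappa> m" by (rule \<kappa>)
          have "norm (R m) \<le> 2 * \<kappa> m ^ 3 * (exp (norm (u m)) * norm (u m) ^ 4 / 6)"
            unfolding R_def norm_mult using norm_exp_diff_cubic[of "u m"] k1 by (intro mult_mono) (auto simp: norm_power norm_mult)
          also have "\<dots> \<le> 2 * \<kappa> m ^ 3 * (exp (norm \<omega>) * norm (u m) ^ 4 / 6)"
          proof -
            have "norm (u m) \<le> norm \<omega>" unfolding nu using k1 by (intro mult_left_le) (auto simp: inverse_le_1_iff)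
            then show ?thesis using k1 by (intro mult_left_mono divide_right_mono mult_right_mono) auto
          qed
          also have "\<dots> = exp (norm \<omega>) * norm \<omega> ^ 4 / 3 * inverse (\<kappa> m)"
            unfolding nu using k1 by (simp add: field_simps power_mult_distrib power3_eq_cube power4_eq_xxxx)
          finally show "norm (R m) \<le> exp (norm \<omega>) * norm \<omega> ^ 4 / 3 * inverse (\<kappa> m)" .
        qed
        show "(\<lambda>m. exp (norm \<omega>) * norm \<omega> ^ 4 / 3 * inverse (\<kappa> m)) \<longlonglongrightarrow> 0"
          using tendsto_mult_right_zero[OF inv] by simp
      qed
      \<comment> \<open>The term linear in \<open>u m\<close> cancels the 2 \<kappa>^2 coming from
        the centre 2 \<kappa>^3 of the index, the cubic term is \<omega>^3 / 3, and everything of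
        higher order is collected in \<open>R m\<close>.\<close>
      have e: "of_real (\<kappa> m ^ 3) * (exp (\<omega> / of_real (\<kappa> m)) - exp (- \<omega> / of_real (\<kappa> m))) - of_real (2 * (\<kappa> m)\<^sup>2 + \<xi> m) * \<omega>
         = R m + \<omega> ^ 3 / 3 - of_real (\<xi> m) * \<omega>" for m
      proof -
        have "of_real (2 * \<kappa> m ^ 3) * u m = of_real (2 * (\<kappa> m)\<^sup>2) * \<omega>" "of_real (2 * \<kappa> m ^ 3) * (u m ^ 3 / 6) = \<omega> ^ 3 / 3"
          using \<kappa>(1)[of m] by (simp_all add: u_def field_simps power3_eq_cube power2_eq_square)
        then show ?thesis unfolding R_def right_diff_distrib by (simp add: u_def algebra_simps)
      qed
      have "(\<lambda>m. exp (R m + \<omega> ^ 3 / 3 - of_real (\<xi> m) * \<omega>)) \<longlonglongrightarrow> exp (0 + \<omega> ^ 3 / 3 - of_real x * \<omega>)"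
        by (intro tendsto_intros R0 lim)
      moreover have "\<forall>\<^sub>F m in sequentially. exp (R m + \<omega> ^ 3 / 3 - of_real (\<xi> m) * \<omega>) = bessel_integrand c (\<kappa> m) (\<xi> m) t"
      proof -
        have "\<forall>\<^sub>F m in sequentially. \<bar>t\<bar> \<le> \<kappa> m" using \<kappa>(2) by (simp add: filterlim_at_top)
        then show ?thesis
        proof eventually_elim
          fix m assume "\<bar>t\<bar> \<le> \<kappa> m"
          also have "\<kappa> m \<le> pi * \<kappa> m" using \<kappa>(1)[of m] pi_gt3 by simp
          finally have "t \<in> {- pi * \<kappa> m..pi * \<kappa> m}" by (auto simp: abs_le_iff)
          then show "exp (R m + \<omega> ^ 3 / 3 - of_real (\<xi> m) * \<omega>) = bessel_integrand c (\<kappa> m) (\<xi> m) t"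
            unfolding bessel_integrand_def using e[of m] by (simp add: \<omega>_def)
        qed
      qed
      ultimately show "(\<lambda>m. bessel_integrand c (\<kappa> m) (\<xi> m) t) \<longlonglongrightarrow> airy_exp x (Complex c t)"
        unfolding airy_exp_def \<omega>_def by (simp add: Lim_transform_eventually)
    qed
  qed
  from tendsto_divide[OF tendsto_Re[OF this] tendsto_const[of "2 * pi"]]
  have "(\<lambda>m. Re (integral\<^sup>L lborel (bessel_integrand c (\<kappa> m) (\<xi> m))) / (2 * pi)) \<longlonglongrightarrow> Ai_line c x" by (simp add: Ai_line_def)
  moreover have "\<kappa> m * W (\<kappa> m ^ 3) (- (\<kappa> m ^ 3)) (k m) = Re (integral\<^sup>L lborel (bessel_integrand c (\<kappa> m) (\<xi> m))) / (2 * pi)" for m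
    using \<kappa>(1)[of m] by (intro bessel_eq_integral k) auto
  ultimately show ?thesis by simp
qed

section \<open>Summation over partitions\<close>

definition part :: "nat list \<Rightarrow> nat \<Rightarrow> nat" where
  "part l i = (if i < length l then l ! i else 0)"

text \<open>Particle positions (Maya diagram). Partitions with at most N parts become N-element sets
  of integers above - N, which makes Cauchy-Binet applicable.\<close>

definition cfg :: "nat list \<Rightarrow> nat \<Rightarrow> int" where
  "cfg l i = int (part l i) - int i"

lemma part_antimono:
  assumes "l \<in> partitions" "i \<le> j"
  shows "part l j \<le> part l i"
  using assms by (cases "i = j") (auto simp: part_def partitions_def is_partition_def sorted_wrt_iff_nth_less)

lemma part_le_lam1: "l \<in> partitions \<Longrightarrow> part l i \<le> lam1 l"
  using part_antimono[of l 0 i] by (auto simp: part_def lam1_def hd_conv_nth split: if_splits)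

lemma part_0: "part l 0 = lam1 l"
  by (auto simp: part_def lam1_def hd_conv_nth)

lemma cfg_strict_antimono: "l \<in> partitions \<Longrightarrow> i < j \<Longrightarrow> cfg l j < cfg l i"
  using part_antimono[of l i j] by (simp add: cfg_def)

lemma cfg_inj_on: "l \<in> partitions \<Longrightarrow> inj_on (cfg l) S"
  by (rule inj_onI, rule ccontr) (metis cfg_strict_antimono linorder_neqE_nat order_less_irrefl)

lemma partition_eqI:
  assumes l: "l \<in> partitions" and l': "l' \<in> partitions" and eq: "\<And>i. part l i = part l' i"
  shows "l = l'"
proof -
  have pos: "i < length m \<longleftrightarrow> 0 < part m i" if "m \<in> partitions" for m i
    using that by (auto simp: part_def partitions_def is_partition_def)
  have "i < length l \<longleftrightarrow> i < length l'" for i using pos[OF l] pos[OF l'] eq by simp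
  then have len: "length l = length l'" by (metis linorder_neqE_nat order_less_irrefl)
  show ?thesis
  proof (rule nth_equalityI[OF len])
    fix i assume "i < length l" then show "l ! i = l' ! i" using eq[of i] len by (simp add: part_def)
  qed
qed

lemma partition_of_config:
  fixes y :: "nat \<Rightarrow> int"
  assumes dec: "\<And>i j. i < j \<Longrightarrow> j < N \<Longrightarrow> y j < y i" and lb: "\<And>i. i < N \<Longrightarrow> - int N < y i"
  shows "\<exists>l\<in>partitions. length l \<le> N \<and> (\<forall>i<N. cfg l i = y i)"
proof -
  \<comment> \<open>The last position exceeds - N; going backwards, strict decrease of integers
    raises the lower bound by one at every step.\<close>
  have ge: "- int i \<le> y i" if "i < N" for i
    using that
  proof (induction "N - i" arbitrary: i)
    case (Suc k)
    show ?case
    proof (cases "Suc i < N")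
      case True
      then show ?thesis using Suc(1)[of "Suc i"] Suc(2) dec[of i "Suc i"] by fastforce
    next
      case False
      then show ?thesis using lb[of i] Suc.prems by simp
    qed
  qed simp
  define lm where "lm i = nat (y i + int i)" for i
  have la: "int (lm i) = y i + int i" if "i < N" for i using ge[OF that] by (simp add: lm_def)
  have dec1: "lm j \<le> lm i" if "i \<le> j" "j < N" for i j
    using that
  proof (induction j)
    case (Suc j)
    show ?case
    proof (cases "i = Suc j")
      case False
      then have "lm j \<le> lm i" using Suc by simp
      moreover have "lm (Suc j) \<le> lm j" using dec[of j "Suc j"] Suc.prems la[of j] la[of "Suc j"] by simp
      ultimately show ?thesis by simp
    qed simp
  qed simp
  define l where "l = takeWhile (\<lambda>x. 0 < x) (map lm [0..<N])"
  have len: "length l \<le> N" unfolding l_def by (metis length_map length_takeWhile_le length_upt minus_nat.diff_0)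
  have nth: "l ! i = lm i" if "i < length l" for i
    using that len unfolding l_def by (subst takeWhile_nth) auto
  have after: "lm i = 0" if "length l \<le> i" "i < N" for i
  proof -
    have "length l < length (map lm [0..<N])" using that by simp
    from nth_length_takeWhile[OF this[unfolded l_def]] have "lm (length l) = 0"
      using that by (simp add: l_def[symmetric])
    with dec1[of "length l" i] that show ?thesis by simp
  qed
  have "l \<in> partitions"
    unfolding partitions_def is_partition_def
  proof (intro CollectI conjI ballI)
    show "sorted_wrt (\<ge>) l"
      unfolding sorted_wrt_iff_nth_less using nth dec1 len by simp
    fix x assume "x \<in> set l" then show "0 < x" unfolding l_def using set_takeWhileD by fastforce
  qed
  moreover have "cfg l i = y i" if "i < N" for i
    using nth[of i] after[of i] la[OF that] that by (auto simp: cfg_def part_def)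
  ultimately show ?thesis using len by blast
qed

text \<open>Positions decrease strictly, so their list is the unique decreasing enumeration of their
  set.\<close>

lemma cfg_determines_partition:
  assumes l: "l \<in> partitions" "length l \<le> N" and l': "l' \<in> partitions" "length l' \<le> N"
    and eq: "cfg l ` {..<N} = cfg l' ` {..<N}"
  shows "l = l'"
proof -
  have s: "rev (map (cfg m) [0..<N]) = sorted_list_of_set (cfg m ` {..<N})" if "m \<in> partitions" for m
  proof -
    have "sorted_wrt (<) (rev (map (cfg m) [0..<N]))"
      unfolding sorted_wrt_rev by (auto simp: sorted_wrt_iff_nth_less cfg_strict_antimono[OF that])
    then show ?thesis
      by (metis atLeast_upt list.set_map set_rev sorted_list_of_set.idem_if_sorted_distinct strict_sorted_iff)
  qed
  have "map (cfg l) [0..<N] = map (cfg l') [0..<N]"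
    using s[OF l(1)] s[OF l'(1)] eq by (metis rev_rev_ident)
  then have c: "cfg l i = cfg l' i" if "i < N" for i using that by (metis add_0 diff_zero length_upt nth_map nth_upt)
  have "part l i = part l' i" for i
    using c[of i] l(2) l'(2) by (cases "i < N") (auto simp: cfg_def part_def split: if_splits)
  then show ?thesis by (intro partition_eqI l l') 
qed

text \<open>An injective tuple is a point set together with an ordering of it, that is, a partition
  and a permutation. The cutoffs \<open>N\<close> and \<open>n\<close> on the partition are exactly
  the two ends of the interval.\<close>

lemma injective_maps_by_partitions:
  fixes N n :: nat
  defines "X \<equiv> {- int N<..int n}"
  defines "L \<equiv> {l \<in> partitions. length l \<le> N \<and> lam1 l \<le> n}"
  shows "bij_betw (\<lambda>(l, p). restrict (cfg l \<circ> p) {..<N}) (L \<times> {p. p permutes {..<N}})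
    {x \<in> PiE {..<N} (\<lambda>_. X). inj_on x {..<N}}"
proof -
  have cX: "cfg l i \<in> X" if "l \<in> L" "i < N" for l i
    using that part_le_lam1[of l i] by (auto simp: X_def L_def cfg_def)
  show ?thesis unfolding bij_betw_def
  proof
    show "inj_on (\<lambda>(l, p). restrict (cfg l \<circ> p) {..<N}) (L \<times> {p. p permutes {..<N}})"
    proof (rule inj_onI, clarify)
      fix l p l' p'
      assume l: "l \<in> L" "l' \<in> L" and p: "p permutes {..<N}" "p' permutes {..<N}"
        and eq: "restrict (cfg l \<circ> p) {..<N} = restrict (cfg l' \<circ> p') {..<N}"
      have im: "(cfg m \<circ> q) ` {..<N} = cfg m ` {..<N}" if "q permutes {..<N}" for m q
        unfolding image_comp[symmetric] using permutes_image[OF that] by simp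
      have "(cfg l \<circ> p) ` {..<N} = (cfg l' \<circ> p') ` {..<N}"
        using eq by (metis image_restrict_eq)
      then have "cfg l ` {..<N} = cfg l' ` {..<N}" using im p by simp
      then have ll: "l = l'" using l by (intro cfg_determines_partition) (auto simp: L_def)
      have "p i = p' i" for i
      proof (cases "i < N")
        case True
        then have "cfg l (p i) = cfg l (p' i)" using fun_cong[OF eq, of i] ll by simp
        then show ?thesis using cfg_inj_on[of l UNIV] l by (auto simp: L_def inj_on_def)
      next
        case False
        then show ?thesis using p by (simp add: permutes_not_in)
      qed
      with ll show "l = l' \<and> p = p'" by auto
    qed
    show "(\<lambda>(l, p). restrict (cfg l \<circ> p) {..<N}) ` (L \<times> {p. p permutes {..<N}}) = {x \<in> PiE {..<N} (\<lambda>_. X). inj_on x {..<N}}"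
    proof (intro set_eqI iffI)
      fix x assume "x \<in> (\<lambda>(l, p). restrict (cfg l \<circ> p) {..<N}) ` (L \<times> {p. p permutes {..<N}})"
      then obtain l p where l: "l \<in> L" and p: "p permutes {..<N}" and x: "x = restrict (cfg l \<circ> p) {..<N}" by auto
      have "inj_on (cfg l \<circ> p) {..<N}"
        using l permutes_inj_on[OF p] by (intro comp_inj_on cfg_inj_on) (auto simp: L_def)
      moreover have "p i < N" if "i < N" for i using permutes_in_image[OF p, of i] that by simp
      ultimately show "x \<in> {x \<in> PiE {..<N} (\<lambda>_. X). inj_on x {..<N}}"
        using cX[OF l] by (auto simp: x inj_on_def)
    next
      fix x assume x: "x \<in> {x \<in> PiE {..<N} (\<lambda>_. X). inj_on x {..<N}}"
      define S where "S = x ` {..<N}"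
      have S: "finite S" "card S = N" "S \<subseteq> X" using x by (auto simp: S_def card_image PiE_iff)
      define ys where "ys = rev (sorted_list_of_set S)"
      have ly: "length ys = N" "set ys = S" "distinct ys" using S by (auto simp: ys_def)
      have dec: "ys ! j < ys ! i" if "i < j" "j < N" for i j
      proof -
        have "sorted_wrt (>) ys"
          unfolding ys_def sorted_wrt_rev using strict_sorted_list_of_set[of S] by simp
        then show ?thesis using that ly by (simp add: sorted_wrt_iff_nth_less)
      qed
      have inX: "ys ! i \<in> X" if "i < N" for i using that ly S by (metis nth_mem subsetD)
      then obtain l where l: "l \<in> partitions" "length l \<le> N" "\<And>i. i < N \<Longrightarrow> cfg l i = ys ! i"
        using partition_of_config[of N "\<lambda>i. ys ! i"] dec by (auto simp: X_def)
      have lL: "l \<in> L"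
      proof (cases "N = 0")
        case True
        then show ?thesis using l by (auto simp: L_def lam1_def)
      next
        case False
        then have "int (part l 0) = ys ! 0" using l(3)[of 0] by (simp add: cfg_def)
        moreover have "ys ! 0 \<le> int n" using inX[of 0] False by (simp add: X_def)
        ultimately show ?thesis using l by (simp add: L_def part_0)
      qed
      have "\<forall>i<N. \<exists>k<N. x i = cfg l k"
      proof (intro allI impI)
        fix i assume "i < N"
        then have "x i \<in> set ys" using ly by (simp add: S_def)
        then show "\<exists>k<N. x i = cfg l k" using ly l(3) by (metis in_set_conv_nth)
      qed
      then obtain q where q: "\<And>i. i < N \<Longrightarrow> q i < N \<and> x i = cfg l (q i)" by metis
      have "inj_on (restrict q {..<N}) {..<N}"
      proof (rule inj_onI)
        fix i j assume ij: "i \<in> {..<N}" "j \<in> {..<N}" "restrict q {..<N} i = restrict q {..<N} j"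
        then have "x i = x j" using q[of i] q[of j] by simp
        then show "i = j" using x ij by (auto simp: inj_on_def)
      qed
      moreover have "restrict q {..<N} \<in> PiE {..<N} (\<lambda>_. {..<N})" using q by auto
      ultimately obtain p where p: "p permutes {..<N}" "restrict q {..<N} = restrict p {..<N}"
        using inj_PiE_permutes by blast
      have "x = restrict (cfg l \<circ> p) {..<N}"
      proof
        fix i show "x i = restrict (cfg l \<circ> p) {..<N} i"
        proof (cases "i < N")
          case True
          then show ?thesis using q[of i] fun_cong[OF p(2), of i] by simp
        next
          case False
          then show ?thesis using x by (auto simp: PiE_iff extensional_def)
        qed
      qed
      then show "x \<in> (\<lambda>(l, p). restrict (cfg l \<circ> p) {..<N}) ` (L \<times> {p. p permutes {..<N}})"
        using lL p(1) by auto
    qed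
  qed
qed

text \<open>The constraint on the largest part enters solely as the upper end of the summation
  interval. Hence the edge event is again described by a Gram determinant, with the points above
  \<open>n\<close> removed.\<close>

lemma cauchy_binet_partitions:
  fixes f g :: "nat \<Rightarrow> int \<Rightarrow> real"
  shows "detn N (\<lambda>i j. \<Sum>x\<in>{- int N<..int n}. f i x * g j x) =
    (\<Sum>l | l \<in> partitions \<and> length l \<le> N \<and> lam1 l \<le> n. detn N (\<lambda>i j. f j (cfg l i)) * detn N (\<lambda>i j. g j (cfg l i)))"
proof -
  define X where "X = {- int N<..int n}"
  define L where "L = {l \<in> partitions. length l \<le> N \<and> lam1 l \<le> n}"
  define T where "T x = (\<Prod>i<N. f i (x i)) * detn N (\<lambda>i j. g j (x i))" for x
  have finE: "finite (PiE {..<N} (\<lambda>_. X))" by (intro finite_PiE) (auto simp: X_def)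
  have "detn N (\<lambda>i j. \<Sum>x\<in>X. f i x * g j x) = (\<Sum>x\<in>PiE {..<N} (\<lambda>_. X). T x)"
    unfolding T_def using detn_row_sums[of X N f "\<lambda>x j. g j x"] by (simp add: X_def)
  also have "\<dots> = (\<Sum>x | x \<in> PiE {..<N} (\<lambda>_. X) \<and> inj_on x {..<N}. T x)"
  proof (rule sum.mono_neutral_right[OF finE])
    show "\<forall>x\<in>PiE {..<N} (\<lambda>_. X) - {x \<in> PiE {..<N} (\<lambda>_. X). inj_on x {..<N}}. T x = 0"
    proof
      fix x assume "x \<in> PiE {..<N} (\<lambda>_. X) - {x \<in> PiE {..<N} (\<lambda>_. X). inj_on x {..<N}}"
      then obtain a b where "a < N" "b < N" "a \<noteq> b" "x a = x b" by (auto simp: inj_on_def)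
      then have "detn N (\<lambda>i j. g j (x i)) = 0" by (intro detn_identical_rows[of a N b]) auto
      then show "T x = 0" by (simp add: T_def)
    qed
  qed auto
  also have "\<dots> = (\<Sum>(l, p)\<in>L \<times> {p. p permutes {..<N}}. T (restrict (cfg l \<circ> p) {..<N}))"
    using sum.reindex_bij_betw[OF injective_maps_by_partitions[of N n], of T, symmetric]
    by (simp add: X_def L_def case_prod_beta)
  also have "\<dots> = (\<Sum>l\<in>L. \<Sum>p | p permutes {..<N}. T (restrict (cfg l \<circ> p) {..<N}))"
    by (simp add: sum.cartesian_product)
  also have "\<dots> = (\<Sum>l\<in>L. detn N (\<lambda>i j. f j (cfg l i)) * detn N (\<lambda>i j. g j (cfg l i)))"
  proof (rule sum.cong[OF refl])
    fix l assume "l \<in> L"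
    have "T (restrict (cfg l \<circ> p) {..<N}) = of_int (sign p) * (\<Prod>i<N. f i (cfg l (p i))) * detn N (\<lambda>i j. g j (cfg l i))"
      if p: "p permutes {..<N}" for p
    proof -
      have "detn N (\<lambda>i j. g j (restrict (cfg l \<circ> p) {..<N} i)) = detn N (\<lambda>i j. g j (cfg l (p i)))"
        by (rule detn_cong) simp
      also have "\<dots> = of_int (sign p) * detn N (\<lambda>i j. g j (cfg l i))"
        using detn_permute_rows[OF p, of "\<lambda>i j. g j (cfg l i)"] .
      finally show ?thesis by (simp add: T_def)
    qed
    then have "(\<Sum>p | p permutes {..<N}. T (restrict (cfg l \<circ> p) {..<N})) = detn N (\<lambda>i j. f i (cfg l j)) * detn N (\<lambda>i j. g j (cfg l i))"
      unfolding detn_def[of N "\<lambda>i j. f i (cfg l j)"] sum_distrib_right by (intro sum.cong) auto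
    then show "(\<Sum>p | p permutes {..<N}. T (restrict (cfg l \<circ> p) {..<N})) = detn N (\<lambda>i j. f j (cfg l i)) * detn N (\<lambda>i j. g j (cfg l i))"
      using detn_transpose[of N "\<lambda>i j. f i (cfg l j)"] by simp
  qed
  finally show ?thesis by (simp add: X_def L_def)
qed

section \<open>Counting partitions and absolute convergence\<close>

definition psize :: "nat list \<Rightarrow> nat" where "psize l = sum_list l"

lemma sum_part: "length l \<le> N \<Longrightarrow> (\<Sum>i<N. part l i) = psize l"
proof -
  assume "length l \<le> N"
  then have "(\<Sum>i<N. part l i) = (\<Sum>i<length l. part l i)"
    by (intro sum.mono_neutral_right) (auto simp: part_def)
  also have "\<dots> = psize l" by (simp add: psize_def sum_list_sum_nth part_def atLeast0LessThan)
  finally show ?thesis .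
qed

lemma length_le_psize: "l \<in> partitions \<Longrightarrow> length l \<le> psize l"
proof -
  assume "l \<in> partitions"
  then have "\<forall>x\<in>set l. 1 \<le> x" by (auto simp: partitions_def is_partition_def Suc_leI)
  then show ?thesis unfolding psize_def by (induction l) auto
qed

text \<open>Unordered structure is forgotten: compositions obey a simple recursion on the first
  part, and any geometric count is good enough against the root of a factorial.\<close>

lemma card_compositions:
  "finite {l. sum_list l = m \<and> (\<forall>x\<in>set l. 0 < x)} \<and> card {l. sum_list l = m \<and> (\<forall>x\<in>set l. (0::nat) < x)} \<le> 2 ^ m"
proof (induction m rule: less_induct)
  case (less m)
  let ?C = "\<lambda>m. {l. sum_list l = m \<and> (\<forall>x\<in>set l. (0::nat) < x)}"
  show ?case
  proof (cases "m = 0")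
    case True
    then have "?C m = {[]}"
      by (auto simp: sum_list_eq_0_iff) (metis list.set_intros(1) neq_Nil_conv less_irrefl)
    then show ?thesis by simp
  next
    case False
    have sub: "?C m \<subseteq> (\<Union>k<m. (#) (m - k) ` ?C k)"
    proof
      fix l assume l: "l \<in> ?C m"
      with False obtain x xs where "l = x # xs" by (cases l) auto
      with l have "sum_list xs < m" "x = m - sum_list xs" "xs \<in> ?C (sum_list xs)" by auto
      then show "l \<in> (\<Union>k<m. (#) (m - k) ` ?C k)" using \<open>l = x # xs\<close> by blast
    qed
    have fin: "finite (\<Union>k<m. (#) (m - k) ` ?C k)" using less by auto
    have "card (?C m) \<le> card (\<Union>k<m. (#) (m - k) ` ?C k)" by (rule card_mono[OF fin sub])
    also have "\<dots> \<le> (\<Sum>k<m. card ((#) (m - k) ` ?C k))" by (rule card_UN_le) simp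
    also have "\<dots> \<le> (\<Sum>k<m. 2 ^ k)"
      using less by (intro sum_mono order_trans[OF card_image_le]) auto
    also have "\<dots> \<le> 2 ^ m" by (induction m) auto
    finally show ?thesis using finite_subset[OF sub fin] by blast
  qed
qed

lemma summable_on_partitions:
  fixes c :: "nat \<Rightarrow> real"
  assumes c: "\<And>m. 0 \<le> c m" and s: "summable (\<lambda>m. 2 ^ m * c m)"
  shows "(\<lambda>l. c (psize l)) summable_on partitions"
proof (rule nonneg_bdd_above_summable_on)
  let ?C = "\<lambda>m. {l. sum_list l = m \<and> (\<forall>x\<in>set l. (0::nat) < x)}"
  show "bdd_above (sum (\<lambda>l. c (psize l)) ` {F. F \<subseteq> partitions \<and> finite F})"
  proof (rule bdd_aboveI2)
    fix F assume "F \<in> {F. F \<subseteq> partitions \<and> finite F}"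
    then have F: "F \<subseteq> partitions" "finite F" by auto
    obtain M where M: "\<And>l. l \<in> F \<Longrightarrow> psize l < M"
      using finite_nat_set_iff_bounded[of "psize ` F"] F(2) by auto
    have "(\<Sum>l\<in>F. c (psize l)) \<le> (\<Sum>l\<in>(\<Union>m<M. ?C m). c (psize l))"
      using F M c card_compositions
      by (intro sum_mono2) (auto simp: partitions_def is_partition_def psize_def)
    also have "\<dots> = (\<Sum>m<M. \<Sum>l\<in>?C m. c (psize l))"
      by (rule sum.UNION_disjoint) (use card_compositions in auto)
    also have "\<dots> = (\<Sum>m<M. real (card (?C m)) * c m)"
      by (intro sum.cong refl) (simp add: psize_def)
    also have "\<dots> \<le> (\<Sum>m<M. 2 ^ m * c m)"
    proof (intro sum_mono mult_right_mono c)
      fix m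
      have "real (card (?C m)) \<le> real (2 ^ m)" using card_compositions[of m] of_nat_mono by blast
      then show "real (card (?C m)) \<le> 2 ^ m" by simp
    qed
    also have "\<dots> \<le> (\<Sum>m. 2 ^ m * c m)" by (rule sum_le_suminf[OF s]) (use c in auto)
    finally show "(\<Sum>l\<in>F. c (psize l)) \<le> (\<Sum>m. 2 ^ m * c m)" .
  qed
qed (use c in auto)

definition pweight :: "real \<Rightarrow> nat list \<Rightarrow> real" where
  "pweight Q l = Q ^ psize l / sqrt (fact (psize l))"

lemma pweight_nonneg: "0 \<le> Q \<Longrightarrow> 0 \<le> pweight Q l"
  by (simp add: pweight_def)

lemma pweight_summable: "0 \<le> Q \<Longrightarrow> pweight Q summable_on partitions"
proof -
  assume "0 \<le> Q"
  moreover have "summable (\<lambda>m. 2 ^ m * (Q ^ m / sqrt (fact m)))"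
    using summable_pow_div_sqrt_fact[of "2 * Q"] by (simp add: power_mult_distrib)
  ultimately show ?thesis unfolding pweight_def[abs_def] by (intro summable_on_partitions) auto
qed

text \<open>Partitions with exactly N parts carry the error in the differential equation for the N
  by N determinants; their weights are the terms of a convergent series.\<close>

lemma pweight_fibers_tendsto_0:
  assumes "0 \<le> Q"
  shows "(\<lambda>N. \<Sum>\<^sub>\<infinity>l | l \<in> partitions \<and> length l = N. pweight Q l) \<longlonglongrightarrow> 0"
proof -
  have b: "bij_betw snd (SIGMA N:UNIV. {l \<in> partitions. length l = N}) partitions"
    by (rule bij_betw_byWitness[where f' = "\<lambda>l. (length l, l)"]) auto
  have "(\<lambda>x. pweight Q (snd x)) summable_on (SIGMA N:UNIV. {l \<in> partitions. length l = N})"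
    unfolding summable_on_reindex_bij_betw[OF b] by (rule pweight_summable[OF assms])
  then have "(\<lambda>(N, l). pweight Q l) summable_on (SIGMA N:UNIV. {l \<in> partitions. length l = N})"
    by (simp add: case_prod_beta')
  from summable_on_Sigma_banach[OF this]
  have "(\<lambda>N. \<Sum>\<^sub>\<infinity>l | l \<in> partitions \<and> length l = N. pweight Q l) summable_on UNIV" .
  then have "summable (\<lambda>N. \<Sum>\<^sub>\<infinity>l | l \<in> partitions \<and> length l = N. pweight Q l)"
    by (subst (asm) summable_on_UNIV_nonneg_real_iff) (auto intro!: infsum_nonneg pweight_nonneg assms)
  then show ?thesis by (rule summable_LIMSEQ_zero)
qed

lemma sum_distinct_positive_ge:
  assumes "finite (S :: nat set)" "0 \<notin> S"
  shows "card S * (card S + 1) \<le> 2 * \<Sum>S"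
  using assms
proof (induction "card S" arbitrary: S)
  case (Suc r)
  have ne: "S \<noteq> {}" using Suc(2) by auto
  define M where "M = Max S"
  have M: "M \<in> S" using Suc ne by (simp add: M_def)
  have "S \<subseteq> {1..M}" using Suc(3,4) by (auto simp: M_def Suc_le_eq intro: Max_ge gr0I)
  then have "card S \<le> M" using card_mono[of "{1..M}" S] by simp
  moreover have "card (S - {M}) * (card (S - {M}) + 1) \<le> 2 * \<Sum>(S - {M})"
    by (rule Suc(1)) (use Suc M in auto)
  moreover have "\<Sum>S = M + \<Sum>(S - {M})" using sum.remove[OF Suc(3) M, of "\<lambda>x. x"] by simp
  moreover have "card (S - {M}) = r" "card S = Suc r" using Suc M by auto
  ultimately show ?case by (simp add: algebra_simps)
qed simp

text \<open>The recursion k h_k = b h_{k-1} turns the determinant into a sum over removable corners,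
  of which a diagram of size m has at most sqrt (2 m).\<close>

lemma abs_schur_det_le:
  fixes \<mu> :: "nat \<Rightarrow> nat"
  assumes anti: "\<And>i j. i \<le> j \<Longrightarrow> \<mu> j \<le> \<mu> i" and z: "\<And>i. N \<le> i \<Longrightarrow> \<mu> i = 0"
  shows "\<bar>detn N (\<lambda>i j. h_pl b (int (\<mu> i) - int i + int j))\<bar> \<le> (sqrt 2 * \<bar>b\<bar>) ^ (\<Sum>i<N. \<mu> i) / sqrt (fact (\<Sum>i<N. \<mu> i))"
  using assms
proof (induction "\<Sum>i<N. \<mu> i" arbitrary: \<mu>)
  case 0
  then have "\<mu> i = 0" if "i < N" for i using that by simp
  then have "detn N (\<lambda>i j. h_pl b (int (\<mu> i) - int i + int j)) = 1"
    by (intro detn_upper_unitriangular) (auto simp: h_pl_def)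
  then show ?case using 0(1) by simp
next
  case (Suc m)
  define M where "M i j = h_pl b (int (\<mu> i) - int i + int j)" for i j
  define M' where "M' k = M(k := (\<lambda>j. h_pl b (int (\<mu> k) - int k + int j - 1)))" for k
  have hrec: "of_int k * h_pl b k = b * h_pl b (k - 1)" for k
  proof (cases "k \<le> 0")
    case True
    then show ?thesis by (cases "k = 0") (auto simp: h_pl_def)
  next
    case False
    then obtain n where k: "k = int (Suc n)" by (metis gr0_conv_Suc not_le pos_int_cases)
    have "h_pl b k = b ^ Suc n / fact (Suc n)" unfolding k h_pl_def by (simp del: of_nat_Suc fact_Suc)
    moreover have "h_pl b (k - 1) = b ^ n / fact n" unfolding k h_pl_def by simp
    moreover have "real_of_int k = of_nat (Suc n)" unfolding k by simp
    ultimately show ?thesis unfolding fact_Suc by (simp del: of_nat_Suc)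
  qed
  \<comment> \<open>For every permutation the indices of the h-factors add up to the size of the
    diagram. Weighting each factor by its index therefore multiplies the determinant by the size,
    while the recursion lowers one row at a time.\<close>
  have e1: "of_nat (Suc m) * detn N M = b * (\<Sum>k<N. detn N (M' k))"
  proof -
    have "b * (\<Sum>k<N. detn N (M' k)) = (\<Sum>k<N. \<Sum>p | p permutes {..<N}. of_int (sign p) * (of_int (int (\<mu> k) - int k + int (p k)) * (\<Prod>i<N. M i (p i))))"
      unfolding sum_distrib_left
    proof (rule sum.cong[OF refl])
      fix k assume k: "k \<in> {..<N}"
      have "b * (\<Prod>i<N. M' k i (p i)) = of_int (int (\<mu> k) - int k + int (p k)) * (\<Prod>i<N. M i (p i))" for p
      proof -
        have "(\<Prod>i<N. M' k i (p i)) = h_pl b (int (\<mu> k) - int k + int (p k) - 1) * (\<Prod>i\<in>{..<N} - {k}. M i (p i))"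
          using k by (subst prod.remove[of _ k]) (auto simp: M'_def intro!: prod.cong)
        moreover have "(\<Prod>i<N. M i (p i)) = M k (p k) * (\<Prod>i\<in>{..<N} - {k}. M i (p i))"
          using k by (subst prod.remove[of _ k]) auto
        moreover have "of_int (int (\<mu> k) - int k + int (p k)) * M k (p k) = b * h_pl b (int (\<mu> k) - int k + int (p k) - 1)"
          unfolding M_def by (rule hrec)
        ultimately show ?thesis by (metis mult.assoc)
      qed
      then show "b * detn N (M' k) = (\<Sum>p | p permutes {..<N}. of_int (sign p) * (of_int (int (\<mu> k) - int k + int (p k)) * (\<Prod>i<N. M i (p i))))"
        unfolding detn_def sum_distrib_left by (intro sum.cong refl) (metis mult.left_commute)
    qed
    also have "\<dots> = (\<Sum>p | p permutes {..<N}. of_int (sign p) * ((\<Sum>k<N. of_int (int (\<mu> k) - int k + int (p k))) * (\<Prod>i<N. M i (p i))))"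
      by (subst sum.swap) (simp add: sum_distrib_left sum_distrib_right)
    also have "\<dots> = (\<Sum>p | p permutes {..<N}. of_int (sign p) * (of_nat (Suc m) * (\<Prod>i<N. M i (p i))))"
    proof (intro sum.cong refl)
      fix p assume "p \<in> {p. p permutes {..<N}}"
      then have p: "p permutes {..<N}" by simp
      have "(\<Sum>k<N. p k) = (\<Sum>k<N. k)" using sum.permute[OF p, of "\<lambda>x. x"] by (simp add: o_def)
      then have "(\<Sum>k<N. int (\<mu> k) - int k + int (p k)) = int (Suc m)"
        unfolding Suc(2) by (simp add: sum.distrib sum_subtractf of_nat_sum[symmetric] del: of_nat_sum)
      then have "(\<Sum>k<N. of_int (int (\<mu> k) - int k + int (p k))) = (of_nat (Suc m) :: real)"
        by (metis of_int_of_nat_eq of_int_sum)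
      then show "of_int (sign p) * ((\<Sum>k<N. of_int (int (\<mu> k) - int k + int (p k))) * (\<Prod>i<N. M i (p i))) =
        of_int (sign p) * (of_nat (Suc m) * (\<Prod>i<N. M i (p i)))" by simp
    qed
    also have "\<dots> = of_nat (Suc m) * detn N M"
      unfolding detn_def sum_distrib_left by (intro sum.cong refl) (simp add: mult_ac)
    finally show ?thesis by simp
  qed
  define I where "I = {i. i < N \<and> \<mu> (Suc i) < \<mu> i}"
  define Bm where "Bm = (sqrt 2 * \<bar>b\<bar>) ^ m / sqrt (fact m)"
  \<comment> \<open>Lowering a row that is not a removable corner makes it equal to the next row, or
    to zero when it is the last one.\<close>
  have zero: "detn N (M' k) = 0" if "k < N" "k \<notin> I" for k
  proof -
    have eq: "\<mu> (Suc k) = \<mu> k" using that Suc.prems(1)[of k "Suc k"] by (auto simp: I_def)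
    show ?thesis
    proof (cases "Suc k < N")
      case True
      then show ?thesis using eq by (intro detn_identical_rows[of k N "Suc k"]) (auto simp: M'_def M_def algebra_simps)
    next
      case False
      then have "\<mu> k = 0" using eq Suc.prems(2)[of "Suc k"] by simp
      then have "detn N (M' k) = detn N (M(k := (\<lambda>j. 0 * 0)))"
        using False that by (intro detn_cong) (auto simp: M'_def h_pl_def)
      then show ?thesis using detn_row_scale[OF that(1), of M 0 "\<lambda>_. 0"] by simp
    qed
  qed
  have bound: "\<bar>detn N (M' k)\<bar> \<le> Bm" if "k \<in> I" for k
  proof -
    define \<nu> where "\<nu> = \<mu>(k := \<mu> k - 1)"
    have k: "k < N" "\<mu> (Suc k) < \<mu> k" using that by (auto simp: I_def)
    have "(\<Sum>i<N. \<mu> i) = \<mu> k + (\<Sum>i\<in>{..<N}-{k}. \<mu> i)" using k by (subst sum.remove[of _ k]) auto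
    moreover have "(\<Sum>i<N. \<nu> i) = (\<mu> k - 1) + (\<Sum>i\<in>{..<N}-{k}. \<mu> i)"
      using k by (subst sum.remove[of _ k]) (auto simp: \<nu>_def intro!: sum.cong)
    ultimately have m: "m = (\<Sum>i<N. \<nu> i)" using Suc(2) k by simp
    have "\<nu> j \<le> \<nu> i" if "i \<le> j" for i j
    proof (cases "i = k \<and> j \<noteq> k")
      case True
      then have "Suc k \<le> j" using that by simp
      then have "\<mu> j \<le> \<mu> (Suc k)" by (rule Suc.prems)
      then show ?thesis using True k by (simp add: \<nu>_def)
    next
      case False
      then show ?thesis using Suc.prems(1)[OF that] by (auto simp: \<nu>_def)
    qed
    moreover have "\<nu> i = 0" if "N \<le> i" for i using Suc.prems(2)[OF that] that k by (simp add: \<nu>_def)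
    ultimately have "\<bar>detn N (\<lambda>i j. h_pl b (int (\<nu> i) - int i + int j))\<bar> \<le> Bm"
      unfolding Bm_def m by (intro Suc(1) m)
    moreover have "detn N (\<lambda>i j. h_pl b (int (\<nu> i) - int i + int j)) = detn N (M' k)"
      using k by (intro detn_cong) (auto simp: M'_def M_def \<nu>_def of_nat_diff algebra_simps)
    ultimately show ?thesis by simp
  qed
  \<comment> \<open>Distinct corners have distinct positive part sizes, and c distinct positive
    integers sum to at least c (c + 1) / 2.\<close>
  have cardI: "real (card I) \<le> sqrt 2 * sqrt (real (Suc m))"
  proof -
    have inj: "inj_on \<mu> I"
    proof (rule inj_onI, rule ccontr)
      have lt: "\<mu> j < \<mu> i" if "i \<in> I" "i < j" for i j
        using that Suc.prems(1)[of "Suc i" j] by (auto simp: I_def)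
      fix i j assume "i \<in> I" "j \<in> I" "\<mu> i = \<mu> j" "i \<noteq> j"
      then show False using lt[of i j] lt[of j i] by (cases "i < j") auto
    qed
    have finI: "finite I" by (simp add: I_def)
    have "0 \<notin> \<mu> ` I" by (force simp: I_def)
    then have "card I * (card I + 1) \<le> 2 * \<Sum>(\<mu> ` I)"
      using sum_distinct_positive_ge[of "\<mu> ` I"] finI card_image[OF inj] by simp
    also have "\<Sum>(\<mu> ` I) = (\<Sum>i\<in>I. \<mu> i)" using inj by (simp add: sum.reindex)
    also have "\<dots> \<le> (\<Sum>i<N. \<mu> i)" by (intro sum_mono2) (auto simp: I_def)
    also have "\<dots> = Suc m" using Suc(2) by simp
    finally have "card I * card I \<le> 2 * Suc m" by (simp add: algebra_simps)
    then have "(real (card I))\<^sup>2 \<le> 2 * real (Suc m)" unfolding power2_eq_square by (metis of_nat_le_iff of_nat_mult of_nat_numeral)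
    then have "real (card I) \<le> sqrt (2 * real (Suc m))" by (rule real_le_rsqrt)
    then show ?thesis unfolding real_sqrt_mult .
  qed
  have Bm0: "0 \<le> Bm" by (simp add: Bm_def)
  have "real (Suc m) * \<bar>detn N M\<bar> = \<bar>b\<bar> * \<bar>\<Sum>k<N. detn N (M' k)\<bar>"
    using arg_cong[OF e1, of abs] by (simp add: abs_mult)
  also have "(\<Sum>k<N. detn N (M' k)) = (\<Sum>k\<in>I. detn N (M' k))"
    using zero by (intro sum.mono_neutral_right) (auto simp: I_def)
  also have "\<bar>b\<bar> * \<bar>\<Sum>k\<in>I. detn N (M' k)\<bar> \<le> \<bar>b\<bar> * (\<Sum>k\<in>I. Bm)"
    using bound by (intro mult_left_mono order_trans[OF sum_abs] sum_mono) auto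
  also have "\<dots> = \<bar>b\<bar> * (real (card I) * Bm)" by simp
  also have "\<dots> \<le> \<bar>b\<bar> * (sqrt 2 * sqrt (real (Suc m)) * Bm)"
    using cardI Bm0 by (intro mult_left_mono mult_right_mono) auto
  finally have "sqrt (real (Suc m)) * (sqrt (real (Suc m)) * \<bar>detn N M\<bar>) \<le> sqrt (real (Suc m)) * (sqrt 2 * \<bar>b\<bar> * Bm)"
    by (simp add: mult_ac)
  then have "sqrt (real (Suc m)) * \<bar>detn N M\<bar> \<le> sqrt 2 * \<bar>b\<bar> * Bm"
    by (rule mult_left_le_imp_le) simp
  then have "\<bar>detn N M\<bar> \<le> sqrt 2 * \<bar>b\<bar> * Bm / sqrt (real (Suc m))"
    by (simp add: pos_le_divide_eq mult.commute del: of_nat_Suc)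
  also have "\<dots> = (sqrt 2 * \<bar>b\<bar>) ^ Suc m / sqrt (fact (Suc m))"
    unfolding Bm_def fact_Suc real_sqrt_mult by (simp add: mult_ac del: of_nat_Suc)
  finally show ?case using Suc(2) by (simp only: M_def[abs_def])
qed

lemma sum_tendsto_infsum:
  fixes f :: "'a \<Rightarrow> real"
  assumes "f summable_on A" "\<And>n. finite (B n)" "\<And>n. B n \<subseteq> A" "\<And>x. x \<in> A \<Longrightarrow> eventually (\<lambda>n. x \<in> B n) F"
  shows "((\<lambda>n. sum f (B n)) \<longlongrightarrow> infsum f A) F"
proof -
  have "(sum f \<longlongrightarrow> infsum f A) (finite_subsets_at_top A)"
    using has_sum_infsum[OF assms(1)] by (simp add: has_sum_def)
  moreover have "filterlim B (finite_subsets_at_top A) F"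
    unfolding filterlim_finite_subsets_at_top
  proof (intro allI impI)
    fix X assume "finite X \<and> X \<subseteq> A"
    then have "eventually (\<lambda>n. \<forall>x\<in>X. x \<in> B n) F" using assms(4) by (intro eventually_ball_finite) auto
    then show "eventually (\<lambda>n. finite (B n) \<and> X \<subseteq> B n \<and> B n \<subseteq> A) F"
      by eventually_elim (use assms in auto)
  qed
  ultimately show ?thesis by (rule filterlim_compose)
qed

section \<open>Gram determinants\<close>

text \<open>The two families of symmetric Laurent polynomials: the basis z^(-i) + z^i for the symplectic case
  (halved at i = 0), and z^(-i) - z^(i+2) for the orthogonal case (os = True).\<close>

definition refl_sign :: "bool \<Rightarrow> nat \<Rightarrow> real" where
  "refl_sign os i = (if os then -1 else if i = 0 then 0 else 1)"

definition refl_shift :: "bool \<Rightarrow> int" where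
  "refl_shift os = (if os then 2 else 0)"

definition bas :: "bool \<Rightarrow> (int \<Rightarrow> real) \<Rightarrow> nat \<Rightarrow> int \<Rightarrow> real" where
  "bas os f i x = f (x + int i) + refl_sign os i * f (x - int i - refl_shift os)"

lemma abs_refl_sign_le: "\<bar>refl_sign os i\<bar> \<le> 1"
  by (simp add: refl_sign_def)

definition pterm :: "bool \<Rightarrow> real \<Rightarrow> real \<Rightarrow> nat list \<Rightarrow> real" where
  "pterm os a b l = detn (length l) (\<lambda>i j. bas os (h_pl a) j (cfg l i)) * schur_pl b l"

text \<open>A zero part adds a row of zeros ending in 1, so any N above the length gives the same
  determinant. All partitions with at most N parts can thus share one matrix size.\<close>

lemma pad_schur:
  assumes "length l \<le> N"
  shows "detn N (\<lambda>i j. h_pl b (cfg l i + int j)) = schur_pl b l"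
  using assms
proof (induction N rule: dec_induct)
  case base
  show ?case unfolding schur_pl_def by (intro detn_cong) (simp add: cfg_def part_def)
next
  case (step N)
  have "detn (Suc N) (\<lambda>i j. h_pl b (cfg l i + int j)) = h_pl b (cfg l N + int N) * detn N (\<lambda>i j. h_pl b (cfg l i + int j))"
    by (rule detn_last_row) (use step in \<open>simp add: cfg_def part_def h_pl_def\<close>)
  also have "h_pl b (cfg l N + int N) = 1" using step by (simp add: cfg_def part_def h_pl_def)
  finally show ?case using step by simp
qed

lemma pad_bas:
  assumes "length l \<le> N"
  shows "detn N (\<lambda>i j. bas os (h_pl a) j (cfg l i)) = detn (length l) (\<lambda>i j. bas os (h_pl a) j (cfg l i))"
  using assms
proof (induction N rule: dec_induct)
  case (step N)
  have "detn (Suc N) (\<lambda>i j. bas os (h_pl a) j (cfg l i)) = bas os (h_pl a) N (cfg l N) * detn N (\<lambda>i j. bas os (h_pl a) j (cfg l i))"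
    by (rule detn_last_row) (use step in \<open>auto simp: bas_def refl_shift_def cfg_def part_def h_pl_def\<close>)
  \<comment> \<open>When N = 0 in the symplectic case both summands of \<open>bas\<close> sit at
    index 0; the vanishing sign there makes the entry 1 rather than 2.\<close>
  also have "bas os (h_pl a) N (cfg l N) = 1"
    using step by (auto simp: bas_def refl_shift_def refl_sign_def cfg_def part_def h_pl_def)
  finally show ?case using step by simp
qed simp

lemma pterm_pad:
  assumes "length l \<le> N"
  shows "detn N (\<lambda>i j. bas os (h_pl a) j (cfg l i)) * detn N (\<lambda>i j. h_pl b (cfg l i + int j)) = pterm os a b l"
  unfolding pterm_def pad_schur[OF assms] pad_bas[OF assms] ..

lemma o_pl_pterm: "o_pl a l * schur_pl b l = pterm True a b l"
  unfolding o_pl_def pterm_def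
  by (intro arg_cong2[of _ _ _ _ "(*)"] refl detn_cong) (simp add: bas_def refl_sign_def refl_shift_def cfg_def part_def algebra_simps)

text \<open>The factor 1/2 in front of the empty determinant makes \<open>sp_pl\<close> equal to 1/2, not 1, at the empty partition.\<close>

lemma sp_pl_pterm: "sp_pl a l * schur_pl b l = pterm False a b l - (if l = [] then 1 / 2 else 0)"
proof (cases "l = []")
  case True
  then show ?thesis by (simp add: sp_pl_def pterm_def schur_pl_def)
next
  case False
  define n where "n = length l"
  define M where "M i j = bas False (h_pl a) j (cfg l i)" for i j
  have n: "0 < n" using False by (simp add: n_def)
  have "detn n (\<lambda>i j. h_pl a (int (l ! i) - int i + int j) + h_pl a (int (l ! i) - int i - int j)) =
     detn n (\<lambda>i j. ((\<lambda>j i. M i j)(0 := (\<lambda>i. 2 * M i 0))) j i)"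
    by (rule detn_cong) (auto simp: M_def bas_def refl_sign_def refl_shift_def cfg_def part_def n_def algebra_simps)
  also have "\<dots> = detn n ((\<lambda>j i. M i j)(0 := (\<lambda>i. 2 * M i 0)))"
    by (rule detn_transpose)
  also have "\<dots> = 2 * detn n ((\<lambda>j i. M i j)(0 := (\<lambda>i. M i 0)))"
    using detn_row_scale[OF n, of "\<lambda>j i. M i j" 2 "\<lambda>i. M i 0"] .
  also have "(\<lambda>j i. M i j)(0 := (\<lambda>i. M i 0)) = (\<lambda>j i. M i j)" by auto
  also have "detn n (\<lambda>j i. M i j) = detn n M" by (rule detn_transpose)
  finally show ?thesis using False by (simp add: sp_pl_def pterm_def n_def M_def[abs_def])
qed

lemma sum_abs_h_pl_le:
  assumes "finite S"
  shows "(\<Sum>k\<in>S. \<bar>h_pl a k\<bar>) \<le> exp \<bar>a\<bar>"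
proof -
  have "(\<Sum>\<^sub>\<infinity>n. \<bar>h_pl a (int n)\<bar>) = exp \<bar>a\<bar>"
  proof -
    have "(\<lambda>n. \<bar>h_pl a (int n)\<bar>) sums exp \<bar>a\<bar>"
      using exp_converges[of "\<bar>a\<bar>"] by (simp add: h_pl_of_nat power_abs divide_inverse mult.commute abs_mult)
    then have "((\<lambda>n. \<bar>h_pl a (int n)\<bar>) has_sum exp \<bar>a\<bar>) UNIV" by (intro sums_nonneg_imp_has_sum) auto
    then show ?thesis by (rule infsumI)
  qed
  then have "infsum (\<lambda>k. \<bar>h_pl a k\<bar>) UNIV = exp \<bar>a\<bar>" by (subst infsum_int_nat(2)) (auto simp: h_pl_def)
  moreover have "(\<Sum>k\<in>S. \<bar>h_pl a k\<bar>) \<le> infsum (\<lambda>k. \<bar>h_pl a k\<bar>) UNIV"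
    using assms h_pl_abs_summable by (intro finite_sum_le_infsum) auto
  ultimately show ?thesis by simp
qed

text \<open>Distinct shifts hit distinct coefficients, so both halves are partial sums of an
  exponential series whatever N is. The reindexing \<open>c\<close> is there for the matrix in which
  the last basis function is replaced by its successor.\<close>

lemma sum_abs_bas_le:
  fixes c :: "nat \<Rightarrow> nat"
  assumes "inj_on c {..<N}"
  shows "(\<Sum>j<N. \<bar>bas os (h_pl a) (c j) x\<bar>) \<le> 2 * exp \<bar>a\<bar>"
proof -
  have "(\<Sum>j<N. \<bar>bas os (h_pl a) (c j) x\<bar>) \<le> (\<Sum>j<N. \<bar>h_pl a (x + int (c j))\<bar> + \<bar>h_pl a (x - int (c j) - refl_shift os)\<bar>)"
  proof (rule sum_mono)
    fix j
    have "\<bar>refl_sign os (c j) * h_pl a (x - int (c j) - refl_shift os)\<bar> \<le> \<bar>h_pl a (x - int (c j) - refl_shift os)\<bar>"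
      unfolding abs_mult using abs_refl_sign_le by (intro mult_left_le_one_le) auto
    then show "\<bar>bas os (h_pl a) (c j) x\<bar> \<le> \<bar>h_pl a (x + int (c j))\<bar> + \<bar>h_pl a (x - int (c j) - refl_shift os)\<bar>"
      unfolding bas_def by linarith
  qed
  also have "\<dots> = (\<Sum>j<N. \<bar>h_pl a (x + int (c j))\<bar>) + (\<Sum>j<N. \<bar>h_pl a (x - int (c j) - refl_shift os)\<bar>)"
    by (rule sum.distrib)
  also have "(\<Sum>j<N. \<bar>h_pl a (x + int (c j))\<bar>) = (\<Sum>k\<in>(\<lambda>j. x + int (c j)) ` {..<N}. \<bar>h_pl a k\<bar>)"
    by (subst sum.reindex) (use assms in \<open>auto simp: inj_on_def\<close>)
  also have "(\<Sum>j<N. \<bar>h_pl a (x - int (c j) - refl_shift os)\<bar>) = (\<Sum>k\<in>(\<lambda>j. x - int (c j) - refl_shift os) ` {..<N}. \<bar>h_pl a k\<bar>)"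
    by (subst sum.reindex) (use assms in \<open>auto simp: inj_on_def\<close>)
  finally show ?thesis
    using sum_abs_h_pl_le[of "(\<lambda>j. x + int (c j)) ` {..<N}" a, OF finite_imageI[OF finite_lessThan]]
      sum_abs_h_pl_le[of "(\<lambda>j. x - int (c j) - refl_shift os) ` {..<N}" a, OF finite_imageI[OF finite_lessThan]]
    by linarith
qed

text \<open>The basis determinant is exponential in the number of parts, which is at most the size;
  the root of the factorial in the Schur bound then wins.\<close>

lemma abs_bas_det_schur_le:
  assumes l: "l \<in> partitions" "length l = N" and c: "inj_on c {..<N}" and ab: "\<bar>a\<bar> \<le> A" "\<bar>b\<bar> \<le> A"
  shows "\<bar>detn N (\<lambda>i j. bas os (h_pl a) (c j) (cfg l i)) * schur_pl b l\<bar> \<le> pweight (2 * exp A * (sqrt 2 * A)) l"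
proof -
  have A: "0 \<le> A" using ab by linarith
  have "\<bar>detn N (\<lambda>i j. bas os (h_pl a) (c j) (cfg l i))\<bar> \<le> (\<Prod>i<N. 2 * exp \<bar>a\<bar>)"
    by (rule order_trans[OF abs_detn_le_prod_row_sums prod_mono]) (use sum_abs_bas_le[OF c] in \<open>auto intro: sum_nonneg\<close>)
  also have "\<dots> \<le> (2 * exp A) ^ N" using ab by (simp add: power_mono)
  also have "\<dots> \<le> (2 * exp A) ^ psize l"
  proof (rule power_increasing)
    show "1 \<le> 2 * exp A" using one_le_exp_iff[of A] A by linarith
  qed (use length_le_psize l in auto)
  finally have 1: "\<bar>detn N (\<lambda>i j. bas os (h_pl a) (c j) (cfg l i))\<bar> \<le> (2 * exp A) ^ psize l" .
  have "\<bar>schur_pl b l\<bar> \<le> (sqrt 2 * \<bar>b\<bar>) ^ psize l / sqrt (fact (psize l))"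
  proof -
    have "\<bar>detn N (\<lambda>i j. h_pl b (int (part l i) - int i + int j))\<bar> \<le> (sqrt 2 * \<bar>b\<bar>) ^ (\<Sum>i<N. part l i) / sqrt (fact (\<Sum>i<N. part l i))"
      by (rule abs_schur_det_le, rule part_antimono[OF l(1)]) (use l in \<open>auto simp: part_def\<close>)
    then show ?thesis using pad_schur[of l N b] l sum_part[of l N] by (simp add: cfg_def)
  qed
  also have "\<dots> \<le> (sqrt 2 * A) ^ psize l / sqrt (fact (psize l))"
    using ab by (intro divide_right_mono power_mono) auto
  finally have 2: "\<bar>schur_pl b l\<bar> \<le> (sqrt 2 * A) ^ psize l / sqrt (fact (psize l))" .
  have "\<bar>detn N (\<lambda>i j. bas os (h_pl a) (c j) (cfg l i)) * schur_pl b l\<bar> \<le> (2 * exp A) ^ psize l * ((sqrt 2 * A) ^ psize l / sqrt (fact (psize l)))"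
    unfolding abs_mult using 1 2 by (intro mult_mono) auto
  then show ?thesis by (simp add: pweight_def power_mult_distrib mult_ac)
qed

lemma abs_pterm_le:
  assumes "l \<in> partitions" "\<bar>a\<bar> \<le> A" "\<bar>b\<bar> \<le> A"
  shows "\<bar>pterm os a b l\<bar> \<le> pweight (2 * exp A * (sqrt 2 * A)) l"
  unfolding pterm_def using abs_bas_det_schur_le[of l "length l" id a A b os] assms by simp

lemma pterm_summable: 
  assumes "S \<subseteq> partitions"
  shows "pterm os a b summable_on S"
proof -
  define A where "A = \<bar>a\<bar> + \<bar>b\<bar>"
  have "pweight (2 * exp A * (sqrt 2 * A)) summable_on S"
    by (rule summable_on_subset_banach[OF pweight_summable assms]) (simp add: A_def)
  then have "(\<lambda>l. \<bar>pterm os a b l\<bar>) summable_on S"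
    by (rule summable_on_comparison_test) (use assms abs_pterm_le[of _ a A b os] in \<open>auto simp: A_def\<close>)
  then show ?thesis
    by (rule summable_on_iff_abs_summable_on_real[THEN iffD2, unfolded real_norm_def])
qed

section \<open>Toeplitz-plus-Hankel Gram matrices of exp (a z + b / z) as sums over
  partitions\<close>

definition Gm :: "bool \<Rightarrow> real \<Rightarrow> real \<Rightarrow> nat \<Rightarrow> nat \<Rightarrow> real" where
  "Gm os a b i j = bas os (W a b) i (- int j)"

lemma bas_conv_summable:
  assumes "absummable f UNIV" "absummable g UNIV"
  shows "(\<lambda>x. bas os f i x * g (k - x)) summable_on UNIV"
proof -
  have s: "(\<lambda>x. f (x + c) * g (k - x)) summable_on UNIV" for c
  proof -
    have "(\<lambda>l. f l * g (k + c - l)) summable_on UNIV"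
      using summable_on_iff_abs_summable_on_real[THEN iffD2, unfolded real_norm_def, OF conv_summable(1)[OF assms]] .
    then have "(\<lambda>x. f (x + c) * g (k + c - (x + c))) summable_on UNIV"
      by (subst summable_on_shift(2)[of "\<lambda>l. f l * g (k + c - l)" c])
    then show ?thesis by simp
  qed
  have "(\<lambda>x. f (x + int i) * g (k - x) + refl_sign os i * (f (x + (- int i - refl_shift os)) * g (k - x))) summable_on UNIV"
    by (intro summable_on_add summable_on_cmult_right s)
  then show ?thesis by (simp add: bas_def algebra_simps)
qed

lemma bas_conv:
  assumes "absummable f UNIV" "absummable g UNIV"
  shows "(\<Sum>\<^sub>\<infinity>x. bas os f i x * g (k - x)) = bas os (conv f g) i k"
proof -
  have s: "(\<lambda>x. f (x + c) * g (k - x)) summable_on UNIV" "(\<Sum>\<^sub>\<infinity>x. f (x + c) * g (k - x)) = conv f g (k + c)" for c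
  proof -
    have "(\<lambda>l. f l * g (k + c - l)) summable_on UNIV"
      using summable_on_iff_abs_summable_on_real[THEN iffD2, unfolded real_norm_def, OF conv_summable(1)[OF assms]] .
    then have "(\<lambda>x. f (x + c) * g (k + c - (x + c))) summable_on UNIV"
      by (subst summable_on_shift(2)[of "\<lambda>l. f l * g (k + c - l)" c])
    then show "(\<lambda>x. f (x + c) * g (k - x)) summable_on UNIV" by simp
    have "(\<Sum>\<^sub>\<infinity>x. f (x + c) * g (k + c - (x + c))) = conv f g (k + c)"
      unfolding conv_def by (rule infsum_shift(2))
    then show "(\<Sum>\<^sub>\<infinity>x. f (x + c) * g (k - x)) = conv f g (k + c)" by simp
  qed
  have "(\<Sum>\<^sub>\<infinity>x. bas os f i x * g (k - x)) = (\<Sum>\<^sub>\<infinity>x. f (x + int i) * g (k - x) + refl_sign os i * (f (x + (- int i - refl_shift os)) * g (k - x)))"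
    by (intro infsum_cong) (simp add: bas_def algebra_simps)
  also have "\<dots> = conv f g (k + int i) + refl_sign os i * conv f g (k + (- int i - refl_shift os))"
    by (subst infsum_add) (auto intro!: summable_on_cmult_right s simp: s infsum_cmult_right')
  finally show ?thesis by (simp add: bas_def algebra_simps)
qed

lemma Gm_eq_infsum:
  "(\<lambda>x. bas os (h_pl a) i x * h_pl b (x + int j)) summable_on UNIV"
  "Gm os a b i j = (\<Sum>\<^sub>\<infinity>x. bas os (h_pl a) i x * h_pl b (x + int j))"
proof -
  note s = h_pl_abs_summable[of a] h_pl_uminus_abs_summable[of b]
  have e: "h_pl b (- (- int j - x)) = h_pl b (x + int j)" for x by (simp add: add.commute)
  show "(\<lambda>x. bas os (h_pl a) i x * h_pl b (x + int j)) summable_on UNIV"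
    using bas_conv_summable[OF s, of os i "- int j"] unfolding e .
  show "Gm os a b i j = (\<Sum>\<^sub>\<infinity>x. bas os (h_pl a) i x * h_pl b (x + int j))"
    using bas_conv[OF s, of os i "- int j"] unfolding e by (simp add: Gm_def W_def)
qed

lemma interval_sum_tendsto:
  fixes f :: "int \<Rightarrow> real"
  assumes "f summable_on UNIV" "\<And>x. x \<le> - int N \<Longrightarrow> f x = 0"
  shows "(\<lambda>n. \<Sum>x\<in>{- int N<..int n}. f x) \<longlonglongrightarrow> infsum f UNIV"
proof -
  have "(\<lambda>n. \<Sum>x\<in>{- int N<..int n}. f x) \<longlonglongrightarrow> infsum f {- int N<..}"
  proof (rule sum_tendsto_infsum)
    fix x :: int assume "x \<in> {- int N<..}"
    then show "eventually (\<lambda>n. x \<in> {- int N<..int n}) sequentially"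
      unfolding eventually_sequentially by (intro exI[of _ "nat x"]) auto
  qed (auto intro: summable_on_subset_banach[OF assms(1)])
  also have "infsum f {- int N<..} = infsum f UNIV" by (rule infsum_cong_neutral) (use assms in auto)
  finally show ?thesis .
qed

lemma finite_bounded_partitions: "finite {l \<in> partitions. length l \<le> N \<and> lam1 l \<le> n}"
proof (rule finite_subset)
  show "{l \<in> partitions. length l \<le> N \<and> lam1 l \<le> n} \<subseteq> {l. set l \<subseteq> {..n} \<and> length l \<le> N}"
  proof clarify
    fix l x assume l: "l \<in> partitions" "length l \<le> N" "lam1 l \<le> n" and "x \<in> set l"
    then obtain i where "i < length l" "x = l ! i" by (auto simp: in_set_conv_nth)
    then show "x \<le> n" using part_le_lam1[OF l(1), of i] l by (simp add: part_def)
  qed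
qed (rule finite_lists_length_le, simp)

lemma detn_eq_infsum_partitions:
  fixes f g :: "nat \<Rightarrow> int \<Rightarrow> real"
  assumes s: "\<And>i j. i < N \<Longrightarrow> j < N \<Longrightarrow> (\<lambda>x. f i x * g j x) summable_on UNIV"
    and z: "\<And>i j x. i < N \<Longrightarrow> j < N \<Longrightarrow> x \<le> - int N \<Longrightarrow> f i x * g j x = 0"
    and t: "(\<lambda>l. detn N (\<lambda>i j. f j (cfg l i)) * detn N (\<lambda>i j. g j (cfg l i))) summable_on {l \<in> partitions. length l \<le> N}"
  shows "detn N (\<lambda>i j. \<Sum>\<^sub>\<infinity>x. f i x * g j x) =
    (\<Sum>\<^sub>\<infinity>l | l \<in> partitions \<and> length l \<le> N. detn N (\<lambda>i j. f j (cfg l i)) * detn N (\<lambda>i j. g j (cfg l i)))"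
proof -
  have "(\<lambda>n. detn N (\<lambda>i j. \<Sum>x\<in>{- int N<..int n}. f i x * g j x)) \<longlonglongrightarrow> detn N (\<lambda>i j. \<Sum>\<^sub>\<infinity>x. f i x * g j x)"
    by (intro tendsto_detn interval_sum_tendsto s z)
  moreover have "(\<lambda>n. \<Sum>l\<in>{l \<in> partitions. length l \<le> N \<and> lam1 l \<le> n}. detn N (\<lambda>i j. f j (cfg l i)) * detn N (\<lambda>i j. g j (cfg l i)))
     \<longlonglongrightarrow> (\<Sum>\<^sub>\<infinity>l | l \<in> partitions \<and> length l \<le> N. detn N (\<lambda>i j. f j (cfg l i)) * detn N (\<lambda>i j. g j (cfg l i)))"
    by (rule sum_tendsto_infsum[OF t]) (use finite_bounded_partitions in \<open>auto simp: eventually_sequentially\<close>)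
  ultimately show ?thesis unfolding cauchy_binet_partitions by (rule LIMSEQ_unique)
qed

text \<open>The upper cutoff in Cauchy-Binet is sent to infinity. No lower cutoff is lost: at points
  up to - N all N functions \<open>h_pl b\<close> vanish, so the finite section sees exactly the
  partitions with at most N parts.\<close>

lemma detn_Gm_eq: "detn N (Gm os a b) = (\<Sum>\<^sub>\<infinity>l | l \<in> partitions \<and> length l \<le> N. pterm os a b l)"
proof -
  have p: "detn N (\<lambda>i j. bas os (h_pl a) j (cfg l i)) * detn N (\<lambda>i j. h_pl b (cfg l i + int j)) = pterm os a b l"
    if "l \<in> {l \<in> partitions. length l \<le> N}" for l using pterm_pad that by simp
  have "detn N (Gm os a b) = detn N (\<lambda>i j. \<Sum>\<^sub>\<infinity>x. bas os (h_pl a) i x * h_pl b (x + int j))"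
    by (intro detn_cong Gm_eq_infsum)
  also have "\<dots> = (\<Sum>\<^sub>\<infinity>l | l \<in> partitions \<and> length l \<le> N. detn N (\<lambda>i j. bas os (h_pl a) j (cfg l i)) * detn N (\<lambda>i j. h_pl b (cfg l i + int j)))"
  proof (rule detn_eq_infsum_partitions[OF Gm_eq_infsum(1)])
    show "(\<lambda>l. detn N (\<lambda>i j. bas os (h_pl a) j (cfg l i)) * detn N (\<lambda>i j. h_pl b (cfg l i + int j))) summable_on {l \<in> partitions. length l \<le> N}"
      using p pterm_summable[of "{l \<in> partitions. length l \<le> N}" os a b] by (subst summable_on_cong[OF p]) auto
  qed (auto simp: h_pl_def)
  also have "\<dots> = (\<Sum>\<^sub>\<infinity>l | l \<in> partitions \<and> length l \<le> N. pterm os a b l)" by (rule infsum_cong) (rule p)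
  finally show ?thesis .
qed

section \<open>The differential equation and the normalisation\<close>

lemma has_field_derivative_h_pl:
  "((\<lambda>a. h_pl a k) has_field_derivative h_pl a (k - 1)) (at a within S)"
proof (cases "k \<le> 0")
  case True
  then have "h_pl a k = (if k = 0 then 1 else 0)" for a by (auto simp: h_pl_def)
  then show ?thesis using True by (simp add: h_pl_def)
next
  case False
  then obtain n where k: "k = int (Suc n)" by (metis gr0_conv_Suc not_le pos_int_cases)
  have "((\<lambda>a. a ^ Suc n / fact (Suc n)) has_field_derivative real (Suc n) * a ^ n / fact (Suc n)) (at a within S)"
    using DERIV_cdivide[OF DERIV_pow[of "Suc n" a S], of "fact (Suc n)"] by (simp del: of_nat_Suc fact_Suc)
  moreover have "real (Suc n) * a ^ n / fact (Suc n) = h_pl a (k - 1)"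
  proof -
    have "real (Suc n) * a ^ n / fact (Suc n) = a ^ n / fact n" unfolding fact_Suc by (simp del: of_nat_Suc)
    moreover have "h_pl a (k - 1) = a ^ n / fact n" using h_pl_of_nat[of a n] k by simp
    ultimately show ?thesis by simp
  qed
  moreover have "(\<lambda>a. a ^ Suc n / fact (Suc n)) = (\<lambda>a. h_pl a k)"
    unfolding k by (simp add: h_pl_def fun_eq_iff del: of_nat_Suc fact_Suc)
  ultimately show ?thesis by simp
qed

lemma abs_h_pl_mono: "\<bar>a\<bar> \<le> A \<Longrightarrow> \<bar>h_pl a k\<bar> \<le> h_pl A k"
  by (auto simp: h_pl_def power_abs intro!: divide_right_mono power_mono)

text \<open>The symbol exp ((a + t) z + t / z) is differentiated to itself times z + 1 / z. Moving
  both parameters together makes this factor symmetric, so that it acts on the basis by a three-term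
  recurrence.\<close>

lemma has_field_derivative_W:
  "((\<lambda>t. W (a + t) t k) has_field_derivative (W (a + t) t (k - 1) + W (a + t) t (k + 1))) (at t)"
proof -
  define f where "f n t = h_pl (a + t) (k + int n) * h_pl t (int n)" for n t
  define f' where "f' n t = h_pl (a + t) (k - 1 + int n) * h_pl t (int n) + h_pl (a + t) (k + int n) * h_pl t (int n - 1)" for n t
  \<comment> \<open>An interval with t in its interior, on which the M-test gives uniform
    convergence of the differentiated series.\<close>
  define R where "R = \<bar>t\<bar> + 1"
  define E where "E = exp (\<bar>a\<bar> + R)"
  define M where "M n = E * (R ^ n / fact n) + E * h_pl R (int n - 1)" for n
  have sumsf: "(\<lambda>n. f n t) sums W (a + t) t k" for t unfolding f_def by (rule W_sums)
  have sumsf': "(\<lambda>n. f' n t) sums (W (a + t) t (k - 1) + W (a + t) t (k + 1))" for t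
  proof -
    have "(\<lambda>n. h_pl (a + t) (k + int (Suc n)) * h_pl t (int (Suc n) - 1)) sums W (a + t) t (k + 1)"
      using W_sums[of "a + t" "k + 1" t] by (simp add: add.assoc)
    then have "(\<lambda>n. h_pl (a + t) (k + int n) * h_pl t (int n - 1)) sums (W (a + t) t (k + 1) + h_pl (a + t) (k + int 0) * h_pl t (int 0 - 1))"
      by (rule sums_Suc)
    then have "(\<lambda>n. h_pl (a + t) (k + int n) * h_pl t (int n - 1)) sums W (a + t) t (k + 1)" by (simp add: h_pl_def)
    from sums_add[OF W_sums[of "a + t" "k - 1" t] this] show ?thesis unfolding f'_def .
  qed
  have S1: "(\<lambda>n. R ^ n / fact n) sums exp R" by (rule exp_sums_div)
  have "summable (\<lambda>n. h_pl R (int n - 1))"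
  proof -
    have "summable (\<lambda>n. h_pl R (int (Suc n) - 1))" using sums_summable[OF S1] by (simp add: h_pl_of_nat)
    then show ?thesis by (subst (asm) summable_Suc_iff)
  qed
  then have "summable M" unfolding M_def using sums_summable[OF S1] by (intro summable_add summable_mult)
  moreover have bd: "norm (f' n s) \<le> M n" if "s \<in> {-R..R}" for n s
  proof -
    have s: "\<bar>s\<bar> \<le> R" using that by auto
    have h: "\<bar>h_pl (a + s) j\<bar> \<le> E" for j
      using abs_h_pl_le[of "a + s" j] s order_trans[of _ "exp \<bar>a + s\<bar>" E] by (auto simp: E_def)
    have "\<bar>h_pl (a + s) (k - 1 + int n) * h_pl s (int n)\<bar> \<le> E * h_pl R (int n)"
      unfolding abs_mult using h abs_h_pl_mono[OF s] by (intro mult_mono) (auto simp: E_def)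
    moreover have "\<bar>h_pl (a + s) (k + int n) * h_pl s (int n - 1)\<bar> \<le> E * h_pl R (int n - 1)"
      unfolding abs_mult using h abs_h_pl_mono[OF s] by (intro mult_mono) (auto simp: E_def)
    ultimately show ?thesis unfolding f'_def M_def h_pl_of_nat[symmetric] real_norm_def
      by (intro order_trans[OF abs_triangle_ineq add_mono])
  qed
  ultimately have uc: "uniformly_convergent_on {-R..R} (\<lambda>n s. \<Sum>i<n. f' i s)"
    using Weierstrass_m_test[of "{-R..R}" f' M] by (auto simp: uniformly_convergent_on_def)
  have "((\<lambda>s. \<Sum>n. f n s) has_field_derivative (\<Sum>n. f' n t)) (at t)"
  proof (rule has_field_derivative_series'(2)[where ?x0.0 = t, OF _ _ uc])
    fix n s
    have d: "((\<lambda>s. h_pl (a + s) j) has_field_derivative h_pl (a + s) (j - 1)) (at s within {-R..R})" for j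
    proof -
      have "((\<lambda>s. a + s) has_field_derivative 1) (at s within {-R..R})" by (auto intro!: derivative_eq_intros)
      from DERIV_chain2[OF has_field_derivative_h_pl this] show ?thesis by simp
    qed
    from DERIV_mult[OF d has_field_derivative_h_pl[of "int n"], of "k + int n"]
    show "(f n has_field_derivative f' n s) (at s within {-R..R})"
      unfolding f_def[abs_def] f'_def by (simp add: algebra_simps)
  qed (use sumsf[of t] in \<open>auto simp: sums_iff R_def\<close>)
  then show ?thesis using sumsf sumsf' by (simp add: sums_iff)
qed

text \<open>Coefficients of the Chebyshev recurrences, of the first kind in the symplectic case and
  of the second kind in the orthogonal case. The value 2 compensates the halved constant function;
  the value 0 at i = 0 holds because there is no earlier basis element.\<close>

definition bas_rec :: "bool \<Rightarrow> nat \<Rightarrow> real" where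
  "bas_rec os i = (if i = 0 then 0 else if \<not> os \<and> i = 1 then 2 else 1)"

lemma bas_three_term:
  "bas os f i (x - 1) + bas os f i (x + 1) = bas os f (Suc i) x + bas_rec os i * bas os f (i - 1) x"
proof (cases i)
  case 0
  then show ?thesis
    by (cases os) (simp_all add: bas_def bas_rec_def refl_sign_def refl_shift_def add.commute)
next
  case (Suc m)
  then show ?thesis
    by (cases os; cases m) (simp_all add: bas_def bas_rec_def refl_sign_def refl_shift_def algebra_simps)
qed

text \<open>The initial value of the differential equation: at b = 0 the matrix is triangular with
  unit diagonal.\<close>

lemma Gm_0_right_det: "detn N (Gm os a 0) = 1"
proof -
  have "detn N (\<lambda>i j. Gm os a 0 j i) = 1"
    by (rule detn_upper_unitriangular)
       (auto simp: Gm_def bas_def W_0_right h_pl_def refl_sign_def refl_shift_def)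
  then show ?thesis using detn_transpose[of N "Gm os a 0"] by simp
qed

text \<open>Differentiating along (a + t, t) multiplies the symbol by z + 1/z, which shifts rows by one;
  all resulting determinants but the last have two equal rows.\<close>

lemma has_field_derivative_detn_Gm:
  "((\<lambda>t. detn (Suc n) (Gm os (a + t) t)) has_field_derivative
     detn (Suc n) ((Gm os (a + t) t)(n := Gm os (a + t) t (Suc n)))) (at t)"
proof -
  define G where "G = Gm os (a + t) t"
  have d: "((\<lambda>t. Gm os (a + t) t i j) has_field_derivative (G (Suc i) j + bas_rec os i * G (i - 1) j)) (at t)" for i j
  proof -
    have "((\<lambda>t. Gm os (a + t) t i j) has_field_derivative
       ((W (a + t) t (- int j + int i - 1) + W (a + t) t (- int j + int i + 1)) +
        refl_sign os i * (W (a + t) t (- int j - int i - refl_shift os - 1) + W (a + t) t (- int j - int i - refl_shift os + 1)))) (at t)"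
      unfolding Gm_def bas_def by (intro DERIV_add DERIV_cmult has_field_derivative_W)
    also have "(W (a + t) t (- int j + int i - 1) + W (a + t) t (- int j + int i + 1)) +
        refl_sign os i * (W (a + t) t (- int j - int i - refl_shift os - 1) + W (a + t) t (- int j - int i - refl_shift os + 1))
      = bas os (W (a + t) t) i (- int j - 1) + bas os (W (a + t) t) i (- int j + 1)"
      by (simp add: bas_def algebra_simps)
    also have "\<dots> = G (Suc i) j + bas_rec os i * G (i - 1) j"
      unfolding bas_three_term G_def Gm_def ..
    finally show ?thesis .
  qed
  have z: "detn (Suc n) (G(k := G m)) = 0" if "k < Suc n" "m < Suc n" "m \<noteq> k" for k m
    using that by (intro detn_identical_rows[of k "Suc n" m]) auto
  have dk: "detn (Suc n) (G(k := (\<lambda>j. G (Suc k) j + bas_rec os k * G (k - 1) j))) = detn (Suc n) (G(k := G (Suc k)))"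
    if k: "k < Suc n" for k
  proof -
    have "G(k := (\<lambda>j. G (Suc k) j + bas_rec os k * G (k - 1) j)) = G(k := (\<lambda>j. bas_rec os k * G (k - 1) j + G (Suc k) j))"
      by (simp add: add.commute)
    then have "detn (Suc n) (G(k := (\<lambda>j. G (Suc k) j + bas_rec os k * G (k - 1) j)))
      = bas_rec os k * detn (Suc n) (G(k := G (k - 1))) + detn (Suc n) (G(k := G (Suc k)))"
      using detn_row_add[OF k, of G "bas_rec os k" "G (k - 1)" "G (Suc k)"] by simp
    moreover have "bas_rec os k * detn (Suc n) (G(k := G (k - 1))) = 0"
      using z[OF k, of "k - 1"] k by (cases "k = 0") (auto simp: bas_rec_def)
    ultimately show ?thesis by simp
  qed
  have "(\<Sum>k<Suc n. detn (Suc n) (G(k := (\<lambda>j. G (Suc k) j + bas_rec os k * G (k - 1) j)))) = (\<Sum>k<Suc n. detn (Suc n) (G(k := G (Suc k))))"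
    by (rule sum.cong[OF refl], rule dk) simp
  also have "\<dots> = detn (Suc n) (G(n := G (Suc n)))"
    using z by simp
  finally show ?thesis
    using has_field_derivative_detn[of "Suc n" "\<lambda>t. Gm os (a + t) t" "\<lambda>i j. G (Suc i) j + bas_rec os i * G (i - 1) j" t] d
    by (simp add: G_def)
qed

definition fiber_weight :: "real \<Rightarrow> nat \<Rightarrow> real" where
  "fiber_weight A N = (\<Sum>\<^sub>\<infinity>l | l \<in> partitions \<and> length l = N. pweight (2 * exp A * (sqrt 2 * A)) l)"

lemma fiber_weight_tendsto: "0 \<le> A \<Longrightarrow> fiber_weight A \<longlonglongrightarrow> 0"
  unfolding fiber_weight_def by (rule pweight_fibers_tendsto_0) simp

lemma abs_infsum_fiber_le:
  assumes A: "0 \<le> A" and le: "\<And>l. l \<in> partitions \<Longrightarrow> length l = N \<Longrightarrow> \<bar>f l\<bar> \<le> pweight (2 * exp A * (sqrt 2 * A)) l"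
  shows "\<bar>\<Sum>\<^sub>\<infinity>l | l \<in> partitions \<and> length l = N. f l\<bar> \<le> fiber_weight A N" "f summable_on {l \<in> partitions. length l = N}"
proof -
  have w: "pweight (2 * exp A * (sqrt 2 * A)) summable_on {l \<in> partitions. length l = N}"
    by (rule summable_on_subset_banach[OF pweight_summable]) (use A in auto)
  have s: "(\<lambda>l. \<bar>f l\<bar>) summable_on {l \<in> partitions. length l = N}"
    by (rule summable_on_comparison_test[OF w]) (use le in auto)
  then show "f summable_on {l \<in> partitions. length l = N}"
    by (rule summable_on_iff_abs_summable_on_real[THEN iffD2, unfolded real_norm_def])
  have "norm (\<Sum>\<^sub>\<infinity>l | l \<in> partitions \<and> length l = N. f l) \<le> (\<Sum>\<^sub>\<infinity>l | l \<in> partitions \<and> length l = N. norm (f l))"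
    by (rule norm_infsum_bound) (use s in simp)
  also have "\<dots> \<le> fiber_weight A N"
    unfolding fiber_weight_def real_norm_def by (rule infsum_mono[OF s w]) (use le in auto)
  finally show "\<bar>\<Sum>\<^sub>\<infinity>l | l \<in> partitions \<and> length l = N. f l\<bar> \<le> fiber_weight A N" by simp
qed

lemma detn_Gm_Suc:
  "detn (Suc n) (Gm os a b) = detn n (Gm os a b) + (\<Sum>\<^sub>\<infinity>l | l \<in> partitions \<and> length l = Suc n. pterm os a b l)"
proof -
  have "{l \<in> partitions. length l \<le> Suc n} = {l \<in> partitions. length l \<le> n} \<union> {l \<in> partitions. length l = Suc n}" by auto
  then show ?thesis unfolding detn_Gm_eq
    by (simp add: infsum_Un_disjoint pterm_summable disjoint_iff)
qed

lemma abs_detn_Gm_diff_le: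
  assumes "\<bar>a\<bar> \<le> A" "\<bar>b\<bar> \<le> A"
  shows "\<bar>detn (Suc n) (Gm os a b) - detn n (Gm os a b)\<bar> \<le> fiber_weight A (Suc n)"
  unfolding detn_Gm_Suc using abs_infsum_fiber_le(1)[of A "Suc n" "pterm os a b"] abs_pterm_le[of _ a A b os] assms
  by auto

lemma infsum_pterm_eq_lim: "(\<lambda>N. detn N (Gm os a b)) \<longlonglongrightarrow> (\<Sum>\<^sub>\<infinity>l\<in>partitions. pterm os a b l)"
proof -
  define T where "T k = (\<Sum>\<^sub>\<infinity>l | l \<in> partitions \<and> length l = k. pterm os a b l)" for k
  have b: "bij_betw snd (SIGMA N:UNIV. {l \<in> partitions. length l = N}) partitions"
    by (rule bij_betw_byWitness[where f' = "\<lambda>l. (length l, l)"]) auto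
  have s: "(\<lambda>x. pterm os a b (snd x)) summable_on (SIGMA N:UNIV. {l \<in> partitions. length l = N})"
    unfolding summable_on_reindex_bij_betw[OF b] by (rule pterm_summable) simp
  then have s': "(\<lambda>(N, l). pterm os a b l) summable_on (SIGMA N:UNIV. {l \<in> partitions. length l = N})"
    by (simp add: case_prod_beta')
  have "T summable_on UNIV"
    using summable_on_Sigma_banach[OF s'] unfolding T_def[abs_def] .
  moreover have "infsum T UNIV = (\<Sum>\<^sub>\<infinity>l\<in>partitions. pterm os a b l)"
    using infsum_Sigma_banach[OF s] infsum_reindex_bij_betw[OF b, of "pterm os a b"] by (simp add: T_def[abs_def])
  ultimately have "T sums (\<Sum>\<^sub>\<infinity>l\<in>partitions. pterm os a b l)"
    by (metis has_sum_imp_sums has_sum_infsum)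
  then have "(\<lambda>N. \<Sum>k<Suc N. T k) \<longlonglongrightarrow> (\<Sum>\<^sub>\<infinity>l\<in>partitions. pterm os a b l)"
    unfolding sums_def by (rule LIMSEQ_Suc)
  moreover have "(\<Sum>k<Suc N. T k) = detn N (Gm os a b)" for N
  proof (induction N)
    case 0
    show ?case unfolding detn_Gm_eq by (simp add: T_def)
  next
    case (Suc N)
    then show ?case by (simp add: detn_Gm_Suc T_def)
  qed
  ultimately show ?thesis by simp
qed

text \<open>This closes the differential equation up to a small error. At the lowest site - n only
  the shifted basis function (value a) and the last dual function (value 1) are nonzero. Splitting
  that site off contributes a times the smaller determinant; what remains uses sites above - n,
  hence only partitions with exactly n + 1 parts.\<close>

lemma detn_Gm_shifted_row:
  assumes "\<bar>a\<bar> \<le> A" "\<bar>b\<bar> \<le> A"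
  shows "\<bar>detn (Suc n) ((Gm os a b)(n := Gm os a b (Suc n))) - a * detn n (Gm os a b)\<bar> \<le> fiber_weight A (Suc n)"
proof -
  define N where "N = Suc n"
  define c where "c = id(n := Suc n)"
  have cinj: "inj_on c {..<N}" by (auto simp: c_def N_def inj_on_def)
  define f where "f i x = (if - int n < x then bas os (h_pl a) (c i) x else 0)" for i x
  define g where "g j x = h_pl b (x + int j)" for j x
  define F where "F i j = (\<Sum>\<^sub>\<infinity>x. f i x * g j x)" for i j
  have z: "f i x * g j x = 0" if "x \<le> - int N" for i j x using that by (simp add: f_def N_def)
  have s0: "(\<lambda>x. bas os (h_pl a) (c i) x * g j x) summable_on UNIV" for i j
    unfolding g_def by (rule Gm_eq_infsum)
  have s: "(\<lambda>x. f i x * g j x) summable_on UNIV" for i j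
  proof -
    have "(\<lambda>x. bas os (h_pl a) (c i) x * g j x) summable_on {x. - int n < x}"
      by (rule summable_on_subset_banach[OF s0]) simp
    also have "?this \<longleftrightarrow> ?thesis" by (rule summable_on_cong_neutral) (auto simp: f_def)
    finally show ?thesis .
  qed
  have entry: "Gm os a b (c i) j = F i j + (if i = n \<and> j = n then a else 0)" if ij: "i < N" "j < N" for i j
  proof -
    have b: "bas os (h_pl a) (c i) (- int n) = (if i = n then a else 0)"
      using ij by (auto simp: bas_def c_def N_def h_pl_def refl_shift_def)
    have gj: "g j (- int n) = (if j = n then 1 else 0)"
      using ij by (auto simp: g_def N_def h_pl_def)
    have "Gm os a b (c i) j = (\<Sum>\<^sub>\<infinity>x. f i x * g j x + (if x = - int n then bas os (h_pl a) (c i) (- int n) * g j (- int n) else 0))"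
      unfolding Gm_eq_infsum(2) 
    proof (rule infsum_cong)
      fix x
      have "g j x = 0" if "x < - int n" using that ij by (simp add: g_def h_pl_def N_def)
      then show "bas os (h_pl a) (c i) x * h_pl b (x + int j) = f i x * g j x + (if x = - int n then bas os (h_pl a) (c i) (- int n) * g j (- int n) else 0)"
        by (cases "x = - int n"; cases "x < - int n") (auto simp: f_def g_def)
    qed
    also have "\<dots> = F i j + (\<Sum>\<^sub>\<infinity>x. if x = - int n then bas os (h_pl a) (c i) (- int n) * g j (- int n) else 0)"
      unfolding F_def
    proof (rule infsum_add[OF s])
      show "(\<lambda>x. if x = - int n then bas os (h_pl a) (c i) (- int n) * g j (- int n) else 0) summable_on UNIV"
        by (rule summable_on_cong_neutral[THEN iffD1, OF _ _ _ summable_on_finite[of "{- int n}"]]) auto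
    qed
    also have "(\<Sum>\<^sub>\<infinity>x. if x = - int n then bas os (h_pl a) (c i) (- int n) * g j (- int n) else 0) = bas os (h_pl a) (c i) (- int n) * g j (- int n)"
    proof -
      have "(\<Sum>\<^sub>\<infinity>x. if x = - int n then bas os (h_pl a) (c i) (- int n) * g j (- int n) else 0) =
         (\<Sum>\<^sub>\<infinity>x\<in>{- int n}. bas os (h_pl a) (c i) (- int n) * g j (- int n))"
        by (rule infsum_cong_neutral) auto
      then show ?thesis by simp
    qed
    finally show ?thesis unfolding b gj by simp
  qed
  have "detn N ((Gm os a b)(n := Gm os a b (Suc n))) = detn N (F(n := (\<lambda>j. a * (if j = n then 1 else 0) + F n j)))"
  proof (rule detn_cong)
    fix i j assume ij: "i < N" "j < N"
    have "((Gm os a b)(n := Gm os a b (Suc n))) i j = Gm os a b (c i) j" by (simp add: c_def)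
    also note entry[OF ij]
    finally show "((Gm os a b)(n := Gm os a b (Suc n))) i j = (F(n := (\<lambda>j. a * (if j = n then 1 else 0) + F n j))) i j"
      by auto
  qed
  also have "\<dots> = a * detn N (F(n := (\<lambda>j. if j = n then 1 else 0))) + detn N F"
    using detn_row_add[of n N F a "\<lambda>j. if j = n then 1 else 0" "F n"] by (simp add: N_def)
  also have "detn N (F(n := (\<lambda>j. if j = n then 1 else 0))) = detn n (Gm os a b)"
  proof -
    have "detn N (F(n := (\<lambda>j. if j = n then 1 else 0))) = detn n (F(n := (\<lambda>j. if j = n then 1 else 0)))"
      unfolding N_def by (subst detn_last_row) auto
    also have "\<dots> = detn n (Gm os a b)"
    proof (rule detn_cong)
      fix i j assume "i < n" "j < n"
      then show "(F(n := (\<lambda>j. if j = n then 1 else 0))) i j = Gm os a b i j"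
        using entry[of i j] by (simp add: c_def N_def)
    qed
    finally show ?thesis .
  qed
  also have "detn N F = (\<Sum>\<^sub>\<infinity>l | l \<in> partitions \<and> length l = N. detn N (\<lambda>i j. bas os (h_pl a) (c j) (cfg l i)) * schur_pl b l)"
  proof -
    define t where "t l = detn N (\<lambda>i j. f j (cfg l i)) * detn N (\<lambda>i j. g j (cfg l i))" for l
    \<comment> \<open>With fewer than N parts the lowest position is - n, where \<open>f\<close> has
      been cut off.\<close>
    have t0: "t l = 0" if "length l < N" for l
    proof -
      have "cfg l n = - int n" using that by (simp add: cfg_def part_def N_def)
      then have "detn N (\<lambda>i j. f j (cfg l i)) = 0 * detn n (\<lambda>i j. f j (cfg l i))"
        unfolding N_def by (subst detn_last_row) (auto simp: f_def)
      then show ?thesis by (simp add: t_def)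
    qed
    have t1: "t l = detn N (\<lambda>i j. bas os (h_pl a) (c j) (cfg l i)) * schur_pl b l" if l: "l \<in> partitions" "length l = N" for l
    proof -
      have "- int n < cfg l i" if "i < N" for i
      proof -
        have "l ! i \<in> set l" using l that by simp
        then have "0 < l ! i" using l by (auto simp: partitions_def is_partition_def)
        then show ?thesis using that l by (simp add: cfg_def part_def N_def)
      qed
      then have "detn N (\<lambda>i j. f j (cfg l i)) = detn N (\<lambda>i j. bas os (h_pl a) (c j) (cfg l i))"
        by (intro detn_cong) (simp add: f_def)
      then show ?thesis using pad_schur[of l N b] l by (simp add: t_def g_def)
    qed
    have le: "\<bar>t l\<bar> \<le> pweight (2 * exp A * (sqrt 2 * A)) l" if "l \<in> partitions" "length l = N" for l
      unfolding t1[OF that] using abs_bas_det_schur_le[OF that cinj assms] .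
    have st: "t summable_on {l \<in> partitions. length l \<le> N}"
    proof -
      have "t summable_on {l \<in> partitions. length l = N}"
        by (rule abs_infsum_fiber_le(2)[of A]) (use le assms in auto)
      also have "?this \<longleftrightarrow> ?thesis" by (rule summable_on_cong_neutral) (use t0 in auto)
      finally show ?thesis .
    qed
    have "detn N F = (\<Sum>\<^sub>\<infinity>l | l \<in> partitions \<and> length l \<le> N. t l)"
      unfolding F_def t_def by (rule detn_eq_infsum_partitions[OF s z st[unfolded t_def]])
    also have "\<dots> = (\<Sum>\<^sub>\<infinity>l | l \<in> partitions \<and> length l = N. t l)"
      by (rule infsum_cong_neutral) (use t0 in auto)
    also have "\<dots> = (\<Sum>\<^sub>\<infinity>l | l \<in> partitions \<and> length l = N. detn N (\<lambda>i j. bas os (h_pl a) (c j) (cfg l i)) * schur_pl b l)"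
      by (rule infsum_cong) (use t1 in auto)
    finally show ?thesis .
  qed
  finally have eq: "detn N ((Gm os a b)(n := Gm os a b (Suc n))) = a * detn n (Gm os a b) +
     (\<Sum>\<^sub>\<infinity>l | l \<in> partitions \<and> length l = N. detn N (\<lambda>i j. bas os (h_pl a) (c j) (cfg l i)) * schur_pl b l)" .
  have "\<bar>\<Sum>\<^sub>\<infinity>l | l \<in> partitions \<and> length l = N. detn N (\<lambda>i j. bas os (h_pl a) (c j) (cfg l i)) * schur_pl b l\<bar> \<le> fiber_weight A N"
  proof (rule abs_infsum_fiber_le(1))
    show "0 \<le> A" using assms by linarith
  qed (rule abs_bas_det_schur_le[OF _ _ cinj assms])
  then show ?thesis using eq unfolding N_def by linarith
qed

text \<open>On the line (a0 + t, t) the determinant starts at 1 and its derivative is a0 + t times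
  itself, up to a multiple of \<open>fiber_weight\<close>. Multiplying by exp (- (a0 t + t^2 / 2))
  removes the main term, and the mean value bound controls the rest. The choice a0 = a - b makes t =
  b the endpoint (a, b).\<close>

theorem detn_Gm_tendsto: "(\<lambda>N. detn N (Gm os a b)) \<longlonglongrightarrow> exp (a * b - b\<^sup>2 / 2)"
proof -
  define a0 where "a0 = a - b"
  define A where "A = \<bar>a0\<bar> + \<bar>b\<bar>"
  define L where "L = exp (\<bar>a0\<bar> * \<bar>b\<bar>)"
  define D where "D n t = detn (Suc n) (Gm os (a0 + t) t)" for n t
  define g where "g n t = D n t * exp (- (a0 * t + t\<^sup>2 / 2))" for n t
  define g' where "g' n t = (detn (Suc n) ((Gm os (a0 + t) t)(n := Gm os (a0 + t) t (Suc n))) - (a0 + t) * D n t) * exp (- (a0 * t + t\<^sup>2 / 2))" for n t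
  define \<epsilon> where "\<epsilon> n = (1 + A) * fiber_weight A (Suc n) * L" for n
  have A0: "0 \<le> A" by (simp add: A_def)
  have fw0: "0 \<le> fiber_weight A n" for n
    unfolding fiber_weight_def by (intro infsum_nonneg pweight_nonneg) (use A0 in auto)
  have dg: "(g n has_field_derivative g' n t) (at t within S)" for n t S
  proof -
    have "((\<lambda>t. exp (- (a0 * t + t\<^sup>2 / 2))) has_field_derivative exp (- (a0 * t + t\<^sup>2 / 2)) * - (a0 + t)) (at t)"
      by (auto intro!: derivative_eq_intros)
    from DERIV_mult[OF has_field_derivative_detn_Gm[of n os a0 t] this]
    have "(g n has_field_derivative g' n t) (at t)"
      unfolding g_def[abs_def] g'_def D_def by (simp add: algebra_simps)
    then show ?thesis by (rule has_field_derivative_at_within)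
  qed
  have bg: "norm (g' n t) \<le> \<epsilon> n" if "t \<in> {- \<bar>b\<bar>..\<bar>b\<bar>}" for n t
  proof -
    have t: "\<bar>t\<bar> \<le> \<bar>b\<bar>" using that by auto
    then have tA: "\<bar>a0 + t\<bar> \<le> A" "\<bar>t\<bar> \<le> A" by (auto simp: A_def)
    have "exp (- (a0 * t + t\<^sup>2 / 2)) \<le> L"
    proof -
      have "- (a0 * t) \<le> \<bar>a0\<bar> * \<bar>t\<bar>" by (metis abs_ge_minus_self abs_mult)
      also have "\<dots> \<le> \<bar>a0\<bar> * \<bar>b\<bar>" using t by (intro mult_left_mono) auto
      finally have "- (a0 * t + t\<^sup>2 / 2) \<le> \<bar>a0\<bar> * \<bar>b\<bar>" using zero_le_power2[of t] by linarith
      then show ?thesis by (simp add: L_def)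
    qed
    moreover have "\<bar>detn (Suc n) ((Gm os (a0 + t) t)(n := Gm os (a0 + t) t (Suc n))) - (a0 + t) * D n t\<bar> \<le> (1 + A) * fiber_weight A (Suc n)"
    proof -
      have 1: "\<bar>detn (Suc n) ((Gm os (a0 + t) t)(n := Gm os (a0 + t) t (Suc n))) - (a0 + t) * detn n (Gm os (a0 + t) t)\<bar> \<le> fiber_weight A (Suc n)"
        by (rule detn_Gm_shifted_row[OF tA])
      have "\<bar>(a0 + t) * (D n t - detn n (Gm os (a0 + t) t))\<bar> \<le> A * fiber_weight A (Suc n)"
        unfolding abs_mult D_def using abs_detn_Gm_diff_le[OF tA] tA A0 by (intro mult_mono) auto
      then have "\<bar>(a0 + t) * D n t - (a0 + t) * detn n (Gm os (a0 + t) t)\<bar> \<le> A * fiber_weight A (Suc n)"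
        by (simp add: right_diff_distrib)
      with 1 show ?thesis by (simp add: algebra_simps)
    qed
    ultimately show ?thesis unfolding g'_def \<epsilon>_def norm_mult using A0 fw0 by (intro mult_mono) auto
  qed
  have "\<bar>g n b - g n 0\<bar> \<le> \<epsilon> n * \<bar>b\<bar>" for n
  proof -
    have "norm (g n b - g n 0) \<le> \<epsilon> n * norm (b - 0)"
      by (rule field_differentiable_bound[of "{- \<bar>b\<bar>..\<bar>b\<bar>}"]) (use dg bg in auto)
    then show ?thesis by simp
  qed
  moreover have "g n 0 = 1" for n by (simp add: g_def D_def Gm_0_right_det)
  ultimately have le: "norm (g n b - 1) \<le> \<epsilon> n * \<bar>b\<bar>" for n by simp
  have "(\<lambda>n. \<epsilon> n * \<bar>b\<bar>) \<longlonglongrightarrow> (1 + A) * 0 * L * \<bar>b\<bar>"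
    unfolding \<epsilon>_def by (intro tendsto_intros LIMSEQ_Suc[OF fiber_weight_tendsto] A0)
  then have "(\<lambda>n. g n b - 1) \<longlonglongrightarrow> 0"
    by (simp add: Lim_null_comparison[OF always_eventually[OF allI[OF le]]])
  from tendsto_mult[OF tendsto_add[OF this tendsto_const[of 1]] tendsto_const[of "exp (a0 * b + b\<^sup>2 / 2)"]]
  have "(\<lambda>n. D n b) \<longlonglongrightarrow> exp (a0 * b + b\<^sup>2 / 2)"
    by (simp add: g_def mult.assoc exp_add[symmetric])
  also have "a0 * b + b\<^sup>2 / 2 = a * b - b\<^sup>2 / 2" by (simp add: a0_def power2_eq_square algebra_simps)
  finally have "(\<lambda>n. detn (Suc n) (Gm os a b)) \<longlonglongrightarrow> exp (a * b - b\<^sup>2 / 2)" by (simp add: D_def a0_def)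
  then show ?thesis by (rule LIMSEQ_imp_Suc)
qed

lemma infsum_pterm: "(\<Sum>\<^sub>\<infinity>l\<in>partitions. pterm os a b l) = exp (a * b - b\<^sup>2 / 2)"
  using LIMSEQ_unique[OF infsum_pterm_eq_lim detn_Gm_tendsto] .

section \<open>The infinite Gram matrix\<close>

lemma geometric_absummable:
  assumes "0 < q" "q < 1"
  shows "absummable (\<lambda>k::nat. q ^ k) UNIV"
proof -
  have "(\<lambda>k. q ^ k) summable_on UNIV"
    by (rule norm_summable_imp_summable_on) (use assms in \<open>simp add: summable_geometric\<close>)
  then show ?thesis using assms by simp
qed

lemma summable_on_of_abs_le:
  fixes f g :: "'a \<Rightarrow> real"
  assumes "g summable_on S" "\<And>x. x \<in> S \<Longrightarrow> \<bar>f x\<bar> \<le> g x"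
  shows "absummable f S" "f summable_on S"
proof -
  show "absummable f S" by (rule summable_on_comparison_test[OF assms(1)]) (use assms(2) in auto)
  then show "f summable_on S"
    by (rule summable_on_iff_abs_summable_on_real[THEN iffD2, unfolded real_norm_def])
qed

lemma abs_infsum_le:
  fixes f g :: "'a \<Rightarrow> real"
  assumes "g summable_on S" "\<And>x. x \<in> S \<Longrightarrow> \<bar>f x\<bar> \<le> g x"
  shows "\<bar>infsum f S\<bar> \<le> infsum g S"
proof -
  have s: "absummable f S" by (rule summable_on_of_abs_le[OF assms])
  have "norm (infsum f S) \<le> (\<Sum>\<^sub>\<infinity>x\<in>S. norm (f x))" by (rule norm_infsum_bound) (use s in simp)
  also have "\<dots> \<le> infsum g S" unfolding real_norm_def by (rule infsum_mono[OF s assms(1)]) (use assms(2) in auto)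
  finally show ?thesis by simp
qed

definition adist :: "int \<Rightarrow> int \<Rightarrow> nat" where
  "adist x y = nat \<bar>x - y\<bar>"

lemma power_le_of_ge: "0 < q \<Longrightarrow> q < 1 \<Longrightarrow> n \<le> m \<Longrightarrow> q ^ m \<le> (q::real) ^ n"
  by (rule power_decreasing) auto

lemma W_decay:
  assumes "0 < q" "q < 1"
  shows "\<exists>C>0. \<forall>k. \<bar>W a b k\<bar> \<le> C * q ^ nat \<bar>k\<bar>"
proof -
  define C1 where "C1 = exp (\<bar>a\<bar> / q + \<bar>b\<bar> * q)"
  define C2 where "C2 = exp (\<bar>a\<bar> / (1 / q) + \<bar>b\<bar> * (1 / q))"
  have "\<bar>W a b k\<bar> \<le> (C1 + C2) * q ^ nat \<bar>k\<bar>" for k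
  proof (cases "0 \<le> k")
    case True
    then have "\<bar>W a b k\<bar> \<le> C1 * q ^ nat \<bar>k\<bar>"
      using W_decay_aux[OF assms(1), of a b k] by (simp add: C1_def power_int_def)
    also have "\<dots> \<le> (C1 + C2) * q ^ nat \<bar>k\<bar>" using assms by (intro mult_right_mono) (auto simp: C2_def)
    finally show ?thesis .
  next
    case False
    have "0 < 1 / q" using assms by simp
    from W_decay_aux[OF this, of a b k] have "\<bar>W a b k\<bar> \<le> C2 * (1 / q) powi k" by (simp only: C2_def)
    also have "(1 / q) powi k = q ^ nat \<bar>k\<bar>" using False assms by (simp add: power_int_def field_simps)
    also have "C2 * q ^ nat \<bar>k\<bar> \<le> (C1 + C2) * q ^ nat \<bar>k\<bar>" using assms by (intro mult_right_mono) (auto simp: C1_def)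
    finally show ?thesis .
  qed
  moreover have "0 < C1 + C2" by (simp add: C1_def C2_def add_pos_pos)
  ultimately show ?thesis by blast
qed

lemma bas_W_decay:
  assumes q: "0 < q" "q < 1"
  shows "\<exists>C>0. \<forall>i x. (0 \<le> x \<longrightarrow> \<bar>bas os (W a b) i x\<bar> \<le> C * q ^ adist (int i) x) \<and>
     (x \<le> 0 \<longrightarrow> \<bar>bas os (W a b) i x\<bar> \<le> C * q ^ adist (int i) (- x))"
proof -
  obtain C where C: "0 < C" "\<And>k. \<bar>W a b k\<bar> \<le> C * q ^ nat \<bar>k\<bar>" using W_decay[OF q] by blast
  \<comment> \<open>The slack of 2 in the exponent absorbs the reflection shift of the orthogonal
    case, at the price of the factor 1 / q^2.\<close>
  have le: "\<bar>bas os (W a b) i x\<bar> \<le> 2 * C / q\<^sup>2 * q ^ e"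
    if e: "e \<le> nat \<bar>x + int i\<bar> + 2" "e \<le> nat \<bar>x - int i - refl_shift os\<bar> + 2" for i x e
  proof -
    have w: "\<bar>W a b k\<bar> \<le> C / q\<^sup>2 * q ^ e" if "e \<le> nat \<bar>k\<bar> + 2" for k
    proof -
      have "q ^ (nat \<bar>k\<bar> + 2) \<le> q ^ e" using q that by (intro power_le_of_ge)
      then have "C * q ^ nat \<bar>k\<bar> \<le> C / q\<^sup>2 * q ^ e"
        using C(1) q by (simp add: power_add field_simps power2_eq_square)
      then show ?thesis using C(2)[of k] by linarith
    qed
    have "\<bar>refl_sign os i * W a b (x - int i - refl_shift os)\<bar> \<le> \<bar>W a b (x - int i - refl_shift os)\<bar>"
      unfolding abs_mult using abs_refl_sign_le by (intro mult_left_le_one_le) auto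
    then show ?thesis unfolding bas_def using w[OF e(1)] w[OF e(2)] by linarith
  qed
  have "adist (int i) x \<le> nat \<bar>x + int i\<bar> + 2" "adist (int i) x \<le> nat \<bar>x - int i - refl_shift os\<bar> + 2" if "0 \<le> x" for i x
    using that by (auto simp: adist_def refl_shift_def)
  moreover have "adist (int i) (- x) \<le> nat \<bar>x + int i\<bar> + 2" "adist (int i) (- x) \<le> nat \<bar>x - int i - refl_shift os\<bar> + 2" if "x \<le> 0" for i x
    using that by (auto simp: adist_def refl_shift_def)
  moreover have "0 < 2 * C / q\<^sup>2" using C q by simp
  ultimately show ?thesis using le by blast
qed

lemma Gm_decay:
  assumes q: "0 < q" "q < 1"
  shows "\<exists>C>0. \<forall>i j. \<bar>Gm os a b i j\<bar> \<le> C * q ^ adist (int i) (int j)"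
proof -
  obtain C where "0 < C" "\<forall>i x. (0 \<le> x \<longrightarrow> \<bar>bas os (W a b) i x\<bar> \<le> C * q ^ adist (int i) x) \<and>
     (x \<le> 0 \<longrightarrow> \<bar>bas os (W a b) i x\<bar> \<le> C * q ^ adist (int i) (- x))" using bas_W_decay[OF q] by blast
  then have "\<bar>Gm os a b i j\<bar> \<le> C * q ^ adist (int i) (int j)" for i j unfolding Gm_def by (metis minus_minus neg_le_0_iff_le of_nat_0_le_iff)
  then show ?thesis using \<open>0 < C\<close> by blast
qed

text \<open>Multiplication by a symmetric symbol maps the span of the basis polynomials to itself.\<close>

lemma infsum_symmetric_product:
  assumes w: "absummable w UNIV" and f: "absummable f UNIV" and sym: "\<And>k. w (- k) = w k"
  shows "(\<lambda>k. bas os w i (- int k) * bas os f k x) summable_on UNIV"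
    "(\<Sum>\<^sub>\<infinity>k. bas os w i (- int k) * bas os f k x) = bas os (conv w f) i x"
proof -
  define c where "c k = bas os w i (- k)" for k :: int
  define H where "H k = c k * f (x + k)" for k
  have HS: "H summable_on UNIV" and Hs: "infsum H UNIV = bas os (conv w f) i x"
  proof -
    have e: "(\<lambda>k. bas os w i k * f (x - k)) = (\<lambda>k. H (0 - k))" by (simp add: H_def c_def)
    show "H summable_on UNIV" using bas_conv_summable[OF w f, of os i x] unfolding e summable_on_shift(1) .
    show "infsum H UNIV = bas os (conv w f) i x" using bas_conv[OF w f, of os i x] unfolding e infsum_shift(1) .
  qed
  have wsym: "w (k + int i + refl_shift os) = w (- k - int i - refl_shift os)" "w (k - int i) = w (int i - k)" for k
    using sym[of "k + int i + refl_shift os"] sym[of "k - int i"] by (simp_all add: algebra_simps)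
  \<comment> \<open>Symmetry of \<open>w\<close> makes the expansion coefficients of w times the
    i-th basis function symmetric or antisymmetric under the same reflection. The negative half of
    the two-sided sum can therefore be folded onto the reflected terms of the basis.\<close>
  have crefl: "refl_sign os k * c (int k) = c (- int k - refl_shift os)" if "os \<or> 0 < k" for k
  proof -
    have "c (- int k - refl_shift os) = w (- int k - int i - refl_shift os) + refl_sign os i * w (int i - int k)"
      unfolding c_def bas_def using wsym[of "int k"] by (simp add: algebra_simps)
    moreover have "c (int k) = w (int i - int k) + refl_sign os i * w (- int k - int i - refl_shift os)"
      unfolding c_def bas_def by (simp add: algebra_simps)
    moreover have "w (- int k) = w (int k)" by (rule sym)
    ultimately show ?thesis using that by (cases "i = 0") (auto simp: refl_sign_def refl_shift_def)
  qed
  \<comment> \<open>The orthogonal reflection k to - k - 2 fixes - 1, a site that no reflected term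
    reaches; antisymmetry makes its coefficient vanish.\<close>
  have cm1: "c (- 1) = 0" if os
    using that sym[of "1 + int i"] sym[of "- 1 - int i"] by (simp add: c_def bas_def refl_sign_def refl_shift_def algebra_simps)
  have c0: "refl_sign os k = 0" if "\<not> (os \<or> 0 < k)" for k using that by (simp add: refl_sign_def)
  have pos: "bij_betw int UNIV {0..}" by (rule bij_betw_byWitness[where f' = nat]) auto
  have neg: "bij_betw (\<lambda>k. - int k - refl_shift os) {k. os \<or> 0 < k} ({..<0} - (if os then {- 1} else {}))"
    by (rule bij_betw_byWitness[where f' = "\<lambda>m. nat (- m - refl_shift os)"]) (auto simp: refl_shift_def)
  have P: "(\<lambda>k. H (int k)) summable_on UNIV" "(\<Sum>\<^sub>\<infinity>k. H (int k)) = infsum H {0..}"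
  proof -
    show "(\<lambda>k. H (int k)) summable_on UNIV"
      unfolding summable_on_reindex_bij_betw[OF pos] by (rule summable_on_subset_banach[OF HS]) simp
    show "(\<Sum>\<^sub>\<infinity>k. H (int k)) = infsum H {0..}" by (rule infsum_reindex_bij_betw[OF pos])
  qed
  define R where "R k = refl_sign os k * c (int k) * f (x - int k - refl_shift os)" for k
  have R: "R k = H (- int k - refl_shift os)" if "os \<or> 0 < k" for k
    using crefl[OF that] by (simp add: R_def H_def algebra_simps)
  have R0: "R k = 0" if "\<not> (os \<or> 0 < k)" for k using c0[OF that] by (simp add: R_def)
  have Q: "R summable_on UNIV" "infsum R UNIV = infsum H {..<0}"
  proof -
    have s: "H summable_on ({..<0} - (if os then {- 1} else {}))" by (rule summable_on_subset_banach[OF HS]) simp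
    have "R summable_on UNIV \<longleftrightarrow> (\<lambda>k. H (- int k - refl_shift os)) summable_on {k. os \<or> 0 < k}"
      by (rule summable_on_cong_neutral) (use R R0 in auto)
    then show "R summable_on UNIV" using s unfolding summable_on_reindex_bij_betw[OF neg] by simp
    have "infsum R UNIV = (\<Sum>\<^sub>\<infinity>k\<in>{k. os \<or> 0 < k}. H (- int k - refl_shift os))"
      by (rule infsum_cong_neutral) (use R R0 in auto)
    also have "\<dots> = infsum H ({..<0} - (if os then {- 1} else {}))" by (rule infsum_reindex_bij_betw[OF neg])
    also have "\<dots> = infsum H {..<0}"
      by (rule infsum_cong_neutral) (use cm1 in \<open>auto simp: H_def split: if_splits\<close>)
    finally show "infsum R UNIV = infsum H {..<0}" .
  qed
  have e: "bas os w i (- int k) * bas os f k x = H (int k) + R k" for k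
    by (simp add: H_def R_def c_def[symmetric] bas_def[of os f] algebra_simps)
  show "(\<lambda>k. bas os w i (- int k) * bas os f k x) summable_on UNIV"
    unfolding e by (intro summable_on_add P Q)
  have "(\<Sum>\<^sub>\<infinity>k. bas os w i (- int k) * bas os f k x) = infsum H {0..} + infsum H {..<0}"
    unfolding e by (simp add: infsum_add P Q)
  also have "\<dots> = infsum H ({0..} \<union> {..<0})"
    by (rule infsum_Un_disjoint[symmetric]) (auto intro: summable_on_subset_banach[OF HS])
  also have "{0..} \<union> {..<0} = (UNIV :: int set)" by auto
  finally show "(\<Sum>\<^sub>\<infinity>k. bas os w i (- int k) * bas os f k x) = bas os (conv w f) i x" using Hs by simp
qed

lemma W_symmetric: "W c c (- k) = W c c k"
  by (rule W_uminus)

lemma Gm_symmetric_product: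
  "(\<Sum>\<^sub>\<infinity>k. Gm os c c i k * bas os (W a b) k x) = bas os (W (c + a) (c + b)) i x"
  unfolding Gm_def using infsum_symmetric_product(2)[OF W_abs_summable W_abs_summable W_symmetric, of os c i a b x]
  by (simp add: conv_W)

lemma Gm_lower: "Gm os c 0 k j = h_pl c (int k - int j)"
  by (auto simp: Gm_def bas_def W_0_right refl_sign_def refl_shift_def h_pl_def)

text \<open>Truncating the intermediate index to nonnegative values normally spoils products of
  Toeplitz type. Here the right factor is lower triangular and vanishes for negative k, so the
  half-line sum is a full convolution.\<close>

lemma Gm_mult_lower: "(\<Sum>\<^sub>\<infinity>k. Gm os a b i k * Gm os c 0 k j) = Gm os (a + c) b i j"
proof -
  have "(\<Sum>\<^sub>\<infinity>k. Gm os a b i k * Gm os c 0 k j) = (\<Sum>\<^sub>\<infinity>k::int. bas os (W a b) i (- k) * h_pl c (k - int j))"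
    unfolding Gm_lower by (subst infsum_int_nat(2)) (auto simp: Gm_def h_pl_def)
  also have "\<dots> = (\<Sum>\<^sub>\<infinity>x. bas os (W a b) i x * h_pl c (- int j - x))"
    using infsum_shift(1)[of "\<lambda>k. bas os (W a b) i k * h_pl c (- int j - k)" 0] by (simp add: algebra_simps)
  also have "\<dots> = bas os (conv (W a b) (W c 0)) i (- int j)"
    using bas_conv[OF W_abs_summable[of a b] h_pl_abs_summable[of c], of os i "- int j"] by (simp add: W_0_right)
  finally show ?thesis by (simp add: conv_W Gm_def)
qed

lemma h_pl_mult_lower: "(\<Sum>\<^sub>\<infinity>k. h_pl b (y + int k) * Gm os c 0 k j) = W b c (y + int j)"
proof -
  have "(\<Sum>\<^sub>\<infinity>k. h_pl b (y + int k) * Gm os c 0 k j) = (\<Sum>\<^sub>\<infinity>k::int. h_pl b (y + k) * h_pl c (k - int j))"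
    by (subst infsum_int_nat(2)) (auto simp: Gm_lower h_pl_def)
  also have "\<dots> = (\<Sum>\<^sub>\<infinity>l. h_pl b l * h_pl c (l - (y + int j)))"
    using infsum_shift(2)[of "\<lambda>l. h_pl b l * h_pl c (l - (y + int j))" y] by (simp add: algebra_simps)
  finally show ?thesis by (simp add: W_def conv_def)
qed

lemma Gm_0_0: "Gm os 0 0 i j = (if i = j then 1 else 0)"
  by (auto simp: Gm_lower h_pl_def)

text \<open>The inverse of the infinite Gram matrix \<open>Gm os (2 \<theta>) \<theta>\<close>, from its factorisation into a symmetric and a triangular part.\<close>

definition Gm_inv :: "bool \<Rightarrow> real \<Rightarrow> nat \<Rightarrow> nat \<Rightarrow> real" where
  "Gm_inv os \<theta> k j = (\<Sum>\<^sub>\<infinity>m. Gm os (- \<theta>) 0 k m * Gm os (- \<theta>) (- \<theta>) m j)"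

lemma adist_triangle: "adist x z \<le> adist x y + adist y z"
  by (simp add: adist_def)

lemma adist_commute: "adist x y = adist y x"
  by (simp add: adist_def abs_minus_commute)

lemma summable_adist:
  fixes q :: real
  assumes "0 < q" "q < 1"
  shows "(\<lambda>m. q ^ adist k (int m)) summable_on UNIV" "(\<Sum>\<^sub>\<infinity>m. q ^ adist k (int m)) \<le> 2 / (1 - q)"
proof -
  have g: "((\<lambda>n. q ^ n) has_sum (1 / (1 - q))) (UNIV :: nat set)"
    by (rule sums_nonneg_imp_has_sum) (use assms geometric_sums[of q] in auto)
  have gs: "(\<lambda>n. q ^ n) summable_on (UNIV :: nat set)" "(\<Sum>\<^sub>\<infinity>n::nat. q ^ n) = 1 / (1 - q)"
    using g by (auto simp: has_sum_imp_summable infsumI)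
  have fin: "(\<Sum>m\<in>F. q ^ adist k (int m)) \<le> 2 / (1 - q)" if F: "finite F" for F :: "nat set"
  proof -
    let ?A = "{m\<in>F. k \<le> int m}" and ?B = "{m\<in>F. int m < k}"
    have "(\<Sum>m\<in>F. q ^ adist k (int m)) = (\<Sum>m\<in>?A \<union> ?B. q ^ adist k (int m))" by (rule sum.cong) auto
    also have "\<dots> = (\<Sum>m\<in>?A. q ^ adist k (int m)) + (\<Sum>m\<in>?B. q ^ adist k (int m))"
      by (rule sum.union_disjoint) (use F in auto)
    also have "(\<Sum>m\<in>?A. q ^ adist k (int m)) = (\<Sum>n\<in>(\<lambda>m. adist k (int m)) ` ?A. q ^ n)"
      by (subst sum.reindex) (auto simp: inj_on_def adist_def)
    also have "\<dots> \<le> 1 / (1 - q)"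
      using finite_sum_le_infsum[OF gs(1), of "(\<lambda>m. adist k (int m)) ` ?A"] F assms gs(2) by auto
    also have "(\<Sum>m\<in>?B. q ^ adist k (int m)) = (\<Sum>n\<in>(\<lambda>m. adist k (int m)) ` ?B. q ^ n)"
      by (subst sum.reindex) (auto simp: inj_on_def adist_def)
    also have "\<dots> \<le> 1 / (1 - q)"
      using finite_sum_le_infsum[OF gs(1), of "(\<lambda>m. adist k (int m)) ` ?B"] F assms gs(2) by auto
    finally show ?thesis by simp
  qed
  show s: "(\<lambda>m. q ^ adist k (int m)) summable_on UNIV"
    by (rule nonneg_bdd_above_summable_on) (use assms fin in \<open>auto intro!: bdd_aboveI2\<close>)
  show "(\<Sum>\<^sub>\<infinity>m. q ^ adist k (int m)) \<le> 2 / (1 - q)"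
    by (rule infsum_le_finite_sums[OF s]) (use fin in auto)
qed

lemma prod_geom_bound:
  fixes q :: real
  assumes "0 < q" "q < 1" "n \<le> m" "\<bar>x\<bar> \<le> C * q ^ m" "0 \<le> C"
  shows "\<bar>x\<bar> \<le> C * q ^ n"
  using assms power_le_of_ge[OF assms(1-3)] mult_left_mono[of "q ^ m" "q ^ n" C] by linarith

text \<open>The left factor is lower triangular, hence row k only involves m up to k. So the N by N
  section of the inverse is exactly the product of the sections of its factors, and its determinant
  is that of the symmetric factor.\<close>

lemma Gm_inv_eq_sum:
  assumes "k < N"
  shows "Gm_inv os \<theta> k j = (\<Sum>m<N. Gm os (- \<theta>) 0 k m * Gm os (- \<theta>) (- \<theta>) m j)"
proof -
  have "Gm_inv os \<theta> k j = (\<Sum>\<^sub>\<infinity>m\<in>{..<N}. Gm os (- \<theta>) 0 k m * Gm os (- \<theta>) (- \<theta>) m j)"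
    unfolding Gm_inv_def by (rule infsum_cong_neutral) (use assms in \<open>auto simp: Gm_lower h_pl_def\<close>)
  then show ?thesis by simp
qed

lemma Gm_inv_decay:
  assumes q: "0 < q" "q < 1"
  shows "\<exists>C>0. \<forall>k j. \<bar>Gm_inv os \<theta> k j\<bar> \<le> C * q ^ adist (int k) (int j)"
proof -
  \<comment> \<open>The rate is doubled beforehand: one half pays for the distance from k to j
    through the triangle inequality, the other makes the sum over m converge.\<close>
  have q2: "0 < q\<^sup>2" "q\<^sup>2 < 1" using q by (auto simp: power_less_one_iff abs_square_less_1)
  obtain C1 where C1: "0 < C1" "\<And>i j. \<bar>Gm os (- \<theta>) 0 i j\<bar> \<le> C1 * (q\<^sup>2) ^ adist (int i) (int j)" using Gm_decay[OF q2] by blast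
  obtain C2 where C2: "0 < C2" "\<And>i j. \<bar>Gm os (- \<theta>) (- \<theta>) i j\<bar> \<le> C2 * (q\<^sup>2) ^ adist (int i) (int j)" using Gm_decay[OF q2] by blast
  have "\<bar>Gm_inv os \<theta> k j\<bar> \<le> C1 * C2 * (2 / (1 - q)) * q ^ adist (int k) (int j)" for k j
  proof -
    have "\<bar>Gm_inv os \<theta> k j\<bar> \<le> (\<Sum>\<^sub>\<infinity>m. C1 * C2 * q ^ adist (int k) (int j) * q ^ adist (int k) (int m))"
      unfolding Gm_inv_def
    proof (rule abs_infsum_le)
      show "(\<lambda>m. C1 * C2 * q ^ adist (int k) (int j) * q ^ adist (int k) (int m)) summable_on UNIV"
        by (intro summable_on_cmult_right summable_adist q)
      fix m
      have "\<bar>Gm os (- \<theta>) 0 k m * Gm os (- \<theta>) (- \<theta>) m j\<bar> \<le> (C1 * (q\<^sup>2) ^ adist (int k) (int m)) * (C2 * (q\<^sup>2) ^ adist (int m) (int j))"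
        unfolding abs_mult using C1 C2 q by (intro mult_mono) auto
      also have "\<dots> = C1 * C2 * q ^ (2 * adist (int k) (int m) + 2 * adist (int m) (int j))"
        by (simp add: power_add power_mult)
      also have "\<dots> \<le> C1 * C2 * q ^ (adist (int k) (int j) + adist (int k) (int m))"
        using C1 C2 q adist_triangle[of "int k" "int j" "int m"] by (intro mult_left_mono power_le_of_ge) auto
      finally show "\<bar>Gm os (- \<theta>) 0 k m * Gm os (- \<theta>) (- \<theta>) m j\<bar> \<le> C1 * C2 * q ^ adist (int k) (int j) * q ^ adist (int k) (int m)"
        by (simp add: power_add mult_ac)
    qed
    also have "\<dots> = C1 * C2 * q ^ adist (int k) (int j) * (\<Sum>\<^sub>\<infinity>m. q ^ adist (int k) (int m))"
      by (rule infsum_cmult_right')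
    also have "\<dots> \<le> C1 * C2 * q ^ adist (int k) (int j) * (2 / (1 - q))"
      using C1 C2 q summable_adist[OF q] by (intro mult_left_mono) auto
    finally show ?thesis by (simp add: mult_ac)
  qed
  moreover have "0 < C1 * C2 * (2 / (1 - q))" using C1 C2 q by simp
  ultimately show ?thesis by blast
qed

text \<open>Geometric decay justifies reassociating the infinite product. The triangular factor is
  absorbed first, turning the parameters (2 \<theta>, \<theta>) into the symmetric (\<theta>,
  \<theta>), which the second factor then cancels.\<close>

lemma Gm_inv_right:
  "(\<Sum>\<^sub>\<infinity>k. Gm os (2 * \<theta>) \<theta> i k * Gm_inv os \<theta> k j) = (if i = j then 1 else 0)"
proof -
  have q: "0 < (1/2::real)" "(1/2::real) < 1" by auto
  obtain C0 where C0: "0 < C0" "\<And>i j. \<bar>Gm os (2 * \<theta>) \<theta> i j\<bar> \<le> C0 * (1/2) ^ adist (int i) (int j)" using Gm_decay[OF q] by blast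
  obtain C1 where C1: "0 < C1" "\<And>i j. \<bar>Gm os (- \<theta>) 0 i j\<bar> \<le> C1 * (1/2) ^ adist (int i) (int j)" using Gm_decay[OF q] by blast
  obtain C2 where C2: "0 < C2" "\<And>i j. \<bar>Gm os (- \<theta>) (- \<theta>) i j\<bar> \<le> C2 * (1/2) ^ adist (int i) (int j)" using Gm_decay[OF q] by blast
  define T where "T k m = Gm os (2 * \<theta>) \<theta> i k * Gm os (- \<theta>) 0 k m * Gm os (- \<theta>) (- \<theta>) m j" for k m
  have a: "absummable (\<lambda>k. (1/2::real) ^ adist (int c) (int k)) UNIV" for c
    using summable_adist(1)[OF q, of "int c"] by simp
  have S: "(\<lambda>(k, m). T k m) summable_on UNIV \<times> UNIV"
  proof (rule summable_on_of_abs_le(2))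
    show "(\<lambda>x. C0 * C1 * C2 * \<bar>case x of (k, m) \<Rightarrow> (1/2) ^ adist (int i) (int k) * (1/2) ^ adist (int j) (int m)\<bar>) summable_on UNIV \<times> UNIV"
      using summable_on_cmult_right[OF absummable_prod[OF a[of i] a[of j]], of "C0 * C1 * C2"] by simp
    fix x :: "nat \<times> nat"
    obtain k m where x: "x = (k, m)" by (cases x)
    have "\<bar>T k m\<bar> \<le> (C0 * (1/2) ^ adist (int i) (int k)) * (C1 * 1) * (C2 * (1/2) ^ adist (int m) (int j))"
    proof -
      have "\<bar>Gm os (- \<theta>) 0 k m\<bar> \<le> C1 * 1"
        by (rule order_trans[OF C1(2) mult_left_mono]) (use C1 in \<open>auto simp: power_le_one\<close>)
      then show ?thesis unfolding T_def abs_mult using C0 C1 C2 by (intro mult_mono) auto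
    qed
    then show "\<bar>case x of (k, m) \<Rightarrow> T k m\<bar> \<le> C0 * C1 * C2 * \<bar>case x of (k, m) \<Rightarrow> (1/2) ^ adist (int i) (int k) * (1/2) ^ adist (int j) (int m)\<bar>"
      unfolding x by (simp add: adist_commute[of "int m"] mult_ac)
  qed
  have "(\<Sum>\<^sub>\<infinity>k. Gm os (2 * \<theta>) \<theta> i k * Gm_inv os \<theta> k j) = (\<Sum>\<^sub>\<infinity>k. \<Sum>\<^sub>\<infinity>m. T k m)"
    unfolding Gm_inv_def T_def by (simp add: infsum_cmult_right' mult.assoc)
  also have "\<dots> = (\<Sum>\<^sub>\<infinity>m. \<Sum>\<^sub>\<infinity>k. T k m)" by (rule infsum_swap_banach[OF S])
  also have "\<dots> = (\<Sum>\<^sub>\<infinity>m. (\<Sum>\<^sub>\<infinity>k. Gm os (2 * \<theta>) \<theta> i k * Gm os (- \<theta>) 0 k m) * Gm os (- \<theta>) (- \<theta>) m j)"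
    unfolding T_def by (simp add: infsum_cmult_left')
  also have "\<dots> = (\<Sum>\<^sub>\<infinity>m. Gm os \<theta> \<theta> i m * bas os (W (- \<theta>) (- \<theta>)) m (- int j))"
    unfolding Gm_mult_lower by (simp add: Gm_def)
  also have "\<dots> = Gm os 0 0 i j" unfolding Gm_symmetric_product by (simp add: Gm_def)
  finally show ?thesis by (simp add: Gm_0_0)
qed

lemma detn_Gm_inv: "detn N (Gm_inv os \<theta>) = detn N (Gm os (- \<theta>) (- \<theta>))"
proof -
  have "detn N (Gm_inv os \<theta>) = detn N (\<lambda>k j. \<Sum>m<N. Gm os (- \<theta>) 0 k m * Gm os (- \<theta>) (- \<theta>) m j)"
    by (intro detn_cong Gm_inv_eq_sum)
  then show ?thesis by (simp add: detn_mult Gm_0_right_det)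
qed

section \<open>The tail beyond the cutoff, and finite sections\<close>

definition tail_gram :: "bool \<Rightarrow> real \<Rightarrow> nat \<Rightarrow> nat \<Rightarrow> nat \<Rightarrow> real" where
  "tail_gram os \<theta> n i j = (\<Sum>\<^sub>\<infinity>x\<in>{int n<..}. bas os (h_pl (2 * \<theta>)) i x * h_pl \<theta> (x + int j))"

text \<open>Multiplying the Gram section without its tail by the section of \<open>Gm_inv\<close>
  gives identity minus truncation defect minus this matrix.\<close>

definition tail_mat :: "bool \<Rightarrow> real \<Rightarrow> nat \<Rightarrow> nat \<Rightarrow> nat \<Rightarrow> nat \<Rightarrow> real" where
  "tail_mat os \<theta> n N i j = (\<Sum>k<N. tail_gram os \<theta> n i k * Gm_inv os \<theta> k j)"

lemma h_pl_decay_nat: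
  assumes "0 < q"
  shows "\<exists>C>0. \<forall>x j. 0 \<le> x \<longrightarrow> \<bar>h_pl b (x + int j)\<bar> \<le> C * q ^ (nat x + j)"
proof -
  have "\<bar>h_pl b (x + int j)\<bar> \<le> exp (\<bar>b\<bar> / q) * q ^ (nat x + j)" if "0 \<le> x" for x j
    using h_pl_decay[OF assms, of b "x + int j"] that by (simp add: power_int_def nat_add_distrib)
  then show ?thesis by (intro exI[of _ "exp (\<bar>b\<bar> / q)"]) simp
qed

lemma summable_int_tail:
  fixes q :: real
  assumes "0 < q" "q < 1"
  shows "(\<lambda>x. q ^ nat x) summable_on {int n<..}"
proof -
  have b: "bij_betw int {n<..} {int n<..}" by (rule bij_betw_byWitness[where f' = nat]) auto
  have "(\<lambda>k. q ^ k) summable_on {n<..}"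
    by (rule summable_on_subset_banach[of _ UNIV]) (use geometric_absummable[OF assms] assms in auto)
  then show ?thesis using summable_on_reindex_bij_betw[OF b, of "\<lambda>x. q ^ nat x"] by simp
qed

lemma tail_gram_decay:
  assumes q: "0 < q" "q < 1"
  shows "\<exists>C>0. \<forall>i j. \<bar>tail_gram os \<theta> n i j\<bar> \<le> C * q ^ (i + j)"
proof -
  have q2: "0 < q\<^sup>2" "q\<^sup>2 < 1" using q by (auto simp: power_less_one_iff abs_square_less_1)
  obtain C1 where C1: "0 < C1" "\<And>i x. 0 \<le> x \<Longrightarrow> \<bar>bas os (h_pl (2 * \<theta>)) i x\<bar> \<le> C1 * (q\<^sup>2) ^ adist (int i) x"
    using bas_W_decay[OF q2, of os "2 * \<theta>" 0] unfolding W_0_right by blast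
  obtain C2 where C2: "0 < C2" "\<And>x j. 0 \<le> x \<Longrightarrow> \<bar>h_pl \<theta> (x + int j)\<bar> \<le> C2 * (q\<^sup>2) ^ (nat x + j)"
    using h_pl_decay_nat[OF q2(1)] by blast
  define S where "S = (\<Sum>\<^sub>\<infinity>x\<in>{int n<..}. q ^ nat x)"
  have "\<bar>tail_gram os \<theta> n i j\<bar> \<le> C1 * C2 * (S + 1) * q ^ (i + j)" for i j
  proof -
    have "\<bar>tail_gram os \<theta> n i j\<bar> \<le> (\<Sum>\<^sub>\<infinity>x\<in>{int n<..}. C1 * C2 * q ^ (i + j) * q ^ nat x)"
      unfolding tail_gram_def
    proof (rule abs_infsum_le)
      show "(\<lambda>x. C1 * C2 * q ^ (i + j) * q ^ nat x) summable_on {int n<..}"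
        by (intro summable_on_cmult_right summable_int_tail q)
      fix x assume "x \<in> {int n<..}"
      then have x: "0 \<le> x" by auto
      have "\<bar>bas os (h_pl (2 * \<theta>)) i x * h_pl \<theta> (x + int j)\<bar> \<le> (C1 * (q\<^sup>2) ^ adist (int i) x) * (C2 * (q\<^sup>2) ^ (nat x + j))"
        unfolding abs_mult using C1 C2 x by (intro mult_mono) auto
      also have "\<dots> = C1 * C2 * q ^ (2 * adist (int i) x + 2 * (nat x + j))"
        unfolding power_mult[symmetric] by (simp add: power_add mult_ac)
      also have "\<dots> \<le> C1 * C2 * q ^ (i + j + nat x)"
      proof -
        have "i \<le> adist (int i) x + nat x" using x by (simp add: adist_def)
        then show ?thesis using C1 C2 q by (intro mult_left_mono power_le_of_ge) auto
      qed
      finally show "\<bar>bas os (h_pl (2 * \<theta>)) i x * h_pl \<theta> (x + int j)\<bar> \<le> C1 * C2 * q ^ (i + j) * q ^ nat x"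
        by (simp add: power_add mult_ac)
    qed
    also have "\<dots> = C1 * C2 * q ^ (i + j) * S" unfolding S_def by (rule infsum_cmult_right')
    also have "\<dots> \<le> C1 * C2 * q ^ (i + j) * (S + 1)" using C1 C2 q by (intro mult_left_mono) auto
    finally show ?thesis by (simp add: mult_ac)
  qed
  moreover have "0 \<le> S" unfolding S_def using q by (intro infsum_nonneg) auto
  then have "0 < C1 * C2 * (S + 1)" using C1 C2 by simp
  ultimately show ?thesis by blast
qed

text \<open>The tail lives near the corner (0, 0), and the inverse transports weight from column k
  to column j only at a cost exponential in their distance. The bound does not depend on N.\<close>

lemma tail_mat_decay:
  assumes q: "0 < q" "q < 1"
  shows "\<exists>C>0. \<forall>N i j. \<bar>tail_mat os \<theta> n N i j\<bar> \<le> C * q ^ (i + j)"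
proof -
  have q2: "0 < q\<^sup>2" "q\<^sup>2 < 1" using q by (auto simp: power_less_one_iff abs_square_less_1)
  obtain C1 where C1: "0 < C1" "\<And>i j. \<bar>tail_gram os \<theta> n i j\<bar> \<le> C1 * (q\<^sup>2) ^ (i + j)"
    using tail_gram_decay[OF q2] by blast
  obtain C2 where C2: "0 < C2" "\<And>i j. \<bar>Gm_inv os \<theta> i j\<bar> \<le> C2 * (q\<^sup>2) ^ adist (int i) (int j)"
    using Gm_inv_decay[OF q2] by blast
  have "\<bar>tail_mat os \<theta> n N i j\<bar> \<le> C1 * C2 * (1 / (1 - q)) * q ^ (i + j)" for N i j
  proof -
    have "\<bar>tail_mat os \<theta> n N i j\<bar> \<le> (\<Sum>k<N. C1 * C2 * q ^ (i + j) * q ^ k)"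
      unfolding tail_mat_def
    proof (rule order_trans[OF sum_abs sum_mono])
      fix k
      have "\<bar>tail_gram os \<theta> n i k * Gm_inv os \<theta> k j\<bar> \<le> (C1 * (q\<^sup>2) ^ (i + k)) * (C2 * (q\<^sup>2) ^ adist (int k) (int j))"
        unfolding abs_mult using C1 C2 by (intro mult_mono) auto
      also have "\<dots> = C1 * C2 * q ^ (2 * (i + k) + 2 * adist (int k) (int j))"
        unfolding power_mult[symmetric] by (simp add: power_add mult_ac)
      also have "\<dots> \<le> C1 * C2 * q ^ (i + j + k)"
      proof -
        have "j \<le> k + adist (int k) (int j)" by (simp add: adist_def)
        then show ?thesis using C1 C2 q by (intro mult_left_mono power_le_of_ge) auto
      qed
      finally show "\<bar>tail_gram os \<theta> n i k * Gm_inv os \<theta> k j\<bar> \<le> C1 * C2 * q ^ (i + j) * q ^ k"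
        by (simp add: power_add mult_ac)
    qed
    also have "\<dots> = C1 * C2 * q ^ (i + j) * (\<Sum>k<N. q ^ k)" by (simp add: sum_distrib_left)
    also have "\<dots> \<le> C1 * C2 * q ^ (i + j) * (1 / (1 - q))"
    proof (rule mult_left_mono)
      show "(\<Sum>k<N. q ^ k) \<le> 1 / (1 - q)"
        using sum_le_suminf[of "\<lambda>k. q ^ k" "{..<N}"] q by (simp add: suminf_geometric summable_geometric)
    qed (use C1 C2 q in simp)
    finally show ?thesis by (simp add: mult_ac)
  qed
  moreover have "0 < C1 * C2 * (1 / (1 - q))" using C1 C2 q by simp
  ultimately show ?thesis by blast
qed

text \<open>The truncated product of the Gram matrix and its inverse misses the identity only near the corner (N, N).\<close>

lemma corner_decay:
  assumes q: "0 < q" "q < 1"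
  shows "\<exists>C>0. \<forall>N i j. i < N \<longrightarrow> j < N \<longrightarrow>
    \<bar>(if i = j then 1 else 0) - (\<Sum>k<N. Gm os (2 * \<theta>) \<theta> i k * Gm_inv os \<theta> k j)\<bar> \<le> C * q ^ ((N - i) + (N - j))"
proof -
  obtain C1 where C1: "0 < C1" "\<And>i j. \<bar>Gm os (2 * \<theta>) \<theta> i j\<bar> \<le> C1 * q ^ adist (int i) (int j)"
    using Gm_decay[OF q] by blast
  obtain C2 where C2: "0 < C2" "\<And>i j. \<bar>Gm_inv os \<theta> i j\<bar> \<le> C2 * q ^ adist (int i) (int j)"
    using Gm_inv_decay[OF q] by blast
  have "\<bar>(if i = j then 1 else 0) - (\<Sum>k<N. Gm os (2 * \<theta>) \<theta> i k * Gm_inv os \<theta> k j)\<bar> \<le> C1 * C2 * (2 / (1 - q)) * q ^ ((N - i) + (N - j))"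
    if ij: "i < N" "j < N" for N i j
  proof -
    define T where "T k = Gm os (2 * \<theta>) \<theta> i k * Gm_inv os \<theta> k j" for k
    have b: "\<bar>T k\<bar> \<le> C1 * C2 * q ^ (adist (int i) (int k) + adist (int k) (int j))" for k
    proof -
      have "\<bar>T k\<bar> \<le> (C1 * q ^ adist (int i) (int k)) * (C2 * q ^ adist (int k) (int j))"
        unfolding T_def abs_mult using C1 C2 q by (intro mult_mono) auto
      then show ?thesis by (simp add: power_add mult_ac)
    qed
    have s: "T summable_on UNIV"
    proof (rule summable_on_of_abs_le(2))
      show "(\<lambda>k. C1 * C2 * q ^ adist (int i) (int k)) summable_on UNIV"
        by (intro summable_on_cmult_right summable_adist q)
      show "\<bar>T k\<bar> \<le> C1 * C2 * q ^ adist (int i) (int k)" for k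
        by (rule prod_geom_bound[OF q _ b]) (use C1 C2 in auto)
    qed
    have "(if i = j then 1 else 0) = infsum T UNIV" unfolding T_def by (rule Gm_inv_right[symmetric])
    also have "\<dots> = infsum T ({..<N} \<union> {N..})" by (rule arg_cong[where f = "infsum T"]) auto
    also have "\<dots> = infsum T {..<N} + infsum T {N..}"
      by (rule infsum_Un_disjoint) (auto intro: summable_on_subset_banach[OF s])
    finally have "(if i = j then 1 else 0) - (\<Sum>k<N. T k) = infsum T {N..}" by simp
    also have "\<bar>infsum T {N..}\<bar> \<le> (\<Sum>\<^sub>\<infinity>k\<in>{N..}. C1 * C2 * q ^ ((N - i) + (N - j)) * q ^ adist (int N) (int k))"
    proof (rule abs_infsum_le)
      show "(\<lambda>k. C1 * C2 * q ^ ((N - i) + (N - j)) * q ^ adist (int N) (int k)) summable_on {N..}"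
        by (intro summable_on_cmult_right summable_on_subset_banach[OF summable_adist(1)[OF q]]) auto
      fix k assume "k \<in> {N..}"
      then have "(N - i) + (N - j) + adist (int N) (int k) \<le> adist (int i) (int k) + adist (int k) (int j)"
        using ij by (auto simp: adist_def)
      from prod_geom_bound[OF q this b]
      show "\<bar>T k\<bar> \<le> C1 * C2 * q ^ ((N - i) + (N - j)) * q ^ adist (int N) (int k)"
        using C1 C2 by (simp add: power_add mult_ac)
    qed
    also have "\<dots> = C1 * C2 * q ^ ((N - i) + (N - j)) * (\<Sum>\<^sub>\<infinity>k\<in>{N..}. q ^ adist (int N) (int k))"
      by (rule infsum_cmult_right')
    also have "\<dots> \<le> C1 * C2 * q ^ ((N - i) + (N - j)) * (2 / (1 - q))"
    proof (rule mult_left_mono)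
      have "(\<Sum>\<^sub>\<infinity>k\<in>{N..}. q ^ adist (int N) (int k)) \<le> (\<Sum>\<^sub>\<infinity>k. q ^ adist (int N) (int k))"
        by (rule infsum_mono_neutral) (use q summable_adist(1)[OF q] in \<open>auto intro: summable_on_subset_banach\<close>)
      then show "(\<Sum>\<^sub>\<infinity>k\<in>{N..}. q ^ adist (int N) (int k)) \<le> 2 / (1 - q)"
        using summable_adist(2)[OF q, of "int N"] by linarith
    qed (use C1 C2 q in simp)
    finally show ?thesis by (simp add: T_def mult_ac)
  qed
  moreover have "0 < C1 * C2 * (2 / (1 - q))" using C1 C2 q by simp
  ultimately show ?thesis by blast
qed

text \<open>The corners at (0, 0) and (N, N) interact only through terms of size q^N, so I - c - t is close to (I - t) (I - c).\<close>

lemma detn_two_corners: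
  fixes t c :: "nat \<Rightarrow> nat \<Rightarrow> nat \<Rightarrow> real"
  assumes q: "0 < q" "q < 1" and C: "0 < C"
    and t: "\<And>N i j. i < N \<Longrightarrow> j < N \<Longrightarrow> \<bar>t N i j\<bar> \<le> C * q ^ (i + j)"
    and c: "\<And>N i j. i < N \<Longrightarrow> j < N \<Longrightarrow> \<bar>c N i j\<bar> \<le> C * q ^ ((N - i) + (N - j))"
  defines "I \<equiv> (\<lambda>i j. if i = j then 1 else (0::real))"
  shows "(\<lambda>N. detn N (\<lambda>i j. I i j - c N i j - t N i j) - detn N (\<lambda>i j. I i j - t N i j) * detn N (\<lambda>i j. I i j - c N i j)) \<longlonglongrightarrow> 0"
proof (rule Lim_null_comparison)
  define G where "G = 1 / (1 - q)"
  define Q where "Q N = real N ^ 3 * C\<^sup>2 * q ^ N" for N :: nat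
  have G0: "0 \<le> G" using q by (simp add: G_def)
  have geo: "(\<Sum>k<N. q ^ k) \<le> G" for N
    unfolding G_def using sum_le_suminf[of "\<lambda>k. q ^ k" "{..<N}"] q by (simp add: suminf_geometric summable_geometric)
  have geo': "(\<Sum>k<N. q ^ (N - k)) \<le> G" for N
  proof -
    have "(\<Sum>k<N. q ^ (N - k)) = (\<Sum>k<N. q ^ Suc k)"
      by (subst sum.nat_diff_reindex[symmetric]) (auto intro!: sum.cong simp: Suc_diff_Suc)
    also have "\<dots> \<le> (\<Sum>k<N. q ^ k)" using q by (intro sum_mono power_le_of_ge) auto
    finally show ?thesis using geo[of N] by linarith
  qed
  have bound: "norm (detn N (\<lambda>i j. I i j - c N i j - t N i j) - detn N (\<lambda>i j. I i j - t N i j) * detn N (\<lambda>i j. I i j - c N i j))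
      \<le> exp (2 * C * G * G + Q N) * Q N" for N
  proof -
    define X where "X i j = I i j - c N i j - t N i j" for i j
    \<comment> \<open>The product (I - t) (I - c); it differs from \<open>X\<close> by t c, whose
      entries pass through both corners and are of size q^N up to a factor N.\<close>
    define Y where "Y i j = (\<Sum>k<N. (I i k - t N i k) * (I k j - c N k j))" for i j
    \<comment> \<open>Row bounds common to \<open>X\<close> and \<open>Y\<close>: the diagonal, an
      excess decaying away from both ends, and the total of t c over a row.\<close>
    define b where "b i = 1 + C * G * (q ^ i + q ^ (N - i)) + real N * (real N * C\<^sup>2 * q ^ N)" for i
    have YX: "Y i j = X i j + (\<Sum>k<N. t N i k * c N k j)" if "i < N" "j < N" for i j
    proof -
      have "Y i j = (\<Sum>k<N. I i k * I k j - I i k * c N k j - t N i k * I k j + t N i k * c N k j)"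
        unfolding Y_def by (intro sum.cong refl) (simp add: algebra_simps)
      also have "\<dots> = (\<Sum>k<N. I i k * I k j) - (\<Sum>k<N. I i k * c N k j) - (\<Sum>k<N. t N i k * I k j) + (\<Sum>k<N. t N i k * c N k j)"
        by (simp add: sum.distrib sum_subtractf)
      moreover have "(\<Sum>k<N. I i k * I k j) = I i j" "(\<Sum>k<N. I i k * c N k j) = c N i j" "(\<Sum>k<N. t N i k * I k j) = t N i j"
        using that by (simp_all add: I_def if_distrib[of "\<lambda>x. _ * x"] if_distrib[of "\<lambda>x. x * _"] sum.delta sum.delta' cong: if_cong)
      ultimately show ?thesis by (simp add: X_def)
    qed
    have tc: "\<bar>\<Sum>k<N. t N i k * c N k j\<bar> \<le> real N * C\<^sup>2 * q ^ N" if ij: "i < N" "j < N" for i j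
    proof -
      have "\<bar>t N i k * c N k j\<bar> \<le> C\<^sup>2 * q ^ N" if k: "k < N" for k
      proof -
        have "\<bar>t N i k * c N k j\<bar> \<le> (C * q ^ (i + k)) * (C * q ^ ((N - k) + (N - j)))"
          unfolding abs_mult using t[OF ij(1) k] c[OF k ij(2)] C q by (intro mult_mono) auto
        also have "\<dots> = C\<^sup>2 * q ^ (i + k + ((N - k) + (N - j)))" by (simp add: power_add power2_eq_square mult_ac)
        also have "\<dots> \<le> C\<^sup>2 * q ^ N" using q k by (intro mult_left_mono power_le_of_ge) auto
        finally show ?thesis .
      qed
      then have "\<bar>\<Sum>k<N. t N i k * c N k j\<bar> \<le> (\<Sum>k<N. C\<^sup>2 * q ^ N)"
        by (intro order_trans[OF sum_abs sum_mono]) auto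
      then show ?thesis by simp
    qed
    have rowX: "(\<Sum>j<N. \<bar>X i j\<bar>) \<le> 1 + C * G * (q ^ i + q ^ (N - i))" if i: "i < N" for i
    proof -
      have "(\<Sum>j<N. \<bar>X i j\<bar>) \<le> (\<Sum>j<N. I i j + C * q ^ (N - i) * q ^ (N - j) + C * q ^ i * q ^ j)"
      proof (rule sum_mono)
        fix j assume "j \<in> {..<N}"
        then have j: "j < N" by simp
        have "\<bar>t N i j\<bar> \<le> C * q ^ i * q ^ j" using t[OF i j] by (simp only: power_add mult.assoc)
        moreover have "\<bar>c N i j\<bar> \<le> C * q ^ (N - i) * q ^ (N - j)" using c[OF i j] by (simp only: power_add mult.assoc)
        moreover have "0 \<le> I i j" by (simp add: I_def)
        ultimately show "\<bar>X i j\<bar> \<le> I i j + C * q ^ (N - i) * q ^ (N - j) + C * q ^ i * q ^ j"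
          unfolding X_def by linarith
      qed
      also have "\<dots> = (\<Sum>j<N. I i j) + C * q ^ (N - i) * (\<Sum>j<N. q ^ (N - j)) + C * q ^ i * (\<Sum>j<N. q ^ j)"
        by (simp add: sum.distrib sum_distrib_left)
      also have "\<dots> \<le> 1 + C * q ^ (N - i) * G + C * q ^ i * G"
      proof -
        have "(\<Sum>j<N. I i j) = 1" using i by (simp add: I_def)
        moreover have "C * q ^ (N - i) * (\<Sum>j<N. q ^ (N - j)) \<le> C * q ^ (N - i) * G" "C * q ^ i * (\<Sum>j<N. q ^ j) \<le> C * q ^ i * G"
          using C q geo geo' by (auto intro!: mult_left_mono)
        ultimately show ?thesis by linarith
      qed
      finally show ?thesis by (simp add: algebra_simps)
    qed
    have rowX': "(\<Sum>j<N. \<bar>X i j\<bar>) \<le> b i" if "i < N" for i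
    proof -
      have "0 \<le> real N * (real N * C\<^sup>2 * q ^ N)" using q by simp
      then show ?thesis using rowX[OF that] unfolding b_def by linarith
    qed
    have rowY: "(\<Sum>j<N. \<bar>Y i j\<bar>) \<le> b i" if i: "i < N" for i
    proof -
      have "(\<Sum>j<N. \<bar>Y i j\<bar>) \<le> (\<Sum>j<N. \<bar>X i j\<bar> + real N * C\<^sup>2 * q ^ N)"
      proof (rule sum_mono)
        fix j assume "j \<in> {..<N}"
        then show "\<bar>Y i j\<bar> \<le> \<bar>X i j\<bar> + real N * C\<^sup>2 * q ^ N" using YX[OF i] tc[OF i] by (smt (verit) lessThan_iff)
      qed
      also have "\<dots> = (\<Sum>j<N. \<bar>X i j\<bar>) + real N * (real N * C\<^sup>2 * q ^ N)" by (simp add: sum.distrib)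
      finally show ?thesis using rowX[OF i] unfolding b_def by linarith
    qed
    have b1: "1 \<le> b i" for i using C q G0 by (simp add: b_def)
    have "detn N Y = detn N (\<lambda>i j. I i j - t N i j) * detn N (\<lambda>i j. I i j - c N i j)"
      unfolding Y_def by (rule detn_mult)
    then have "norm (detn N (\<lambda>i j. I i j - c N i j - t N i j) - detn N (\<lambda>i j. I i j - t N i j) * detn N (\<lambda>i j. I i j - c N i j)) = \<bar>detn N X - detn N Y\<bar>"
      by (simp add: X_def[abs_def])
    also have "\<dots> \<le> (\<Prod>i<N. b i) * (\<Sum>i<N. \<Sum>j<N. \<bar>X i j - Y i j\<bar>)"
      by (rule abs_detn_diff_le) (use rowX' rowY b1 in auto)
    also have "\<dots> \<le> exp (2 * C * G * G + Q N) * Q N"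
    proof (rule mult_mono)
      \<comment> \<open>The excesses over 1 are summable uniformly in N, so the product of all N row
        bounds stays bounded.\<close>
      have "(\<Prod>i<N. b i) \<le> (\<Prod>i<N. exp (b i - 1))"
        using b1 exp_ge_add_one_self[of "b i - 1" for i] by (intro prod_mono conjI) (auto intro: order_trans[of 0 1])
      also have "\<dots> = exp (\<Sum>i<N. b i - 1)" by (simp add: exp_sum)
      also have "(\<Sum>i<N. b i - 1) \<le> 2 * C * G * G + Q N"
      proof -
        have "(\<Sum>i<N. b i - 1) = C * G * ((\<Sum>i<N. q ^ i) + (\<Sum>i<N. q ^ (N - i))) + Q N"
          by (simp add: b_def Q_def sum.distrib sum_distrib_left algebra_simps power3_eq_cube)
        also have "\<dots> \<le> C * G * (G + G) + Q N" using C G0 geo geo' by (intro add_mono mult_left_mono) auto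
        finally show ?thesis by (simp add: algebra_simps)
      qed
      finally show "(\<Prod>i<N. b i) \<le> exp (2 * C * G * G + Q N)" by simp
      have "(\<Sum>i<N. \<Sum>j<N. \<bar>X i j - Y i j\<bar>) \<le> (\<Sum>i<N. \<Sum>j<N. real N * C\<^sup>2 * q ^ N)"
        using YX tc by (intro sum_mono) (simp add: abs_minus_commute)
      also have "\<dots> = Q N" by (simp add: Q_def power3_eq_cube)
      finally show "(\<Sum>i<N. \<Sum>j<N. \<bar>X i j - Y i j\<bar>) \<le> Q N" .
    qed (auto intro: sum_nonneg)
    finally show ?thesis .
  qed
  then show "\<forall>\<^sub>F N in sequentially. norm (detn N (\<lambda>i j. I i j - c N i j - t N i j) - detn N (\<lambda>i j. I i j - t N i j) * detn N (\<lambda>i j. I i j - c N i j))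
      \<le> exp (2 * C * G * G + Q N) * Q N" by (rule always_eventually[OF allI])
  have "Q \<longlonglongrightarrow> 0"
  proof -
    have lim: "(\<lambda>N. real N ^ 3 * q ^ N) \<longlonglongrightarrow> 0" using q by real_asymp
    from tendsto_mult_right_zero[OF this, of "C\<^sup>2"] show ?thesis unfolding Q_def by (simp add: mult_ac)
  qed
  then have "(\<lambda>N. exp (2 * C * G * G + Q N) * Q N) \<longlonglongrightarrow> exp (2 * C * G * G + 0) * 0" by (intro tendsto_intros)
  then show "(\<lambda>N. exp (2 * C * G * G + Q N) * Q N) \<longlonglongrightarrow> 0" by simp
qed

text \<open>By Cauchy-Binet the Gram section without its tail has as determinant the sum over
  partitions within both cutoffs. Multiplied by the determinant of the inverse section it is
  asymptotic to the determinant with \<open>tail_mat\<close> times det G det B. The last factor has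
  a nonzero limit and can be divided out.\<close>

theorem detn_tail_mat_tendsto:
  "(\<lambda>N. detn N (\<lambda>i j. (if i = j then 1 else 0) - tail_mat os \<theta> n N i j)) \<longlonglongrightarrow>
     (\<Sum>\<^sub>\<infinity>l | l \<in> partitions \<and> lam1 l \<le> n. pterm os (2 * \<theta>) \<theta> l) / exp (3 * \<theta>\<^sup>2 / 2)"
proof -
  define I where "I = (\<lambda>i j::nat. if i = j then 1 else (0::real))"
  define G where "G = Gm os (2 * \<theta>) \<theta>"
  define B where "B = Gm_inv os \<theta>"
  define t where "t = tail_mat os \<theta> n"
  define c where "c N i j = I i j - (\<Sum>k<N. G i k * B k j)" for N i j
  have q: "0 < (1/2::real)" "(1/2::real) < 1" by auto
  obtain C1 where C1: "0 < C1" "\<And>N i j. \<bar>t N i j\<bar> \<le> C1 * (1/2) ^ (i + j)"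
    using tail_mat_decay[OF q] unfolding t_def by blast
  obtain C2 where C2: "0 < C2" "\<And>N i j. i < N \<Longrightarrow> j < N \<Longrightarrow> \<bar>c N i j\<bar> \<le> C2 * (1/2) ^ ((N - i) + (N - j))"
    using corner_decay[OF q, of os \<theta>] unfolding c_def I_def G_def B_def by blast
  define S where "S = (\<Sum>\<^sub>\<infinity>l | l \<in> partitions \<and> lam1 l \<le> n. pterm os (2 * \<theta>) \<theta> l)"
  define SN where "SN N = detn N (\<lambda>i j. G i j - tail_gram os \<theta> n i j)" for N
  have SN: "SN \<longlonglongrightarrow> S"
  proof -
    have eqS: "SN N = (\<Sum>l\<in>{l \<in> partitions. length l \<le> N \<and> lam1 l \<le> n}. pterm os (2 * \<theta>) \<theta> l)" for N
    proof -
      have "SN N = detn N (\<lambda>i j. \<Sum>x\<in>{- int N<..int n}. bas os (h_pl (2 * \<theta>)) i x * h_pl \<theta> (x + int j))"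
        unfolding SN_def
      proof (rule detn_cong)
        fix i j assume ij: "i < N" "j < N"
        define F where "F x = bas os (h_pl (2 * \<theta>)) i x * h_pl \<theta> (x + int j)" for x
        have s: "F summable_on UNIV" unfolding F_def by (rule Gm_eq_infsum)
        have z: "F x = 0" if "x \<le> - int N" for x using that ij by (simp add: F_def h_pl_def)
        have "G i j = infsum F UNIV" unfolding G_def F_def by (rule Gm_eq_infsum)
        also have "\<dots> = infsum F ({- int N<..int n} \<union> {int n<..})"
          by (rule infsum_cong_neutral) (use z in auto)
        also have "\<dots> = infsum F {- int N<..int n} + infsum F {int n<..}"
          by (rule infsum_Un_disjoint) (auto intro: summable_on_subset_banach[OF s])
        finally show "G i j - tail_gram os \<theta> n i j = (\<Sum>x\<in>{- int N<..int n}. bas os (h_pl (2 * \<theta>)) i x * h_pl \<theta> (x + int j))"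
          by (simp add: tail_gram_def F_def[abs_def])
      qed
      also have "\<dots> = (\<Sum>l | l \<in> partitions \<and> length l \<le> N \<and> lam1 l \<le> n. pterm os (2 * \<theta>) \<theta> l)"
        unfolding cauchy_binet_partitions by (intro sum.cong refl pterm_pad) auto
      finally show ?thesis by simp
    qed
    show ?thesis
      unfolding eqS[abs_def] S_def
      by (rule sum_tendsto_infsum[OF pterm_summable]) (use finite_bounded_partitions in \<open>auto simp: eventually_sequentially\<close>)
  qed
  have B: "(\<lambda>N. detn N B) \<longlonglongrightarrow> exp (\<theta>\<^sup>2 / 2)"
  proof -
    have "(- \<theta>) * (- \<theta>) - (- \<theta>)\<^sup>2 / 2 = \<theta>\<^sup>2 / 2" by (simp add: power2_eq_square)
    then show ?thesis using detn_Gm_tendsto[of os "- \<theta>" "- \<theta>"] by (simp only: B_def detn_Gm_inv)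
  qed
  have Gl: "(\<lambda>N. detn N G) \<longlonglongrightarrow> exp (3 * \<theta>\<^sup>2 / 2)"
  proof -
    have "(2 * \<theta>) * \<theta> - \<theta>\<^sup>2 / 2 = 3 * \<theta>\<^sup>2 / 2" by (simp add: power2_eq_square)
    then show ?thesis using detn_Gm_tendsto[of os "2 * \<theta>" \<theta>] by (simp only: G_def)
  qed
  have e1: "detn N (\<lambda>i j. I i j - c N i j) = detn N G * detn N B" for N
    by (simp add: c_def detn_mult[symmetric])
  have e2: "detn N (\<lambda>i j. I i j - c N i j - t N i j) = SN N * detn N B" for N
    unfolding SN_def detn_mult[symmetric]
    by (rule detn_cong) (simp add: c_def t_def tail_mat_def B_def left_diff_distrib sum_subtractf)
  have "(\<lambda>N. detn N (\<lambda>i j. I i j - c N i j - t N i j) - detn N (\<lambda>i j. I i j - t N i j) * detn N (\<lambda>i j. I i j - c N i j)) \<longlonglongrightarrow> 0"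
    unfolding I_def
  proof (rule detn_two_corners[OF q, of "max C1 C2"])
    show "\<bar>t N i j\<bar> \<le> max C1 C2 * (1/2) ^ (i + j)" for N i j
      by (rule order_trans[OF C1(2) mult_right_mono]) auto
    show "\<bar>c N i j\<bar> \<le> max C1 C2 * (1/2) ^ ((N - i) + (N - j))" if "i < N" "j < N" for N i j
      by (rule order_trans[OF C2(2)[OF that] mult_right_mono]) auto
  qed (use C1 in auto)
  then have d: "(\<lambda>N. SN N * detn N B - detn N (\<lambda>i j. I i j - t N i j) * (detn N G * detn N B)) \<longlonglongrightarrow> 0"
    unfolding e1 e2 .
  have pos: "exp (3 * \<theta>\<^sup>2 / 2) * exp (\<theta>\<^sup>2 / 2) \<noteq> 0" by simp
  have GB: "(\<lambda>N. detn N G * detn N B) \<longlonglongrightarrow> exp (3 * \<theta>\<^sup>2 / 2) * exp (\<theta>\<^sup>2 / 2)" by (intro tendsto_intros Gl B)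
  have "(\<lambda>N. (SN N * detn N B - (SN N * detn N B - detn N (\<lambda>i j. I i j - t N i j) * (detn N G * detn N B))) / (detn N G * detn N B))
     \<longlonglongrightarrow> (S * exp (\<theta>\<^sup>2 / 2) - 0) / (exp (3 * \<theta>\<^sup>2 / 2) * exp (\<theta>\<^sup>2 / 2))"
    by (intro tendsto_divide tendsto_diff tendsto_mult SN B d Gl pos)
  moreover have "\<forall>\<^sub>F N in sequentially. (SN N * detn N B - (SN N * detn N B - detn N (\<lambda>i j. I i j - t N i j) * (detn N G * detn N B))) / (detn N G * detn N B)
      = detn N (\<lambda>i j. I i j - t N i j)"
    using tendsto_imp_eventually_ne[OF GB pos] by eventually_elim simp
  ultimately have "(\<lambda>N. detn N (\<lambda>i j. I i j - t N i j)) \<longlonglongrightarrow> (S * exp (\<theta>\<^sup>2 / 2) - 0) / (exp (3 * \<theta>\<^sup>2 / 2) * exp (\<theta>\<^sup>2 / 2))"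
    by (rule Lim_transform_eventually)
  then show ?thesis by (simp add: I_def t_def S_def)
qed

section \<open>The discrete kernel\<close>

text \<open>Lattice sums are rewritten as integrals of step functions, so that discrete determinants
  become values of \<open>fredholm_det\<close>. Each cell is open on the left; the cell starting at
  \<open>s\<close> carries the value at 1, which later is the first lattice point above the
  cutoff.\<close>

lemma step_function_integral:
  fixes F :: "int \<Rightarrow> real"
  assumes \<kappa>: "0 < \<kappa>" and F: "summable (\<lambda>m. \<bar>F (int m + 1)\<bar>)"
  shows "integrable (restrict_space lborel {s<..}) (\<lambda>\<xi>. F \<lceil>(\<xi> - s) * \<kappa>\<rceil>)"
    "(LINT \<xi>|restrict_space lborel {s<..}. F \<lceil>(\<xi> - s) * \<kappa>\<rceil>) = (\<Sum>m. F (int m + 1)) / \<kappa>"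
proof -
  define A where "A m = {s + real m / \<kappa><..s + (real m + 1) / \<kappa>}" for m
  define f where "f m \<xi> = indicator (A m) \<xi> * F (int m + 1)" for m \<xi>
  have A: "\<xi> \<in> A m \<longleftrightarrow> \<lceil>(\<xi> - s) * \<kappa>\<rceil> = int m + 1" for m \<xi>
    using \<kappa> by (auto simp: A_def ceiling_eq_iff field_simps)
  have fi: "integrable lborel (f m)" for m
  proof -
    have "s + real m / \<kappa> \<le> s + (real m + 1) / \<kappa>" using \<kappa> by (simp add: divide_right_mono)
    then have "integrable lborel (indicator (A m) :: real \<Rightarrow> real)"
      unfolding A_def by (intro integrable_real_indicator) (auto simp: emeasure_lborel_Ioc)
    then show ?thesis unfolding f_def[abs_def] by (rule integrable_mult_left)
  qed
  have mA: "measure lborel (A m) = 1 / \<kappa>" for m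
    using \<kappa> by (simp add: A_def divide_right_mono add_divide_distrib)
  have val: "(\<Sum>m. f m \<xi>) = indicator {s<..} \<xi> *\<^sub>R F \<lceil>(\<xi> - s) * \<kappa>\<rceil>" for \<xi>
  proof (cases "s < \<xi>")
    case True
    define m0 where "m0 = nat (\<lceil>(\<xi> - s) * \<kappa>\<rceil> - 1)"
    have "0 < (\<xi> - s) * \<kappa>" using True \<kappa> by simp
    then have m0: "\<lceil>(\<xi> - s) * \<kappa>\<rceil> = int m0 + 1" by (simp add: m0_def)
    have "f m \<xi> = (if m = m0 then F (int m0 + 1) else 0)" for m
      using A[of \<xi> m] m0 by (auto simp: f_def)
    then have "(\<lambda>m. f m \<xi>) sums F (int m0 + 1)" using sums_single[of m0 "\<lambda>_. F (int m0 + 1)"] by simp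
    then show ?thesis using True m0 by (simp add: sums_iff)
  next
    case False
    have "\<xi> \<notin> A m" for m
    proof -
      have "s \<le> s + real m / \<kappa>" using \<kappa> by simp
      then show ?thesis using False by (auto simp: A_def)
    qed
    then show ?thesis using False by (simp add: f_def)
  qed
  have n1: "summable (\<lambda>m. norm (f m \<xi>))" for \<xi>
    by (rule summable_comparison_test'[OF F]) (auto simp: f_def indicator_def abs_mult)
  have i1: "integral\<^sup>L lborel (f m) = F (int m + 1) / \<kappa>" for m
    by (simp add: f_def[abs_def] mA)
  have i2: "integral\<^sup>L lborel (\<lambda>\<xi>. norm (f m \<xi>)) = \<bar>F (int m + 1)\<bar> / \<kappa>" for m
  proof -
    have "(\<lambda>\<xi>. norm (f m \<xi>)) = (\<lambda>\<xi>. indicator (A m) \<xi> * \<bar>F (int m + 1)\<bar>)" by (auto simp: f_def abs_mult)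
    then show ?thesis by (simp add: mA)
  qed
  have n2: "summable (\<lambda>m. integral\<^sup>L lborel (\<lambda>\<xi>. norm (f m \<xi>)))"
    unfolding i2 by (rule summable_divide[OF F])
  note S = fi AE_I2[OF n1] n2
  have "integrable lborel (\<lambda>\<xi>. \<Sum>m. f m \<xi>)" by (rule integrable_suminf[OF S])
  then show "integrable (restrict_space lborel {s<..}) (\<lambda>\<xi>. F \<lceil>(\<xi> - s) * \<kappa>\<rceil>)"
    unfolding val by (simp add: integrable_restrict_space)
  have "integral\<^sup>L lborel (\<lambda>\<xi>. \<Sum>m. f m \<xi>) = (\<Sum>m. integral\<^sup>L lborel (f m))" by (rule integral_suminf[OF S])
  also have "\<dots> = (\<Sum>m. F (int m + 1)) / \<kappa>" unfolding i1 by (rule suminf_divide[OF summable_rabs_cancel[OF F]])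
  finally show "(LINT \<xi>|restrict_space lborel {s<..}. F \<lceil>(\<xi> - s) * \<kappa>\<rceil>) = (\<Sum>m. F (int m + 1)) / \<kappa>"
    unfolding val by (simp add: integral_restrict_space)
qed

lemma
  fixes f :: "'k \<Rightarrow> 'a \<Rightarrow> real"
  assumes "finite K" "\<And>k. k \<in> K \<Longrightarrow> f k summable_on A"
  shows summable_on_sum: "(\<lambda>x. \<Sum>k\<in>K. f k x) summable_on A"
    and infsum_sum: "(\<Sum>\<^sub>\<infinity>x\<in>A. \<Sum>k\<in>K. f k x) = (\<Sum>k\<in>K. infsum (f k) A)"
proof -
  have "(\<lambda>x. \<Sum>k\<in>K. f k x) summable_on A \<and> (\<Sum>\<^sub>\<infinity>x\<in>A. \<Sum>k\<in>K. f k x) = (\<Sum>k\<in>K. infsum (f k) A)"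
    using assms
  proof (induction K rule: finite_induct)
    case (insert k K)
    then show ?case by (auto simp: infsum_add intro!: summable_on_add)
  qed simp
  then show "(\<lambda>x. \<Sum>k\<in>K. f k x) summable_on A" "(\<Sum>\<^sub>\<infinity>x\<in>A. \<Sum>k\<in>K. f k x) = (\<Sum>k\<in>K. infsum (f k) A)"
    by auto
qed

definition bessel_kernel :: "bool \<Rightarrow> real \<Rightarrow> int \<Rightarrow> int \<Rightarrow> real" where
  "bessel_kernel os \<theta> x y = (\<Sum>\<^sub>\<infinity>m. bas os (W \<theta> (- \<theta>)) m x * W \<theta> (- \<theta>) (y + int m))"

text \<open>The functions paired with the basis, multiplied by the section of the inverse Gram
  matrix. Integrating them against the basis over the tail gives \<open>tail_mat\<close>, and the
  resulting finite-rank kernel is \<open>kernel_approx\<close>.\<close>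

definition dual_fun :: "bool \<Rightarrow> real \<Rightarrow> nat \<Rightarrow> nat \<Rightarrow> int \<Rightarrow> real" where
  "dual_fun os \<theta> N i y = (\<Sum>k<N. h_pl \<theta> (y + int k) * Gm_inv os \<theta> k i)"

definition kernel_approx :: "bool \<Rightarrow> real \<Rightarrow> nat \<Rightarrow> int \<Rightarrow> int \<Rightarrow> real" where
  "kernel_approx os \<theta> N x y = (\<Sum>i<N. bas os (h_pl (2 * \<theta>)) i x * dual_fun os \<theta> N i y)"

lemma kernel_triple_bound:
  assumes q: "0 < q" "q < 1"
  shows "\<exists>C>0. \<forall>x y m k i. 0 \<le> x \<longrightarrow> 0 \<le> y \<longrightarrow>
    \<bar>h_pl \<theta> (y + int k) * Gm os (- \<theta>) 0 k m * (Gm os (- \<theta>) (- \<theta>) m i * bas os (h_pl (2 * \<theta>)) i x)\<bar>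
      \<le> C * q ^ nat x * q ^ nat y * (q ^ m * (q ^ k * q ^ i))"
proof -
  \<comment> \<open>Along the chain from 0 through k, m, i to x each of y + k, m, i and x is at most
    the total exponent \<open>E\<close>; their sum is thus at most 4 E, which explains the fourth
    power.\<close>
  define r where "r = q ^ 4"
  have r: "0 < r" "r < 1" using q by (auto simp: r_def power_less_one_iff)
  obtain C1 where C1: "0 < C1" "\<And>x j. 0 \<le> x \<Longrightarrow> \<bar>h_pl \<theta> (x + int j)\<bar> \<le> C1 * r ^ (nat x + j)"
    using h_pl_decay_nat[OF r(1)] by blast
  obtain C2 where C2: "0 < C2" "\<And>i j. \<bar>Gm os (- \<theta>) 0 i j\<bar> \<le> C2 * r ^ adist (int i) (int j)" using Gm_decay[OF r] by blast
  obtain C3 where C3: "0 < C3" "\<And>i j. \<bar>Gm os (- \<theta>) (- \<theta>) i j\<bar> \<le> C3 * r ^ adist (int i) (int j)" using Gm_decay[OF r] by blast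
  obtain C4 where C4: "0 < C4" "\<And>i x. 0 \<le> x \<Longrightarrow> \<bar>bas os (h_pl (2 * \<theta>)) i x\<bar> \<le> C4 * r ^ adist (int i) x"
    using bas_W_decay[OF r, of os "2 * \<theta>" 0] unfolding W_0_right by blast
  have "\<bar>h_pl \<theta> (y + int k) * Gm os (- \<theta>) 0 k m * (Gm os (- \<theta>) (- \<theta>) m i * bas os (h_pl (2 * \<theta>)) i x)\<bar>
      \<le> C1 * C2 * C3 * C4 * q ^ nat x * q ^ nat y * (q ^ m * (q ^ k * q ^ i))" if xy: "0 \<le> x" "0 \<le> y" for x y m k i
  proof -
    define E where "E = nat y + k + adist (int k) (int m) + adist (int m) (int i) + adist (int i) x"
    have "\<bar>h_pl \<theta> (y + int k) * Gm os (- \<theta>) 0 k m * (Gm os (- \<theta>) (- \<theta>) m i * bas os (h_pl (2 * \<theta>)) i x)\<bar>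
      \<le> (C1 * r ^ (nat y + k)) * (C2 * r ^ adist (int k) (int m)) * ((C3 * r ^ adist (int m) (int i)) * (C4 * r ^ adist (int i) x))"
      unfolding abs_mult using C1(1) C2(1) C3(1) C4(1) r
      by (intro mult_mono C1(2) C2(2) C3(2) C4(2) xy mult_nonneg_nonneg) auto
    also have "\<dots> = C1 * C2 * C3 * C4 * r ^ E" by (simp add: E_def power_add mult_ac)
    also have "r ^ E = q ^ (4 * E)" by (simp add: r_def power_mult)
    also have "C1 * C2 * C3 * C4 * q ^ (4 * E) \<le> C1 * C2 * C3 * C4 * q ^ (nat x + nat y + (m + (k + i)))"
    proof (intro mult_left_mono power_le_of_ge q)
      show "nat x + nat y + (m + (k + i)) \<le> 4 * E" using xy by (auto simp: E_def adist_def)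
    qed (use C1 C2 C3 C4 in auto)
    finally show ?thesis by (simp add: power_add mult_ac)
  qed
  moreover have "0 < C1 * C2 * C3 * C4" using C1 C2 C3 C4 by simp
  ultimately show ?thesis by blast
qed

lemma triple_geometric_summable:
  fixes q :: real
  assumes "0 < q" "q < 1"
  shows "(\<lambda>(m::nat, k::nat, i::nat). q ^ m * (q ^ k * q ^ i)) summable_on UNIV"
proof -
  have g: "absummable (\<lambda>(m::nat, p::nat \<times> nat). q ^ m * (case p of (k, i) \<Rightarrow> q ^ k * q ^ i)) UNIV"
    by (rule absummable_prod[OF geometric_absummable[OF assms] absummable_prod[OF geometric_absummable[OF assms] geometric_absummable[OF assms]]])
  have "(\<lambda>x. \<bar>case x of (m::nat, p::nat \<times> nat) \<Rightarrow> q ^ m * (case p of (k, i) \<Rightarrow> q ^ k * q ^ i)\<bar>) = (\<lambda>(m::nat, k::nat, i::nat). q ^ m * (q ^ k * q ^ i))"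
    using assms by (auto simp: fun_eq_iff abs_mult)
  then show ?thesis using g by simp
qed

lemma kernel_approx_eq_sum:
  "kernel_approx os \<theta> N x y = (\<Sum>(m, k, i)\<in>{..<N} \<times> {..<N} \<times> {..<N}.
     h_pl \<theta> (y + int k) * Gm os (- \<theta>) 0 k m * (Gm os (- \<theta>) (- \<theta>) m i * bas os (h_pl (2 * \<theta>)) i x))"
proof -
  have "kernel_approx os \<theta> N x y = (\<Sum>i<N. \<Sum>k<N. \<Sum>m<N. h_pl \<theta> (y + int k) * Gm os (- \<theta>) 0 k m * (Gm os (- \<theta>) (- \<theta>) m i * bas os (h_pl (2 * \<theta>)) i x))"
    unfolding kernel_approx_def dual_fun_def sum_distrib_left
    by (intro sum.cong refl) (simp add: Gm_inv_eq_sum sum_distrib_left mult_ac)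
  also have "\<dots> = (\<Sum>i<N. \<Sum>m<N. \<Sum>k<N. h_pl \<theta> (y + int k) * Gm os (- \<theta>) 0 k m * (Gm os (- \<theta>) (- \<theta>) m i * bas os (h_pl (2 * \<theta>)) i x))"
    by (rule sum.cong[OF refl], rule sum.swap)
  also have "\<dots> = (\<Sum>m<N. \<Sum>i<N. \<Sum>k<N. h_pl \<theta> (y + int k) * Gm os (- \<theta>) 0 k m * (Gm os (- \<theta>) (- \<theta>) m i * bas os (h_pl (2 * \<theta>)) i x))"
    by (rule sum.swap)
  also have "\<dots> = (\<Sum>m<N. \<Sum>k<N. \<Sum>i<N. h_pl \<theta> (y + int k) * Gm os (- \<theta>) 0 k m * (Gm os (- \<theta>) (- \<theta>) m i * bas os (h_pl (2 * \<theta>)) i x))"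
    by (rule sum.cong[OF refl], rule sum.swap)
  finally show ?thesis by (simp add: sum.cartesian_product)
qed

lemma kernel_approx_bound:
  assumes q: "0 < q" "q < 1"
  shows "\<exists>C>0. \<forall>N x y. 0 \<le> x \<longrightarrow> 0 \<le> y \<longrightarrow> \<bar>kernel_approx os \<theta> N x y\<bar> \<le> C * q ^ nat x * q ^ nat y"
proof -
  obtain C where C: "0 < C" "\<And>x y m k i. 0 \<le> x \<Longrightarrow> 0 \<le> y \<Longrightarrow>
    \<bar>h_pl \<theta> (y + int k) * Gm os (- \<theta>) 0 k m * (Gm os (- \<theta>) (- \<theta>) m i * bas os (h_pl (2 * \<theta>)) i x)\<bar>
      \<le> C * q ^ nat x * q ^ nat y * (q ^ m * (q ^ k * q ^ i))"
    using kernel_triple_bound[OF q] by blast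
  define S where "S = infsum (\<lambda>(m::nat, k::nat, i::nat). q ^ m * (q ^ k * q ^ i)) UNIV"
  have S0: "0 \<le> S" unfolding S_def using q by (intro infsum_nonneg) auto
  have "\<bar>kernel_approx os \<theta> N x y\<bar> \<le> C * (S + 1) * q ^ nat x * q ^ nat y" if xy: "0 \<le> x" "0 \<le> y" for N x y
  proof -
    have "\<bar>kernel_approx os \<theta> N x y\<bar> \<le> (\<Sum>(m, k, i)\<in>{..<N} \<times> {..<N} \<times> {..<N}. C * q ^ nat x * q ^ nat y * (q ^ m * (q ^ k * q ^ i)))"
      unfolding kernel_approx_eq_sum
      by (rule order_trans[OF sum_abs sum_mono]) (use C(2)[OF xy] in auto)
    also have "\<dots> = C * q ^ nat x * q ^ nat y * (\<Sum>(m, k, i)\<in>{..<N} \<times> {..<N} \<times> {..<N}. q ^ m * (q ^ k * q ^ i))"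
      by (simp add: sum_distrib_left case_prod_beta)
    also have "\<dots> \<le> C * q ^ nat x * q ^ nat y * (S + 1)"
    proof (rule mult_left_mono)
      have "(\<Sum>(m, k, i)\<in>{..<N} \<times> {..<N} \<times> {..<N}. q ^ m * (q ^ k * q ^ i)) \<le> S"
        unfolding S_def by (rule finite_sum_le_infsum[OF triple_geometric_summable[OF q]]) (use q in auto)
      then show "(\<Sum>(m, k, i)\<in>{..<N} \<times> {..<N} \<times> {..<N}. q ^ m * (q ^ k * q ^ i)) \<le> S + 1" by linarith
    qed (use C q in auto)
    finally show ?thesis by (simp add: mult_ac)
  qed
  moreover have "0 < C * (S + 1)" using C S0 by simp
  ultimately show ?thesis by blast
qed

text \<open>For fixed m the triple sum factorises. The sum over k applies the inverse triangular
  factor to h, the sum over i applies the inverse symmetric factor to the basis, and both produce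
  coefficients of exp (\<theta> (z - 1 / z)).\<close>

lemma kernel_approx_tendsto:
  assumes xy: "0 \<le> x" "0 \<le> y"
  shows "(\<lambda>N. kernel_approx os \<theta> N x y) \<longlonglongrightarrow> bessel_kernel os \<theta> x y"
proof -
  define T where "T m k i = h_pl \<theta> (y + int k) * Gm os (- \<theta>) 0 k m * (Gm os (- \<theta>) (- \<theta>) m i * bas os (h_pl (2 * \<theta>)) i x)" for m k i
  have q: "0 < (1/2::real)" "(1/2::real) < 1" by auto
  obtain C where C: "0 < C" "\<And>m k i. \<bar>T m k i\<bar> \<le> C * (1/2) ^ nat x * (1/2) ^ nat y * ((1/2) ^ m * ((1/2) ^ k * (1/2) ^ i))"
    using kernel_triple_bound[OF q, of \<theta> os] xy unfolding T_def by blast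
  have s: "(\<lambda>(m, k, i). T m k i) summable_on UNIV"
  proof (rule summable_on_of_abs_le(2))
    show "(\<lambda>z. C * (1/2) ^ nat x * (1/2) ^ nat y * (case z of (m, k, i) \<Rightarrow> (1/2) ^ m * ((1/2) ^ k * (1/2) ^ i))) summable_on UNIV"
      by (intro summable_on_cmult_right triple_geometric_summable q)
  qed (use C(2) in auto)
  have "(\<lambda>N. sum (\<lambda>(m, k, i). T m k i) ({..<N} \<times> {..<N} \<times> {..<N})) \<longlonglongrightarrow> infsum (\<lambda>(m, k, i). T m k i) UNIV"
  proof (rule sum_tendsto_infsum[OF s])
    fix z :: "nat \<times> nat \<times> nat"
    obtain m k i where z: "z = (m, k, i)" by (cases z)
    show "\<forall>\<^sub>F N in sequentially. z \<in> {..<N} \<times> {..<N} \<times> {..<N}"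
      using eventually_gt_at_top[of "max m (max k i)"] by eventually_elim (auto simp: z)
  qed auto
  moreover have "infsum (\<lambda>(m, k, i). T m k i) UNIV = bessel_kernel os \<theta> x y"
  proof -
    have s': "(\<lambda>(m, p). case p of (k, i) \<Rightarrow> T m k i) summable_on Sigma UNIV (\<lambda>_. UNIV)"
      using s by simp
    have s2: "(\<lambda>(k, i). T m k i) summable_on UNIV" for m
      using summable_on_SigmaD1[OF s', of m] by simp
    have "infsum (\<lambda>(m, k, i). T m k i) UNIV = (\<Sum>\<^sub>\<infinity>m. infsum (\<lambda>(k, i). T m k i) UNIV)"
      using infsum_Sigma_banach[OF s'] by simp
    also have "\<dots> = (\<Sum>\<^sub>\<infinity>m. bas os (W \<theta> (- \<theta>)) m x * W \<theta> (- \<theta>) (y + int m))"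
    proof (rule infsum_cong)
      fix m
      have "infsum (\<lambda>(k, i). T m k i) UNIV = (\<Sum>\<^sub>\<infinity>k. \<Sum>\<^sub>\<infinity>i. T m k i)"
        using infsum_Sigma_banach[of "\<lambda>(k, i). T m k i" UNIV "\<lambda>_. UNIV"] s2[of m] by simp
      also have "\<dots> = (\<Sum>\<^sub>\<infinity>k. h_pl \<theta> (y + int k) * Gm os (- \<theta>) 0 k m) * (\<Sum>\<^sub>\<infinity>i. Gm os (- \<theta>) (- \<theta>) m i * bas os (h_pl (2 * \<theta>)) i x)"
        unfolding T_def by (simp add: infsum_cmult_right' infsum_cmult_left')
      also have "\<dots> = W \<theta> (- \<theta>) (y + int m) * bas os (W \<theta> (- \<theta>)) m x"
        using Gm_symmetric_product[of os "- \<theta>" m "2 * \<theta>" 0 x] by (simp add: h_pl_mult_lower W_0_right)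
      finally show "infsum (\<lambda>(k, i). T m k i) UNIV = bas os (W \<theta> (- \<theta>)) m x * W \<theta> (- \<theta>) (y + int m)" by simp
    qed
    finally show ?thesis by (simp add: bessel_kernel_def)
  qed
  moreover have "kernel_approx os \<theta> N x y = sum (\<lambda>(m, k, i). T m k i) ({..<N} \<times> {..<N} \<times> {..<N})" for N
    unfolding kernel_approx_eq_sum T_def ..
  ultimately show ?thesis by (simp only:)
qed

lemma ceiling_step_measurable:
  "(\<lambda>\<xi>. int n + \<lceil>(\<xi> - s) * \<kappa>\<rceil>) \<in> measurable borel (count_space UNIV)"
  for \<kappa> s :: real
  by measurable

text \<open>For finite N the matrix determinant is a Fredholm determinant of finite rank; both
  descriptions have limits as N grows. The integer \<open>n\<close> and the real \<open>s\<close>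
  are still unrelated, since the step function only labels lattice points above \<open>n\<close> by
  cells above \<open>s\<close>.\<close>

theorem fredholm_det_bessel_kernel:
  fixes s \<kappa> \<theta> :: real and n :: nat
  assumes \<kappa>: "0 < \<kappa>" and \<theta>: "\<theta> = \<kappa> ^ 3"
  defines "X \<equiv> (\<lambda>\<xi>. int n + \<lceil>(\<xi> - s) * \<kappa>\<rceil>)"
  shows "fredholm_det (\<lambda>\<xi> \<eta>. \<kappa> * bessel_kernel os \<theta> (X \<xi>) (X \<eta>)) s =
    (\<Sum>\<^sub>\<infinity>l | l \<in> partitions \<and> lam1 l \<le> n. pterm os (2 * \<theta>) \<theta> l) / exp (3 * \<theta>\<^sup>2 / 2)"
proof -
  \<comment> \<open>A lattice step has length 1 / \<kappa> in the continuous variable, so this rate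
    is precisely decay exp (- \<xi>), the form in which the convergence of Fredholm determinants is
    stated.\<close>
  define q where "q = exp (- 1 / \<kappa>)"
  have q: "0 < q" "q < 1" using \<kappa> by (auto simp: q_def)
  \<comment> \<open>The factor \<kappa> compensates the cell width 1 / \<kappa>.\<close>
  define f where "f i \<xi> = \<kappa> * bas os (h_pl (2 * \<theta>)) i (X \<xi>)" for i \<xi>
  define g where "g N i \<xi> = dual_fun os \<theta> N i (X \<xi>)" for N i \<xi>
  have X: "0 \<le> X \<xi>" "q ^ nat (X \<xi>) \<le> exp s * exp (- \<xi>)" if "s < \<xi>" for \<xi>
  proof -
    have p: "0 < (\<xi> - s) * \<kappa>" using that \<kappa> by simp
    then show x0: "0 \<le> X \<xi>" by (simp add: X_def)
    have "(\<xi> - s) * \<kappa> \<le> real (nat (X \<xi>))"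
    proof -
      have "(\<xi> - s) * \<kappa> \<le> of_int \<lceil>(\<xi> - s) * \<kappa>\<rceil>" by (rule le_of_int_ceiling)
      also have "\<dots> \<le> real (nat (X \<xi>))" using x0 by (simp add: X_def)
      finally show ?thesis .
    qed
    then have "- real (nat (X \<xi>)) / \<kappa> \<le> s - \<xi>" using \<kappa> by (simp add: field_simps)
    then have "exp (- real (nat (X \<xi>)) / \<kappa>) \<le> exp (s - \<xi>)" by simp
    moreover have "q ^ nat (X \<xi>) = exp (- real (nat (X \<xi>)) / \<kappa>)"
      by (simp add: q_def exp_of_nat_mult[symmetric])
    ultimately show "q ^ nat (X \<xi>) \<le> exp s * exp (- \<xi>)" by (simp add: exp_diff exp_minus divide_inverse)
  qed
  have Sx: "(\<lambda>x. bas os (h_pl (2 * \<theta>)) i x * h_pl \<theta> (x + int k)) summable_on {int n<..}" for i k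
    by (rule summable_on_subset_banach[OF Gm_eq_infsum(1)]) simp
  have bij: "bij_betw (\<lambda>m. int n + (int m + 1)) UNIV {int n<..}"
    by (rule bij_betw_byWitness[where f' = "\<lambda>x. nat (x - int n - 1)"]) auto
  have tails: "summable (\<lambda>m. \<bar>F (int n + (int m + 1))\<bar>)" "(\<Sum>m. F (int n + (int m + 1))) = infsum F {int n<..}"
    if "F summable_on {int n<..}" for F :: "int \<Rightarrow> real"
  proof -
    have s: "(\<lambda>m. F (int n + (int m + 1))) summable_on UNIV"
      unfolding summable_on_reindex_bij_betw[OF bij, of F] using that .
    then have "(\<lambda>m. \<bar>F (int n + (int m + 1))\<bar>) summable_on UNIV"
      using summable_on_iff_abs_summable_on_real[THEN iffD1, OF s] by simp
    then show "summable (\<lambda>m. \<bar>F (int n + (int m + 1))\<bar>)"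
      by (subst (asm) summable_on_UNIV_nonneg_real_iff) auto
    show "(\<Sum>m. F (int n + (int m + 1))) = infsum F {int n<..}"
      using has_sum_imp_sums[OF has_sum_infsum[OF s]] infsum_reindex_bij_betw[OF bij, of F] by (simp add: sums_iff)
  qed
  have fg: "integrable (restrict_space lborel {s<..}) (\<lambda>\<xi>. f i \<xi> * g N j \<xi>)"
      "(LINT \<xi>|restrict_space lborel {s<..}. f i \<xi> * g N j \<xi>) = tail_mat os \<theta> n N i j" for i j N
  proof -
    define F where "F x = \<kappa> * (\<Sum>k<N. bas os (h_pl (2 * \<theta>)) i x * h_pl \<theta> (x + int k) * Gm_inv os \<theta> k j)" for x
    have Fs: "F summable_on {int n<..}"
      unfolding F_def by (intro summable_on_cmult_right summable_on_sum summable_on_cmult_left Sx finite_lessThan)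
    have e: "(\<lambda>\<xi>. f i \<xi> * g N j \<xi>) = (\<lambda>\<xi>. F (int n + \<lceil>(\<xi> - s) * \<kappa>\<rceil>))"
      by (simp add: f_def g_def F_def dual_fun_def X_def sum_distrib_left mult_ac)
    show "integrable (restrict_space lborel {s<..}) (\<lambda>\<xi>. f i \<xi> * g N j \<xi>)"
      unfolding e by (rule step_function_integral(1)[OF \<kappa> tails(1)[OF Fs]])
    have "(LINT \<xi>|restrict_space lborel {s<..}. f i \<xi> * g N j \<xi>) = infsum F {int n<..} / \<kappa>"
      unfolding e using step_function_integral(2)[OF \<kappa> tails(1)[OF Fs]] tails(2)[OF Fs] by simp
    also have "infsum F {int n<..} = \<kappa> * (\<Sum>k<N. tail_gram os \<theta> n i k * Gm_inv os \<theta> k j)"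
      unfolding F_def tail_gram_def
      by (simp add: infsum_cmult_right' infsum_sum infsum_cmult_left' summable_on_cmult_left Sx)
    finally show "(LINT \<xi>|restrict_space lborel {s<..}. f i \<xi> * g N j \<xi>) = tail_mat os \<theta> n N i j"
      using \<kappa> by (simp add: tail_mat_def)
  qed
  define Km where "Km N \<xi> \<eta> = (\<Sum>i<N. f i \<xi> * g N i \<eta>)" for N \<xi> \<eta>
  have Km: "Km N \<xi> \<eta> = \<kappa> * kernel_approx os \<theta> N (X \<xi>) (X \<eta>)" for N \<xi> \<eta>
    by (simp add: Km_def f_def g_def kernel_approx_def sum_distrib_left mult_ac)
  have fd: "detn N (\<lambda>i j. (if i = j then 1 else 0) - tail_mat os \<theta> n N i j) = fredholm_det (Km N) s" for N
    using detn_finite_rank_eq_fredholm_det[of N s f "g N", OF fg(1)] unfolding fg(2) Km_def[abs_def] .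
  have "(\<lambda>N. fredholm_det (Km N) s) \<longlonglongrightarrow> fredholm_det (\<lambda>\<xi> \<eta>. \<kappa> * bessel_kernel os \<theta> (X \<xi>) (X \<eta>)) s"
  proof -
    obtain C where C: "0 < C" "\<And>N x y. 0 \<le> x \<Longrightarrow> 0 \<le> y \<Longrightarrow> \<bar>kernel_approx os \<theta> N x y\<bar> \<le> C * q ^ nat x * q ^ nat y"
      using kernel_approx_bound[OF q] by blast
    show ?thesis
    proof (rule fredholm_det_tendsto[where C = "\<kappa> * (C * exp s * exp s)"])
      fix N
      have m: "(\<lambda>\<xi>. G (X \<xi>)) \<in> borel_measurable borel" for G :: "int \<Rightarrow> real"
        unfolding X_def by (rule measurable_compose[OF ceiling_step_measurable]) simp
      have "(\<lambda>p. f i (fst p)) \<in> borel_measurable (borel \<Otimes>\<^sub>M borel)" "(\<lambda>p. g N i (snd p)) \<in> borel_measurable (borel \<Otimes>\<^sub>M borel)" for i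
        using measurable_compose[OF measurable_fst m[of "\<lambda>x. \<kappa> * bas os (h_pl (2 * \<theta>)) i x"]]
          measurable_compose[OF measurable_snd m[of "dual_fun os \<theta> N i"]]
        by (simp_all add: f_def g_def)
      then show "(\<lambda>p. Km N (fst p) (snd p)) \<in> borel_measurable (borel \<Otimes>\<^sub>M borel)"
        unfolding Km_def by (intro borel_measurable_sum borel_measurable_times)
    next
      fix N \<xi> \<eta> assume \<xi>: "s < \<xi>" and \<eta>: "s < \<eta>"
      have "\<bar>kernel_approx os \<theta> N (X \<xi>) (X \<eta>)\<bar> \<le> C * q ^ nat (X \<xi>) * q ^ nat (X \<eta>)"
        using C(2) X(1)[OF \<xi>] X(1)[OF \<eta>] by blast
      also have "\<dots> \<le> C * (exp s * exp (- \<xi>)) * (exp s * exp (- \<eta>))"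
        using C(1) q X(2)[OF \<xi>] X(2)[OF \<eta>] by (intro mult_mono) auto
      finally have "\<kappa> * \<bar>kernel_approx os \<theta> N (X \<xi>) (X \<eta>)\<bar> \<le> \<kappa> * (C * (exp s * exp (- \<xi>)) * (exp s * exp (- \<eta>)))"
        using \<kappa> by (intro mult_left_mono) auto
      then show "\<bar>Km N \<xi> \<eta>\<bar> \<le> \<kappa> * (C * exp s * exp s) * exp (- \<xi>) * exp (- \<eta>)"
        unfolding Km abs_mult using \<kappa> by (simp add: mult_ac)
    next
      fix \<xi> \<eta> assume "s < \<xi>" "s < \<eta>"
      then show "(\<lambda>N. Km N \<xi> \<eta>) \<longlonglongrightarrow> \<kappa> * bessel_kernel os \<theta> (X \<xi>) (X \<eta>)"
        unfolding Km by (intro tendsto_mult tendsto_const kernel_approx_tendsto X)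
    qed
  qed
  moreover have "(\<lambda>N. fredholm_det (Km N) s) \<longlonglongrightarrow>
     (\<Sum>\<^sub>\<infinity>l | l \<in> partitions \<and> lam1 l \<le> n. pterm os (2 * \<theta>) \<theta> l) / exp (3 * \<theta>\<^sup>2 / 2)"
    using detn_tail_mat_tendsto[of os \<theta> n] unfolding fd .
  ultimately show ?thesis by (rule LIMSEQ_unique)
qed

section \<open>The edge limit\<close>

text \<open>An index error of bounded size is of order 1 / \<kappa> after scaling, so ceilings and
  the reflection shift disappear in the limit.\<close>

lemma scaled_bessel_tendsto_Airy:
  assumes \<kappa>: "\<And>m. 1 \<le> \<kappa> m" "filterlim \<kappa> at_top sequentially"
    and k: "\<And>m. \<bar>(real_of_int (k m) - 2 * \<kappa> m ^ 3) / \<kappa> m - z\<bar> \<le> C / \<kappa> m"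
  shows "(\<lambda>m. \<kappa> m * W (\<kappa> m ^ 3) (- (\<kappa> m ^ 3)) (k m)) \<longlonglongrightarrow> Airy z"
proof -
  define \<xi> where "\<xi> m = (real_of_int (k m) - 2 * \<kappa> m ^ 3) / \<kappa> m" for m
  have "(\<lambda>m. C * inverse (\<kappa> m)) \<longlonglongrightarrow> 0"
    using tendsto_mult_right_zero[OF tendsto_inverse_0_at_top[OF \<kappa>(2)]] .
  then have "(\<lambda>m. \<xi> m - z) \<longlonglongrightarrow> 0"
    by (rule Lim_null_comparison[OF always_eventually[OF allI], rotated]) (use k in \<open>simp add: \<xi>_def divide_inverse\<close>)
  then have lim: "\<xi> \<longlonglongrightarrow> z" by (simp add: LIM_zero_iff)
  have "real_of_int (k m) = 2 * \<kappa> m ^ 3 + \<xi> m * \<kappa> m" for m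
    using \<kappa>(1)[of m] by (simp add: \<xi>_def)
  from scaled_bessel_tendsto[OF zero_less_one \<kappa> this lim]
  show ?thesis by (simp add: Airy_eq_Ai_line[OF zero_less_one])
qed

lemma ceiling_scaled_bound:
  assumes "1 \<le> (\<kappa>::real)"
  shows "\<bar>(real_of_int \<lceil>2 * \<kappa> ^ 3 + x * \<kappa>\<rceil> - 2 * \<kappa> ^ 3) / \<kappa> - x\<bar> \<le> 1 / \<kappa>"
proof -
  have "(real_of_int \<lceil>2 * \<kappa> ^ 3 + x * \<kappa>\<rceil> - 2 * \<kappa> ^ 3) / \<kappa> - x = (real_of_int \<lceil>2 * \<kappa> ^ 3 + x * \<kappa>\<rceil> - (2 * \<kappa> ^ 3 + x * \<kappa>)) / \<kappa>"
    using assms by (simp add: field_simps)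
  moreover have "\<bar>real_of_int \<lceil>2 * \<kappa> ^ 3 + x * \<kappa>\<rceil> - (2 * \<kappa> ^ 3 + x * \<kappa>)\<bar> \<le> 1" by linarith
  ultimately show ?thesis using assms by (simp add: divide_right_mono)
qed

text \<open>The definition through a limit of improper integrals gives no direct access to
  measurability; as a pointwise limit of Bessel step functions along a sequence \<open>Airy\<close>
  inherits it.\<close>

lemma Airy_measurable: "Airy \<in> borel_measurable borel"
proof (rule borel_measurable_LIMSEQ_real)
  have f: "filterlim (\<lambda>m. real m + 1) at_top sequentially" by real_asymp
  show "(\<lambda>m. (real m + 1) * W ((real m + 1) ^ 3) (- ((real m + 1) ^ 3)) \<lceil>2 * (real m + 1) ^ 3 + x * (real m + 1)\<rceil>) \<longlonglongrightarrow> Airy x" for x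
    by (rule scaled_bessel_tendsto_Airy[where C = 1, OF _ f ceiling_scaled_bound]) auto
  show "(\<lambda>x. (real m + 1) * W ((real m + 1) ^ 3) (- ((real m + 1) ^ 3)) \<lceil>2 * (real m + 1) ^ 3 + x * (real m + 1)\<rceil>) \<in> borel_measurable borel" for m
  proof (rule borel_measurable_times)
    have "(\<lambda>x. \<lceil>2 * (real m + 1) ^ 3 + x * (real m + 1)\<rceil>) \<in> measurable borel (count_space UNIV)" by measurable
    from measurable_compose[OF this, of "W ((real m + 1) ^ 3) (- ((real m + 1) ^ 3))" borel]
    show "(\<lambda>x. W ((real m + 1) ^ 3) (- ((real m + 1) ^ 3)) \<lceil>2 * (real m + 1) ^ 3 + x * (real m + 1)\<rceil>) \<in> borel_measurable borel" by simp
  qed simp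
qed

lemma abs_Airy_le:
  assumes c: "0 < c"
  shows "\<exists>D>0. \<forall>x. \<bar>Airy x\<bar> \<le> D * exp (- c * x)"
proof -
  define D where "D = exp (c ^ 3 / 3) * (LINT t|lborel. exp (- c * t\<^sup>2)) / (2 * pi)"
  have "\<bar>Airy x\<bar> \<le> D * exp (- c * x)" for x
  proof -
    have "\<bar>Re (LINT t|lborel. airy_exp x (Complex c t))\<bar> \<le> norm (LINT t|lborel. airy_exp x (Complex c t))"
      by (rule abs_Re_le_cmod)
    also have "\<dots> \<le> (LINT t|lborel. norm (airy_exp x (Complex c t)))" by (rule integral_norm_bound)
    also have "\<dots> = exp (c ^ 3 / 3 - x * c) * (LINT t|lborel. exp (- c * t\<^sup>2))"
      unfolding norm_airy_exp by simp
    also have "\<dots> = D * exp (- c * x) * (2 * pi)"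
    proof -
      have "exp (c ^ 3 / 3 - x * c) = exp (c ^ 3 / 3) * exp (- c * x)"
        unfolding exp_add[symmetric] by (simp add: algebra_simps)
      then show ?thesis by (simp only: D_def) simp
    qed
    finally have "\<bar>Re (LINT t|lborel. airy_exp x (Complex c t))\<bar> / (2 * pi) \<le> D * exp (- c * x)"
      by (simp only: pos_divide_le_eq pi_gt_zero zero_less_mult_iff zero_less_numeral simp_thms)
    then show ?thesis by (simp add: Airy_eq_Ai_line[OF c] Ai_line_def)
  qed
  then have "\<bar>Airy x\<bar> \<le> (\<bar>D\<bar> + 1) * exp (- c * x)" for x
    by (rule order_trans) (auto intro!: mult_right_mono)
  then show ?thesis by (intro exI[of _ "\<bar>D\<bar> + 1"]) auto
qed

definition edge_kernel :: "bool \<Rightarrow> real \<Rightarrow> real \<Rightarrow> real" where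
  "edge_kernel os x y = (LINT u|restrict_space lborel {0<..}.
     (Airy (x + u) + (if os then -1 else 1) * Airy (x - u)) * Airy (y + u))"

lemma edge_kernel_eq: "edge_kernel False = A_plus" "edge_kernel True = A_minus"
proof -
  \<comment> \<open>Two rates are needed: the bound for Ai (x - u) with rate 1 grows like exp u, and
    rate 2 for Ai (y + u) makes the product integrable.\<close>
  obtain D1 where D1: "0 < D1" "\<And>x. \<bar>Airy x\<bar> \<le> D1 * exp (- 1 * x)" using abs_Airy_le[OF zero_less_one] by blast
  obtain D2 where D2: "0 < D2" "\<And>x. \<bar>Airy x\<bar> \<le> D2 * exp (- 2 * x)" using abs_Airy_le[of 2] by auto
  note [measurable] = Airy_measurable
  have e: "(LBINT u:{0..}. f u) = (LINT u|restrict_space lborel {0<..}. f u)" if [measurable]: "f \<in> borel_measurable borel" for f :: "real \<Rightarrow> real"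
  proof -
    have "(LBINT u:{0..}. f u) = (\<integral>u. indicator {0<..} u *\<^sub>R f u \<partial>lborel)"
      unfolding set_lebesgue_integral_def
    proof (rule integral_cong_AE)
      show "AE u in lborel. indicator {0..} u *\<^sub>R f u = indicator {0<..} u *\<^sub>R f u"
        using AE_lborel_singleton[of "0::real"] by eventually_elim (auto simp: indicator_def)
    qed measurable
    then show ?thesis by (simp add: integral_restrict_space)
  qed
  have m1: "(\<lambda>u. Airy (x + u) * Airy (y + u)) \<in> borel_measurable borel"
    and m2: "(\<lambda>u. Airy (x - u) * Airy (y + u)) \<in> borel_measurable borel" for x y
    by measurable
  have i1: "integrable (restrict_space lborel {0<..}) (\<lambda>u. Airy (x + u) * Airy (y + u))" for x y
  proof (rule Bochner_Integration.integrable_bound)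
    show "integrable (restrict_space lborel {0<..}) (\<lambda>u. D1 * exp (- x) * (D2 * exp (- 2 * y)) * exp (- 3 * u))"
      by (intro integrable_mult_right exp_integrable_half_line) simp
    show "(\<lambda>u. Airy (x + u) * Airy (y + u)) \<in> borel_measurable (restrict_space lborel {0<..})"
      by (rule measurable_restrict_space1) measurable
    have bnd: "\<bar>Airy (x + u) * Airy (y + u)\<bar> \<le> D1 * exp (- x) * (D2 * exp (- 2 * y)) * exp (- 3 * u)" for u
    proof -
      have "\<bar>Airy (x + u) * Airy (y + u)\<bar> \<le> (D1 * exp (- 1 * (x + u))) * (D2 * exp (- 2 * (y + u)))"
        unfolding abs_mult by (rule mult_mono[OF D1(2) D2(2)]) (use D1(1) in auto)
      also have "\<dots> = D1 * exp (- x) * (D2 * exp (- 2 * y)) * exp (- 3 * u)" by (simp add: exp_add[symmetric] algebra_simps)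
      finally show ?thesis .
    qed
    show "AE u in restrict_space lborel {0<..}. norm (Airy (x + u) * Airy (y + u)) \<le> norm (D1 * exp (- x) * (D2 * exp (- 2 * y)) * exp (- 3 * u))"
      by (rule AE_I2) (unfold real_norm_def, rule order_trans[OF bnd abs_ge_self])
  qed
  have i2: "integrable (restrict_space lborel {0<..}) (\<lambda>u. Airy (x - u) * Airy (y + u))" for x y
  proof (rule Bochner_Integration.integrable_bound)
    show "integrable (restrict_space lborel {0<..}) (\<lambda>u. D1 * exp (- x) * (D2 * exp (- 2 * y)) * exp (- 1 * u))"
      by (intro integrable_mult_right exp_integrable_half_line) simp
    show "(\<lambda>u. Airy (x - u) * Airy (y + u)) \<in> borel_measurable (restrict_space lborel {0<..})"
      by (rule measurable_restrict_space1) measurable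
    have bnd: "\<bar>Airy (x - u) * Airy (y + u)\<bar> \<le> D1 * exp (- x) * (D2 * exp (- 2 * y)) * exp (- 1 * u)" for u
    proof -
      have "\<bar>Airy (x - u) * Airy (y + u)\<bar> \<le> (D1 * exp (- 1 * (x - u))) * (D2 * exp (- 2 * (y + u)))"
        unfolding abs_mult by (rule mult_mono[OF D1(2) D2(2)]) (use D1(1) in auto)
      also have "\<dots> = D1 * exp (- x) * (D2 * exp (- 2 * y)) * exp (- 1 * u)" by (simp add: exp_add[symmetric] algebra_simps)
      finally show ?thesis .
    qed
    show "AE u in restrict_space lborel {0<..}. norm (Airy (x - u) * Airy (y + u)) \<le> norm (D1 * exp (- x) * (D2 * exp (- 2 * y)) * exp (- 1 * u))"
      by (rule AE_I2) (unfold real_norm_def, rule order_trans[OF bnd abs_ge_self])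
  qed
  show "edge_kernel False = A_plus"
    by (intro ext) (simp add: edge_kernel_def A_plus_def e[OF m1] e[OF m2] distrib_right Bochner_Integration.integral_add i1 i2)
  show "edge_kernel True = A_minus"
    by (intro ext) (simp add: edge_kernel_def A_minus_def e[OF m1] e[OF m2] left_diff_distrib Bochner_Integration.integral_diff i1 i2)
qed

text \<open>The sum over m starts at 0 whereas the first cell carries the value at 1; hence the
  index \<open>nat (\<lceil>u * \<kappa>\<rceil> - 1)\<close>.\<close>

lemma bessel_kernel_eq_integral:
  assumes \<kappa>: "0 < \<kappa>" and y: "0 \<le> y"
  shows "integrable (restrict_space lborel {0<..}) (\<lambda>u. (\<kappa> * bas os (W \<theta> (- \<theta>)) (nat (\<lceil>u * \<kappa>\<rceil> - 1)) x) * (\<kappa> * W \<theta> (- \<theta>) (y + int (nat (\<lceil>u * \<kappa>\<rceil> - 1)))))"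
    "\<kappa> * bessel_kernel os \<theta> x y = (LINT u|restrict_space lborel {0<..}. (\<kappa> * bas os (W \<theta> (- \<theta>)) (nat (\<lceil>u * \<kappa>\<rceil> - 1)) x) * (\<kappa> * W \<theta> (- \<theta>) (y + int (nat (\<lceil>u * \<kappa>\<rceil> - 1)))))"
proof -
  define F where "F k = (\<kappa> * bas os (W \<theta> (- \<theta>)) (nat (k - 1)) x) * (\<kappa> * W \<theta> (- \<theta>) (y + int (nat (k - 1))))" for k
  define T where "T m = bas os (W \<theta> (- \<theta>)) m x * W \<theta> (- \<theta>) (y + int m)" for m
  have FT: "F (int m + 1) = \<kappa> * \<kappa> * T m" for m by (simp add: F_def T_def)
  have q: "0 < (1/2::real)" "(1/2::real) < 1" by auto
  obtain C where C: "0 < C" "\<And>k. \<bar>W \<theta> (- \<theta>) k\<bar> \<le> C * (1/2) ^ nat \<bar>k\<bar>" using W_decay[OF q] by blast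
  have C1: "\<bar>W \<theta> (- \<theta>) k\<bar> \<le> C" for k
    by (rule order_trans[OF C(2)]) (use C(1) in \<open>simp add: mult_left_le power_le_one\<close>)
  have b: "\<bar>bas os (W \<theta> (- \<theta>)) m x\<bar> \<le> 2 * C" for m
  proof -
    have "\<bar>refl_sign os m * W \<theta> (- \<theta>) (x - int m - refl_shift os)\<bar> \<le> \<bar>W \<theta> (- \<theta>) (x - int m - refl_shift os)\<bar>"
      unfolding abs_mult using abs_refl_sign_le by (intro mult_left_le_one_le) auto
    then show ?thesis unfolding bas_def using C1[of "x + int m"] C1[of "x - int m - refl_shift os"] by linarith
  qed
  have Tb: "\<bar>T m\<bar> \<le> 2 * C * C * (1/2) ^ m" for m
  proof -
    have "\<bar>W \<theta> (- \<theta>) (y + int m)\<bar> \<le> C * (1/2) ^ m"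
      by (rule order_trans[OF C(2) mult_left_mono[OF power_le_of_ge]]) (use C(1) y in auto)
    then have "\<bar>T m\<bar> \<le> (2 * C) * (C * (1/2) ^ m)"
      unfolding T_def abs_mult using b C(1) by (intro mult_mono) auto
    then show ?thesis by simp
  qed
  have Ts: "summable (\<lambda>m. \<bar>T m\<bar>)"
    by (rule summable_comparison_test'[of "\<lambda>m. 2 * C * C * (1/2) ^ m"]) (use Tb in \<open>auto intro!: summable_mult summable_geometric\<close>)
  have Fs: "summable (\<lambda>m. \<bar>F (int m + 1)\<bar>)"
    unfolding FT abs_mult by (intro summable_mult Ts)
  have kT: "bessel_kernel os \<theta> x y = (\<Sum>m. T m)"
  proof -
    have "T summable_on UNIV" by (rule norm_summable_imp_summable_on) (use Ts in simp)
    from has_sum_imp_sums[OF has_sum_infsum[OF this]] show ?thesis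
      by (simp add: bessel_kernel_def T_def[abs_def] sums_iff)
  qed
  note S = step_function_integral[OF \<kappa> Fs, of 0]
  show "integrable (restrict_space lborel {0<..}) (\<lambda>u. (\<kappa> * bas os (W \<theta> (- \<theta>)) (nat (\<lceil>u * \<kappa>\<rceil> - 1)) x) * (\<kappa> * W \<theta> (- \<theta>) (y + int (nat (\<lceil>u * \<kappa>\<rceil> - 1)))))"
    using S(1) by (simp add: F_def)
  have "(\<Sum>m. F (int m + 1)) / \<kappa> = \<kappa> * bessel_kernel os \<theta> x y"
    unfolding FT kT using \<kappa> suminf_mult[OF summable_rabs_cancel[OF Ts], of "\<kappa> * \<kappa>"] by simp
  then show "\<kappa> * bessel_kernel os \<theta> x y = (LINT u|restrict_space lborel {0<..}. (\<kappa> * bas os (W \<theta> (- \<theta>)) (nat (\<lceil>u * \<kappa>\<rceil> - 1)) x) * (\<kappa> * W \<theta> (- \<theta>) (y + int (nat (\<lceil>u * \<kappa>\<rceil> - 1)))))"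
    using S(2) by (simp add: F_def)
qed

lemma bessel_kernel_integrand_bound:
  "\<exists>C>0. \<forall>\<kappa> x y \<xi> \<eta> u. 1 \<le> \<kappa> \<longrightarrow> 0 < u \<longrightarrow>
     \<xi> - 1 \<le> (real_of_int x - 2 * \<kappa> ^ 3) / \<kappa> \<longrightarrow> \<eta> - 1 \<le> (real_of_int y - 2 * \<kappa> ^ 3) / \<kappa> \<longrightarrow>
     \<bar>(\<kappa> * bas os (W (\<kappa> ^ 3) (- (\<kappa> ^ 3))) (nat (\<lceil>u * \<kappa>\<rceil> - 1)) x) * (\<kappa> * W (\<kappa> ^ 3) (- (\<kappa> ^ 3)) (y + int (nat (\<lceil>u * \<kappa>\<rceil> - 1))))\<bar>
       \<le> C * exp (- \<xi>) * exp (- 2 * \<eta>) * exp (- 1 * u)"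
proof -
  obtain D1 where D1: "0 < D1" "\<And>\<kappa> \<xi> k. 1 \<le> \<kappa> \<Longrightarrow> real_of_int k = 2 * \<kappa> ^ 3 + \<xi> * \<kappa> \<Longrightarrow> \<bar>\<kappa> * W (\<kappa> ^ 3) (- (\<kappa> ^ 3)) k\<bar> \<le> D1 * exp (- 1 * \<xi>)"
    using scaled_bessel_bound[OF zero_less_one] by blast
  obtain D2 where D2: "0 < D2" "\<And>\<kappa> \<xi> k. 1 \<le> \<kappa> \<Longrightarrow> real_of_int k = 2 * \<kappa> ^ 3 + \<xi> * \<kappa> \<Longrightarrow> \<bar>\<kappa> * W (\<kappa> ^ 3) (- (\<kappa> ^ 3)) k\<bar> \<le> D2 * exp (- 2 * \<xi>)"
    using scaled_bessel_bound[of 2] by (metis zero_less_numeral)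
  \<comment> \<open>Rate 1 is used at x and rate 2 at y, so the possible growth exp u of the
    reflected term is beaten by exp (- 2 u). The 3 collects the rounding of x and the reflection
    shift of at most 2; the 4 is twice the rounding of y and of the summation index.\<close>
  define C where "C = (2 * D1 * exp 3) * (D2 * exp 4)"
  have "\<bar>(\<kappa> * bas os (W (\<kappa> ^ 3) (- (\<kappa> ^ 3))) (nat (\<lceil>u * \<kappa>\<rceil> - 1)) x) * (\<kappa> * W (\<kappa> ^ 3) (- (\<kappa> ^ 3)) (y + int (nat (\<lceil>u * \<kappa>\<rceil> - 1))))\<bar>
       \<le> C * exp (- \<xi>) * exp (- 2 * \<eta>) * exp (- 1 * u)"
    if \<kappa>: "1 \<le> \<kappa>" and u: "0 < u" and x: "\<xi> - 1 \<le> (real_of_int x - 2 * \<kappa> ^ 3) / \<kappa>" and y: "\<eta> - 1 \<le> (real_of_int y - 2 * \<kappa> ^ 3) / \<kappa>"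
    for \<kappa> x y \<xi> \<eta> u
  proof -
    define j where "j = nat (\<lceil>u * \<kappa>\<rceil> - 1)"
    define J where "J k = \<kappa> * W (\<kappa> ^ 3) (- (\<kappa> ^ 3)) k" for k
    define z where "z k = (real_of_int k - 2 * \<kappa> ^ 3) / \<kappa>" for k
    have zk: "real_of_int k = 2 * \<kappa> ^ 3 + z k * \<kappa>" for k using \<kappa> by (simp add: z_def)
    have J1: "\<bar>J k\<bar> \<le> D1 * exp e" if "- z k \<le> e" for k e
      by (rule order_trans[OF D1(2)[OF \<kappa> zk, folded J_def] mult_left_mono]) (use that D1(1) in auto)
    have J2: "\<bar>J k\<bar> \<le> D2 * exp e" if "- 2 * z k \<le> e" for k e
      by (rule order_trans[OF D2(2)[OF \<kappa> zk, folded J_def] mult_left_mono]) (use that D2(1) in auto)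
    have uk: "0 < u * \<kappa>" using u \<kappa> by simp
    then have j: "u * \<kappa> - 1 \<le> real j" "real j \<le> u * \<kappa>" unfolding j_def by linarith+
    have jk: "u - 1 \<le> real j / \<kappa>" "real j / \<kappa> \<le> u"
    proof -
      have "(u - 1) * \<kappa> \<le> real j" using j(1) \<kappa> by (simp add: algebra_simps)
      then show "u - 1 \<le> real j / \<kappa>" using \<kappa> by (simp add: pos_le_divide_eq)
      show "real j / \<kappa> \<le> u" using j(2) \<kappa> by (simp add: pos_divide_le_eq)
    qed
    have zp: "z (k + int j) = z k + real j / \<kappa>" for k by (simp add: z_def diff_divide_distrib add_divide_distrib)
    have zm: "z (k - int j - refl_shift os) = z k - real j / \<kappa> - real_of_int (refl_shift os) / \<kappa>" for k
      by (simp add: z_def diff_divide_distrib add_divide_distrib)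
    have d: "real_of_int (refl_shift os) / \<kappa> \<le> 2" using \<kappa> by (auto simp: refl_shift_def divide_le_eq)
    have zx: "\<xi> - 1 \<le> z x" "\<eta> - 1 \<le> z y" using x y by (auto simp: z_def)
    have j0: "0 \<le> real j / \<kappa>" using \<kappa> by simp
    have "\<bar>J (x + int j)\<bar> \<le> D1 * exp (3 - \<xi> + u)"
      by (rule J1) (use zx(1) j0 u in \<open>simp add: zp\<close>)
    moreover have "\<bar>J (x - int j - refl_shift os)\<bar> \<le> D1 * exp (3 - \<xi> + u)"
      by (rule J1) (use zx(1) jk(2) d in \<open>simp add: zm\<close>)
    moreover have "\<bar>refl_sign os j * J (x - int j - refl_shift os)\<bar> \<le> \<bar>J (x - int j - refl_shift os)\<bar>"
      unfolding abs_mult using abs_refl_sign_le by (intro mult_left_le_one_le) auto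
    moreover have "\<kappa> * bas os (W (\<kappa> ^ 3) (- (\<kappa> ^ 3))) j x = J (x + int j) + refl_sign os j * J (x - int j - refl_shift os)"
      by (simp add: bas_def J_def algebra_simps)
    ultimately have 1: "\<bar>\<kappa> * bas os (W (\<kappa> ^ 3) (- (\<kappa> ^ 3))) j x\<bar> \<le> 2 * D1 * exp (3 - \<xi> + u)"
      by linarith
    have 2: "\<bar>J (y + int j)\<bar> \<le> D2 * exp (4 - 2 * \<eta> - 2 * u)"
      by (rule J2) (use zx(2) jk(1) in \<open>simp add: zp\<close>)
    have "\<bar>(\<kappa> * bas os (W (\<kappa> ^ 3) (- (\<kappa> ^ 3))) j x) * J (y + int j)\<bar> \<le> (2 * D1 * exp (3 - \<xi> + u)) * (D2 * exp (4 - 2 * \<eta> - 2 * u))"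
      unfolding abs_mult[of "\<kappa> * bas os (W (\<kappa> ^ 3) (- (\<kappa> ^ 3))) j x"] using 1 2 D1(1) by (intro mult_mono) auto
    also have "\<dots> = C * exp (- \<xi>) * exp (- 2 * \<eta>) * exp (- 1 * u)"
    proof -
      have "exp (3 - \<xi> + u) * exp (4 - 2 * \<eta> - 2 * u) = exp 3 * exp 4 * exp (- \<xi>) * exp (- 2 * \<eta>) * exp (- 1 * u)"
        by (simp add: exp_add[symmetric])
      then show ?thesis by (simp add: C_def mult_ac)
    qed
    finally show ?thesis by (simp only: j_def J_def)
  qed
  moreover have "0 < C" using D1 D2 by (simp add: C_def)
  ultimately show ?thesis by blast
qed

theorem fredholm_det_bessel_kernel_tendsto:
  fixes s :: real and \<kappa> :: "nat \<Rightarrow> real" and n :: "nat \<Rightarrow> nat"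
  assumes \<kappa>: "\<And>m. 1 \<le> \<kappa> m" "filterlim \<kappa> at_top sequentially"
    and n: "\<And>m. \<bar>real (n m) - (2 * \<kappa> m ^ 3 + s * \<kappa> m)\<bar> \<le> 1" "\<And>m. 2 * \<kappa> m ^ 3 + s * \<kappa> m - 1 \<le> real (n m)"
  defines "X \<equiv> (\<lambda>m \<xi>. int (n m) + \<lceil>(\<xi> - s) * \<kappa> m\<rceil>)"
  shows "(\<lambda>m. fredholm_det (\<lambda>\<xi> \<eta>. \<kappa> m * bessel_kernel os (\<kappa> m ^ 3) (X m \<xi>) (X m \<eta>)) s) \<longlonglongrightarrow> fredholm_det (edge_kernel os) s"
proof -
  define M0 where "M0 = restrict_space lborel {0::real<..}"
  define j where "j m u = nat (\<lceil>u * \<kappa> m\<rceil> - 1)" for m u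
  define A where "A m x u = \<kappa> m * bas os (W (\<kappa> m ^ 3) (- (\<kappa> m ^ 3))) (j m u) x" for m x u
  define B where "B m y u = \<kappa> m * W (\<kappa> m ^ 3) (- (\<kappa> m ^ 3)) (y + int (j m u))" for m y u
  have kpos: "0 < \<kappa> m" for m using \<kappa>(1)[of m] by linarith
  have X0: "0 \<le> X m \<xi>" if "s < \<xi>" for m \<xi>
  proof -
    have "0 < (\<xi> - s) * \<kappa> m" using that kpos[of m] by simp
    then show ?thesis by (simp add: X_def)
  qed
  have Xabs: "\<bar>(real_of_int (X m \<xi>) - 2 * \<kappa> m ^ 3) / \<kappa> m - \<xi>\<bar> \<le> 2 / \<kappa> m" for m \<xi>
  proof -
    have "(real_of_int (X m \<xi>) - 2 * \<kappa> m ^ 3) / \<kappa> m - \<xi> = (real_of_int (X m \<xi>) - (2 * \<kappa> m ^ 3 + \<xi> * \<kappa> m)) / \<kappa> m"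
      using kpos[of m] by (simp add: field_simps)
    moreover have "\<bar>real_of_int (X m \<xi>) - (2 * \<kappa> m ^ 3 + \<xi> * \<kappa> m)\<bar> \<le> 2"
    proof -
      have "\<bar>real_of_int \<lceil>(\<xi> - s) * \<kappa> m\<rceil> - (\<xi> - s) * \<kappa> m\<bar> \<le> 1" by linarith
      moreover have "real_of_int (X m \<xi>) = real (n m) + real_of_int \<lceil>(\<xi> - s) * \<kappa> m\<rceil>" by (simp add: X_def)
      moreover have "(\<xi> - s) * \<kappa> m = \<xi> * \<kappa> m - s * \<kappa> m" by (rule left_diff_distrib)
      ultimately show ?thesis using n(1)[of m] by linarith
    qed
    ultimately show ?thesis using kpos[of m] by (simp add: divide_right_mono)
  qed
  have Xlow: "\<xi> - 1 \<le> (real_of_int (X m \<xi>) - 2 * \<kappa> m ^ 3) / \<kappa> m" for m \<xi>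
  proof -
    have "(\<xi> - s) * \<kappa> m \<le> real_of_int \<lceil>(\<xi> - s) * \<kappa> m\<rceil>" by (rule le_of_int_ceiling)
    moreover have "real_of_int (X m \<xi>) = real (n m) + real_of_int \<lceil>(\<xi> - s) * \<kappa> m\<rceil>" by (simp add: X_def)
    moreover have "(\<xi> - s) * \<kappa> m = \<xi> * \<kappa> m - s * \<kappa> m" by (rule left_diff_distrib)
    ultimately have "\<xi> * \<kappa> m - 1 \<le> real_of_int (X m \<xi>) - 2 * \<kappa> m ^ 3" using n(2)[of m] by linarith
    then have "(\<xi> - 1) * \<kappa> m \<le> real_of_int (X m \<xi>) - 2 * \<kappa> m ^ 3" using \<kappa>(1)[of m] by (simp add: left_diff_distrib)
    then show ?thesis using kpos[of m] by (simp add: pos_le_divide_eq)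
  qed
  have ker: "integrable M0 (\<lambda>u. A m x u * B m y u)" "\<kappa> m * bessel_kernel os (\<kappa> m ^ 3) x y = (LINT u|M0. A m x u * B m y u)"
    if "0 \<le> y" for m x y
    using bessel_kernel_eq_integral[OF kpos that] unfolding A_def B_def j_def M0_def by blast+
  obtain C where C: "0 < C" "\<And>\<kappa> x y \<xi> \<eta> u. 1 \<le> \<kappa> \<Longrightarrow> 0 < u \<Longrightarrow>
     \<xi> - 1 \<le> (real_of_int x - 2 * \<kappa> ^ 3) / \<kappa> \<Longrightarrow> \<eta> - 1 \<le> (real_of_int y - 2 * \<kappa> ^ 3) / \<kappa> \<Longrightarrow>
     \<bar>(\<kappa> * bas os (W (\<kappa> ^ 3) (- (\<kappa> ^ 3))) (nat (\<lceil>u * \<kappa>\<rceil> - 1)) x) * (\<kappa> * W (\<kappa> ^ 3) (- (\<kappa> ^ 3)) (y + int (nat (\<lceil>u * \<kappa>\<rceil> - 1))))\<bar>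
       \<le> C * exp (- \<xi>) * exp (- 2 * \<eta>) * exp (- 1 * u)"
    using bessel_kernel_integrand_bound[of os] by blast
  have ABb: "\<bar>A m (X m \<xi>) u * B m (X m \<eta>) u\<bar> \<le> C * exp (- \<xi>) * exp (- 2 * \<eta>) * exp (- 1 * u)" if "0 < u" for m \<xi> \<eta> u
    unfolding A_def B_def j_def by (rule C(2)[OF \<kappa>(1) that Xlow Xlow])
  have spM0: "space M0 = {0<..}" by (simp add: M0_def space_restrict_space)
  have wint: "integrable M0 (\<lambda>u. C * exp (- \<xi>) * exp (- 2 * \<eta>) * exp (- 1 * u))" for \<xi> \<eta>
    unfolding M0_def by (intro integrable_mult_right exp_integrable_half_line) simp
  have lim: "(\<lambda>m. A m (X m \<xi>) u * B m (X m \<eta>) u) \<longlonglongrightarrow> (Airy (\<xi> + u) + (if os then -1 else 1) * Airy (\<xi> - u)) * Airy (\<eta> + u)"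
    if u: "0 < u" for \<xi> \<eta> u
  proof -
    have j: "\<bar>real (j m u) / \<kappa> m - u\<bar> \<le> 1 / \<kappa> m" for m
    proof -
      have "0 < u * \<kappa> m" using u kpos[of m] by simp
      then have "\<bar>real (j m u) - u * \<kappa> m\<bar> \<le> 1" unfolding j_def by linarith
      moreover have "real (j m u) / \<kappa> m - u = (real (j m u) - u * \<kappa> m) / \<kappa> m" using kpos[of m] by (simp add: field_simps)
      ultimately show ?thesis using kpos[of m] by (simp add: divide_right_mono)
    qed
    have p: "(\<lambda>m. \<kappa> m * W (\<kappa> m ^ 3) (- (\<kappa> m ^ 3)) (X m z + int (j m u))) \<longlonglongrightarrow> Airy (z + u)" for z
    proof (rule scaled_bessel_tendsto_Airy[OF \<kappa>, where C = 3])
      fix m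
      have "(real_of_int (X m z + int (j m u)) - 2 * \<kappa> m ^ 3) / \<kappa> m - (z + u) = ((real_of_int (X m z) - 2 * \<kappa> m ^ 3) / \<kappa> m - z) + (real (j m u) / \<kappa> m - u)"
        by (simp add: add_divide_distrib diff_divide_distrib)
      moreover have "3 / \<kappa> m = 2 / \<kappa> m + 1 / \<kappa> m" by (simp add: add_divide_distrib[symmetric])
      ultimately show "\<bar>(real_of_int (X m z + int (j m u)) - 2 * \<kappa> m ^ 3) / \<kappa> m - (z + u)\<bar> \<le> 3 / \<kappa> m"
        using Xabs[of m z] j[of m] by linarith
    qed
    have mns: "(\<lambda>m. \<kappa> m * W (\<kappa> m ^ 3) (- (\<kappa> m ^ 3)) (X m z - int (j m u) - refl_shift os)) \<longlonglongrightarrow> Airy (z - u)" for z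
    \<comment> \<open>Two for the rounding in \<open>X\<close>, one for that of the summation index,
      two for the reflection shift.\<close>
    proof (rule scaled_bessel_tendsto_Airy[OF \<kappa>, where C = 5])
      fix m
      have "(real_of_int (X m z - int (j m u) - refl_shift os) - 2 * \<kappa> m ^ 3) / \<kappa> m - (z - u) =
         ((real_of_int (X m z) - 2 * \<kappa> m ^ 3) / \<kappa> m - z) - (real (j m u) / \<kappa> m - u) - real_of_int (refl_shift os) / \<kappa> m"
        by (simp add: add_divide_distrib diff_divide_distrib)
      moreover have "5 / \<kappa> m = 2 / \<kappa> m + 1 / \<kappa> m + 2 / \<kappa> m" by (simp add: add_divide_distrib[symmetric])
      moreover have "0 \<le> real_of_int (refl_shift os) / \<kappa> m" "real_of_int (refl_shift os) / \<kappa> m \<le> 2 / \<kappa> m"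
        using kpos[of m] by (auto simp: refl_shift_def)
      ultimately show "\<bar>(real_of_int (X m z - int (j m u) - refl_shift os) - 2 * \<kappa> m ^ 3) / \<kappa> m - (z - u)\<bar> \<le> 5 / \<kappa> m"
        using Xabs[of m z] j[of m] by linarith
    qed
    \<comment> \<open>In the symplectic case the sign is 0 at index 0, but for fixed u > 0 the
      scaled index is eventually positive.\<close>
    have sgn: "\<forall>\<^sub>F m in sequentially. refl_sign os (j m u) = (if os then -1 else 1)"
    proof -
      have "\<forall>\<^sub>F m in sequentially. 2 / u \<le> \<kappa> m" using \<kappa>(2) by (simp add: filterlim_at_top)
      then show ?thesis
      proof eventually_elim
        fix m assume "2 / u \<le> \<kappa> m"
        then have "2 \<le> u * \<kappa> m" using u by (simp add: divide_le_eq mult.commute)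
        then have "0 < j m u" unfolding j_def by linarith
        then show "refl_sign os (j m u) = (if os then -1 else 1)" by (simp add: refl_sign_def)
      qed
    qed
    have "(\<lambda>m. (\<kappa> m * W (\<kappa> m ^ 3) (- (\<kappa> m ^ 3)) (X m \<xi> + int (j m u)) + refl_sign os (j m u) * (\<kappa> m * W (\<kappa> m ^ 3) (- (\<kappa> m ^ 3)) (X m \<xi> - int (j m u) - refl_shift os)))
        * (\<kappa> m * W (\<kappa> m ^ 3) (- (\<kappa> m ^ 3)) (X m \<eta> + int (j m u))))
       \<longlonglongrightarrow> (Airy (\<xi> + u) + (if os then -1 else 1) * Airy (\<xi> - u)) * Airy (\<eta> + u)"
      by (intro tendsto_mult tendsto_add p mns tendsto_eventually[OF sgn])
    then show ?thesis by (simp add: A_def B_def bas_def distrib_left mult_ac)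
  qed
  show ?thesis
  proof (rule fredholm_det_tendsto[where C = "C * exp (- s)"])
    fix m
    have "(\<lambda>p. (X m (fst p), X m (snd p))) \<in> measurable (borel \<Otimes>\<^sub>M borel) (count_space UNIV \<Otimes>\<^sub>M count_space UNIV)"
      unfolding X_def using measurable_compose[OF measurable_fst ceiling_step_measurable] measurable_compose[OF measurable_snd ceiling_step_measurable]
      by (intro measurable_Pair) auto
    \<comment> \<open>Pairs of integers form a countable discrete space, so no measurability of the
      kernel itself has to be shown.\<close>
    then have "(\<lambda>p. (X m (fst p), X m (snd p))) \<in> measurable (borel \<Otimes>\<^sub>M borel) (count_space UNIV)"
      by (simp add: pair_measure_countable)
    from measurable_compose[OF this, of "\<lambda>(x, y). \<kappa> m * bessel_kernel os (\<kappa> m ^ 3) x y" borel]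
    show "(\<lambda>p. \<kappa> m * bessel_kernel os (\<kappa> m ^ 3) (X m (fst p)) (X m (snd p))) \<in> borel_measurable (borel \<Otimes>\<^sub>M borel)" by simp
  next
    fix m \<xi> \<eta> assume \<xi>: "s < \<xi>" and \<eta>: "s < \<eta>"
    have "\<bar>\<kappa> m * bessel_kernel os (\<kappa> m ^ 3) (X m \<xi>) (X m \<eta>)\<bar> \<le> (LINT u|M0. C * exp (- \<xi>) * exp (- 2 * \<eta>) * exp (- 1 * u))"
      unfolding ker(2)[OF X0[OF \<eta>]]
      by (rule order_trans[OF integral_abs_bound integral_mono[OF integrable_abs[OF ker(1)[OF X0[OF \<eta>]]] wint]])
         (use ABb spM0 in auto)
    also have "\<dots> = C * exp (- \<xi>) * exp (- 2 * \<eta>) * (LINT u|M0. exp (- 1 * u))" by simp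
    also have "(LINT u|M0. exp (- 1 * u)) \<le> 1"
    proof -
      have "(\<integral>\<^sup>+u. ennreal (exp (- u)) * indicator {0..} u \<partial>lborel) = ennreal (0 - (- exp (- 0)))"
      proof (rule nn_integral_FTC_atLeast)
        show "((\<lambda>x::real. - exp (- x)) \<longlongrightarrow> 0) at_top" by real_asymp
      qed (auto intro!: derivative_eq_intros)
      then have 1: "(\<integral>\<^sup>+u. ennreal (exp (- u)) * indicator {0..} u \<partial>lborel) = 1" by simp
      have "(LINT u|M0. exp (- 1 * u)) = enn2real (\<integral>\<^sup>+u. ennreal (exp (- u)) * indicator {0<..} u \<partial>lborel)"
        unfolding M0_def by (subst integral_eq_nn_integral) (auto simp: nn_integral_restrict_space intro!: measurable_restrict_space1)
      also have "(\<integral>\<^sup>+u. ennreal (exp (- u)) * indicator {0<..} u \<partial>lborel) \<le> (\<integral>\<^sup>+u. ennreal (exp (- u)) * indicator {0..} u \<partial>lborel)"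
        by (rule nn_integral_mono) (auto split: split_indicator)
      then have "enn2real (\<integral>\<^sup>+u. ennreal (exp (- u)) * indicator {0<..} u \<partial>lborel) \<le> 1"
        unfolding 1 using enn2real_mono[of _ 1] by fastforce
      finally show ?thesis .
    qed
    then have "C * exp (- \<xi>) * exp (- 2 * \<eta>) * (LINT u|M0. exp (- 1 * u)) \<le> C * exp (- \<xi>) * exp (- 2 * \<eta>) * 1"
      using C(1) by (intro mult_left_mono) auto
    also have "C * exp (- \<xi>) * exp (- 2 * \<eta>) * 1 \<le> C * exp (- \<xi>) * (exp (- s) * exp (- \<eta>))"
    proof -
      \<comment> \<open>The second unit of decay was there for u; above \<open>s\<close> its part in
        \<eta> goes into the constant.\<close>
      have "exp (- 2 * \<eta>) \<le> exp (- s) * exp (- \<eta>)" using \<eta> by (simp add: exp_add[symmetric])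
      then show ?thesis using C(1) by (simp add: mult_left_mono)
    qed
    finally show "\<bar>\<kappa> m * bessel_kernel os (\<kappa> m ^ 3) (X m \<xi>) (X m \<eta>)\<bar> \<le> C * exp (- s) * exp (- \<xi>) * exp (- \<eta>)"
      by (simp add: mult_ac)
  next
    fix \<xi> \<eta> assume \<xi>: "s < \<xi>" and \<eta>: "s < \<eta>"
    have "(\<lambda>m. LINT u|M0. A m (X m \<xi>) u * B m (X m \<eta>) u) \<longlonglongrightarrow> (LINT u|M0. (Airy (\<xi> + u) + (if os then -1 else 1) * Airy (\<xi> - u)) * Airy (\<eta> + u))"
    proof (rule integral_dominated_convergence[where w = "\<lambda>u. C * exp (- \<xi>) * exp (- 2 * \<eta>) * exp (- 1 * u)"])
      note [measurable] = Airy_measurable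
      show "(\<lambda>u. (Airy (\<xi> + u) + (if os then -1 else 1) * Airy (\<xi> - u)) * Airy (\<eta> + u)) \<in> borel_measurable M0"
        unfolding M0_def by (rule measurable_restrict_space1) measurable
      show "(\<lambda>u. A m (X m \<xi>) u * B m (X m \<eta>) u) \<in> borel_measurable M0" for m
        by (rule borel_measurable_integrable[OF ker(1)[OF X0[OF \<eta>]]])
    qed (use wint ABb lim spM0 in \<open>auto intro!: AE_I2\<close>)
    then show "(\<lambda>m. \<kappa> m * bessel_kernel os (\<kappa> m ^ 3) (X m \<xi>) (X m \<eta>)) \<longlonglongrightarrow> edge_kernel os \<xi> \<eta>"
      unfolding ker(2)[OF X0[OF \<eta>]] edge_kernel_def M0_def .
  qed
qed

section \<open>Transfer to the two measures\<close>

lemma edge_event_eq: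
  assumes "0 < \<theta>" "0 \<le> 2 * \<theta> + s * \<theta> powr (1/3)"
  shows "edge_event \<theta> s = {l \<in> partitions. lam1 l \<le> nat \<lfloor>2 * \<theta> + s * \<theta> powr (1/3)\<rfloor>}"
proof -
  have p: "0 < \<theta> powr (1/3)" using assms by simp
  have "(real (lam1 l) - 2 * \<theta>) / \<theta> powr (1/3) \<le> s \<longleftrightarrow> lam1 l \<le> nat \<lfloor>2 * \<theta> + s * \<theta> powr (1/3)\<rfloor>" for l
  proof -
    have "(real (lam1 l) - 2 * \<theta>) / \<theta> powr (1/3) \<le> s \<longleftrightarrow> real (lam1 l) \<le> 2 * \<theta> + s * \<theta> powr (1/3)"
      using p by (simp add: pos_divide_le_eq algebra_simps)
    also have "\<dots> \<longleftrightarrow> lam1 l \<le> nat \<lfloor>2 * \<theta> + s * \<theta> powr (1/3)\<rfloor>"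
      \<comment> \<open>Nonnegativity of the threshold matters here: \<open>nat\<close> would send a
        negative floor to 0 and admit the empty partition.\<close>
      using assms(2) by (simp add: le_nat_iff le_floor_iff)
    finally show ?thesis .
  qed
  then show ?thesis by (simp add: edge_event_def)
qed

lemma P_o_eq: "E \<subseteq> partitions \<Longrightarrow> P_o \<theta> E = (\<Sum>\<^sub>\<infinity>l\<in>E. pterm True (2 * \<theta>) \<theta> l) / exp (3 * \<theta>\<^sup>2 / 2)"
  by (simp add: P_o_def Z_o_def o_pl_pterm infsum_pterm power2_eq_square)

lemma infsum_sp:
  assumes "E \<subseteq> partitions" "[] \<in> E"
  shows "(\<Sum>\<^sub>\<infinity>l\<in>E. sp_pl (2 * \<theta>) l * schur_pl \<theta> l) = (\<Sum>\<^sub>\<infinity>l\<in>E. pterm False (2 * \<theta>) \<theta> l) - 1 / 2"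
proof -
  have e: "(\<Sum>\<^sub>\<infinity>l\<in>E. if l = [] then - (1 / 2) else 0) = - (1 / 2 :: real)"
  proof -
    have "(\<Sum>\<^sub>\<infinity>l\<in>E. if l = [] then - (1 / 2) else 0) = (\<Sum>\<^sub>\<infinity>l\<in>{[] :: nat list}. - (1 / 2))"
      by (rule infsum_cong_neutral) (use assms in auto)
    then show ?thesis by simp
  qed
  have s: "(\<lambda>l. if l = [] then - (1 / 2) else (0::real)) summable_on E"
    by (rule summable_on_cong_neutral[THEN iffD1, OF _ _ _ summable_on_finite[of "{[]}" "\<lambda>l. - (1 / 2)"]]) (use assms in auto)
  have "(\<Sum>\<^sub>\<infinity>l\<in>E. sp_pl (2 * \<theta>) l * schur_pl \<theta> l) = (\<Sum>\<^sub>\<infinity>l\<in>E. pterm False (2 * \<theta>) \<theta> l + (if l = [] then - (1 / 2) else 0))"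
    by (rule infsum_cong) (simp add: sp_pl_pterm)
  also have "\<dots> = (\<Sum>\<^sub>\<infinity>l\<in>E. pterm False (2 * \<theta>) \<theta> l) + (\<Sum>\<^sub>\<infinity>l\<in>E. if l = [] then - (1 / 2) else 0)"
    by (rule infsum_add[OF pterm_summable[OF assms(1)] s])
  finally show ?thesis unfolding e by simp
qed

lemma nil_partition: "[] \<in> partitions" "lam1 [] = 0"
  by (auto simp: partitions_def is_partition_def lam1_def)

lemma P_sp_eq:
  assumes "E \<subseteq> partitions" "[] \<in> E"
  shows "P_sp \<theta> E = ((\<Sum>\<^sub>\<infinity>l\<in>E. pterm False (2 * \<theta>) \<theta> l) - 1 / 2) / (exp (3 * \<theta>\<^sup>2 / 2) - 1 / 2)"
  by (simp add: P_sp_def Z_sp_def infsum_sp[OF assms] infsum_sp[OF subset_refl nil_partition(1)] infsum_pterm power2_eq_square)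

text \<open>The maximum with \<open>b\<close> in the proof makes all estimates hold for every index, not just eventually.\<close>

lemma edge_sequence_limit:
  fixes \<theta> :: "nat \<Rightarrow> real"
  assumes lim: "filterlim \<theta> at_top sequentially"
  shows "(\<lambda>m. (\<Sum>\<^sub>\<infinity>l\<in>edge_event (\<theta> m) s. pterm os (2 * \<theta> m) (\<theta> m) l) / exp (3 * (\<theta> m)\<^sup>2 / 2)) \<longlonglongrightarrow> fredholm_det (edge_kernel os) s"
    "\<forall>\<^sub>F m in sequentially. edge_event (\<theta> m) s \<subseteq> partitions \<and> [] \<in> edge_event (\<theta> m) s"
proof -
  \<comment> \<open>The cube makes the scale at least 1 + |s|, from which both \<kappa> \<ge> 1 and
    a nonnegative threshold 2 \<kappa>^3 + s \<kappa> follow.\<close>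
  define b where "b = (1 + \<bar>s\<bar>) ^ 3"
  define \<kappa> where "\<kappa> m = (max (\<theta> m) b) powr (1/3)" for m
  define n where "n m = nat \<lfloor>2 * \<kappa> m ^ 3 + s * \<kappa> m\<rfloor>" for m
  have b: "1 \<le> b" unfolding b_def by (rule one_le_power) simp
  have cube: "\<kappa> m ^ 3 = max (\<theta> m) b" for m
    using b by (simp add: \<kappa>_def powr_realpow[symmetric] powr_powr max_def)
  have kb: "1 + \<bar>s\<bar> \<le> \<kappa> m" for m
  proof -
    have "(1 + \<bar>s\<bar>) ^ 3 \<le> \<kappa> m ^ 3" unfolding cube b_def by simp
    then show ?thesis by (rule power_mono_iff[THEN iffD1, rotated -1]) (auto simp: \<kappa>_def)
  qed
  have k1: "1 \<le> \<kappa> m" for m using kb[of m] by linarith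
  have nonneg: "0 \<le> 2 * \<kappa> m ^ 3 + s * \<kappa> m" for m
  proof -
    have "\<bar>s\<bar> * \<kappa> m \<le> \<kappa> m * \<kappa> m" using kb[of m] k1[of m] by (intro mult_right_mono) auto
    also have "\<dots> \<le> \<kappa> m * (\<kappa> m * \<kappa> m)" using k1[of m] by (intro mult_left_mono) auto
    also have "\<dots> \<le> 2 * \<kappa> m ^ 3" using k1[of m] by (simp add: power3_eq_cube)
    finally have "\<bar>s\<bar> * \<kappa> m \<le> 2 * \<kappa> m ^ 3" .
    moreover have "- (\<bar>s\<bar> * \<kappa> m) \<le> s * \<kappa> m" using k1[of m] mult_right_mono[of "- \<bar>s\<bar>" s "\<kappa> m"] by auto
    ultimately show ?thesis by linarith
  qed
  have nn: "\<bar>real (n m) - (2 * \<kappa> m ^ 3 + s * \<kappa> m)\<bar> \<le> 1" "2 * \<kappa> m ^ 3 + s * \<kappa> m - 1 \<le> real (n m)" for m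
    using nonneg[of m] unfolding n_def by linarith+
  have flim: "filterlim \<kappa> at_top sequentially"
  proof -
    have "filterlim (\<lambda>m. \<theta> m powr (1/3)) at_top sequentially"
    proof (rule filterlim_compose[OF _ lim])
      show "filterlim (\<lambda>x::real. x powr (1/3)) at_top at_top" by real_asymp
    qed
    moreover have "\<forall>\<^sub>F m in sequentially. \<theta> m powr (1/3) \<le> \<kappa> m"
    proof -
      have "\<forall>\<^sub>F m in sequentially. 0 \<le> \<theta> m" using lim by (simp add: filterlim_at_top)
      then show ?thesis by eventually_elim (auto simp: \<kappa>_def intro!: powr_mono2)
    qed
    ultimately show ?thesis by (rule filterlim_at_top_mono)
  qed
  have ev: "\<forall>\<^sub>F m in sequentially. b \<le> \<theta> m" using lim by (simp add: filterlim_at_top)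
  have event: "edge_event (\<theta> m) s = {l \<in> partitions. lam1 l \<le> n m}" "\<kappa> m ^ 3 = \<theta> m" if "b \<le> \<theta> m" for m
  proof -
    show c: "\<kappa> m ^ 3 = \<theta> m" using that cube by simp
    have k: "\<theta> m powr (1/3) = \<kappa> m" using that by (simp add: \<kappa>_def)
    have "0 < \<theta> m" using that b by linarith
    then show "edge_event (\<theta> m) s = {l \<in> partitions. lam1 l \<le> n m}"
      unfolding n_def c using edge_event_eq[of "\<theta> m" s] nonneg[of m] unfolding k c by blast
  qed
  show "\<forall>\<^sub>F m in sequentially. edge_event (\<theta> m) s \<subseteq> partitions \<and> [] \<in> edge_event (\<theta> m) s"
    using ev by eventually_elim (auto simp: event nil_partition)
  have "(\<lambda>m. fredholm_det (\<lambda>\<xi> \<eta>. \<kappa> m * bessel_kernel os (\<kappa> m ^ 3) (int (n m) + \<lceil>(\<xi> - s) * \<kappa> m\<rceil>) (int (n m) + \<lceil>(\<eta> - s) * \<kappa> m\<rceil>)) s)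
     \<longlonglongrightarrow> fredholm_det (edge_kernel os) s"
    by (rule fredholm_det_bessel_kernel_tendsto[OF k1 flim nn])
  moreover have "\<forall>\<^sub>F m in sequentially. fredholm_det (\<lambda>\<xi> \<eta>. \<kappa> m * bessel_kernel os (\<kappa> m ^ 3) (int (n m) + \<lceil>(\<xi> - s) * \<kappa> m\<rceil>) (int (n m) + \<lceil>(\<eta> - s) * \<kappa> m\<rceil>)) s
     = (\<Sum>\<^sub>\<infinity>l\<in>edge_event (\<theta> m) s. pterm os (2 * \<theta> m) (\<theta> m) l) / exp (3 * (\<theta> m)\<^sup>2 / 2)"
    using ev
  proof eventually_elim
    fix m assume m: "b \<le> \<theta> m"
    have "0 < \<kappa> m" using k1[of m] by linarith
    from fredholm_det_bessel_kernel[OF this refl, where n = "n m" and s = s and os = os]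
    show "fredholm_det (\<lambda>\<xi> \<eta>. \<kappa> m * bessel_kernel os (\<kappa> m ^ 3) (int (n m) + \<lceil>(\<xi> - s) * \<kappa> m\<rceil>) (int (n m) + \<lceil>(\<eta> - s) * \<kappa> m\<rceil>)) s
     = (\<Sum>\<^sub>\<infinity>l\<in>edge_event (\<theta> m) s. pterm os (2 * \<theta> m) (\<theta> m) l) / exp (3 * (\<theta> m)\<^sup>2 / 2)"
      unfolding event[OF m] .
  qed
  ultimately show "(\<lambda>m. (\<Sum>\<^sub>\<infinity>l\<in>edge_event (\<theta> m) s. pterm os (2 * \<theta> m) (\<theta> m) l) / exp (3 * (\<theta> m)\<^sup>2 / 2)) \<longlonglongrightarrow> fredholm_det (edge_kernel os) s"
    by (rule Lim_transform_eventually)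
qed

theorem theorem5:
  fixes s :: real
  shows "((\<lambda>\<theta>. P_sp \<theta> (edge_event \<theta> s)) \<longlongrightarrow> fredholm_det A_plus s) at_top \<and>
         ((\<lambda>\<theta>. P_o \<theta> (edge_event \<theta> s)) \<longlongrightarrow> fredholm_det A_minus s) at_top"
proof (intro conjI tendsto_at_topI_sequentially)
  \<comment> \<open>The dominated convergence arguments concern sequences, so the limit is tested
    along an arbitrary sequence tending to infinity.\<close>
  fix \<theta> :: "nat \<Rightarrow> real" assume \<theta>: "filterlim \<theta> at_top sequentially"
  define Z where "Z m = exp (3 * (\<theta> m)\<^sup>2 / 2)" for m
  define S where "S m = (\<Sum>\<^sub>\<infinity>l\<in>edge_event (\<theta> m) s. pterm False (2 * \<theta> m) (\<theta> m) l)" for m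
  have lim: "(\<lambda>m. S m / Z m) \<longlonglongrightarrow> fredholm_det A_plus s"
    using edge_sequence_limit(1)[OF \<theta>, where s = s and os = False] by (simp add: edge_kernel_eq S_def Z_def)
  have Zinv: "(\<lambda>m. 1 / (2 * Z m)) \<longlonglongrightarrow> 0"
  proof (rule filterlim_compose[OF _ \<theta>, of "\<lambda>t. 1 / (2 * exp (3 * t\<^sup>2 / 2))", folded Z_def])
    show "((\<lambda>t::real. 1 / (2 * exp (3 * t\<^sup>2 / 2))) \<longlongrightarrow> 0) at_top" by real_asymp
  qed
  \<comment> \<open>The anomalous weight 1/2 of the empty partition shifts numerator and denominator
    alike; after division by the diverging \<open>Z m\<close> both shifts vanish.\<close>
  have "(\<lambda>m. (S m / Z m - 1 / (2 * Z m)) / (1 - 1 / (2 * Z m))) \<longlonglongrightarrow> (fredholm_det A_plus s - 0) / (1 - 0)"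
    by (intro tendsto_divide tendsto_diff lim Zinv tendsto_const) simp
  moreover have "\<forall>\<^sub>F m in sequentially. (S m / Z m - 1 / (2 * Z m)) / (1 - 1 / (2 * Z m)) = P_sp (\<theta> m) (edge_event (\<theta> m) s)"
    using edge_sequence_limit(2)[OF \<theta>, of s]
  proof eventually_elim
    fix m assume m: "edge_event (\<theta> m) s \<subseteq> partitions \<and> [] \<in> edge_event (\<theta> m) s"
    have Z: "1 \<le> Z m" by (simp add: Z_def)
    have "P_sp (\<theta> m) (edge_event (\<theta> m) s) = (S m - 1 / 2) / (Z m - 1 / 2)"
      using m by (simp add: P_sp_eq S_def Z_def)
    also have "\<dots> = ((S m - 1 / 2) / Z m) / ((Z m - 1 / 2) / Z m)" using Z by simp
    also have "\<dots> = (S m / Z m - 1 / (2 * Z m)) / (1 - 1 / (2 * Z m))" using Z by (simp add: diff_divide_distrib)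
    finally show "(S m / Z m - 1 / (2 * Z m)) / (1 - 1 / (2 * Z m)) = P_sp (\<theta> m) (edge_event (\<theta> m) s)" by simp
  qed
  ultimately show "(\<lambda>m. P_sp (\<theta> m) (edge_event (\<theta> m) s)) \<longlonglongrightarrow> fredholm_det A_plus s"
    using Lim_transform_eventually by fastforce
next
  fix \<theta> :: "nat \<Rightarrow> real" assume \<theta>: "filterlim \<theta> at_top sequentially"
  have "\<forall>\<^sub>F m in sequentially. (\<Sum>\<^sub>\<infinity>l\<in>edge_event (\<theta> m) s. pterm True (2 * \<theta> m) (\<theta> m) l) / exp (3 * (\<theta> m)\<^sup>2 / 2) = P_o (\<theta> m) (edge_event (\<theta> m) s)"
    using edge_sequence_limit(2)[OF \<theta>, of s] by eventually_elim (simp add: P_o_eq)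
  with edge_sequence_limit(1)[OF \<theta>, where s = s and os = True]
  show "(\<lambda>m. P_o (\<theta> m) (edge_event (\<theta> m) s)) \<longlonglongrightarrow> fredholm_det A_minus s"
    unfolding edge_kernel_eq by (rule Lim_transform_eventually)
qed

end
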